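(* (i) Let $\phi$ and $\phi^*$ be conjugate special Bernstein functions with representations, for $\theta\ge 0$, $$\phi(\theta)=\kappa+\mathrm{d}\theta+\int_{(0,\infty)}(1-e^{-\theta x})\Upsilon(dx),\qquad \phi^*(\theta)=\kappa^*+\mathrm{d}^*\theta+\int_{(0,\infty)}(1-e^{-\theta x})\Upsilon^*(dx),$$ where $\Upsilon$ is absolutely continuous with a non-increasing density on $(0,\infty)$. Then there exists a spectrally negative Lévy process that does not drift to $-\infty$, whose Laplace exponent is $$\psi(\theta)=\frac{\theta^2}{\phi^*(\theta)}=\theta\phi(\theta),\qquad \theta\ge 0,$$ and whose scale function $W$ is a concave function (on $[0,\infty)$) given by $$W(x)=\mathrm{d}^*+\kappa^*x+\int_0^x\Upsilon^*(y,\infty)\,dy,\qquad x\ge 0.$$ (ii) Conversely, if $\psi$ is the Laplace exponent of a spectrally negative Lévy process that does not drift to $-\infty$ and its associated scale function $W$ is a concave function (on $[0,\infty)$), then there exists a pair of conjugate Bernstein functions $\phi$ and $\phi^*$, with representations as displayed in (i) for some $(\kappa,\mathrm{d},\Upsilon)$ and $(\kappa^*,\mathrm{d}^*,\Upsilon^* )$, where $\Upsilon$ is absolutely continuous with a non-increasing density, such that $\psi(\theta)=\theta^2/\phi^*(\theta)=\theta\phi(\theta)$ for $\theta\ge0$ and $W(x)=\mathrm{d}^*+\kappa^*x+\int_0^x\Upsilon^*(y,\infty)\,dy$ for $x\ge0$.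
   Context: A spectrally negative Lévy process is a real-valued Lévy process $X$ (not killed) with no positive jumps which is not the negative of a subordinator. Its Laplace exponent is $\psi(\theta)=\log\mathbb{E}[e^{\theta X_1}]$, $\theta\ge 0$ ($X_0=0$). It does not drift to $-\infty$ if and only if $\psi'(0+)\ge 0$; in that case $\psi(\theta)>0$ for all $\theta>0$. For such a process not drifting to $-\infty$, its scale function $W:\mathbb{R}\to[0,\infty)$ is the function vanishing on $(-\infty,0)$, continuous on $[0,\infty)$ (right continuous at the origin), with $\int_0^\infty e^{-\theta x}W(x)\,dx=1/\psi(\theta)$ for $\theta>0$. A Bernstein function is a function of the form $\phi(\theta)=\kappa+\mathrm{d}\theta+\int_{(0,\infty)}(1-e^{-\theta x})\Upsilon(dx)$, $\theta\ge0$, with $\kappa,\mathrm{d}\ge 0$ and $\Upsilon$ a measure on $(0,\infty)$ with $\int_{(0,\infty)}(1\wedge x)\Upsilon(dx)<\infty$. A Bernstein function $\phi$ is special if there is a Bernstein function $\phi^*$ with $\phi(\theta)=\theta/\phi^*(\theta)$; then $\phi^*$ is also special, and $\phi,\phi^*$ are called conjugate. Quotients are understood at $\theta=0$ as limits as $\theta\downarrow 0$. The notation $\Upsilon^*(y,\infty)$ means the $\Upsilon^*$-measure of the interval $(y,\infty)$. *)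

theory Defs
  imports "HOL-Probability.Probability"
begin

section \<open>L\'evy processes\<close>

text \<open>
  A process is a family of random variables \<open>X t\<close> of which only the times \<open>t \<ge> 0\<close> matter.
\<close>

definition cadlag :: "(real \<Rightarrow> real) \<Rightarrow> bool" where
  "cadlag x \<longleftrightarrow>
     (\<forall>t\<ge>0. (x \<longlongrightarrow> x t) (at_right t)) \<and>
     (\<forall>t>0. \<exists>l. (x \<longlongrightarrow> l) (at_left t))"

definition levy_process :: "'w measure \<Rightarrow> (real \<Rightarrow> 'w \<Rightarrow> real) \<Rightarrow> bool" where
  "levy_process M X \<longleftrightarrow>
     prob_space M \<and>
     (\<forall>t\<ge>0. X t \<in> borel_measurable M) \<and>
     (AE \<omega> in M. X 0 \<omega> = 0) \<and>
     (AE \<omega> in M. cadlag (\<lambda>t. X t \<omega>)) \<and>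
     (\<forall>(n::nat) (t::nat \<Rightarrow> real). 0 \<le> t 0 \<and> (\<forall>i<n. t i \<le> t (Suc i)) \<longrightarrow>
        prob_space.indep_vars M (\<lambda>_. borel) (\<lambda>i \<omega>. X (t (Suc i)) \<omega> - X (t i) \<omega>) {..<n}) \<and>
     (\<forall>s t. 0 \<le> s \<and> s \<le> t \<longrightarrow>
        distr M borel (\<lambda>\<omega>. X t \<omega> - X s \<omega>) = distr M borel (X (t - s)))"

definition subordinator :: "'w measure \<Rightarrow> (real \<Rightarrow> 'w \<Rightarrow> real) \<Rightarrow> bool" where
  "subordinator M Y \<longleftrightarrow> levy_process M Y \<and> (AE \<omega> in M. mono_on {0..} (\<lambda>t. Y t \<omega>))"

definition no_positive_jumps :: "(real \<Rightarrow> real) \<Rightarrow> bool" where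
  "no_positive_jumps x \<longleftrightarrow> (\<forall>t>0. \<forall>l. (x \<longlongrightarrow> l) (at_left t) \<longrightarrow> x t - l \<le> 0)"

definition spectrally_negative :: "'w measure \<Rightarrow> (real \<Rightarrow> 'w \<Rightarrow> real) \<Rightarrow> bool" where
  "spectrally_negative M X \<longleftrightarrow>
     levy_process M X \<and>
     (AE \<omega> in M. no_positive_jumps (\<lambda>t. X t \<omega>)) \<and>
     \<not> subordinator M (\<lambda>t \<omega>. - X t \<omega>)"

definition drifts_to_minus_infinity :: "'w measure \<Rightarrow> (real \<Rightarrow> 'w \<Rightarrow> real) \<Rightarrow> bool" where
  "drifts_to_minus_infinity M X \<longleftrightarrow>
     (AE \<omega> in M. filterlim (\<lambda>t. X t \<omega>) at_bot at_top)"

text \<open>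
  As the Laplace exponent is real valued, finiteness of the exponential moments is part of
  what it means for \<open>\<psi>\<close> to be the exponent; without it the Bochner integral below
  would silently be \<open>0\<close>.
\<close>

definition has_laplace_exponent ::
    "'w measure \<Rightarrow> (real \<Rightarrow> 'w \<Rightarrow> real) \<Rightarrow> (real \<Rightarrow> real) \<Rightarrow> bool" where
  "has_laplace_exponent M X \<psi> \<longleftrightarrow>
     (\<forall>\<theta>\<ge>0. integrable M (\<lambda>\<omega>. exp (\<theta> * X 1 \<omega>)) \<and>
            \<psi> \<theta> = ln (LINT \<omega>|M. exp (\<theta> * X 1 \<omega>)))"

definition is_scale_function :: "(real \<Rightarrow> real) \<Rightarrow> (real \<Rightarrow> real) \<Rightarrow> bool" where
  "is_scale_function \<psi> W \<longleftrightarrow>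
     (\<forall>x. 0 \<le> W x) \<and>
     (\<forall>x<0. W x = 0) \<and>
     continuous_on {0..} W \<and>
     (\<forall>\<theta>>0. set_integrable lborel {0..} (\<lambda>x. exp (- \<theta> * x) * W x) \<and>
            (LINT x:{0..}|lborel. exp (- \<theta> * x) * W x) = 1 / \<psi> \<theta>)"

section \<open>Bernstein functions\<close>

definition bernstein_rep ::
    "real \<Rightarrow> real \<Rightarrow> real measure \<Rightarrow> (real \<Rightarrow> real) \<Rightarrow> bool" where
  "bernstein_rep \<kappa> d \<Upsilon> \<phi> \<longleftrightarrow>
     0 \<le> \<kappa> \<and> 0 \<le> d \<and>
     sets \<Upsilon> = sets (restrict_space borel {0<..}) \<and>
     (\<integral>\<^sup>+x. ennreal (min 1 x) \<partial>\<Upsilon>) < \<infinity> \<and>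
     (\<forall>\<theta>\<ge>0. \<phi> \<theta> = \<kappa> + d * \<theta> + (LINT x|\<Upsilon>. 1 - exp (- \<theta> * x)))"

definition bernstein :: "(real \<Rightarrow> real) \<Rightarrow> bool" where
  "bernstein \<phi> \<longleftrightarrow> (\<exists>\<kappa> d \<Upsilon>. bernstein_rep \<kappa> d \<Upsilon> \<phi>)"

text \<open>
  \<open>eq_quotient f g h\<close> is the identity \<open>f = g / h\<close> on \<open>[0, \<infinity>)\<close>, read as a limit at \<open>0\<close>.
  The condition \<open>h \<theta> \<noteq> 0\<close> rules out the convention \<open>x / 0 = 0\<close>, by which \<open>0\<close>
  would be conjugate to itself.
\<close>

definition eq_quotient :: "(real \<Rightarrow> real) \<Rightarrow> (real \<Rightarrow> real) \<Rightarrow> (real \<Rightarrow> real) \<Rightarrow> bool" where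
  "eq_quotient f g h \<longleftrightarrow>
     (\<forall>\<theta>>0. h \<theta> \<noteq> 0 \<and> f \<theta> = g \<theta> / h \<theta>) \<and>
     ((\<lambda>\<theta>. g \<theta> / h \<theta>) \<longlongrightarrow> f 0) (at_right 0)"

definition conjugate_bernstein :: "(real \<Rightarrow> real) \<Rightarrow> (real \<Rightarrow> real) \<Rightarrow> bool" where
  "conjugate_bernstein \<phi> \<phi>s \<longleftrightarrow>
     bernstein \<phi> \<and> bernstein \<phi>s \<and> eq_quotient \<phi> (\<lambda>\<theta>. \<theta>) \<phi>s"

definition special_bernstein :: "(real \<Rightarrow> real) \<Rightarrow> bool" where
  "special_bernstein \<phi> \<longleftrightarrow> (\<exists>\<phi>s. conjugate_bernstein \<phi> \<phi>s)"

text \<open>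
  Measurability of the density \<open>u\<close> on \<open>(0, \<infinity>)\<close> follows from monotonicity. A
  non-increasing density of a measure integrating \<open>min 1 x\<close> is finite on \<open>(0, \<infinity>)\<close>, so
  taking it real valued loses nothing.
\<close>

definition has_nonincreasing_density :: "real measure \<Rightarrow> bool" where
  "has_nonincreasing_density \<Upsilon> \<longleftrightarrow>
     (\<exists>u::real \<Rightarrow> real. (\<forall>x>0. 0 \<le> u x) \<and> antimono_on {0<..} u \<and>
        \<Upsilon> = density (restrict_space lborel {0<..}) (\<lambda>x. ennreal (u x)))"

lemma bernstein_tendsto_0:
  assumes "bernstein \<phi>"
  shows "(\<phi> \<longlongrightarrow> \<phi> 0) (at_right 0)"
proof -
  obtain \<kappa> d \<Upsilon> where s: "sets \<Upsilon> = sets (restrict_space borel {0<..})"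
    and i: "(\<integral>\<^sup>+x. ennreal (min 1 x) \<partial>\<Upsilon>) < \<infinity>"
    and rep: "\<And>\<theta>. \<theta> \<ge> 0 \<Longrightarrow> \<phi> \<theta> = \<kappa> + d * \<theta> + (LINT x|\<Upsilon>. 1 - exp (- \<theta> * x))"
    using assms unfolding bernstein_def bernstein_rep_def by blast
  have sp: "space \<Upsilon> = {0<..}"
    using sets_eq_imp_space_eq[OF s] by (simp add: space_restrict_space)
  have m: "f \<in> borel_measurable \<Upsilon>" if "f \<in> borel_measurable borel" for f :: "real \<Rightarrow> real"
    unfolding measurable_cong_sets[OF s refl] using that by (rule measurable_restrict_space1)
  have int: "integrable \<Upsilon> (\<lambda>x. min 1 x)"
  proof (rule integrableI_nonneg)
    show "AE x in \<Upsilon>. 0 \<le> min 1 x" by (rule AE_I2) (auto simp: sp)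
  qed (use i in \<open>auto intro: m\<close>)
  have ev: "eventually (\<lambda>\<theta>::real. 0 < \<theta> \<and> \<theta> < 1) (at_right 0)"
    by (auto simp: eventually_at_right_field intro!: exI[of _ 1])
  have "((\<lambda>\<theta>. LINT x|\<Upsilon>. 1 - exp (- \<theta> * x)) \<longlongrightarrow> (LINT x|\<Upsilon>. 0)) (at_right 0)"
  proof (rule tendsto_at_right_sequentially[where b = 1])
    fix S :: "nat \<Rightarrow> real"
    assume S: "\<And>n. 0 < S n" "\<And>n. S n < 1" "S \<longlonglongrightarrow> 0"
    show "(\<lambda>n. LINT x|\<Upsilon>. 1 - exp (- S n * x)) \<longlonglongrightarrow> (LINT x|\<Upsilon>. 0)"
    proof (rule integral_dominated_convergence[where w = "\<lambda>x. min 1 x"])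
      show "AE x in \<Upsilon>. (\<lambda>n. 1 - exp (- S n * x)) \<longlonglongrightarrow> 0"
        by (intro AE_I2) (use S(3) in \<open>auto intro!: tendsto_eq_intros\<close>)
      show "AE x in \<Upsilon>. norm (1 - exp (- S n * x)) \<le> min 1 x" for n
      proof (rule AE_I2)
        fix x assume "x \<in> space \<Upsilon>"
        hence x: "x > 0" by (simp add: sp)
        have "S n * x \<le> x" "0 \<le> S n * x" using S(1,2)[of n] x by (auto simp: mult_left_le_one_le)
        moreover have "1 + - S n * x \<le> exp (- S n * x)" by (rule exp_ge_add_one_self)
        moreover have "exp (- S n * x) \<le> 1" "0 < exp (- S n * x)" using calculation by auto
        ultimately show "norm (1 - exp (- S n * x)) \<le> min 1 x" by auto
      qed
    qed (auto intro: m int)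
  qed simp
  hence "((\<lambda>\<theta>. \<kappa> + d * \<theta> + (LINT x|\<Upsilon>. 1 - exp (- \<theta> * x))) \<longlongrightarrow> \<kappa> + d * 0 + 0) (at_right 0)"
    by (intro tendsto_intros) auto
  moreover have "eventually (\<lambda>\<theta>. \<kappa> + d * \<theta> + (LINT x|\<Upsilon>. 1 - exp (- \<theta> * x)) = \<phi> \<theta>) (at_right 0)"
    using ev by eventually_elim (simp add: rep)
  ultimately have "(\<phi> \<longlongrightarrow> \<kappa> + d * 0 + 0) (at_right 0)"
    by (rule Lim_transform_eventually)
  thus ?thesis using rep[of 0] by simp
qed

lemma conjugate_bernstein_sym:
  assumes "conjugate_bernstein \<phi> \<phi>s"
  shows "conjugate_bernstein \<phi>s \<phi>"
proof -
  have q: "\<phi> \<theta> \<noteq> 0 \<and> \<phi>s \<theta> = \<theta> / \<phi> \<theta>" if "\<theta> > 0" for \<theta>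
    using assms that unfolding conjugate_bernstein_def eq_quotient_def by auto
  have "(\<phi>s \<longlongrightarrow> \<phi>s 0) (at_right 0)"
    using assms bernstein_tendsto_0 unfolding conjugate_bernstein_def by blast
  moreover have "eventually (\<lambda>\<theta>. \<phi>s \<theta> = \<theta> / \<phi> \<theta>) (at_right 0)"
    using q by (auto simp: eventually_at_right_field intro!: exI[of _ 1])
  ultimately have "((\<lambda>\<theta>. \<theta> / \<phi> \<theta>) \<longlongrightarrow> \<phi>s 0) (at_right 0)"
    by (rule Lim_transform_eventually)
  with q assms show ?thesis
    unfolding conjugate_bernstein_def eq_quotient_def by blast
qed

corollary conjugate_bernstein_imp_special:
  assumes "conjugate_bernstein \<phi> \<phi>s"
  shows "special_bernstein \<phi>" "special_bernstein \<phi>s"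
  using assms conjugate_bernstein_sym unfolding special_bernstein_def by blast+

end

theory Submission
  imports Defs
begin

text \<open>
  Write \<open>\<psi> \<theta> = \<theta> * \<phi> \<theta>\<close>. For a step function \<open>u\<close> the function \<open>\<theta> * \<integral> (1 - exp (- \<theta> * x)) * u x dx\<close> is
  a finite sum of exponents of compensated Poisson processes with negative jumps; dyadic approximation of a
  non-increasing \<open>u\<close> and tightness give infinitely divisible laws with exponent \<open>\<psi>\<close>, hence a convolution
  semigroup, and Kolmogorov's theorem yields a process on the dyadic times. Two consecutive increments over
  time \<open>h\<close> are both large with probability of order \<open>h\<^sup>2\<close>, so Chentsov's chaining makes the paths cadlag;
  a single increment exceeds \<open>\<epsilon>\<close> with probability of order \<open>h\<^sup>2\<close>, which excludes positive jumps. Optional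
  stopping of \<open>exp (\<theta> * X)\<close>, with \<open>\<theta> \<down> 0\<close>, shows that every level is passed almost surely, so there is no drift to
  \<open>-\<infinity>\<close>.
  The formula for the scale function is Fubini's theorem for \<open>\<psi> \<theta> = \<theta>\<^sup>2 / \<phi>s \<theta>\<close>.

  Conversely, a concave \<open>W\<close> is \<open>W 0 + \<kappa>s * x + \<integral>\<^sub>0\<^sup>x v\<close> with \<open>v\<close> non-increasing and vanishing at infinity, so
  \<open>v\<close> is the tail of a measure and \<open>\<theta>\<^sup>2 / \<psi> \<theta>\<close> is a Bernstein function. That \<open>\<psi> \<theta> / \<theta>\<close> is one as well does not
  involve \<open>W\<close>: with \<open>Y = exp (X (1 / n))\<close> the identity \<open>n * E (Y powr \<theta> - 1) \<longlonglongrightarrow> \<psi> \<theta>\<close> shows that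
  \<open>\<psi> \<theta> - \<theta> * \<psi> 1\<close> is a limit of integrals of the second order Taylor quotient of \<open>y powr \<theta>\<close> at \<open>1\<close>; as there
  are no positive jumps, the limit measure lives on \<open>[0, 1]\<close>. Letting \<open>\<theta> \<down> 0\<close> in \<open>\<psi> \<ge> 0\<close> excludes an atom
  at \<open>0\<close>, and Fubini's theorem puts the representation into the required form.
\<close>

section \<open>Infinitely divisible exponents\<close>

text \<open>Exponents carry a complex argument with \<open>0 \<le> Re z\<close>: the imaginary axis
  determines laws, so that the laws chosen separately for each time form a semigroup, while the
  positive half-line gives the moments behind tightness and all tail bounds. The absence of positive
  jumps is visible in \<open>\<psi>\<close> as quadratic growth: at mesh \<open>1 / 2 ^ n\<close> an
  exponential moment of order proportional to \<open>n\<close> stays bounded, yet brings the factor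
  \<open>(1 / 4) ^ n\<close> into Markov's inequality. The overshoot of a walk over a level is
  controlled only as the mesh tends to zero, so in the optional stopping argument the grid limit
  comes before the limits in time and in \<open>\<theta>\<close>. In the converse the factor
  \<open>(y - 1)\<^sup>2\<close> gives the rescaled laws of \<open>Y\<close> bounded mass, because
  \<open>n * E (Y - 1)\<^sup>2\<close> tends to \<open>\<psi> 2 - 2 * \<psi> 1\<close>; an atom of
  the limit at \<open>1\<close> is the Gaussian part, an atom at \<open>0\<close> would mean jumps
  to minus infinity. There \<open>\<phi>\<close> comes from \<open>\<psi>\<close> and
  \<open>\<phi>s\<close> from \<open>W\<close>, and only the Laplace transform of \<open>W\<close>
  makes them conjugate.\<close>

definition infdiv :: "(complex \<Rightarrow> complex) \<Rightarrow> bool" where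
  "infdiv \<Psi> \<longleftrightarrow> (\<forall>t\<ge>0. \<exists>\<mu>. real_distribution \<mu> \<and>
     (\<forall>z. 0 \<le> Re z \<longrightarrow> integrable \<mu> (\<lambda>x. exp (z * of_real x)) \<and>
        (LINT x|\<mu>. exp (z * of_real x)) = exp (of_real t * \<Psi> z)))"

text \<open>Mean value inequality on the convex half-plane \<open>0 \<le> Re z\<close>, where the
  derivative of \<open>exp (- z)\<close> has modulus at most 1.\<close>

lemma cmod_one_minus_exp_le:
  assumes "0 \<le> Re w" shows "cmod (1 - exp (- w)) \<le> cmod w"
proof -
  have "cmod (exp (- w) - exp (- 0)) \<le> 1 * cmod (w - 0)"
  proof (rule field_differentiable_bound[where S = "{z. 0 \<le> Re z}" and f' = "\<lambda>z. - exp (- z)"])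
    show "convex {z. 0 \<le> Re z}" by (simp add: convex_halfspace_Re_ge)
  qed (use assms in \<open>auto intro!: derivative_eq_intros\<close>)
  then show ?thesis by (simp add: norm_minus_commute)
qed

text \<open>Provides the dominating function for integrals against a density that integrates only
  \<open>min 1 x\<close>: linear near 0, bounded by 2 far out.\<close>

lemma cmod_one_minus_exp_le_min:
  assumes "0 \<le> Re z" "0 \<le> x"
  shows "cmod (1 - exp (- z * of_real x)) \<le> (2 + cmod z) * min 1 x"
proof (cases "x \<le> 1")
  case True
  have "cmod (1 - exp (- (z * of_real x))) \<le> cmod (z * of_real x)"
    using assms by (intro cmod_one_minus_exp_le) auto
  also have "\<dots> \<le> (2 + cmod z) * x" using assms by (simp add: norm_mult algebra_simps)
  finally show ?thesis using True by simp
next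
  case False
  have "cmod (1 - exp (- z * of_real x)) \<le> 1 + cmod (exp (- z * of_real x))"
    by (metis norm_one norm_triangle_ineq4)
  also have "\<dots> \<le> 2" using assms by simp
  finally have "cmod (1 - exp (- z * of_real x)) \<le> 2 + cmod z" using norm_ge_zero[of z] by linarith
  then show ?thesis using False by simp
qed

lemma infdiv_drift: "infdiv (\<lambda>z. of_real k * z)"
  unfolding infdiv_def
proof (intro allI impI)
  fix t :: real
  interpret p: prob_space "return borel (k * t)" by (rule prob_space_return) simp
  have "real_distribution (return borel (k * t))" by unfold_locales auto
  moreover have "integrable (return borel (k * t)) (\<lambda>x. exp (z * complex_of_real x))" for z
    by (subst integrable_cong_AE[where g = "\<lambda>_. exp (z * complex_of_real (k * t))"])
       (auto simp: AE_return)
  moreover have "(LINT x|return borel (k * t). exp (z * complex_of_real x)) = exp (of_real t * (of_real k * z))" for z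
    by (subst integral_return) (auto simp: algebra_simps)
  ultimately show "\<exists>\<mu>. real_distribution \<mu> \<and> (\<forall>z. 0 \<le> Re z \<longrightarrow>
      integrable \<mu> (\<lambda>x. exp (z * complex_of_real x)) \<and>
      (LINT x|\<mu>. exp (z * complex_of_real x)) = exp (complex_of_real t * (of_real k * z)))"
    by blast
qed

text \<open>The modulus of the exponential of a sum factorizes as well; this gives the joint
  integrability that Fubini's theorem asks for.\<close>

lemma exp_integral_convolution:
  assumes "real_distribution M" "real_distribution N"
    and "integrable M (\<lambda>x. exp (z * complex_of_real x))" "integrable N (\<lambda>x. exp (z * complex_of_real x))"
  shows "real_distribution (convolution M N)"
    and "integrable (convolution M N) (\<lambda>x. exp (z * complex_of_real x))"
    and "(LINT x|convolution M N. exp (z * complex_of_real x)) =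
      (LINT x|M. exp (z * complex_of_real x)) * (LINT x|N. exp (z * complex_of_real x))"
proof -
  interpret M: real_distribution M by fact
  interpret N: real_distribution N by fact
  interpret P: pair_prob_space M N ..
  have sb: "sets (M \<Otimes>\<^sub>M N) = sets (borel :: (real \<times> real) measure)"
    by (metis M.events_eq_borel N.events_eq_borel borel_prod sets_pair_measure_cong)
  have m: "(\<lambda>p. fst p + snd p) \<in> borel_measurable (M \<Otimes>\<^sub>M N)"
    by measurable
  have eq: "convolution M N = distr (M \<Otimes>\<^sub>M N) borel (\<lambda>p. fst p + snd p)"
    by (simp add: convolution_def case_prod_unfold)
  have "prob_space (convolution M N)" unfolding eq using m by (rule P.P.prob_space_distr)
  then show "real_distribution (convolution M N)"
    by (auto simp: real_distribution_def real_distribution_axioms_def eq)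
  have e: "exp (z * complex_of_real (fst p + snd p)) =
      exp (z * complex_of_real (fst p)) * exp (z * complex_of_real (snd p))" for p
    by (simp add: ring_distribs exp_add)
  have i: "integrable (M \<Otimes>\<^sub>M N) (\<lambda>(x, y). exp (z * complex_of_real x) * exp (z * complex_of_real y))"
  proof (rule P.Fubini_integrable)
    have "cmod (exp (z * complex_of_real x)) = exp (Re z * x)" for x by simp
    note [simp] = norm_mult this
    show "AE x in M. integrable N (\<lambda>y. case (x, y) of (x, y) \<Rightarrow> exp (z * complex_of_real x) * exp (z * complex_of_real y))"
      using assms(4) by auto
    have "integrable M (\<lambda>x. cmod (exp (z * complex_of_real x)) * (LINT y|N. cmod (exp (z * complex_of_real y))))"
      using integrable_norm[OF assms(3)] by (rule integrable_mult_left)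
    then show "integrable M (\<lambda>x. LINT y|N. cmod (case (x, y) of (x, y) \<Rightarrow> exp (z * complex_of_real x) * exp (z * complex_of_real y)))"
      by (simp add: assms)
  qed measurable
  then show "integrable (convolution M N) (\<lambda>x. exp (z * complex_of_real x))"
    unfolding eq by (subst integrable_distr_eq) (use m in \<open>auto simp: e case_prod_unfold simp del: of_real_add\<close>)
  have "(LINT x|convolution M N. exp (z * complex_of_real x)) =
      (LINT p|(M \<Otimes>\<^sub>M N). (case p of (x, y) \<Rightarrow> exp (z * complex_of_real x) * exp (z * complex_of_real y)))"
    unfolding eq by (subst integral_distr) (use m in \<open>auto simp: e case_prod_unfold simp del: of_real_add\<close>)
  also have "\<dots> = (LINT x|M. LINT y|N. exp (z * complex_of_real x) * exp (z * complex_of_real y))"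
    using P.integral_fst'[OF i] by simp
  also have "\<dots> = (LINT x|M. exp (z * complex_of_real x)) * (LINT x|N. exp (z * complex_of_real x))"
    by simp
  finally show "(LINT x|convolution M N. exp (z * complex_of_real x)) =
      (LINT x|M. exp (z * complex_of_real x)) * (LINT x|N. exp (z * complex_of_real x))" .
qed

lemma infdiv_add:
  assumes "infdiv \<Psi>" "infdiv \<Phi>" shows "infdiv (\<lambda>z. \<Psi> z + \<Phi> z)"
  unfolding infdiv_def
proof (intro allI impI)
  fix t :: real assume "t \<ge> 0"
  with assms obtain M N where
    M: "real_distribution M" "\<And>z. 0 \<le> Re z \<Longrightarrow> integrable M (\<lambda>x. exp (z * complex_of_real x))"
       "\<And>z. 0 \<le> Re z \<Longrightarrow> (LINT x|M. exp (z * complex_of_real x)) = exp (of_real t * \<Psi> z)" and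
    N: "real_distribution N" "\<And>z. 0 \<le> Re z \<Longrightarrow> integrable N (\<lambda>x. exp (z * complex_of_real x))"
       "\<And>z. 0 \<le> Re z \<Longrightarrow> (LINT x|N. exp (z * complex_of_real x)) = exp (of_real t * \<Phi> z)"
    unfolding infdiv_def by metis
  show "\<exists>\<mu>. real_distribution \<mu> \<and> (\<forall>z. 0 \<le> Re z \<longrightarrow>
      integrable \<mu> (\<lambda>x. exp (z * complex_of_real x)) \<and>
      (LINT x|\<mu>. exp (z * complex_of_real x)) = exp (complex_of_real t * (\<Psi> z + \<Phi> z)))"
  proof (intro exI[of _ "convolution M N"] conjI allI impI)
    show "real_distribution (convolution M N)"
      using M(1) N(1) M(2)[of 0] N(2)[of 0] by (intro exp_integral_convolution[of _ _ 0]) auto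
    fix z :: complex assume z: "0 \<le> Re z"
    note c = exp_integral_convolution[OF M(1) N(1) M(2)[OF z] N(2)[OF z]]
    show "integrable (convolution M N) (\<lambda>x. exp (z * complex_of_real x))" by (rule c(2))
    show "(LINT x|convolution M N. exp (z * complex_of_real x)) = exp (complex_of_real t * (\<Psi> z + \<Phi> z))"
      using c(3) M(3)[OF z] N(3)[OF z] by (simp add: ring_distribs exp_add)
  qed
qed

lemma infdiv_sum:
  assumes "finite A" "\<And>i. i \<in> A \<Longrightarrow> infdiv (\<Psi> i)" shows "infdiv (\<lambda>z. \<Sum>i\<in>A. \<Psi> i z)"
  using assms
proof (induction A)
  case empty
  show ?case using infdiv_drift[of 0] by simp
next
  case (insert i A)
  then show ?case using infdiv_add[of "\<Psi> i" "\<lambda>z. \<Sum>i\<in>A. \<Psi> i z"] by simp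
qed

text \<open>The law at time \<open>t\<close> is that of \<open>- b\<close> times a Poisson variable
  with mean \<open>a * t\<close>.\<close>

lemma infdiv_poisson:
  assumes "0 \<le> a" shows "infdiv (\<lambda>z. of_real a * (exp (- z * of_real b) - 1))"
  unfolding infdiv_def
proof (intro allI impI)
  fix t :: real assume t: "t \<ge> 0"
  show "\<exists>\<mu>. real_distribution \<mu> \<and> (\<forall>z. 0 \<le> Re z \<longrightarrow>
      integrable \<mu> (\<lambda>x. exp (z * complex_of_real x)) \<and>
      (LINT x|\<mu>. exp (z * complex_of_real x)) = exp (complex_of_real t * (of_real a * (exp (- z * of_real b) - 1))))"
  \<comment> \<open>The formula for \<open>poisson_pmf\<close> wants a positive rate; in the
    degenerate case the law is the point mass at 0, that is, the zero drift.\<close>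
  proof (cases "a * t = 0")
  case True
  then have "t = 0 \<or> a = 0" by auto
  then show ?thesis using infdiv_drift[of 0, unfolded infdiv_def, rule_format, OF t] by (elim disjE) simp_all
  next
  case False
  then have r: "0 < a * t" using assms t by (simp add: zero_less_mult_iff)
  define p where "p = poisson_pmf (a * t)"
  define \<mu> where "\<mu> = distr (measure_pmf p) borel (\<lambda>k. - b * real k)"
  have pmf: "pmf p k = (a * t) ^ k / fact k * exp (- (a * t))" for k
    unfolding p_def by (rule pmf_poisson[OF r])
  have "prob_space \<mu>" unfolding \<mu>_def by (rule measure_pmf.prob_space_distr) simp
  then have rd: "real_distribution \<mu>"
    by (auto simp: real_distribution_def real_distribution_axioms_def \<mu>_def)
  \<comment> \<open>Stated for any complete normed field: a real \<open>w\<close> gives absolute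
    summability, a complex \<open>w\<close> the value of the transform.\<close>
  have sums: "(\<lambda>k. pmf p k *\<^sub>R w ^ k) sums exp (of_real (a * t) * (w - 1))" for w :: "'b :: {real_normed_field,banach}"
  proof -
    have "(\<lambda>k. of_real (exp (- (a * t))) * ((of_real (a * t) * w) ^ k /\<^sub>R fact k)) sums (of_real (exp (- (a * t))) * exp (of_real (a * t) * w))"
      by (intro sums_mult exp_converges)
    also have "of_real (exp (- (a * t))) * exp (of_real (a * t) * w) = exp (of_real (a * t) * (w - 1))"
      by (simp add: exp_of_real[symmetric] mult_exp_exp del: exp_of_real) (simp add: algebra_simps)
    finally show ?thesis by (simp add: pmf scaleR_conv_of_real field_simps power_mult_distrib)
  qed
  have ex: "exp (z * complex_of_real (- (b * real k))) = exp (- z * of_real b) ^ k" for z k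
    by (simp add: exp_of_nat_mult[symmetric] algebra_simps)
  have i: "integrable (count_space UNIV) (\<lambda>k. pmf p k *\<^sub>R exp (- z * of_real b) ^ k)" for z :: complex
    unfolding integrable_count_space_nat_iff
    using sums_summable[OF sums[of "norm (exp (- z * complex_of_real b))"]]
    by (simp add: norm_power)
  show ?thesis
  proof (intro exI[of _ \<mu>] conjI allI impI rd)
    fix z :: complex
    show "integrable \<mu> (\<lambda>x. exp (z * complex_of_real x))"
      unfolding \<mu>_def using i[of z]
      by (subst integrable_distr_eq) (simp_all add: ex measure_pmf_eq_density integrable_density del: of_real_mult of_real_minus)
    have "(LINT x|\<mu>. exp (z * complex_of_real x)) = (LINT k|count_space UNIV. pmf p k *\<^sub>R exp (- z * of_real b) ^ k)"
      unfolding \<mu>_def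
      by (subst integral_distr) (simp_all add: ex measure_pmf_eq_density integral_density del: of_real_mult of_real_minus)
    also have "\<dots> = exp (of_real (a * t) * (exp (- z * of_real b) - 1))"
      using sums_integral_count_space_nat[OF i] sums by (rule sums_unique2)
    finally show "(LINT x|\<mu>. exp (z * complex_of_real x)) = exp (complex_of_real t * (of_real a * (exp (- z * of_real b) - 1)))"
      by (simp add: algebra_simps)
  qed
  qed
qed

section \<open>Tightness and weak limits of laws with exponential moments\<close>

lemma tightI_eventually:
  assumes rd: "\<And>n. real_distribution (M n)"
    and ev: "\<And>\<epsilon>::real. \<epsilon> > 0 \<Longrightarrow> \<exists>K. \<forall>\<^sub>F n in sequentially. measure (M n) {x. \<bar>x\<bar> > K} < \<epsilon>"
  shows "tight M"
  unfolding tight_def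
proof (intro conjI allI impI rd)
  fix \<epsilon> :: real assume \<epsilon>: "\<epsilon> > 0"
  obtain K N where K: "\<And>n. n \<ge> N \<Longrightarrow> measure (M n) {x. \<bar>x\<bar> > K} < \<epsilon>"
    using ev[OF \<epsilon>] by (auto simp: eventually_sequentially)
  have one: "\<exists>k. measure (M n) {x. \<bar>x\<bar> > k} < \<epsilon>" for n
  proof -
    interpret real_distribution "M n" by (rule rd)
    have "(\<lambda>k. measure (M n) {x. \<bar>x\<bar> > real k}) \<longlonglongrightarrow> measure (M n) (\<Inter>k. {x. \<bar>x\<bar> > real k})"
      by (intro finite_Lim_measure_decseq) (auto simp: decseq_def)
    moreover have "(\<Inter>k. {x. \<bar>x\<bar> > real k}) = {}"
    proof (rule equals0I)
      fix x :: real assume "x \<in> (\<Inter>k. {x. \<bar>x\<bar> > real k})"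
      moreover obtain k :: nat where "\<bar>x\<bar> < real k" using reals_Archimedean2 by blast
      ultimately show False by (metis INT_D UNIV_I mem_Collect_eq less_asym)
    qed
    ultimately have "(\<lambda>k. measure (M n) {x. \<bar>x\<bar> > real k}) \<longlonglongrightarrow> 0" by simp
    then have "\<forall>\<^sub>F k in sequentially. measure (M n) {x. \<bar>x\<bar> > real k} < \<epsilon>"
      using \<epsilon> by (rule order_tendstoD(2))
    then show ?thesis by (auto simp: eventually_sequentially)
  qed
  then obtain k where k: "\<And>n. measure (M n) {x. \<bar>x\<bar> > k n} < \<epsilon>" by metis
  define L where "L = Max (insert K (k ` {..<N}) \<union> {1})"
  have L: "K \<le> L" "\<And>n. n < N \<Longrightarrow> k n \<le> L" "1 \<le> L" unfolding L_def by (rule Max_ge; simp)+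
  have le: "measure (M n) {x. \<bar>x\<bar> > L} < \<epsilon>" for n
  proof -
    interpret real_distribution "M n" by (rule rd)
    show ?thesis
    proof (cases "n < N")
      case True
      have "measure (M n) {x. \<bar>x\<bar> > L} \<le> measure (M n) {x. \<bar>x\<bar> > k n}"
        using L(2)[OF True] by (intro finite_measure_mono) auto
      then show ?thesis using k[of n] by linarith
    next
      case False
      have "measure (M n) {x. \<bar>x\<bar> > L} \<le> measure (M n) {x. \<bar>x\<bar> > K}"
        using L(1) by (intro finite_measure_mono) auto
      then show ?thesis using K[of n] False by linarith
    qed
  qed
  \<comment> \<open>The interval is open on the left, so with left end \<open>-L\<close> it would
    lose the point \<open>-L\<close>; hence the shift to \<open>-L-1\<close>.\<close>
  have "measure (M n) {-L-1<..L} > 1 - \<epsilon>" for n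
  proof -
    interpret real_distribution "M n" by (rule rd)
    have "measure (M n) (UNIV - {-L-1<..L}) \<le> measure (M n) {x. \<bar>x\<bar> > L}"
      by (intro finite_measure_mono) auto
    moreover have "measure (M n) (UNIV - {-L-1<..L}) = 1 - measure (M n) {-L-1<..L}"
      using prob_compl[of "{-L-1<..L}"] by simp
    ultimately show ?thesis using le[of n] by linarith
  qed
  moreover have "-L-1 < L" using L(3) by simp
  ultimately show "\<exists>a b. a < b \<and> (\<forall>n. 1 - \<epsilon> < measure (M n) {a<..b})" by blast
qed

text \<open>The right tail is Markov's inequality for \<open>exp x\<close>. On the left,
  \<open>1 - exp (\<theta> * x)\<close> is at least 1/2 below \<open>- 1 / \<theta>\<close> but
  negative for positive \<open>x\<close>; adding \<open>\<theta> * exp x\<close> makes it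
  nonnegative everywhere, and continuity of \<open>L\<close> at 0 makes its mean small for small
  \<open>\<theta>\<close>.\<close>

lemma tight_if_exp_integrals_converge:
  assumes rd: "\<And>n. real_distribution (M n)"
    and int: "\<And>n \<theta>. \<theta> \<ge> 0 \<Longrightarrow> integrable (M n) (\<lambda>x. exp (\<theta> * x))"
    and lim: "\<And>\<theta>. \<theta> \<ge> 0 \<Longrightarrow> (\<lambda>n. LINT x|M n. exp (\<theta> * x)) \<longlonglongrightarrow> L \<theta>"
    and cont: "(L \<longlongrightarrow> 1) (at_right 0)"
  shows "tight M"
proof (rule tightI_eventually[OF rd])
  fix \<epsilon> :: real assume \<epsilon>: "\<epsilon> > 0"
  define C where "C = L 1 + 1"
  have evC: "\<forall>\<^sub>F n in sequentially. (LINT x|M n. exp x) < C"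
    using order_tendstoD(2)[OF lim[of 1], of C] by (simp add: C_def)
  have C0: "C > 0"
    using tendsto_lowerbound[OF lim[of 1], of 0] by (auto simp: C_def intro!: eventuallyI)
  have "((\<lambda>\<theta>. 1 - L \<theta> + \<theta> * C) \<longlongrightarrow> 1 - 1 + 0 * C) (at_right 0)"
    by (intro tendsto_intros cont)
  then have "\<forall>\<^sub>F \<theta> in at_right 0. 1 - L \<theta> + \<theta> * C < \<epsilon> / 4"
    using \<epsilon> by (intro order_tendstoD(2)) auto
  moreover have "\<forall>\<^sub>F \<theta>::real in at_right 0. 0 < \<theta> \<and> \<theta> < 1"
    by (auto simp: eventually_at_right_field intro!: exI[of _ 1])
  ultimately have "\<forall>\<^sub>F \<theta> in at_right 0. 1 - L \<theta> + \<theta> * C < \<epsilon> / 4 \<and> 0 < \<theta> \<and> \<theta> < 1"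
    by (rule eventually_conj)
  from eventually_happens'[OF _ this] obtain \<theta> where \<theta>: "1 - L \<theta> + \<theta> * C < \<epsilon> / 4" "0 < \<theta>" "\<theta> < 1"
    by auto
  have ev\<theta>: "\<forall>\<^sub>F n in sequentially. L \<theta> - (LINT x|M n. exp (\<theta> * x)) < \<epsilon> / 4 - (1 - L \<theta> + \<theta> * C)"
    using lim[of \<theta>] \<theta> by (intro order_tendstoD(2)[where y = "L \<theta> - L \<theta>"] tendsto_intros) auto
  obtain m where m: "C / exp m < \<epsilon> / 4"
  proof -
    have "((\<lambda>m. C / exp m) \<longlongrightarrow> 0) at_top"
      by (rule tendsto_divide_0[OF tendsto_const filterlim_at_top_imp_at_infinity[OF exp_at_top]])
    then have "\<forall>\<^sub>F m in at_top. C / exp m < \<epsilon> / 4" using \<epsilon> by (intro order_tendstoD(2)) auto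
    from eventually_happens'[OF _ this] that show ?thesis by auto
  qed
  \<comment> \<open>\<open>m\<close> controls the right tail, \<open>1 / \<theta>\<close> the left
    one.\<close>
  define K where "K = max m (1 / \<theta>)"
  have e1: "exp (-1) \<le> (1/2::real)"
    using exp_ge_add_one_self[of "1::real"] by (simp add: exp_minus field_simps)
  show "\<exists>K. \<forall>\<^sub>F n in sequentially. measure (M n) {x. \<bar>x\<bar> > K} < \<epsilon>"
  proof (rule exI[of _ K], use evC ev\<theta> in eventually_elim)
    case (elim n)
    interpret real_distribution "M n" by (rule rd)
    have i1: "integrable (M n) (\<lambda>x. exp x)" using int[of 1 n] by simp
    have "measure (M n) {x. x > K} = (LINT x|M n. indicator {x. x > K} x)" by simp
    also have "\<dots> \<le> (LINT x|M n. exp x / exp m)"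
    proof (intro integral_mono)
      show "integrable (M n) (\<lambda>x. exp x / exp m)" using i1 by simp
      show "indicator {x. x > K} x \<le> exp x / exp m" for x :: real
        by (auto simp: indicator_def K_def)
    qed (rule integrable_const_bound[of _ 1], auto)
    also have "\<dots> = (LINT x|M n. exp x) / exp m" by simp
    also have "\<dots> < \<epsilon> / 4" using elim(1) m by (meson divide_strict_right_mono exp_gt_zero less_trans)
    finally have right: "measure (M n) {x. x > K} < \<epsilon> / 4" .
    have "1 / 2 * measure (M n) {x. x < -K} = (LINT x|M n. 1 / 2 * indicator {x. x < -K} x)" by simp
    also have "\<dots> \<le> (LINT x|M n. 1 - exp (\<theta> * x) + \<theta> * exp x)"
    proof (intro integral_mono)
      show "integrable (M n) (\<lambda>x. 1 - exp (\<theta> * x) + \<theta> * exp x)" using i1 int[of \<theta> n] \<theta> by simp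
      fix x :: real
      show "1 / 2 * indicator {x. x < -K} x \<le> 1 - exp (\<theta> * x) + \<theta> * exp x"
      proof (cases "x < - K")
        case True
        then have "x < - 1 / \<theta>" by (auto simp: K_def)
        then have "\<theta> * x \<le> - 1" using \<theta> by (simp add: field_simps)
        then have "exp (\<theta> * x) \<le> 1 / 2" using e1 by (meson exp_le_cancel_iff order_trans)
        then show ?thesis using \<theta> True by (simp add: add_increasing2)
      next
        case False
        \<comment> \<open>Convexity of \<open>exp\<close> between \<open>0\<close> and
          \<open>x\<close> reads
          \<open>exp (\<theta> * x) \<le> 1 - \<theta> + \<theta> * exp x\<close>.\<close>
        have "exp ((1 - \<theta>) *\<^sub>R 0 + \<theta> *\<^sub>R x) \<le> (1 - \<theta>) * exp 0 + \<theta> * exp x"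
          using \<theta> exp_convex by (intro convex_onD[of UNIV]) (auto intro: convex_on_subset)
        moreover have "\<theta> > 0" by (fact \<theta>(2))
        ultimately show ?thesis using False by (simp add: algebra_simps)
      qed
    qed (rule integrable_const_bound[of _ "1 / 2"], auto simp: indicator_def)
    also have "\<dots> = 1 - (LINT x|M n. exp (\<theta> * x)) + \<theta> * (LINT x|M n. exp x)"
      using i1 int[of \<theta> n] \<theta> prob_space by simp
    also have "\<dots> < \<epsilon> / 4" 
    proof -
      have "\<theta> * (LINT x|M n. exp x) \<le> \<theta> * C" using elim(1) \<theta> by simp
      then show ?thesis using elim(2) by linarith
    qed
    finally have left: "measure (M n) {x. x < -K} < \<epsilon> / 2" by simp
    have "K > 0" using \<theta> by (simp add: K_def less_max_iff_disj)
    then have "measure (M n) {x. \<bar>x\<bar> > K} \<le> measure (M n) ({x. x > K} \<union> {x. x < -K})"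
      by (intro finite_measure_mono) auto
    also have "\<dots> \<le> measure (M n) {x. x > K} + measure (M n) {x. x < -K}"
      by (intro measure_Un_le) auto
    finally show ?case using left right \<epsilon> by linarith
  qed
qed

text \<open>\<open>exp (z * x)\<close> is unbounded only to the right. Cutting \<open>x\<close> at
  \<open>K\<close> gives a bounded continuous function, to which weak convergence applies; the error
  is at most \<open>2 * exp (- K)\<close> times the moment of order \<open>Re z + 1\<close>,
  uniformly along the sequence.\<close>

lemma weak_conv_exp_integral:
  assumes rd: "\<And>n. real_distribution (M n)" "real_distribution N" and wc: "weak_conv_m M N"
    and int: "\<And>n \<theta>. \<theta> \<ge> 0 \<Longrightarrow> integrable (M n) (\<lambda>x. exp (\<theta> * x))"
    and bd: "\<And>\<theta>. \<theta> \<ge> 0 \<Longrightarrow> \<exists>C. \<forall>n. (LINT x|M n. exp (\<theta> * x)) \<le> C"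
    and z: "0 \<le> Re z"
  shows "integrable N (\<lambda>x. exp (z * complex_of_real x))"
    and "(\<lambda>n. LINT x|M n. exp (z * complex_of_real x)) \<longlonglongrightarrow> (LINT x|N. exp (z * complex_of_real x))"
proof -
  interpret N: real_distribution N by fact
  \<comment> \<open>The truncated moments of \<open>N\<close> are limits of truncated moments of
    \<open>M n\<close>, hence bounded by \<open>C\<close>; monotone convergence removes the
    truncation.\<close>
  have intN: "integrable N (\<lambda>x. exp (\<theta> * x))" if \<theta>: "\<theta> \<ge> 0" for \<theta>
  proof -
    obtain C where C: "\<And>n. (LINT x|M n. exp (\<theta> * x)) \<le> C" using bd[OF \<theta>] by auto
    have b: "norm (exp (\<theta> * min x (real k))) \<le> exp (\<theta> * real k)" for k x
      using \<theta> by (simp add: mult_left_mono)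
    have i: "integrable N (\<lambda>x. exp (\<theta> * min x (real k)))" for k
      by (rule N.integrable_const_bound[of _ "exp (\<theta> * real k)"]) (use b in auto)
    have le: "(LINT x|N. exp (\<theta> * min x (real k))) \<le> C" for k
    proof (rule tendsto_upperbound)
      show "(\<lambda>n. LINT x|M n. exp (\<theta> * min x (real k))) \<longlonglongrightarrow> (LINT x|N. exp (\<theta> * min x (real k)))"
        using rd wc by (rule weak_conv_imp_integral_bdd_continuous_conv) (use b in \<open>auto intro!: continuous_intros\<close>)
      show "\<forall>\<^sub>F n in sequentially. (LINT x|M n. exp (\<theta> * min x (real k))) \<le> C"
      proof (rule eventuallyI)
        fix n
        interpret Mn: real_distribution "M n" by (rule rd)
        have "(LINT x|M n. exp (\<theta> * min x (real k))) \<le> (LINT x|M n. exp (\<theta> * x))"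
        proof (rule integral_mono)
          show "integrable (M n) (\<lambda>x. exp (\<theta> * min x (real k)))"
            by (rule Mn.integrable_const_bound[of _ "exp (\<theta> * real k)"]) (use b in auto)
        qed (use \<theta> int in \<open>auto intro: mult_left_mono\<close>)
        with C[of n] show "(LINT x|M n. exp (\<theta> * min x (real k))) \<le> C" by linarith
      qed
    qed simp
    have "incseq (\<lambda>k. LINT x|N. exp (\<theta> * min x (real k)))"
      by (rule incseq_SucI, rule integral_mono, rule i, rule i) (use \<theta> in \<open>auto intro: mult_left_mono\<close>)
    then obtain L where L: "(\<lambda>k. LINT x|N. exp (\<theta> * min x (real k))) \<longlonglongrightarrow> L"
      using incseq_convergent[of _ C] le by metis
    have p: "(\<lambda>k. exp (\<theta> * min x (real k))) \<longlonglongrightarrow> exp (\<theta> * x)" for x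
    proof (rule tendsto_eventually)
      show "\<forall>\<^sub>F k in sequentially. exp (\<theta> * min x (real k)) = exp (\<theta> * x)"
        using eventually_ge_at_top[of "nat \<lceil>x\<rceil>"] by eventually_elim (simp add: min_absorb1 nat_ceiling_le_eq)
    qed
    show ?thesis
      by (rule integrable_monotone_convergence[where f = "\<lambda>k x. exp (\<theta> * min x (real k))", OF i _ _ L])
         (use p \<theta> in \<open>auto simp: mono_def intro!: AE_I2 mult_left_mono\<close>)
  qed
  have ne: "norm (exp (z * complex_of_real x)) = exp (Re z * x)" for x by simp
  have cint: "integrable P (\<lambda>x. exp (z * complex_of_real x))" if "real_distribution P" "integrable P (\<lambda>x. exp (Re z * x))" for P
  proof -
    interpret P: real_distribution P by fact
    show ?thesis by (rule Bochner_Integration.integrable_bound[OF that(2)]) (auto simp: ne)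
  qed
  show iN: "integrable N (\<lambda>x. exp (z * complex_of_real x))" using intN[OF z] rd(2) by (intro cint)
  define r where "r = Re z + 1"
  have r: "r \<ge> 0" using z by (simp add: r_def)
  obtain C0 where C0: "\<And>n. (LINT x|M n. exp (r * x)) \<le> C0" using bd[OF r] by auto
  define C where "C = max C0 (LINT x|N. exp (r * x))"
  have C: "(LINT x|M n. exp (r * x)) \<le> C" "(LINT x|N. exp (r * x)) \<le> C" for n
    using C0[of n] by (auto simp: C_def)
  define f where "f K x = exp (z * complex_of_real (min x K))" for K x
  have fb: "norm (f K x) \<le> exp (Re z * K)" for K x
    using z by (simp add: f_def mult_left_mono)
  have fcont: "isCont (f K) x" for K x unfolding f_def by (intro continuous_intros)
  have tail: "norm ((LINT x|P. exp (z * complex_of_real x)) - (LINT x|P. f K x)) \<le> 2 * exp (- K) * C"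
    if P: "real_distribution P" "\<And>\<theta>. \<theta> \<ge> 0 \<Longrightarrow> integrable P (\<lambda>x. exp (\<theta> * x))" "(LINT x|P. exp (r * x)) \<le> C" for P K
  proof -
    interpret P: real_distribution P by fact
    have [measurable]: "f K \<in> borel_measurable borel"
      using fcont by (intro borel_measurable_continuous_onI continuous_at_imp_continuous_on) auto
    have fi: "integrable P (f K)"
      by (rule P.integrable_const_bound[of _ "exp (Re z * K)"]) (use fb in auto)
    have "norm ((LINT x|P. exp (z * complex_of_real x)) - (LINT x|P. f K x)) = norm (LINT x|P. exp (z * complex_of_real x) - f K x)"
      using fi cint[OF P(1) P(2)[OF z]] by simp
    also have "\<dots> \<le> (LINT x|P. norm (exp (z * complex_of_real x) - f K x))" by (rule integral_norm_bound)
    also have "\<dots> \<le> (LINT x|P. 2 * exp (- K) * exp (r * x))"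
    proof (rule integral_mono)
      fix x
      show "norm (exp (z * complex_of_real x) - f K x) \<le> 2 * exp (- K) * exp (r * x)"
      proof (cases "x \<le> K")
        case False
        have "norm (exp (z * complex_of_real x) - f K x) \<le> exp (Re z * x) + exp (Re z * K)"
          using False norm_triangle_ineq4[of "exp (z * complex_of_real x)" "f K x"] by (simp add: f_def)
        also have "\<dots> \<le> 2 * exp (Re z * x)" using False z by (simp add: mult_left_mono)
        also have "\<dots> \<le> 2 * exp (Re z * x + (x - K))" using False by simp
        finally show ?thesis by (simp add: r_def mult_exp_exp algebra_simps)
      qed (simp add: f_def min_def)
    qed (use fi cint[OF P(1) P(2)[OF z]] P(2)[OF r] in auto)
    also have "\<dots> = 2 * exp (- K) * (LINT x|P. exp (r * x))" by simp
    also have "\<dots> \<le> 2 * exp (- K) * C" using P(3) by (intro mult_left_mono) auto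
    finally show ?thesis .
  qed
  show "(\<lambda>n. LINT x|M n. exp (z * complex_of_real x)) \<longlonglongrightarrow> (LINT x|N. exp (z * complex_of_real x))"
  proof (rule metric_LIMSEQ_I)
    fix e :: real assume e: "e > 0"
    have "((\<lambda>K. 2 * exp (- K) * C) \<longlongrightarrow> 2 * 0 * C) at_top"
      by (intro tendsto_intros filterlim_compose[OF exp_at_bot] filterlim_uminus_at_bot_at_top)
    then have "\<forall>\<^sub>F K in at_top. 2 * exp (- K) * C < e / 3" using e by (intro order_tendstoD(2)) auto
    from eventually_happens'[OF _ this] obtain K where K: "2 * exp (- K) * C < e / 3" by auto
    have "(\<lambda>n. LINT x|M n. f K x) \<longlonglongrightarrow> (LINT x|N. f K x)"
      using rd wc fcont fb by (rule weak_conv_imp_integral_bdd_continuous_conv)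
    from metric_LIMSEQ_D[OF this, of "e / 3"] e obtain n0 where
      n0: "\<And>n. n \<ge> n0 \<Longrightarrow> dist (LINT x|M n. f K x) (LINT x|N. f K x) < e / 3" by auto
    show "\<exists>no. \<forall>n\<ge>no. dist (LINT x|M n. exp (z * complex_of_real x)) (LINT x|N. exp (z * complex_of_real x)) < e"
    proof (intro exI allI impI)
      fix n assume "n0 \<le> n"
      from n0[OF this] tail[OF rd(1) int C(1), of n K] tail[OF rd(2) intN C(2), of K] K
      show "dist (LINT x|M n. exp (z * complex_of_real x)) (LINT x|N. exp (z * complex_of_real x)) < e"
        unfolding dist_norm by norm
    qed
  qed
qed

lemma exp_integral_of_real:
  assumes "integrable M (\<lambda>x. exp (complex_of_real \<theta> * complex_of_real x))"
  shows "integrable M (\<lambda>x. exp (\<theta> * x))"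
    and "(LINT x|M. exp (complex_of_real \<theta> * complex_of_real x)) = complex_of_real (LINT x|M. exp (\<theta> * x))"
proof -
  have e: "exp (complex_of_real \<theta> * complex_of_real x) = complex_of_real (exp (\<theta> * x))" for x
    by (simp add: exp_of_real[symmetric] del: exp_of_real)
  show "integrable M (\<lambda>x. exp (\<theta> * x))"
    using assms unfolding e by (simp add: complex_of_real_integrable_eq)
  show "(LINT x|M. exp (complex_of_real \<theta> * complex_of_real x)) = complex_of_real (LINT x|M. exp (\<theta> * x))"
    unfolding e by simp
qed

text \<open>Real arguments give tightness; the continuity at \<open>0\<close> in \<open>cont\<close>
  excludes mass escaping to minus infinity. A weak limit along one subsequence suffices, since the
  whole sequence of transforms converges and identifies it.\<close>

lemma infdiv_limit:
  assumes id: "\<And>n. infdiv (\<Psi>n n)"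
    and lim: "\<And>z. 0 \<le> Re z \<Longrightarrow> (\<lambda>n. \<Psi>n n z) \<longlonglongrightarrow> \<Psi> z"
    and cont: "((\<lambda>\<theta>. \<Psi> (complex_of_real \<theta>)) \<longlongrightarrow> 0) (at_right 0)"
  shows "infdiv \<Psi>"
  unfolding infdiv_def
proof (intro allI impI)
  fix t :: real assume t: "t \<ge> 0"
  have "\<forall>n. \<exists>\<mu>. real_distribution \<mu> \<and> (\<forall>z. 0 \<le> Re z \<longrightarrow> integrable \<mu> (\<lambda>x. exp (z * of_real x)) \<and>
        (LINT x|\<mu>. exp (z * of_real x)) = exp (of_real t * \<Psi>n n z))"
    using id t unfolding infdiv_def by blast
  then obtain M where rd: "\<And>n. real_distribution (M n)"
    and ci: "\<And>n z. 0 \<le> Re z \<Longrightarrow> integrable (M n) (\<lambda>x. exp (z * complex_of_real x))"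
    and ce: "\<And>n z. 0 \<le> Re z \<Longrightarrow> (LINT x|M n. exp (z * complex_of_real x)) = exp (of_real t * \<Psi>n n z)"
    by metis
  have clim: "(\<lambda>n. LINT x|M n. exp (z * complex_of_real x)) \<longlonglongrightarrow> exp (of_real t * \<Psi> z)" if "0 \<le> Re z" for z
    unfolding ce[OF that] by (intro tendsto_intros lim that)
  define L where "L \<theta> = Re (exp (of_real t * \<Psi> (complex_of_real \<theta>)))" for \<theta>
  have ri: "integrable (M n) (\<lambda>x. exp (\<theta> * x))" if "\<theta> \<ge> 0" for n \<theta>
    using ci[of "of_real \<theta>" n] that by (intro exp_integral_of_real) auto
  have rlim: "(\<lambda>n. LINT x|M n. exp (\<theta> * x)) \<longlonglongrightarrow> L \<theta>" if "\<theta> \<ge> 0" for \<theta>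
    using tendsto_Re[OF clim[of "of_real \<theta>"]] exp_integral_of_real(2)[OF ci[of "of_real \<theta>"]] that
    by (simp add: L_def)
  have "((\<lambda>\<theta>. L \<theta>) \<longlongrightarrow> Re (exp (of_real t * 0))) (at_right 0)"
    unfolding L_def by (intro tendsto_intros cont)
  then have "tight M" using ri rlim by (intro tight_if_exp_integrals_converge[OF rd]) auto
  from tight_imp_convergent_subsubsequence[OF this strict_mono_id] obtain s N where
    s: "strict_mono s" and N: "real_distribution N" and wc: "weak_conv_m (M \<circ> id \<circ> s) N" by auto
  have bd: "\<exists>C. \<forall>n. (LINT x|(M \<circ> id \<circ> s) n. exp (\<theta> * x)) \<le> C" if "\<theta> \<ge> 0" for \<theta>
  proof -
    have "Bseq (\<lambda>n. LINT x|M n. exp (\<theta> * x))" using rlim[OF that] by (intro convergent_imp_Bseq convergentI)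
    then obtain C where "\<And>n. norm (LINT x|M n. exp (\<theta> * x)) \<le> C" by (auto simp: Bseq_def)
    then show ?thesis by (intro exI[of _ C]) (auto intro: order_trans[OF abs_ge_self])
  qed
  show "\<exists>\<mu>. real_distribution \<mu> \<and> (\<forall>z. 0 \<le> Re z \<longrightarrow> integrable \<mu> (\<lambda>x. exp (z * of_real x)) \<and>
        (LINT x|\<mu>. exp (z * of_real x)) = exp (of_real t * \<Psi> z))"
  proof (intro exI[of _ N] conjI allI impI N)
    fix z :: complex assume z: "0 \<le> Re z"
    have w: "integrable N (\<lambda>x. exp (z * complex_of_real x))"
      "(\<lambda>n. LINT x|(M \<circ> id \<circ> s) n. exp (z * complex_of_real x)) \<longlonglongrightarrow> (LINT x|N. exp (z * complex_of_real x))"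
      by (rule weak_conv_exp_integral[OF _ N wc _ bd z]; use rd ri in simp)+
    show "integrable N (\<lambda>x. exp (z * complex_of_real x))" by (rule w)
    have "(\<lambda>n. LINT x|(M \<circ> id \<circ> s) n. exp (z * complex_of_real x)) \<longlonglongrightarrow> exp (of_real t * \<Psi> z)"
      using LIMSEQ_subseq_LIMSEQ[OF clim[OF z] s] by (simp add: o_def)
    with w(2) show "(LINT x|N. exp (z * complex_of_real x)) = exp (of_real t * \<Psi> z)"
      by (rule LIMSEQ_unique)
  qed
qed

section \<open>Exponents of non-increasing densities\<close>

lemma mult_integral_one_minus_exp:
  assumes "0 \<le> b"
  shows "z * (CLINT x:{0..b}|lborel. 1 - exp (- z * of_real x)) = exp (- z * of_real b) - 1 + z * of_real b"
proof -
  have "(LBINT x. indicator {0..b} x *\<^sub>R (z * (1 - exp (- z * complex_of_real x)))) =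
      (z * of_real b + exp (- z * of_real b)) - (z * of_real 0 + exp (- z * of_real 0))"
  proof (rule integral_FTC_atLeastAtMost[OF assms])
    fix x
    show "((\<lambda>x. z * complex_of_real x + exp (- z * complex_of_real x)) has_vector_derivative
        z * (1 - exp (- z * complex_of_real x))) (at x within {0..b})"
      by (rule has_vector_derivative_real_field[where f = "\<lambda>w. z * w + exp (- z * w)"])
         (auto intro!: derivative_eq_intros simp: algebra_simps)
  qed (intro continuous_intros)
  moreover have "(LBINT x. indicator {0..b} x *\<^sub>R (z * (1 - exp (- z * complex_of_real x)))) =
      z * (CLINT x:{0..b}|lborel. 1 - exp (- z * of_real x))"
    unfolding set_lebesgue_integral_def integral_mult_right_zero[symmetric]
    by (intro Bochner_Integration.integral_cong) auto
  ultimately show ?thesis by (simp add: algebra_simps)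
qed

text \<open>By \<open>mult_integral_one_minus_exp\<close> the constant density \<open>a\<close> on
  \<open>{0..b}\<close> belongs to a Poisson process with rate \<open>a\<close> and jumps
  \<open>- b\<close>, compensated by the drift \<open>a * b\<close>.\<close>

lemma infdiv_truncated:
  assumes "0 \<le> a" "0 \<le> b"
  shows "infdiv (\<lambda>z. z * (of_real a * (CLINT x:{0..b}|lborel. 1 - exp (- z * of_real x))))"
proof -
  have "infdiv (\<lambda>z. of_real a * (exp (- z * of_real b) - 1) + of_real (a * b) * z)"
    by (intro infdiv_add infdiv_poisson infdiv_drift assms)
  also have "(\<lambda>z. of_real a * (exp (- z * of_real b) - 1) + of_real (a * b) * z) =
      (\<lambda>z. of_real a * (z * (CLINT x:{0..b}|lborel. 1 - exp (- z * of_real x))))"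
    unfolding mult_integral_one_minus_exp[OF assms(2)] by (simp add: algebra_simps)
  finally show ?thesis by (simp add: mult_ac)
qed

text \<open>The Gaussian part is a limit of compensated Poisson exponents with jumps
  \<open>- 1 / c\<close> at rate \<open>2 * d * c\<^sup>2\<close>: with \<open>w = - z / c\<close>
  the exponent is \<open>2 * d * c\<^sup>2 * (exp w - 1 - w)\<close>, whose leading term is
  \<open>d * z\<^sup>2\<close>. The cubic Taylor remainder leaves an error of order
  \<open>1 / c\<close>.\<close>

lemma infdiv_square:
  assumes "0 \<le> d" shows "infdiv (\<lambda>z. of_real d * z\<^sup>2)"
proof (rule infdiv_limit)
  define c where "c n = real (Suc n)" for n
  define \<Psi>n where "\<Psi>n n z = complex_of_real (2 * d * (c n)\<^sup>2) * (exp (- z * of_real (1 / c n)) - 1)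
      + of_real (2 * d * c n) * z" for n z
  have c: "c n > 0" for n by (simp add: c_def)
  show "infdiv (\<Psi>n n)" for n
    unfolding \<Psi>n_def using assms by (intro infdiv_add infdiv_poisson infdiv_drift) auto
  show "(\<lambda>n. \<Psi>n n z) \<longlonglongrightarrow> of_real d * z\<^sup>2" for z
  proof (rule Lim_null_comparison[THEN LIM_zero_cancel])
    define B where "B = d * exp (cmod z) * cmod z ^ 3"
    show "\<forall>\<^sub>F n in sequentially. norm (\<Psi>n n z - of_real d * z\<^sup>2) \<le> B * inverse (real (Suc n))"
    proof (rule eventuallyI)
      fix n
      define w where "w = - z * of_real (1 / c n)"
      have zw: "z = - of_real (c n) * w" using c[of n] by (simp add: w_def field_simps)
      have "cmod w = cmod z / c n" using c[of n] by (simp add: w_def norm_mult norm_divide)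
      then have nw: "cmod w \<le> cmod z" "cmod w * c n = cmod z" using c[of n] by (auto simp: c_def divide_le_eq mult_le_cancel_left1)
      have "\<Psi>n n z - of_real d * z\<^sup>2 = of_real (2 * d * (c n)\<^sup>2) * (exp w - (\<Sum>k\<le>2. w ^ k / fact k))"
        unfolding \<Psi>n_def w_def[symmetric] 
        by (simp add: zw power2_eq_square field_simps eval_nat_numeral)
      then have "norm (\<Psi>n n z - of_real d * z\<^sup>2) = 2 * d * (c n)\<^sup>2 * cmod (exp w - (\<Sum>k\<le>2. w ^ k / fact k))"
        using assms by (simp add: norm_mult norm_power)
      also have "\<dots> \<le> 2 * d * (c n)\<^sup>2 * (exp \<bar>Re w\<bar> * cmod w ^ Suc 2 / fact 2)"
        using assms by (intro mult_left_mono Taylor_exp) auto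
      also have "\<dots> \<le> 2 * d * (c n)\<^sup>2 * (exp (cmod z) * cmod w ^ Suc 2 / fact 2)"
        using assms order_trans[OF abs_Re_le_cmod nw(1)]
        by (intro mult_left_mono divide_right_mono mult_right_mono) auto
      also have "\<dots> = B * inverse (c n)"
        unfolding B_def nw(2)[symmetric] using c[of n] by (simp add: field_simps power2_eq_square power3_eq_cube)
      finally show "norm (\<Psi>n n z - of_real d * z\<^sup>2) \<le> B * inverse (real (Suc n))" by (simp add: c_def)
    qed
    show "(\<lambda>n. B * inverse (real (Suc n))) \<longlonglongrightarrow> 0"
      using tendsto_mult_right_zero[OF LIMSEQ_inverse_real_of_nat] by simp
  qed
  have "((\<lambda>\<theta>. complex_of_real d * (complex_of_real \<theta>)\<^sup>2) \<longlongrightarrow> complex_of_real d * (complex_of_real 0)\<^sup>2) (at_right 0)"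
    by (intro tendsto_intros)
  then show "((\<lambda>\<theta>. complex_of_real d * (complex_of_real \<theta>)\<^sup>2) \<longlongrightarrow> 0) (at_right 0)" by simp
qed

text \<open>The supremum of the set serves as \<open>b\<close>, and 0 if the set is empty. Whether
  the right end belongs to the set is left open, since a single point is a null set.\<close>

lemma superlevel_set_antimono:
  fixes u :: "real \<Rightarrow> real"
  assumes anti: "antimono_on {0<..} u"
    and bdd: "bdd_above {x. 0 < x \<and> c \<le> u x}"
  shows "\<exists>b\<ge>0. {0<..<b} \<subseteq> {x. 0 < x \<and> c \<le> u x} \<and> {x. 0 < x \<and> c \<le> u x} \<subseteq> {0<..b}"
proof (cases "{x. 0 < x \<and> c \<le> u x} = {}")
  case False
  define S where "S = {x. 0 < x \<and> c \<le> u x}"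
  have S: "S \<noteq> {}" "bdd_above S" using False bdd by (auto simp: S_def)
  have "{0<..<Sup S} \<subseteq> S"
  proof
    fix x assume x: "x \<in> {0<..<Sup S}"
    then obtain y where y: "y \<in> S" "x < y" using less_cSup_iff[OF S] by auto
    then have "u y \<le> u x" using x by (intro monotone_onD[OF anti, of x y]) (auto simp: S_def)
    then show "x \<in> S" using x y by (auto simp: S_def)
  qed
  moreover have "S \<subseteq> {0<..Sup S}" using cSup_upper[OF _ S(2)] by (auto simp: S_def)
  moreover have "Sup S \<ge> 0"
  proof -
    obtain x where "x \<in> S" using S by auto
    then show ?thesis using cSup_upper[OF _ S(2), of x] by (auto simp: S_def)
  qed
  ultimately show ?thesis unfolding S_def by blast
qed (auto intro: exI[of _ 0])

lemma sum_indicator_le_eq_floor: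
  fixes y :: real
  assumes "0 \<le> y"
  shows "(\<Sum>j=1..N. if real j \<le> y then 1 else 0) = real (min N (nat \<lfloor>y\<rfloor>))"
proof -
  have "{j \<in> {1..N}. real j \<le> y} = {1..min N (nat \<lfloor>y\<rfloor>)}"
    using assms by (auto simp: le_nat_iff le_floor_iff)
  then show ?thesis by (simp add: sum.If_cases Int_def)
qed

text \<open>The cap \<open>4 ^ n\<close> is the number of steps of height \<open>1 / 2 ^ n\<close>
  up to the height \<open>2 ^ n\<close>; beyond that height the lower bound fails.\<close>

lemma floor_approx_bounds:
  fixes y :: real
  assumes "0 \<le> y"
  shows "real (min (4 ^ n) (nat \<lfloor>2 ^ n * y\<rfloor>)) / 2 ^ n \<le> y"
    and "y \<le> 2 ^ n \<Longrightarrow> y - 1 / 2 ^ n \<le> real (min (4 ^ n) (nat \<lfloor>2 ^ n * y\<rfloor>)) / 2 ^ n"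
proof -
  have p: "0 \<le> 2 ^ n * y" using assms by simp
  then have f: "real (nat \<lfloor>2 ^ n * y\<rfloor>) \<le> 2 ^ n * y" "2 ^ n * y - 1 \<le> real (nat \<lfloor>2 ^ n * y\<rfloor>)"
    by linarith+
  have "real (min (4 ^ n) (nat \<lfloor>2 ^ n * y\<rfloor>)) \<le> 2 ^ n * y" using f(1) of_nat_mono[OF min.cobounded2[of "4 ^ n" "nat \<lfloor>2 ^ n * y\<rfloor>"], where 'a = real] by linarith
  then show "real (min (4 ^ n) (nat \<lfloor>2 ^ n * y\<rfloor>)) / 2 ^ n \<le> y" by (simp add: field_simps)
  assume "y \<le> 2 ^ n"
  then have "2 ^ n * y \<le> 2 ^ n * 2 ^ n" by (intro mult_left_mono) auto
  also have "\<dots> = (4::real) ^ n" by (simp add: power_mult_distrib[symmetric])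
  finally have "2 ^ n * y - 1 \<le> real (min (4 ^ n) (nat \<lfloor>2 ^ n * y\<rfloor>))" using f(2) by (auto simp: min_def)
  then have "(2 ^ n * y - 1) / 2 ^ n \<le> real (min (4 ^ n) (nat \<lfloor>2 ^ n * y\<rfloor>)) / 2 ^ n"
    by (intro divide_right_mono) auto
  then show "y - 1 / 2 ^ n \<le> real (min (4 ^ n) (nat \<lfloor>2 ^ n * y\<rfloor>)) / 2 ^ n" by (simp add: diff_divide_distrib)
qed

text \<open>
  Dyadic truncation of the values of \<open>u\<close> turns it into a finite sum of indicators of intervals,
  and each interval contributes the exponent of a compensated Poisson process.
\<close>

lemma infdiv_antimono_density:
  fixes u :: "real \<Rightarrow> real"
  assumes nonneg: "\<And>x. 0 < x \<Longrightarrow> 0 \<le> u x" and anti: "antimono_on {0<..} u"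
    and int: "set_integrable lborel {0<..} (\<lambda>x. min 1 x * u x)"
  shows "infdiv (\<lambda>z. z * (CLINT x:{0<..}|lborel. (1 - exp (- z * of_real x)) * of_real (u x)))"
proof -
  define v where "v x = (if 0 < x then u x else 0)" for x
  define w where "w x = (if 0 < x then min 1 x * u x else 0)" for x
  have w_ind: "w = (\<lambda>x. indicator {0<..} x *\<^sub>R (min 1 x * u x))"
    by (auto simp: w_def fun_eq_iff)
  have w: "integrable lborel w" using int unfolding w_ind set_integrable_def .
  have w0: "0 \<le> w x" for x using nonneg[of x] by (simp add: w_def)
  have v0: "0 \<le> v x" for x using nonneg[of x] by (simp add: v_def)
  have [measurable]: "w \<in> borel_measurable borel" using borel_measurable_integrable[OF w] by simp
  have "v = (\<lambda>x. if 0 < x then w x / min 1 x else 0)"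
    by (auto simp: v_def w_def fun_eq_iff min_def)
  then have [measurable]: "v \<in> borel_measurable borel" by simp
  define I where "I = (LINT x|lborel. w x)"
  have S: "\<exists>b\<ge>0. {0<..<b} \<subseteq> {x. 0 < x \<and> c \<le> u x} \<and> {x. 0 < x \<and> c \<le> u x} \<subseteq> {0<..b}" if c: "c > 0" for c
  proof (rule superlevel_set_antimono[OF anti])
    show "bdd_above {x. 0 < x \<and> c \<le> u x}"
    proof (rule bdd_aboveI, elim CollectE conjE)
      fix x assume x: "0 < x" "c \<le> u x"
      show "x \<le> 1 + I / c"
      proof (cases "x \<le> 1")
        case True
        have "0 \<le> I" unfolding I_def using w0 by simp
        then have "0 \<le> I / c" using c by simp
        then show ?thesis using True by linarith
      next
        case False
        \<comment> \<open>On \<open>{1<..x}\<close> monotonicity gives \<open>c \<le> u y\<close>,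
          and there \<open>min 1 y = 1\<close>; so the area \<open>c * (x - 1)\<close> is at most
          \<open>I\<close>, and superlevel sets are bounded.\<close>
        have "c * (x - 1) = (LINT y|lborel. c * indicator {1<..x} y)" using False by simp
        also have "\<dots> \<le> I" unfolding I_def
        proof (rule integral_mono[OF _ w])
          show "integrable lborel (\<lambda>y. c * indicator {1<..x} y)" using False by (intro integrable_mult_right integrable_real_indicator) auto
          fix y show "c * indicator {1<..x} y \<le> w y"
          proof (cases "y \<in> {1<..x}")
            case True
            then have "u x \<le> u y" using x by (intro monotone_onD[OF anti, of y x]) auto
            then show ?thesis using True x by (simp add: w_def)
          qed (use w0 in auto)
        qed
        finally show ?thesis using c by (simp add: field_simps)
      qed
    qed
  qed
  define S where "S c = {x. 0 < x \<and> c \<le> u x}" for c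
  have Sv: "S c = {x. c \<le> v x}" if "c > 0" for c using that by (auto simp: S_def v_def)
  have "\<exists>b. \<forall>c>0. b c \<ge> 0 \<and> {0<..<b c} \<subseteq> S c \<and> S c \<subseteq> {0<..b c}"
    using S unfolding S_def by metis
  then obtain b where b: "\<And>c. c > 0 \<Longrightarrow> b c \<ge> 0" "\<And>c. c > 0 \<Longrightarrow> {0<..<b c} \<subseteq> S c" "\<And>c. c > 0 \<Longrightarrow> S c \<subseteq> {0<..b c}"
    by metis
  define c where "c n j = real j / 2 ^ n" for n j
  have c: "c n j > 0" if "j \<in> {1..4 ^ n}" for n j using that by (simp add: c_def)
  define un where "un n x = real (min (4 ^ n) (nat \<lfloor>2 ^ n * v x\<rfloor>)) / 2 ^ n" for n x
  have un_sum: "un n x = (\<Sum>j=1..4 ^ n. indicator (S (c n j)) x / 2 ^ n)" for n x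
  proof -
    have "un n x = (\<Sum>j=1..4 ^ n. if real j \<le> 2 ^ n * v x then 1 else 0) / 2 ^ n"
      unfolding un_def using v0 by (subst sum_indicator_le_eq_floor) auto
    also have "\<dots> = (\<Sum>j=1..4 ^ n. indicator (S (c n j)) x / 2 ^ n)"
      unfolding sum_divide_distrib
    proof (rule sum.cong[OF refl])
      fix j :: nat assume "j \<in> {1..4 ^ n}"
      then show "(if real j \<le> 2 ^ n * v x then 1 else 0) / 2 ^ n = indicator (S (c n j)) x / (2 ^ n :: real)"
        using c by (auto simp: Sv indicator_def c_def field_simps)
    qed
    finally show ?thesis .
  qed
  have un_le: "un n x \<le> v x" "0 \<le> un n x" for n x
    using floor_approx_bounds(1)[OF v0] by (auto simp: un_def)
  have un_lim: "(\<lambda>n. un n x) \<longlonglongrightarrow> v x" for x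
  proof (rule tendsto_sandwich)
    obtain m :: nat where m: "v x \<le> 2 ^ m"
      using real_arch_pow[of 2 "v x"] by (auto dest: less_imp_le)
    show "\<forall>\<^sub>F n in sequentially. v x - (1 / 2) ^ n \<le> un n x"
      using eventually_ge_at_top[of m]
    proof eventually_elim
      case (elim n)
      then have "v x \<le> 2 ^ n" using m power_increasing[of m n "2::real"] by linarith
      then show ?case using floor_approx_bounds(2)[OF v0, of x n] by (simp add: un_def power_divide)
    qed
    show "(\<lambda>n. v x - (1 / 2) ^ n) \<longlonglongrightarrow> v x"
      by (rule tendsto_eq_intros LIMSEQ_realpow_zero | simp)+
  qed (use un_le in auto)
  define \<Psi>n where "\<Psi>n n z = (\<Sum>j=1..4 ^ n. z * (of_real (1 / 2 ^ n) * (CLINT x:{0..b (c n j)}|lborel. 1 - exp (- z * of_real x))))" for n z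
  have id: "infdiv (\<Psi>n n)" for n
    unfolding \<Psi>n_def using b c by (intro infdiv_sum infdiv_truncated) auto
  have iS: "set_integrable lborel {0..b} (\<lambda>x. 1 - exp (- z * complex_of_real x))" for b z
    by (intro borel_integrable_atLeastAtMost' continuous_intros)
  have \<Psi>n_eq: "\<Psi>n n z = z * (CLINT x|lborel. (1 - exp (- z * of_real x)) * of_real (un n x))" for n z
  proof -
    have "(CLINT x|lborel. (1 - exp (- z * of_real x)) * of_real (un n x)) =
       (CLINT x|lborel. (\<Sum>j=1..4 ^ n. of_real (1 / 2 ^ n) * (indicator {0..b (c n j)} x *\<^sub>R (1 - exp (- z * of_real x)))))"
    proof (rule integral_cong_AE)
      show "AE x in lborel. (1 - exp (- z * complex_of_real x)) * of_real (un n x) =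
          (\<Sum>j=1..4 ^ n. of_real (1 / 2 ^ n) * (indicator {0..b (c n j)} x *\<^sub>R (1 - exp (- z * of_real x))))"
      proof -
        \<comment> \<open>The superlevel sets agree with the intervals \<open>{0..b (c n j)}\<close>
          only away from the endpoints, which form a finite set for fixed \<open>n\<close>.\<close>
        have "AE x in lborel. \<forall>j\<in>{1..4 ^ n}. x \<noteq> b (c n j) \<and> x \<noteq> 0"
          by (intro AE_finite_allI AE_conjI AE_lborel_singleton) auto
        then show ?thesis
        proof eventually_elim
          case (elim x)
          have "indicator (S (c n j)) x = (indicator {0..b (c n j)} x :: real)" if "j \<in> {1..4 ^ n}" for j
            using elim that b(2,3)[OF c[OF that]] by (force simp: indicator_def)
          then have "un n x = (\<Sum>j=1..4 ^ n. indicator {0..b (c n j)} x / 2 ^ n)" unfolding un_sum by simp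
          then show ?case
            by (simp add: sum_distrib_left scaleR_conv_of_real field_simps)
        qed
      qed
    qed (auto simp: un_def)
    also have "\<dots> = (\<Sum>j=1..4 ^ n. of_real (1 / 2 ^ n) * (CLINT x:{0..b (c n j)}|lborel. 1 - exp (- z * of_real x)))"
      unfolding set_lebesgue_integral_def
      using iS[unfolded set_integrable_def]
      by (subst Bochner_Integration.integral_sum, intro integrable_mult_right) (simp, simp only: integral_mult_right_zero)
    finally show ?thesis by (simp add: \<Psi>n_def sum_distrib_left)
  qed
  define H where "H z = (CLINT x:{0<..}|lborel. (1 - exp (- z * of_real x)) * of_real (u x))" for z
  have H_eq: "H z = (CLINT x|lborel. (1 - exp (- z * of_real x)) * of_real (v x))" for z
    unfolding H_def set_lebesgue_integral_def
    by (intro Bochner_Integration.integral_cong) (auto simp: v_def)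
  have dom: "norm ((1 - exp (- z * of_real x)) * of_real y) \<le> (2 + cmod z) * w x"
    if "0 \<le> Re z" "0 \<le> y" "y \<le> v x" for z x y
  proof (cases "0 < x")
    case True
    have "norm ((1 - exp (- z * of_real x)) * of_real y) = cmod (1 - exp (- z * of_real x)) * y"
      using that by (simp add: norm_mult)
    also have "\<dots> \<le> ((2 + cmod z) * min 1 x) * v x"
      using that True by (intro mult_mono cmod_one_minus_exp_le_min) auto
    finally show ?thesis using True by (simp add: w_def v_def)
  next
    case False
    then show ?thesis using that by (simp add: v_def w_def)
  qed
  have lim: "(\<lambda>n. \<Psi>n n z) \<longlonglongrightarrow> z * H z" if z: "0 \<le> Re z" for z
    unfolding \<Psi>n_eq H_eq
  proof (intro tendsto_intros integral_dominated_convergence[where w = "\<lambda>x. (2 + cmod z) * w x"])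
    show "AE x in lborel. (\<lambda>n. (1 - exp (- z * of_real x)) * complex_of_real (un n x)) \<longlonglongrightarrow>
        (1 - exp (- z * of_real x)) * complex_of_real (v x)"
      by (intro AE_I2 tendsto_intros un_lim)
    show "AE x in lborel. norm ((1 - exp (- z * of_real x)) * complex_of_real (un n x)) \<le> (2 + cmod z) * w x" for n
      by (intro AE_I2 dom z un_le)
  qed (use w in \<open>auto simp: un_def\<close>)
  \<comment> \<open>\<open>H\<close> stays bounded by \<open>(2 + \<theta>) * I\<close>, so the
    extra factor \<open>\<theta>\<close> sends the product to 0.\<close>
  have cont: "((\<lambda>\<theta>. complex_of_real \<theta> * H (complex_of_real \<theta>)) \<longlongrightarrow> 0) (at_right 0)"
  proof (rule Lim_null_comparison)
    show "\<forall>\<^sub>F \<theta> in at_right 0. norm (complex_of_real \<theta> * H (complex_of_real \<theta>)) \<le> \<theta> * ((2 + \<theta>) * I)"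
      using eventually_at_right_less[of 0]
    proof eventually_elim
      case (elim \<theta>)
      have "norm (H (complex_of_real \<theta>)) \<le> (LINT x|lborel. norm ((1 - exp (- complex_of_real \<theta> * of_real x)) * complex_of_real (v x)))"
        unfolding H_eq by (rule integral_norm_bound)
      also have "\<dots> \<le> (LINT x|lborel. (2 + cmod (complex_of_real \<theta>)) * w x)"
      proof (rule integral_mono')
        show "norm ((1 - exp (- complex_of_real \<theta> * of_real x)) * complex_of_real (v x)) \<le> (2 + cmod (complex_of_real \<theta>)) * w x" for x
          using elim v0 by (intro dom) auto
      qed (use w w0 in auto)
      also have "\<dots> = (2 + \<theta>) * I" using elim by (simp add: I_def)
      finally show ?case using elim by (simp add: norm_mult)
    qed
    have "((\<lambda>\<theta>. \<theta> * ((2 + \<theta>) * I)) \<longlongrightarrow> 0 * ((2 + 0) * I)) (at_right 0)" by (intro tendsto_intros)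
    then show "((\<lambda>\<theta>. \<theta> * ((2 + \<theta>) * I)) \<longlongrightarrow> 0) (at_right 0)" by simp
  qed
  have "infdiv (\<lambda>z. z * H z)" using id lim cont by (rule infdiv_limit)
  then show ?thesis by (simp add: H_def)
qed

lemma infdiv_times_bernstein:
  fixes u :: "real \<Rightarrow> real"
  assumes "0 \<le> d" "\<And>x. 0 < x \<Longrightarrow> 0 \<le> u x" "antimono_on {0<..} u"
    "set_integrable lborel {0<..} (\<lambda>x. min 1 x * u x)"
  shows "infdiv (\<lambda>z. z * (of_real k + of_real d * z +
    (CLINT x:{0<..}|lborel. (1 - exp (- z * of_real x)) * of_real (u x))))"
proof -
  have "infdiv (\<lambda>z. of_real k * z + of_real d * z\<^sup>2 + z * (CLINT x:{0<..}|lborel. (1 - exp (- z * of_real x)) * of_real (u x)))"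
    by (intro infdiv_add infdiv_drift infdiv_square infdiv_antimono_density assms)
  then show ?thesis by (simp add: algebra_simps power2_eq_square)
qed

section \<open>Processes with stationary independent increments\<close>

text \<open>Restriction to \<open>I\<close> is the identity on the product space, so the joint law
  of the coordinates is the product of the marginals.\<close>

lemma (in product_prob_space) indep_vars_component:
  assumes "I \<noteq> {}"
  shows "P.indep_vars M (\<lambda>i \<omega>. \<omega> i) I"
proof -
  have "distr (PiM I M) (PiM I M) (\<lambda>x. \<lambda>i\<in>I. x i) = distr (PiM I M) (PiM I M) (\<lambda>x. x)"
    by (intro distr_cong refl) (auto simp: space_PiM extensional_def fun_eq_iff PiE_iff)
  also have "\<dots> = PiM I (\<lambda>i. distr (PiM I M) (M i) (\<lambda>\<omega>. \<omega> i))"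
    using PiM_component by (simp cong: PiM_cong)
  finally show ?thesis
    by (subst P.indep_vars_iff_distr_eq_PiM'[OF assms]) auto
qed

locale convolution_semigroup =
  fixes \<mu> :: "real \<Rightarrow> real measure"
  assumes real_distribution: "0 \<le> t \<Longrightarrow> real_distribution (\<mu> t)"
    and convolution_add: "0 \<le> s \<Longrightarrow> 0 \<le> t \<Longrightarrow> convolution (\<mu> s) (\<mu> t) = \<mu> (s + t)"
begin

text \<open>The coordinates play the increments over successive time intervals of length
  \<open>1 / 2 ^ n\<close>.\<close>

definition grid :: "nat \<Rightarrow> (nat \<Rightarrow> real) measure" where
  "grid n = PiM UNIV (\<lambda>_. \<mu> (1 / 2 ^ n))"

definition walk :: "nat \<Rightarrow> (nat \<Rightarrow> real) \<Rightarrow> real \<Rightarrow> real" where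
  "walk n \<xi> t = (\<Sum>i<nat \<lfloor>t * 2 ^ n\<rfloor>. \<xi> i)"

definition walk_law :: "nat \<Rightarrow> real set \<Rightarrow> (real \<Rightarrow> real) measure" where
  "walk_law n J = distr (grid n) (PiM J (\<lambda>_. borel)) (\<lambda>\<xi>. \<lambda>t\<in>J. walk n \<xi> t)"

lemma sets_\<mu>: "0 \<le> t \<Longrightarrow> sets (\<mu> t) = sets borel"
  using real_distribution by (simp add: real_distribution.events_eq_borel)

lemma sets_grid [measurable_cong]: "sets (grid n) = sets (PiM UNIV (\<lambda>_. borel))"
  unfolding grid_def by (rule sets_PiM_cong) (simp_all add: sets_\<mu>)

lemma product_prob_space_grid: "product_prob_space (\<lambda>_::nat. \<mu> (1 / 2 ^ n))"
proof -
  interpret real_distribution "\<mu> (1 / 2 ^ n)" by (rule real_distribution) simp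
  show ?thesis by unfold_locales
qed

lemma measurable_walk [measurable]: "(\<lambda>\<xi>. walk n \<xi> t) \<in> borel_measurable (PiM UNIV (\<lambda>_. borel))"
  unfolding walk_def by measurable

lemma measurable_walk_restrict [measurable]:
  "(\<lambda>\<xi>. \<lambda>t\<in>J. walk n \<xi> t) \<in> measurable (PiM UNIV (\<lambda>_. borel)) (PiM J (\<lambda>_. borel))"
  by (rule measurable_restrict) measurable

lemma prob_space_grid: "prob_space (grid n)"
  unfolding grid_def using real_distribution[of "1 / 2 ^ n"]
  by (intro prob_space_PiM) (auto simp: real_distribution_def)

lemma indep_vars_grid: "prob_space.indep_vars (grid n) (\<lambda>_. borel) (\<lambda>i \<xi>. \<xi> i) UNIV"
proof -
  interpret product_prob_space "\<lambda>_::nat. \<mu> (1 / 2 ^ n)" UNIV by (rule product_prob_space_grid)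
  interpret g: prob_space "grid n" by (rule prob_space_grid)
  have "g.indep_vars (\<lambda>_. \<mu> (1 / 2 ^ n)) (\<lambda>i \<xi>. \<xi> i) UNIV"
    unfolding grid_def by (rule indep_vars_component) simp
  then have "g.indep_vars (\<lambda>_. borel) (\<lambda>i \<xi>. (\<lambda>x. x) (\<xi> i)) UNIV"
    by (rule g.indep_vars_compose2) (simp add: measurable_ident_sets sets_\<mu>)
  then show ?thesis by simp
qed

lemma distr_grid_component: "distr (grid n) borel (\<lambda>\<xi>. \<xi> i) = \<mu> (1 / 2 ^ n)"
proof -
  interpret product_prob_space "\<lambda>_::nat. \<mu> (1 / 2 ^ n)" UNIV by (rule product_prob_space_grid)
  have "distr (grid n) borel (\<lambda>\<xi>. \<xi> i) = distr (grid n) (\<mu> (1 / 2 ^ n)) (\<lambda>\<xi>. \<xi> i)"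
    by (rule distr_cong) (auto simp: sets_\<mu>)
  also have "\<dots> = \<mu> (1 / 2 ^ n)" unfolding grid_def by (rule PiM_component) simp
  finally show ?thesis .
qed

lemma measurable_pairs [measurable]:
  "(\<lambda>\<xi> k. \<xi> (2 * k) + \<xi> (Suc (2 * k))) \<in> measurable (PiM UNIV (\<lambda>_. borel)) (PiM UNIV (\<lambda>_. borel :: real measure))"
  by (rule measurable_PiM_single') (auto simp: space_PiM)

text \<open>Adding coordinates in pairs passes to the next coarser grid: by the semigroup property a
  pair has the law of one coarser increment. This is what makes the finite-dimensional laws
  consistent.\<close>

lemma distr_grid_Suc:
  "distr (grid (Suc n)) (PiM UNIV (\<lambda>_. borel)) (\<lambda>\<xi> k. \<xi> (2 * k) + \<xi> (Suc (2 * k))) = grid n"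
proof -
  interpret g: prob_space "grid (Suc n)" by (rule prob_space_grid)
  define B where "B k = {2 * k, Suc (2 * k)}" for k :: nat
  have disj: "disjoint_family B"
    unfolding disjoint_family_on_def B_def by auto
  have "g.indep_vars (\<lambda>k. PiM (B k) (\<lambda>_. borel)) (\<lambda>k \<xi>. restrict (\<lambda>i. \<xi> i) (B k)) UNIV"
    using g.indep_vars_restrict[OF indep_vars_grid, of UNIV B] disj by simp
  then have "g.indep_vars (\<lambda>_. borel) (\<lambda>k \<xi>. (\<lambda>x. x (2 * k) + x (Suc (2 * k))) (restrict (\<lambda>i. \<xi> i) (B k))) UNIV"
    by (rule g.indep_vars_compose2) (auto simp: B_def)
  then have ind: "g.indep_vars (\<lambda>_. borel) (\<lambda>k \<xi>. \<xi> (2 * k) + \<xi> (Suc (2 * k))) UNIV"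
    by (simp add: B_def)
  have m: "(\<lambda>\<xi>. \<xi> i) \<in> borel_measurable (grid n)" for n i
    using sets_grid[of n] by (simp cong: measurable_cong_sets)
  have law: "distr (grid (Suc n)) borel (\<lambda>\<xi>. \<xi> (2 * k) + \<xi> (Suc (2 * k))) = \<mu> (1 / 2 ^ n)" for k
  proof -
    have "g.indep_vars (\<lambda>_. borel) (\<lambda>i \<xi>. \<xi> i) (insert (2 * k) {Suc (2 * k)})"
      using indep_vars_grid by (rule g.indep_vars_subset) simp
    from g.indep_vars_sum[OF _ _ this]
    have "g.indep_var borel (\<lambda>\<xi>. \<xi> (2 * k)) borel (\<lambda>\<xi>. \<xi> (Suc (2 * k)))" by simp
    then have "distr (grid (Suc n)) borel (\<lambda>\<xi>. \<xi> (2 * k) + \<xi> (Suc (2 * k))) =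
        convolution (\<mu> (1 / 2 ^ Suc n)) (\<mu> (1 / 2 ^ Suc n))"
      by (subst g.sum_indep_random_variable) (auto simp: distr_grid_component m)
    also have "\<dots> = \<mu> (1 / 2 ^ n)" by (simp add: convolution_add field_simps)
    finally show ?thesis .
  qed
  show ?thesis
    using ind g.indep_vars_iff_distr_eq_PiM'[where I = UNIV and M' = "\<lambda>_. borel" and X = "\<lambda>k \<xi>. \<xi> (2 * k) + \<xi> (Suc (2 * k))"]
    by (simp add: law restrict_UNIV m grid_def[symmetric])
qed

lemma walk_pairs:
  assumes "t * 2 ^ n \<in> \<nat>"
  shows "walk n (\<lambda>k. \<xi> (2 * k) + \<xi> (Suc (2 * k))) t = walk (Suc n) \<xi> t"
proof -
  obtain m where m: "t * 2 ^ n = real m" using assms by (auto elim: Nats_cases)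
  have m': "t * 2 ^ Suc n = real (2 * m)" using m by simp
  have "(\<Sum>k<m. \<xi> (2 * k) + \<xi> (Suc (2 * k))) = (\<Sum>i<2 * m. \<xi> i)"
    by (induction m) (auto simp: algebra_simps)
  then show ?thesis unfolding walk_def m m' by (simp del: of_nat_mult)
qed

lemma walk_law_Suc:
  assumes "\<And>t. t \<in> J \<Longrightarrow> t * 2 ^ n \<in> \<nat>"
  shows "walk_law (Suc n) J = walk_law n J"
proof -
  have "walk_law n J = distr (grid (Suc n)) (PiM J (\<lambda>_. borel))
      ((\<lambda>\<xi>. \<lambda>t\<in>J. walk n \<xi> t) \<circ> (\<lambda>\<xi> k. \<xi> (2 * k) + \<xi> (Suc (2 * k))))"
    unfolding walk_law_def by (subst distr_grid_Suc[symmetric], rule distr_distr) measurable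
  also have "\<dots> = walk_law (Suc n) J"
    unfolding walk_law_def
    by (intro distr_cong refl) (auto simp: assms walk_pairs restrict_def fun_eq_iff)
  finally show ?thesis by simp
qed

lemma walk_law_ge:
  assumes "\<And>t. t \<in> J \<Longrightarrow> t * 2 ^ n \<in> \<nat>" "n \<le> m"
  shows "walk_law m J = walk_law n J"
  using assms(2)
proof (induction m rule: dec_induct)
  case (step m)
  have "t * 2 ^ m \<in> \<nat>" if "t \<in> J" for t
  proof -
    have "t * 2 ^ m = (t * 2 ^ n) * real (2 ^ (m - n))"
      using step(1) by (simp add: power_add[symmetric])
    moreover have "(t * 2 ^ n) * real (2 ^ (m - n)) \<in> \<nat>"
      by (intro Nats_mult assms(1) that of_nat_in_Nats)
    ultimately show ?thesis by (simp only:)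
  qed
  then show ?case using walk_law_Suc step by simp
qed simp

definition dyadics :: "real set" where
  "dyadics = {t. \<exists>n. t * 2 ^ n \<in> \<nat>}"

lemma finite_dyadics_level:
  assumes "finite J" "J \<subseteq> dyadics" shows "\<exists>n. \<forall>t\<in>J. t * 2 ^ n \<in> \<nat>"
  using assms
proof (induction J)
  case (insert s J)
  then obtain n m where nm: "\<forall>t\<in>J. t * 2 ^ n \<in> \<nat>" "s * 2 ^ m \<in> \<nat>" by (auto simp: dyadics_def)
  have "t * 2 ^ (n + m) \<in> \<nat>" if "t \<in> insert s J" for t
  proof -
    have "t * 2 ^ (n + m) = (t * 2 ^ n) * real (2 ^ m)" "t * 2 ^ (n + m) = (t * 2 ^ m) * real (2 ^ n)"
      by (simp_all add: power_add)
    moreover have "(t * 2 ^ n) * real (2 ^ m) \<in> \<nat> \<or> (t * 2 ^ m) * real (2 ^ n) \<in> \<nat>"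
    proof -
      have "t * 2 ^ n \<in> \<nat> \<or> t * 2 ^ m \<in> \<nat>" using that nm by auto
      then show ?thesis using Nats_mult[OF _ of_nat_in_Nats] by blast
    qed
    ultimately show ?thesis by metis
  qed
  then show ?case by blast
qed simp

text \<open>One resolution is fixed for each finite \<open>J\<close>, so that the projective family
  becomes a function of \<open>J\<close> alone.\<close>

definition level :: "real set \<Rightarrow> nat" where
  "level J = (LEAST n. \<forall>t\<in>J. t * 2 ^ n \<in> \<nat>)"

lemma level:
  assumes "finite J" "J \<subseteq> dyadics" "t \<in> J" shows "t * 2 ^ level J \<in> \<nat>"
  using LeastI_ex[OF finite_dyadics_level[OF assms(1,2)]] assms(3) by (auto simp: level_def)

lemma walk_law_level:
  assumes "finite J" "J \<subseteq> dyadics" "\<And>t. t \<in> J \<Longrightarrow> t * 2 ^ n \<in> \<nat>"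
  shows "walk_law (level J) J = walk_law n J"
proof -
  have "level J \<le> n" unfolding level_def using assms(3) by (intro Least_le) auto
  then show ?thesis using walk_law_ge level[OF assms(1,2)] by metis
qed

lemma prob_space_walk_law: "prob_space (walk_law n J)"
proof -
  interpret prob_space "grid n" by (rule prob_space_grid)
  show ?thesis unfolding walk_law_def by (intro prob_space_distr) measurable
qed

lemma walk_law_restrict:
  assumes "J \<subseteq> H"
  shows "distr (walk_law n H) (PiM J (\<lambda>_. borel)) (\<lambda>f. restrict f J) = walk_law n J"
proof -
  have "distr (walk_law n H) (PiM J (\<lambda>_. borel)) (\<lambda>f. restrict f J) =
     distr (grid n) (PiM J (\<lambda>_. borel)) ((\<lambda>f. restrict f J) \<circ> (\<lambda>\<xi>. \<lambda>t\<in>H. walk n \<xi> t))"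
    unfolding walk_law_def using assms by (intro distr_distr measurable_restrict_subset) measurable
  also have "\<dots> = walk_law n J" unfolding walk_law_def
    using assms by (intro distr_cong refl) (auto simp: restrict_def fun_eq_iff)
  finally show ?thesis .
qed

text \<open>Kolmogorov's extension of the walk laws. Only increments between neighbouring grid
  points are recorded; all other increments between dyadic times are sums of these.\<close>

lemma dyadic_process_exists:
  "\<exists>L :: (real \<Rightarrow> real) measure. prob_space L \<and> (\<forall>t\<in>dyadics. (\<lambda>\<omega>. \<omega> t) \<in> borel_measurable L) \<and>
     (AE \<omega> in L. \<omega> 0 = 0) \<and>
     (\<forall>n. prob_space.indep_vars L (\<lambda>_. borel) (\<lambda>k \<omega>. \<omega> (real (Suc k) / 2 ^ n) - \<omega> (real k / 2 ^ n)) UNIV \<and>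
        (\<forall>k. distr L borel (\<lambda>\<omega>. \<omega> (real (Suc k) / 2 ^ n) - \<omega> (real k / 2 ^ n)) = \<mu> (1 / 2 ^ n)))"
proof -
  define P where "P J = walk_law (level J) J" for J
  interpret L: polish_projective dyadics P
  proof (rule polish_projective.intro, rule projective_family.intro)
    fix J H assume JH: "J \<subseteq> H" "finite H" "H \<subseteq> dyadics"
    have "walk_law (level J) J = walk_law (level H) J"
      using JH level by (intro walk_law_level) (auto intro: finite_subset)
    then show "P J = distr (P H) (PiM J (\<lambda>_. borel)) (\<lambda>f. restrict f J)"
      unfolding P_def using walk_law_restrict[OF JH(1)] by simp
  qed (simp add: P_def prob_space_walk_law)
  let ?L = L.lim
  have rm: "(\<lambda>f. restrict f J) \<in> measurable ?L (PiM J (\<lambda>_. borel))" if "J \<subseteq> dyadics" for J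
    unfolding measurable_cong_sets[OF L.sets_lim refl] using that by (rule measurable_restrict_subset)
  have fin: "distr ?L (PiM J (\<lambda>_. borel)) (\<lambda>f. restrict f J) = walk_law n J"
    if J: "finite J" "J \<subseteq> dyadics" "\<And>t. t \<in> J \<Longrightarrow> t * 2 ^ n \<in> \<nat>" for J n
  proof (rule measure_eqI)
    fix A assume "A \<in> sets (distr ?L (PiM J (\<lambda>_. borel)) (\<lambda>f. restrict f J))"
    then have A: "A \<in> sets (PiM J (\<lambda>_. borel))" by simp
    have "emeasure (distr ?L (PiM J (\<lambda>_. borel)) (\<lambda>f. restrict f J)) A = emeasure ?L (prod_emb dyadics (\<lambda>_. borel) J A)"
      using A rm[OF J(2)] by (subst emeasure_distr) (auto simp: prod_emb_def space_PiM)
    also have "\<dots> = emeasure (P J) A" using A J by (intro L.emeasure_lim_emb) auto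
    finally show "emeasure (distr ?L (PiM J (\<lambda>_. borel)) (\<lambda>f. restrict f J)) A = emeasure (walk_law n J) A"
      by (simp add: P_def walk_law_level[OF J])
  qed (simp add: walk_law_def)
  have meas: "(\<lambda>\<omega>. \<omega> t) \<in> borel_measurable ?L" if "t \<in> dyadics" for t
    using that by (simp cong: measurable_cong_sets)
  have dy: "real k / 2 ^ n \<in> dyadics" for k n by (auto simp: dyadics_def intro!: exI[of _ n])
  define D where "D n k \<omega> = \<omega> (real (Suc k) / 2 ^ n) - (\<omega> (real k / 2 ^ n) :: real)" for n k \<omega>
  have D_walk: "walk n \<xi> (real (Suc k) / 2 ^ n) - walk n \<xi> (real k / 2 ^ n) = \<xi> k" for n k \<xi>
    by (simp add: walk_def del: of_nat_Suc)
  \<comment> \<open>The increments are a function \<open>F\<close> of the values at the grid times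
    \<open>J\<close>, and along the walk this function returns the coordinates of
    \<open>grid n\<close>.\<close>
  have law: "distr ?L (PiM {..<N} (\<lambda>_. borel)) (\<lambda>\<omega>. \<lambda>k\<in>{..<N}. D n k \<omega>) = PiM {..<N} (\<lambda>_. \<mu> (1 / 2 ^ n))" for n N
  proof -
    define J where "J = (\<lambda>k. real k / 2 ^ n) ` {..N}"
    have J: "finite J" "J \<subseteq> dyadics" "\<And>t. t \<in> J \<Longrightarrow> t * 2 ^ n \<in> \<nat>" by (auto simp: J_def dy)
    define F where "F \<omega> = (\<lambda>k\<in>{..<N}. D n k \<omega>)" for \<omega>
    have Fm: "F \<in> measurable (PiM J (\<lambda>_. borel)) (PiM {..<N} (\<lambda>_. borel))"
      unfolding F_def D_def
      by (intro measurable_restrict borel_measurable_diff measurable_component_singleton) (auto simp: J_def simp del: of_nat_Suc)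
    have "distr ?L (PiM {..<N} (\<lambda>_. borel)) F = distr ?L (PiM {..<N} (\<lambda>_. borel)) (F \<circ> (\<lambda>f. restrict f J))"
      by (intro distr_cong refl) (auto simp: F_def D_def J_def restrict_def fun_eq_iff simp del: of_nat_Suc)
    also have "\<dots> = distr (distr ?L (PiM J (\<lambda>_. borel)) (\<lambda>f. restrict f J)) (PiM {..<N} (\<lambda>_. borel)) F"
      by (rule distr_distr[symmetric, OF Fm rm[OF J(2)]])
    also have "\<dots> = distr (walk_law n J) (PiM {..<N} (\<lambda>_. borel)) F"
      by (simp only: fin[OF J])
    also have "\<dots> = distr (grid n) (PiM {..<N} (\<lambda>_. borel)) (F \<circ> (\<lambda>\<xi>. \<lambda>t\<in>J. walk n \<xi> t))"
      unfolding walk_law_def by (intro distr_distr Fm) measurable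
    also have "\<dots> = distr (grid n) (PiM {..<N} (\<lambda>_. borel)) (\<lambda>\<xi>. restrict \<xi> {..<N})"
      by (intro distr_cong refl) (auto simp: F_def D_def J_def restrict_def fun_eq_iff D_walk simp del: of_nat_Suc)
    also have "\<dots> = distr (grid n) (PiM {..<N} (\<lambda>_. \<mu> (1 / 2 ^ n))) (\<lambda>\<xi>. restrict \<xi> {..<N})"
      by (intro distr_cong refl sets_PiM_cong) (auto simp: sets_\<mu>)
    also have "\<dots> = PiM {..<N} (\<lambda>_. \<mu> (1 / 2 ^ n))"
    proof -
      interpret product_prob_space "\<lambda>_::nat. \<mu> (1 / 2 ^ n)" UNIV by (rule product_prob_space_grid)
      show ?thesis unfolding grid_def by (rule distr_PiM_restrict_finite) auto
    qed
    finally show ?thesis unfolding F_def .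
  qed
  have Dm: "D n k \<in> borel_measurable ?L" for n k
    unfolding D_def by (intro borel_measurable_diff meas dy)
  have comp: "distr ?L borel (D n k) = \<mu> (1 / 2 ^ n)" for n k
  proof -
    have "distr ?L borel (D n k) = distr ?L (\<mu> (1 / 2 ^ n)) (D n k)" by (intro distr_cong) (auto simp: sets_\<mu>)
    also have "\<dots> = distr ?L (\<mu> (1 / 2 ^ n)) ((\<lambda>f. f k) \<circ> (\<lambda>\<omega>. \<lambda>k\<in>{..<Suc k}. D n k \<omega>))"
      by (intro distr_cong) auto
    also have "\<dots> = distr (distr ?L (PiM {..<Suc k} (\<lambda>_. borel)) (\<lambda>\<omega>. \<lambda>k\<in>{..<Suc k}. D n k \<omega>)) (\<mu> (1 / 2 ^ n)) (\<lambda>f. f k)"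
      by (intro distr_distr[symmetric] measurable_restrict Dm)
         (auto simp: measurable_cong_sets[OF refl sets_\<mu>])
    also have "\<dots> = \<mu> (1 / 2 ^ n)"
      unfolding law using real_distribution[of "1 / 2 ^ n"]
      by (intro distr_PiM_component) (auto simp: real_distribution_def)
    finally show ?thesis .
  qed
  have ind: "L.P.indep_vars (\<lambda>_. borel) (D n) UNIV" for n
  proof -
    have "L.P.indep_vars (\<lambda>_. borel) (D n) {..<Suc N}" for N
      using law[of "Suc N" n] by (subst L.P.indep_vars_iff_distr_eq_PiM') (auto simp: Dm comp)
    note * = this
    show ?thesis unfolding L.P.indep_vars_def2
    proof (intro conjI ballI Dm)
      show "L.P.indep_sets (\<lambda>i. {D n i -` A \<inter> space ?L |A. A \<in> sets borel}) UNIV"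
      \<comment> \<open>Independence is tested on finite index sets, each contained in an initial
        segment of the increments.\<close>
      proof (subst L.P.indep_sets_finite_index_sets, intro allI impI)
        fix J :: "nat set" assume "finite J"
        have "J \<subseteq> {..<Suc (Max (insert 0 J))}"
        proof (intro subsetI)
          fix x assume "x \<in> J"
          then have "x \<le> Max (insert 0 J)" using \<open>finite J\<close> by (intro Max_ge) auto
          then show "x \<in> {..<Suc (Max (insert 0 J))}" unfolding lessThan_iff less_Suc_eq_le .
        qed
        with * have "L.P.indep_vars (\<lambda>_. borel) (D n) J" by (rule L.P.indep_vars_subset)
        then show "L.P.indep_sets (\<lambda>i. {D n i -` A \<inter> space ?L |A. A \<in> sets borel}) J"
          unfolding L.P.indep_vars_def2 by simp
      qed
    qed
  qed
  have "AE \<omega> in ?L. \<omega> 0 = 0"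
  proof -
    have z: "{0} \<subseteq> dyadics" using dy[of 0 0] by simp
    have "AE f in walk_law 0 {0}. f 0 = 0"
      unfolding walk_law_def by (subst AE_distr_iff) (auto simp: walk_def)
    then have "AE f in distr ?L (PiM {0} (\<lambda>_. borel)) (\<lambda>f. restrict f {0}). f 0 = 0"
      using z by (subst fin[of "{0}" 0]) auto
    from AE_distrD[OF rm[OF z] this] show ?thesis by simp
  qed
  then show ?thesis
    using L.P.prob_space_axioms meas ind comp unfolding D_def by (intro exI[of _ ?L]) auto
qed

end

section \<open>Chentsov chaining on dyadic times\<close>

definition oscillation_bound :: "(nat \<Rightarrow> real) \<Rightarrow> (real \<Rightarrow> real) \<Rightarrow> bool" where
  "oscillation_bound \<delta> f \<longleftrightarrow> (\<forall>T. \<exists>n0. \<forall>n\<ge>n0. \<forall>k. k + 2 \<le> T * 2 ^ n \<longrightarrow>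
     min \<bar>f (real (k + 1) / 2 ^ n) - f (real k / 2 ^ n)\<bar>
         \<bar>f (real (k + 2) / 2 ^ n) - f (real (k + 1) / 2 ^ n)\<bar> \<le> \<delta> n)"

text \<open>The minimum of two adjacent increments tolerates isolated jumps. For the induction step,
  each point of the finer grid has a neighbouring coarse point whose value differs by at most
  \<open>\<delta> (Suc m)\<close>: an even point is a coarse point itself, and for an odd point one
  of the two adjacent increments is small. Both ends of an increment are moved, so each level costs
  twice \<open>\<delta>\<close>.\<close>

lemma oscillation_chaining:
  fixes f :: "real \<Rightarrow> real"
  assumes H: "\<And>n k. n0 \<le> n \<Longrightarrow> k + 2 \<le> T * 2 ^ n \<Longrightarrow>
      min \<bar>f (real (k + 1) / 2 ^ n) - f (real k / 2 ^ n)\<bar>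
          \<bar>f (real (k + 2) / 2 ^ n) - f (real (k + 1) / 2 ^ n)\<bar> \<le> \<delta> n"
    and \<delta>: "\<And>n. 0 \<le> \<delta> n" and n: "n0 \<le> n" "k + 2 \<le> T * 2 ^ n" and m: "n \<le> m"
    and ijl: "k * 2 ^ (m - n) \<le> i" "i \<le> j" "j \<le> l" "l \<le> (k + 2) * 2 ^ (m - n)"
  shows "min \<bar>f (real j / 2 ^ m) - f (real i / 2 ^ m)\<bar> \<bar>f (real l / 2 ^ m) - f (real j / 2 ^ m)\<bar>
    \<le> 2 * (\<Sum>p=n..m. \<delta> p)"
  using m ijl
proof (induction m arbitrary: i j l rule: dec_induct)
  case base
  \<comment> \<open>At level \<open>n\<close> the block contains only three grid points.\<close>
  consider "i = j" | "j = l" | "i = k" "j = k + 1" "l = k + 2" using base by fastforce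
  then show ?case
    by cases (use H[OF n] \<delta>[of n] in \<open>auto simp: min_le_iff_disj\<close>)
next
  case (step m)
  have "\<exists>r. (r = x div 2 \<or> odd x \<and> r = x div 2 + 1) \<and>
      \<bar>f (real x / 2 ^ Suc m) - f (real r / 2 ^ m)\<bar> \<le> \<delta> (Suc m)" if "x \<le> T * 2 ^ Suc m" for x
  proof (cases "even x")
    case True
    then have "real x / 2 ^ Suc m = real (x div 2) / 2 ^ m" by (auto elim: evenE)
    then show ?thesis using \<delta>[of "Suc m"] by (intro exI[of _ "x div 2"]) auto
  next
    case False
    then obtain a where a: "x = 2 * a + 1" by (elim oddE)
    have "T * 2 ^ Suc m = 2 * (T * 2 ^ m)" by simp
    with a that have "2 * a + 2 \<le> T * 2 ^ Suc m" by presburger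
    moreover have "n0 \<le> Suc m" using n step by simp
    ultimately have h: "min \<bar>f (real (2 * a + 1) / 2 ^ Suc m) - f (real (2 * a) / 2 ^ Suc m)\<bar>
       \<bar>f (real (2 * a + 2) / 2 ^ Suc m) - f (real (2 * a + 1) / 2 ^ Suc m)\<bar> \<le> \<delta> (Suc m)" by (intro H)
    have e: "real (2 * a) / 2 ^ Suc m = real a / 2 ^ m" "real (2 * a + 2) / 2 ^ Suc m = real (a + 1) / 2 ^ m"
      by (simp_all add: field_simps)
    consider "\<bar>f (real x / 2 ^ Suc m) - f (real a / 2 ^ m)\<bar> \<le> \<delta> (Suc m)"
      | "\<bar>f (real x / 2 ^ Suc m) - f (real (a + 1) / 2 ^ m)\<bar> \<le> \<delta> (Suc m)"
      using h unfolding e a min_le_iff_disj by (metis abs_minus_commute)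
    then show ?thesis
    proof cases
      case 1 then show ?thesis using a by (intro exI[of _ a]) auto
    next
      case 2 then show ?thesis using a by (intro exI[of _ "a + 1"]) auto
    qed
  qed
  then obtain r where r: "\<And>x. x \<le> T * 2 ^ Suc m \<Longrightarrow> r x = x div 2 \<or> odd x \<and> r x = x div 2 + 1"
    "\<And>x. x \<le> T * 2 ^ Suc m \<Longrightarrow> \<bar>f (real x / 2 ^ Suc m) - f (real (r x) / 2 ^ m)\<bar> \<le> \<delta> (Suc m)"
    by metis
  have pw: "(2::nat) ^ (Suc m - n) = 2 * 2 ^ (m - n)" using step by (simp add: Suc_diff_le)
  have "(k + 2) * 2 ^ (Suc m - n) \<le> (T * 2 ^ n) * 2 ^ (Suc m - n)" using n(2) by (rule mult_right_mono) simp
  also have "\<dots> = T * 2 ^ Suc m" using step by (simp add: power_add[symmetric])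
  finally have lT: "l \<le> T * 2 ^ Suc m" using step by linarith
  then have T: "i \<le> T * 2 ^ Suc m" "j \<le> T * 2 ^ Suc m" using step by linarith+
  \<comment> \<open>Rounding to the coarse grid preserves order, so the rounded triple is admissible
    for the induction hypothesis.\<close>
  have rmono: "r x \<le> r y" if "x \<le> y" "y \<le> T * 2 ^ Suc m" for x y
  proof (cases "x = y")
    case False
    then have "x < y" using that by simp
    then show ?thesis using r(1)[of x] r(1)[of y] that by presburger
  qed simp
  have "k * 2 ^ (m - n) \<le> r i"
    using r(1)[OF T(1)] step(4) unfolding pw mult.left_commute[of _ 2] by presburger
  moreover have "r l \<le> (k + 2) * 2 ^ (m - n)"
    using r(1)[OF lT] step(7) unfolding pw mult.left_commute[of _ 2] by presburger
  moreover have "r i \<le> r j" "r j \<le> r l" using step lT T by (auto intro: rmono)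
  ultimately have "min \<bar>f (real (r j) / 2 ^ m) - f (real (r i) / 2 ^ m)\<bar> \<bar>f (real (r l) / 2 ^ m) - f (real (r j) / 2 ^ m)\<bar>
    \<le> 2 * (\<Sum>p=n..m. \<delta> p)" by (intro step.IH)
  moreover have "(\<Sum>p=n..Suc m. \<delta> p) = (\<Sum>p=n..m. \<delta> p) + \<delta> (Suc m)" using step by simp
  ultimately show ?case
    using r(2)[OF T(1)] r(2)[OF T(2)] r(2)[OF lT] unfolding min_le_iff_disj by (elim disjE) linarith+
qed

definition dyadic_rats :: "real set" where
  "dyadic_rats = {t. \<exists>n k. t = real k / 2 ^ n}"

lemma dyadic_rats_common_level:
  assumes "x \<in> dyadic_rats"
  shows "\<exists>n. \<forall>m\<ge>n. \<exists>k. x = real k / 2 ^ m"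
proof -
  obtain n k where x: "x = real k / 2 ^ n" using assms by (auto simp: dyadic_rats_def)
  have "x = real (k * 2 ^ (m - n)) / 2 ^ m" if "n \<le> m" for m
    using that by (simp add: x field_simps power_add[symmetric])
  then show ?thesis by blast
qed

text \<open>Three points within \<open>1 / 2 ^ n\<close> of each other lie in two adjacent cells of
  level \<open>n\<close>, starting at \<open>k = nat \<lfloor>p * 2 ^ n\<rfloor>\<close>. Chaining
  bounds the minimum by twice a piece of the tail of the convergent series
  \<open>\<delta>\<close>.\<close>

lemma oscillation_modulus:
  fixes f :: "real \<Rightarrow> real"
  assumes H: "oscillation_bound \<delta> f" and \<delta>: "\<And>n. 0 \<le> \<delta> n" "summable \<delta>" and \<epsilon>: "\<epsilon> > 0"
  shows "\<exists>\<eta>>0. \<forall>p\<in>dyadic_rats. \<forall>q\<in>dyadic_rats. \<forall>r\<in>dyadic_rats. p \<le> q \<and> q \<le> r \<and> r < p + \<eta> \<and> r \<le> B \<longrightarrow>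
    min \<bar>f q - f p\<bar> \<bar>f r - f q\<bar> \<le> \<epsilon>"
proof -
  \<comment> \<open>The two cells end at index \<open>k + 2\<close>, where \<open>k\<close> may
    reach \<open>nat \<lceil>B\<rceil> * 2 ^ n\<close>; the summand 2 leaves room for this at every
    level.\<close>
  define T where "T = nat \<lceil>B\<rceil> + 2"
  obtain n0 where n0: "\<And>n k. n0 \<le> n \<Longrightarrow> k + 2 \<le> T * 2 ^ n \<Longrightarrow>
      min \<bar>f (real (k + 1) / 2 ^ n) - f (real k / 2 ^ n)\<bar>
          \<bar>f (real (k + 2) / 2 ^ n) - f (real (k + 1) / 2 ^ n)\<bar> \<le> \<delta> n"
    using H unfolding oscillation_bound_def by blast
  obtain n1 where n1: "\<And>n m. n1 \<le> n \<Longrightarrow> \<bar>\<Sum>p=n..<m. \<delta> p\<bar> < \<epsilon> / 2"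
    using \<delta>(2) \<epsilon> unfolding summable_Cauchy real_norm_def by (metis half_gt_zero)
  define n where "n = max n0 n1"
  show ?thesis
  proof (intro exI[of _ "1 / 2 ^ n"] conjI ballI impI, goal_cases)
    case (2 p q r)
    then have pqr: "p \<le> q" "q \<le> r" "r < p + 1 / 2 ^ n" "r \<le> B" by auto
    have p0: "0 \<le> p" using 2 by (auto simp: dyadic_rats_def)
    obtain np nq nr where
      "\<forall>m\<ge>np. \<exists>k. p = real k / 2 ^ m" "\<forall>m\<ge>nq. \<exists>k. q = real k / 2 ^ m" "\<forall>m\<ge>nr. \<exists>k. r = real k / 2 ^ m"
      using 2 dyadic_rats_common_level by metis
    moreover define m where "m = n + np + nq + nr"
    ultimately obtain i j l where ijl: "p = real i / 2 ^ m" "q = real j / 2 ^ m" "r = real l / 2 ^ m"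
      by (metis le_add1 le_add2 add.commute add.left_commute)
    have nm: "n \<le> m" by (simp add: m_def)
    define k where "k = nat \<lfloor>p * 2 ^ n\<rfloor>"
    have "0 \<le> p * 2 ^ n" using p0 by simp
    then have k: "real k \<le> p * 2 ^ n" "p * 2 ^ n < real k + 1" unfolding k_def by linarith+
    have m2: "(2::real) ^ m = 2 ^ n * 2 ^ (m - n)" using nm by (simp add: power_add[symmetric])
    have "real k * 2 ^ (m - n) \<le> p * 2 ^ n * 2 ^ (m - n)" using k(1) by (rule mult_right_mono) simp
    also have "\<dots> = real i" using m2 by (simp add: ijl)
    finally have i: "k * 2 ^ (m - n) \<le> i" by (metis of_nat_le_iff of_nat_mult of_nat_numeral of_nat_power)
    have r2: "r * 2 ^ n < real k + 2"
    proof -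
      have "r * 2 ^ n < (p + 1 / 2 ^ n) * 2 ^ n" using pqr by (intro mult_strict_right_mono) auto
      also have "\<dots> = p * 2 ^ n + 1" by (simp add: field_simps)
      finally show ?thesis using k(2) by linarith
    qed
    have "real l = r * 2 ^ n * 2 ^ (m - n)" using m2 by (simp add: ijl)
    also have "\<dots> \<le> (real k + 2) * 2 ^ (m - n)" using r2 by (intro mult_right_mono) auto
    also have "\<dots> = real ((k + 2) * 2 ^ (m - n))" by (simp only: of_nat_mult of_nat_add of_nat_power of_nat_numeral)
    finally have l: "l \<le> (k + 2) * 2 ^ (m - n)" by (simp only: of_nat_le_iff)
    have mono: "i \<le> j" "j \<le> l" using pqr by (auto simp: ijl divide_le_cancel)
    have "k + 2 \<le> T * 2 ^ n"
    proof -
      have "p * 2 ^ n \<le> real (nat \<lceil>B\<rceil>) * 2 ^ n" using pqr p0 by (intro mult_right_mono) (linarith | simp)+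
      with k(1) have "real k \<le> real (nat \<lceil>B\<rceil>) * 2 ^ n" by linarith
      then have "real k \<le> real (nat \<lceil>B\<rceil> * 2 ^ n)" by (simp only: of_nat_mult of_nat_power of_nat_numeral)
      then have "k \<le> nat \<lceil>B\<rceil> * 2 ^ n" by (simp only: of_nat_le_iff)
      moreover have "1 \<le> (2::nat) ^ n" by simp
      ultimately have "k + 2 \<le> nat \<lceil>B\<rceil> * 2 ^ n + 2 * 2 ^ n" by linarith
      then show ?thesis unfolding T_def by (simp only: add_mult_distrib)
    qed
    then have "min \<bar>f (real j / 2 ^ m) - f (real i / 2 ^ m)\<bar> \<bar>f (real l / 2 ^ m) - f (real j / 2 ^ m)\<bar>
        \<le> 2 * (\<Sum>p=n..m. \<delta> p)"
      by (intro oscillation_chaining[of n0 T f \<delta> n k m i j l]) (use n0 \<delta> nm i l mono in \<open>auto simp: n_def\<close>)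
    also have "\<dots> \<le> \<epsilon>" using n1[of n "Suc m"] by (simp add: n_def atLeastLessThanSuc_atLeastAtMost)
    finally show ?case by (simp add: ijl)
  qed simp
qed

section \<open>Cadlag regularization from dyadic times\<close>

definition right_approx :: "nat \<Rightarrow> real \<Rightarrow> real" where
  "right_approx n t = real (nat \<lfloor>t * 2 ^ n\<rfloor> + 1) / 2 ^ n"

definition left_approx :: "nat \<Rightarrow> real \<Rightarrow> real" where
  "left_approx n t = real (nat \<lceil>t * 2 ^ n\<rceil> - 1) / 2 ^ n"

text \<open>Because of the \<open>+ 1\<close> the inequality is strict even for dyadic
  \<open>t\<close>, so limits along \<open>right_approx\<close> are genuine right limits.\<close>

lemma right_approx:
  assumes "0 \<le> t"
  shows "t < right_approx n t" "right_approx n t \<le> t + 1 / 2 ^ n" "right_approx n t \<in> dyadic_rats"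
proof -
  have p: "0 \<le> t * 2 ^ n" using assms by simp
  then have "t * 2 ^ n < real (nat \<lfloor>t * 2 ^ n\<rfloor> + 1)" "real (nat \<lfloor>t * 2 ^ n\<rfloor> + 1) \<le> t * 2 ^ n + 1"
    by linarith+
  then show "t < right_approx n t" "right_approx n t \<le> t + 1 / 2 ^ n"
    unfolding right_approx_def by (simp_all add: field_simps)
  show "right_approx n t \<in> dyadic_rats" unfolding right_approx_def dyadic_rats_def by blast
qed

text \<open>Rounding up and subtracting 1, instead of rounding down, keeps the inequality strict at
  dyadic \<open>t\<close>.\<close>

lemma left_approx:
  assumes "0 < t"
  shows "left_approx n t < t" "t - 1 / 2 ^ n \<le> left_approx n t" "left_approx n t \<in> dyadic_rats"
proof -
  have p: "0 < t * 2 ^ n" using assms by simp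
  then have "real (nat \<lceil>t * 2 ^ n\<rceil> - 1) < t * 2 ^ n" "t * 2 ^ n - 1 \<le> real (nat \<lceil>t * 2 ^ n\<rceil> - 1)"
    by linarith+
  then have "left_approx n t * 2 ^ n < t * 2 ^ n" "(t - 1 / 2 ^ n) * 2 ^ n \<le> left_approx n t * 2 ^ n"
    unfolding left_approx_def by (simp_all add: algebra_simps)
  then show "left_approx n t < t" "t - 1 / 2 ^ n \<le> left_approx n t" by simp_all
  show "left_approx n t \<in> dyadic_rats" unfolding left_approx_def dyadic_rats_def by blast
qed

lemma right_approx_tendsto: "0 \<le> t \<Longrightarrow> (\<lambda>n. right_approx n t) \<longlonglongrightarrow> t"
proof (rule tendsto_sandwich[where f = "\<lambda>_. t" and h = "\<lambda>n. t + (1 / 2) ^ n"])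
  show "(\<lambda>n. t + (1 / 2) ^ n) \<longlonglongrightarrow> t"
    by (rule tendsto_eq_intros LIMSEQ_realpow_zero | simp)+
qed (auto intro!: always_eventually less_imp_le[OF right_approx(1)] right_approx(2) simp: power_divide)

lemma left_approx_tendsto: "0 < t \<Longrightarrow> (\<lambda>n. left_approx n t) \<longlonglongrightarrow> t"
proof (rule tendsto_sandwich[where h = "\<lambda>_. t" and f = "\<lambda>n. t - (1 / 2) ^ n"])
  show "(\<lambda>n. t - (1 / 2) ^ n) \<longlonglongrightarrow> t"
    by (rule tendsto_eq_intros LIMSEQ_realpow_zero | simp)+
qed (auto intro!: always_eventually less_imp_le[OF left_approx(1)] left_approx(2) simp: power_divide)

text \<open>Otherwise there are points \<open>p < q < s < u\<close> close to the right of
  \<open>t\<close> such that both pairs differ by more than \<open>\<epsilon>\<close>. The triples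
  \<open>p, q, s\<close> and \<open>p, q, u\<close> then force \<open>f s\<close> and
  \<open>f u\<close> to lie within \<open>\<epsilon> / 2\<close> of \<open>f q\<close>, which
  contradicts the second pair.\<close>

lemma oscillation_Cauchy_right:
  fixes f :: "real \<Rightarrow> real"
  assumes H: "oscillation_bound \<delta> f" and \<delta>: "\<And>n. 0 \<le> \<delta> n" "summable \<delta>" and \<epsilon>: "\<epsilon> > 0" and t: "0 \<le> t"
  shows "\<exists>\<eta>>0. \<forall>x\<in>dyadic_rats. \<forall>y\<in>dyadic_rats. t < x \<and> x < t + \<eta> \<and> t < y \<and> y < t + \<eta> \<longrightarrow> \<bar>f x - f y\<bar> \<le> \<epsilon>"
proof (rule ccontr)
  assume "\<not> ?thesis"
  then have bad: "\<exists>x\<in>dyadic_rats. \<exists>y\<in>dyadic_rats. t < x \<and> x < y \<and> y < t + \<eta> \<and> \<bar>f x - f y\<bar> > \<epsilon>" if "\<eta> > 0" for \<eta>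
    using that by (metis abs_minus_commute linorder_cases not_le \<epsilon> abs_zero diff_self less_imp_le)
  obtain \<eta> where \<eta>: "\<eta> > 0" "\<And>p q r. p \<in> dyadic_rats \<Longrightarrow> q \<in> dyadic_rats \<Longrightarrow> r \<in> dyadic_rats \<Longrightarrow>
      p \<le> q \<Longrightarrow> q \<le> r \<Longrightarrow> r < p + \<eta> \<Longrightarrow> r \<le> t + 1 \<Longrightarrow> min \<bar>f q - f p\<bar> \<bar>f r - f q\<bar> \<le> \<epsilon> / 2"
    using oscillation_modulus[OF H \<delta>, of "\<epsilon> / 2" "t + 1"] \<epsilon> by auto
  obtain s u where su: "s \<in> dyadic_rats" "u \<in> dyadic_rats" "t < s" "s < u" "u < t + min \<eta> 1" "\<bar>f s - f u\<bar> > \<epsilon>"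
    using bad[of "min \<eta> 1"] \<eta>(1) by auto
  obtain p q where pq: "p \<in> dyadic_rats" "q \<in> dyadic_rats" "t < p" "p < q" "q < t + (s - t)" "\<bar>f p - f q\<bar> > \<epsilon>"
    using bad[of "s - t"] su by auto
  have "min \<bar>f q - f p\<bar> \<bar>f s - f q\<bar> \<le> \<epsilon> / 2" "min \<bar>f q - f p\<bar> \<bar>f u - f q\<bar> \<le> \<epsilon> / 2"
    by (intro \<eta>(2); use su pq in linarith)+
  then show False using su(6) pq(6) \<epsilon> unfolding min_le_iff_disj by (elim disjE) linarith+
qed

text \<open>Mirror image of the right-hand case: now the pair closer to \<open>t\<close> from the
  left, \<open>q < r\<close>, pins the values at \<open>s\<close> and \<open>u\<close> to
  \<open>f q\<close>.\<close>

lemma oscillation_Cauchy_left: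
  fixes f :: "real \<Rightarrow> real"
  assumes H: "oscillation_bound \<delta> f" and \<delta>: "\<And>n. 0 \<le> \<delta> n" "summable \<delta>" and \<epsilon>: "\<epsilon> > 0"
  shows "\<exists>\<eta>>0. \<forall>x\<in>dyadic_rats. \<forall>y\<in>dyadic_rats. t - \<eta> < x \<and> x < t \<and> t - \<eta> < y \<and> y < t \<longrightarrow> \<bar>f x - f y\<bar> \<le> \<epsilon>"
proof (rule ccontr)
  assume "\<not> ?thesis"
  then have bad: "\<exists>x\<in>dyadic_rats. \<exists>y\<in>dyadic_rats. t - \<eta> < x \<and> x < y \<and> y < t \<and> \<bar>f x - f y\<bar> > \<epsilon>" if "\<eta> > 0" for \<eta>
    using that by (metis abs_minus_commute linorder_cases not_le \<epsilon> abs_zero diff_self less_imp_le)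
  obtain \<eta> where \<eta>: "\<eta> > 0" "\<And>p q r. p \<in> dyadic_rats \<Longrightarrow> q \<in> dyadic_rats \<Longrightarrow> r \<in> dyadic_rats \<Longrightarrow>
      p \<le> q \<Longrightarrow> q \<le> r \<Longrightarrow> r < p + \<eta> \<Longrightarrow> r \<le> t \<Longrightarrow> min \<bar>f q - f p\<bar> \<bar>f r - f q\<bar> \<le> \<epsilon> / 2"
    using oscillation_modulus[OF H \<delta>, of "\<epsilon> / 2" t] \<epsilon> by auto
  obtain s u where su: "s \<in> dyadic_rats" "u \<in> dyadic_rats" "t - \<eta> < s" "s < u" "u < t" "\<bar>f s - f u\<bar> > \<epsilon>"
    using bad[of \<eta>] \<eta>(1) by auto
  obtain q r where qr: "q \<in> dyadic_rats" "r \<in> dyadic_rats" "t - (t - u) < q" "q < r" "r < t" "\<bar>f q - f r\<bar> > \<epsilon>"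
    using bad[of "t - u"] su by auto
  have "min \<bar>f q - f s\<bar> \<bar>f r - f q\<bar> \<le> \<epsilon> / 2" "min \<bar>f q - f u\<bar> \<bar>f r - f q\<bar> \<le> \<epsilon> / 2"
    by (intro \<eta>(2); use su qr in linarith)+
  then show False using su(6) qr(6) \<epsilon> unfolding min_le_iff_disj by (elim disjE) linarith+
qed

text \<open>The sets \<open>A \<eta>\<close> stand for punctured one-sided dyadic neighbourhoods, so
  that one argument serves right and left limits.\<close>

lemma Cauchy_germ_limit:
  fixes f :: "real \<Rightarrow> real"
  assumes C: "\<And>\<epsilon>. \<epsilon> > 0 \<Longrightarrow> \<exists>\<eta>>0. \<forall>x\<in>A \<eta>. \<forall>y\<in>A \<eta>. \<bar>f x - f y\<bar> \<le> \<epsilon>"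
    and s: "\<And>\<eta>. \<eta> > 0 \<Longrightarrow> \<forall>\<^sub>F n in sequentially. s n \<in> A \<eta>"
  shows "(\<lambda>n. f (s n)) \<longlonglongrightarrow> lim (\<lambda>n. f (s n))"
    and "\<And>\<epsilon>. \<epsilon> > 0 \<Longrightarrow> \<exists>\<eta>>0. \<forall>x\<in>A \<eta>. \<bar>f x - lim (\<lambda>n. f (s n))\<bar> \<le> \<epsilon>"
proof -
  have "Cauchy (\<lambda>n. f (s n))"
  proof (rule metric_CauchyI)
    fix e :: real assume "e > 0"
    then obtain \<eta> where \<eta>: "\<eta> > 0" "\<forall>x\<in>A \<eta>. \<forall>y\<in>A \<eta>. \<bar>f x - f y\<bar> \<le> e / 2" using C[of "e / 2"] by auto
    obtain N where "\<And>n. n \<ge> N \<Longrightarrow> s n \<in> A \<eta>" using s[OF \<eta>(1)] by (auto simp: eventually_sequentially)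
    then show "\<exists>M. \<forall>m\<ge>M. \<forall>n\<ge>M. dist (f (s m)) (f (s n)) < e"
      using \<eta>(2) \<open>e > 0\<close> by (intro exI[of _ N]) (auto simp: dist_real_def intro: le_less_trans[of _ "e / 2"])
  qed
  then show lim: "(\<lambda>n. f (s n)) \<longlonglongrightarrow> lim (\<lambda>n. f (s n))"
    using real_Cauchy_convergent convergent_LIMSEQ_iff by blast
  fix \<epsilon> :: real assume "\<epsilon> > 0"
  then obtain \<eta> where \<eta>: "\<eta> > 0" "\<forall>x\<in>A \<eta>. \<forall>y\<in>A \<eta>. \<bar>f x - f y\<bar> \<le> \<epsilon>" using C by blast
  show "\<exists>\<eta>>0. \<forall>x\<in>A \<eta>. \<bar>f x - lim (\<lambda>n. f (s n))\<bar> \<le> \<epsilon>"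
  proof (intro exI conjI ballI)
    fix x assume x: "x \<in> A \<eta>"
    have l: "(\<lambda>n. \<bar>f x - f (s n)\<bar>) \<longlonglongrightarrow> \<bar>f x - lim (\<lambda>n. f (s n))\<bar>" by (intro tendsto_intros lim)
    from s[OF \<eta>(1)] have "\<forall>\<^sub>F n in sequentially. \<bar>f x - f (s n)\<bar> \<le> \<epsilon>"
      by eventually_elim (use \<eta>(2) x in auto)
    with l show "\<bar>f x - lim (\<lambda>n. f (s n))\<bar> \<le> \<epsilon>" by (rule tendsto_upperbound) simp
  qed (fact \<eta>(1))
qed

definition regularize :: "(real \<Rightarrow> real) \<Rightarrow> real \<Rightarrow> real" where
  "regularize f t = lim (\<lambda>n. f (right_approx n t))"

context
  fixes f :: "real \<Rightarrow> real" and \<delta> :: "nat \<Rightarrow> real"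
  assumes H: "oscillation_bound \<delta> f" and \<delta>: "\<And>n. 0 \<le> \<delta> n" "summable \<delta>"
begin

lemma right_approx_eventually:
  assumes "0 \<le> t" "t < b" shows "\<forall>\<^sub>F n in sequentially. right_approx n t < b"
  using order_tendstoD(2)[OF right_approx_tendsto[OF assms(1)] assms(2)] .

lemma regularize_right:
  assumes t: "0 \<le> t"
  shows "(\<lambda>n. f (right_approx n t)) \<longlonglongrightarrow> regularize f t"
    and "\<And>\<epsilon>. \<epsilon> > 0 \<Longrightarrow> \<exists>\<eta>>0. \<forall>x\<in>dyadic_rats \<inter> {t<..<t + \<eta>}. \<bar>f x - regularize f t\<bar> \<le> \<epsilon>"
proof -
  have C: "\<exists>\<eta>>0. \<forall>x\<in>dyadic_rats \<inter> {t<..<t + \<eta>}. \<forall>y\<in>dyadic_rats \<inter> {t<..<t + \<eta>}. \<bar>f x - f y\<bar> \<le> \<epsilon>" if "\<epsilon> > 0" for \<epsilon>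
    using oscillation_Cauchy_right[OF H \<delta> that t] by auto
  have s: "\<forall>\<^sub>F n in sequentially. right_approx n t \<in> dyadic_rats \<inter> {t<..<t + \<eta>}" if "\<eta> > 0" for \<eta>
    using right_approx_eventually[OF t, of "t + \<eta>"] that by (auto elim!: eventually_mono intro: right_approx t)
  show "(\<lambda>n. f (right_approx n t)) \<longlonglongrightarrow> regularize f t"
    unfolding regularize_def
    using C s by (rule Cauchy_germ_limit(1)[where A = "\<lambda>\<eta>. dyadic_rats \<inter> {t<..<t + \<eta>}"])
  show "\<exists>\<eta>>0. \<forall>x\<in>dyadic_rats \<inter> {t<..<t + \<eta>}. \<bar>f x - regularize f t\<bar> \<le> \<epsilon>" if "\<epsilon> > 0" for \<epsilon>
    unfolding regularize_def
    using C s that by (rule Cauchy_germ_limit(2)[where A = "\<lambda>\<eta>. dyadic_rats \<inter> {t<..<t + \<eta>}"])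
qed

lemma dyadic_left_limit:
  assumes t: "0 < t"
  shows "\<exists>l. (\<lambda>n. f (left_approx n t)) \<longlonglongrightarrow> l \<and>
    (\<forall>\<epsilon>>0. \<exists>\<eta>>0. \<forall>x\<in>dyadic_rats \<inter> {t - \<eta><..<t}. \<bar>f x - l\<bar> \<le> \<epsilon>)"
proof -
  have C: "\<exists>\<eta>>0. \<forall>x\<in>dyadic_rats \<inter> {t - \<eta><..<t}. \<forall>y\<in>dyadic_rats \<inter> {t - \<eta><..<t}. \<bar>f x - f y\<bar> \<le> \<epsilon>" if "\<epsilon> > 0" for \<epsilon>
    using oscillation_Cauchy_left[OF H \<delta> that, of t] by auto
  have s: "\<forall>\<^sub>F n in sequentially. left_approx n t \<in> dyadic_rats \<inter> {t - \<eta><..<t}" if "\<eta> > 0" for \<eta>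
    using order_tendstoD(1)[OF left_approx_tendsto[OF t], of "t - \<eta>"] that
    by (auto elim!: eventually_mono intro: left_approx t)
  show ?thesis
    using Cauchy_germ_limit[where A = "\<lambda>\<eta>. dyadic_rats \<inter> {t - \<eta><..<t}", OF C s] by blast
qed

text \<open>Dyadic estimates on an open interval also reach its left end \<open>a = s\<close>, since
  \<open>right_approx\<close> lies strictly to the right of \<open>s\<close>.\<close>

lemma regularize_le:
  assumes "0 \<le> s" "\<forall>x\<in>dyadic_rats \<inter> {a<..<b}. \<bar>f x - l\<bar> \<le> \<epsilon>" "a \<le> s" "s < b"
  shows "\<bar>regularize f s - l\<bar> \<le> \<epsilon>"
proof (rule tendsto_upperbound)
  show "(\<lambda>n. \<bar>f (right_approx n s) - l\<bar>) \<longlonglongrightarrow> \<bar>regularize f s - l\<bar>"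
    by (intro tendsto_intros regularize_right assms)
  from right_approx_eventually[OF assms(1,4)]
  show "\<forall>\<^sub>F n in sequentially. \<bar>f (right_approx n s) - l\<bar> \<le> \<epsilon>"
  proof eventually_elim
    case (elim n)
    then show ?case using right_approx(1,3)[OF assms(1), of n] assms(2,3) by auto
  qed
qed simp

lemma regularize_right_continuous:
  assumes t: "0 \<le> t" shows "(regularize f \<longlongrightarrow> regularize f t) (at_right t)"
  unfolding tendsto_iff
proof (intro allI impI)
  fix e :: real assume e: "e > 0"
  obtain \<eta> where \<eta>: "\<eta> > 0" "\<forall>x\<in>dyadic_rats \<inter> {t<..<t + \<eta>}. \<bar>f x - regularize f t\<bar> \<le> e / 2"
    using regularize_right(2)[OF t, of "e / 2"] e by auto
  have "\<bar>regularize f s - regularize f t\<bar> \<le> e / 2" if "t < s" "s < t + \<eta>" for s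
    using that t by (intro regularize_le[OF _ \<eta>(2)]) auto
  then show "\<forall>\<^sub>F x in at_right t. dist (regularize f x) (regularize f t) < e"
    using \<eta>(1) e unfolding eventually_at_right_field
    by (intro exI[of _ "t + \<eta>"]) (auto simp: dist_real_def intro: le_less_trans[of _ "e / 2"])
qed

lemma regularize_left_limit:
  assumes t: "0 < t"
  shows "\<exists>l. (\<lambda>n. f (left_approx n t)) \<longlonglongrightarrow> l \<and> (regularize f \<longlongrightarrow> l) (at_left t)"
proof -
  obtain l where l: "(\<lambda>n. f (left_approx n t)) \<longlonglongrightarrow> l"
    "\<And>\<epsilon>. \<epsilon> > 0 \<Longrightarrow> \<exists>\<eta>>0. \<forall>x\<in>dyadic_rats \<inter> {t - \<eta><..<t}. \<bar>f x - l\<bar> \<le> \<epsilon>"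
    using dyadic_left_limit[OF t] by blast
  have "(regularize f \<longlongrightarrow> l) (at_left t)"
    unfolding tendsto_iff
  proof (intro allI impI)
    fix e :: real assume e: "e > 0"
    obtain \<eta> where \<eta>: "\<eta> > 0" "\<forall>x\<in>dyadic_rats \<inter> {t - \<eta><..<t}. \<bar>f x - l\<bar> \<le> e / 2"
      using l(2)[of "e / 2"] e by auto
    have "\<bar>regularize f s - l\<bar> \<le> e / 2" if "max 0 (t - \<eta>) < s" "s < t" for s
      using that t by (intro regularize_le[OF _ \<eta>(2)]) auto
    then show "\<forall>\<^sub>F x in at_left t. dist (regularize f x) l < e"
      using \<eta>(1) e t unfolding eventually_at_left_field
      by (intro exI[of _ "max 0 (t - \<eta>)"]) (auto simp: dist_real_def intro: le_less_trans[of _ "e / 2"])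
  qed
  with l(1) show ?thesis by blast
qed

text \<open>The points \<open>left_approx n t\<close> and \<open>right_approx n t\<close> are one or
  two grid steps apart and each step rises by at most \<open>\<epsilon> / 2\<close>; the jump is the
  limit of the differences.\<close>

lemma regularize_jump_le_0:
  assumes P: "\<And>T \<epsilon>. \<epsilon> > 0 \<Longrightarrow> \<forall>\<^sub>F n in sequentially. \<forall>k<T * 2 ^ n. f (real (Suc k) / 2 ^ n) - f (real k / 2 ^ n) \<le> \<epsilon>"
    and t: "0 < t" and lim: "(regularize f \<longlongrightarrow> l) (at_left t)"
  shows "regularize f t - l \<le> 0"
proof -
  obtain l' where l': "(\<lambda>n. f (left_approx n t)) \<longlonglongrightarrow> l'" "(regularize f \<longlongrightarrow> l') (at_left t)"
    using regularize_left_limit[OF t] by blast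
  have "l' = l" using tendsto_unique[OF _ l'(2) lim] by simp
  then have lt: "(\<lambda>n. f (right_approx n t) - f (left_approx n t)) \<longlonglongrightarrow> regularize f t - l"
    using l'(1) regularize_right(1) t by (intro tendsto_intros) auto
  define T where "T = nat \<lceil>t\<rceil> + 1"
  have "regularize f t - l \<le> \<epsilon>" if \<epsilon>: "\<epsilon> > 0" for \<epsilon>
  proof (rule tendsto_upperbound[OF lt])
    have "\<forall>\<^sub>F n in sequentially. \<forall>k<T * 2 ^ n. f (real (Suc k) / 2 ^ n) - f (real k / 2 ^ n) \<le> \<epsilon> / 2"
      using P[of "\<epsilon> / 2"] \<epsilon> by simp
    then show "\<forall>\<^sub>F n in sequentially. f (right_approx n t) - f (left_approx n t) \<le> \<epsilon>"
    proof eventually_elim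
      case (elim n)
      define a where "a = nat \<lceil>t * 2 ^ n\<rceil> - 1"
      have p: "0 < t * 2 ^ n" using t by simp
      \<comment> \<open>The second case occurs exactly when \<open>t\<close> lies on the
        grid.\<close>
      have "nat \<lfloor>t * 2 ^ n\<rfloor> = a \<or> nat \<lfloor>t * 2 ^ n\<rfloor> = a + 1" using p unfolding a_def by linarith
      then have "right_approx n t = real (Suc a) / 2 ^ n \<or> right_approx n t = real (Suc (Suc a)) / 2 ^ n"
        unfolding right_approx_def by auto
      moreover have "left_approx n t = real a / 2 ^ n" by (simp add: left_approx_def a_def)
      moreover have "Suc a < T * 2 ^ n"
      proof -
        have "t * 2 ^ n \<le> real (nat \<lceil>t\<rceil>) * 2 ^ n" using t by (intro mult_right_mono) (linarith | simp)+
        then have "t * 2 ^ n \<le> real (nat \<lceil>t\<rceil> * 2 ^ n)" by simp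
        then have "nat \<lceil>t * 2 ^ n\<rceil> \<le> nat \<lceil>t\<rceil> * 2 ^ n" by (simp only: nat_ceiling_le_eq)
        moreover have "nat \<lceil>t * 2 ^ n\<rceil> > 0" using p by simp
        moreover have "0 < (2::nat) ^ n" by simp
        ultimately have "Suc (nat \<lceil>t * 2 ^ n\<rceil> - 1) < nat \<lceil>t\<rceil> * 2 ^ n + 1 * 2 ^ n" by linarith
        then show ?thesis unfolding a_def T_def by (simp only: add_mult_distrib)
      qed
      ultimately show ?case using elim[rule_format, of a] elim[rule_format, of "Suc a"] \<epsilon> by auto
    qed
  qed simp
  then show ?thesis by (rule field_le_epsilon[of _ 0, simplified])
qed

end

section \<open>Borel-Cantelli on grids, limits of independent variables, tail estimates\<close>

lemma (in prob_space) AE_eventually_grid: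
  fixes p :: "nat \<Rightarrow> real" and T :: nat
  assumes meas: "\<And>n k. {\<omega>\<in>space M. E n k \<omega>} \<in> events"
    and le: "\<And>n k. prob {\<omega>\<in>space M. E n k \<omega>} \<le> p n"
    and sum: "summable (\<lambda>n. 2 ^ n * p n)"
  shows "AE \<omega> in M. \<forall>\<^sub>F n in sequentially. \<forall>k<T * 2 ^ n. \<not> E n k \<omega>"
proof -
  define A where "A n = (\<Union>k<T * 2 ^ n. {\<omega>\<in>space M. E n k \<omega>})" for n
  have A: "A n \<in> events" for n unfolding A_def using meas by auto
  have "prob (A n) \<le> real T * (2 ^ n * p n)" for n
  proof -
    have "prob (A n) \<le> (\<Sum>k<T * 2 ^ n. prob {\<omega>\<in>space M. E n k \<omega>})"
      unfolding A_def using meas by (intro finite_measure_subadditive_finite) auto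
    also have "\<dots> \<le> (\<Sum>k<T * 2 ^ n. p n)" by (intro sum_mono le)
    finally show ?thesis by (simp add: mult.assoc)
  qed
  then have "summable (\<lambda>n. prob (A n))"
    by (intro summable_comparison_test'[OF summable_mult[OF sum, of "real T"], of 0]) auto
  then have "AE \<omega> in M. \<forall>\<^sub>F n in sequentially. \<omega> \<in> space M - A n"
    by (intro borel_cantelli_AE1 A) (auto simp: less_top[symmetric])
  then show ?thesis
    by eventually_elim (auto elim!: eventually_mono simp: A_def)
qed

text \<open>Independence is tested on closed sets, an intersection-stable generator. The continuous
  functions \<open>h j C\<close> approximate the indicator of a closed \<open>C\<close>; their
  product formula passes to the limit in \<open>m\<close> for fixed \<open>j\<close>, and the limit
  in \<open>j\<close> is taken afterwards.\<close>

lemma (in prob_space) indep_vars_limit: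
  fixes Z :: "nat \<Rightarrow> 'i \<Rightarrow> 'a \<Rightarrow> real"
  assumes I: "finite I"
    and ind: "\<And>m. indep_vars (\<lambda>_. borel) (Z m) I"
    and lim: "\<And>i. i \<in> I \<Longrightarrow> AE \<omega> in M. (\<lambda>m. Z m i \<omega>) \<longlonglongrightarrow> Z' i \<omega>"
    and rv: "\<And>i. i \<in> I \<Longrightarrow> Z' i \<in> borel_measurable M"
  shows "indep_vars (\<lambda>_. borel) Z' I"
proof (cases "I = {}")
  case True
  then show ?thesis by (auto simp: indep_vars_def indep_sets_def)
next
  case False
  have rvZ: "Z m i \<in> borel_measurable M" if "i \<in> I" for m i
    using ind[of m] that by (auto simp: indep_vars_def)
  \<comment> \<open>The empty set is treated apart because \<open>infdist\<close> to it is 0 by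
    convention.\<close>
  define h where "h j C x = (if C = {} then 0 else max 0 (1 - real j * infdist x C))" for j :: nat and C :: "real set" and x
  have hc: "continuous_on UNIV (h j C)" for j C
    unfolding h_def by (cases "C = {}") (auto intro!: continuous_intros)
  then have [measurable]: "h j C \<in> borel_measurable borel" for j C
    by (intro borel_measurable_continuous_onI)
  have hb: "0 \<le> h j C x" "h j C x \<le> 1" for j C x by (auto simp: h_def infdist_nonneg)
  have hl: "(\<lambda>j. h j C x) \<longlonglongrightarrow> indicator C x" if "closed C" for C x
  proof (cases "x \<in> C")
    case True
    then have "h j C x = 1" for j by (auto simp: h_def)
    then show ?thesis using True by simp
  next
    case x: False
    show ?thesis
    proof (cases "C = {}")
      case False
      then have d: "infdist x C > 0" using x in_closed_iff_infdist_zero[OF that False, of x] infdist_nonneg[of x C] by (simp add: less_le)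
      obtain N :: nat where N: "1 < real N * infdist x C" using ex_less_of_nat_mult[OF d, of 1] by blast
      have "\<forall>\<^sub>F j in sequentially. h j C x = 0"
        using eventually_ge_at_top[of N]
      proof eventually_elim
        case (elim j)
        then have "real N * infdist x C \<le> real j * infdist x C" using d by (intro mult_right_mono) auto
        then show ?case using N by (simp add: h_def)
      qed
      then show ?thesis using x by (simp add: tendsto_eventually)
    qed (simp add: h_def)
  qed
  have prod_bd: "norm (\<Prod>i\<in>I. h j (A i) (y i)) \<le> 1" for j A y
    unfolding prod_norm[symmetric] using hb by (intro prod_le_1) auto
  have prod_lim: "(\<integral>\<omega>. (\<Prod>i\<in>I. h j (A i) (Z' i \<omega>)) \<partial>M) = (\<Prod>i\<in>I. \<integral>\<omega>. h j (A i) (Z' i \<omega>) \<partial>M)" for j A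
  proof -
    have conv: "AE \<omega> in M. \<forall>i\<in>I. (\<lambda>m. Z m i \<omega>) \<longlonglongrightarrow> Z' i \<omega>" by (intro AE_finite_allI I lim)
    have h1: "(\<lambda>m. h j C (a m)) \<longlonglongrightarrow> h j C b" if "a \<longlonglongrightarrow> b" for a b C
      using continuous_on_tendsto_compose[OF hc that] by simp
    have "(\<lambda>m. \<integral>\<omega>. (\<Prod>i\<in>I. h j (A i) (Z m i \<omega>)) \<partial>M) \<longlonglongrightarrow> (\<integral>\<omega>. (\<Prod>i\<in>I. h j (A i) (Z' i \<omega>)) \<partial>M)"
    proof (rule integral_dominated_convergence[where w = "\<lambda>_. 1"])
      show "AE \<omega> in M. (\<lambda>m. \<Prod>i\<in>I. h j (A i) (Z m i \<omega>)) \<longlonglongrightarrow> (\<Prod>i\<in>I. h j (A i) (Z' i \<omega>))"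
        using conv by eventually_elim (auto intro!: tendsto_prod h1)
    qed (use rv rvZ prod_bd in auto)
    moreover have "(\<integral>\<omega>. (\<Prod>i\<in>I. h j (A i) (Z m i \<omega>)) \<partial>M) = (\<Prod>i\<in>I. \<integral>\<omega>. h j (A i) (Z m i \<omega>) \<partial>M)" for m
    proof (rule indep_vars_lebesgue_integral[OF I])
      show "indep_vars (\<lambda>_. borel) (\<lambda>i \<omega>. h j (A i) (Z m i \<omega>)) I"
        using ind[of m] by (rule indep_vars_compose2) auto
      show "integrable M (\<lambda>\<omega>. h j (A i) (Z m i \<omega>))" if "i \<in> I" for i
        using rvZ[OF that] hb by (intro integrable_const_bound[of _ 1]) auto
    qed
    moreover have "(\<lambda>m. \<Prod>i\<in>I. \<integral>\<omega>. h j (A i) (Z m i \<omega>) \<partial>M) \<longlonglongrightarrow> (\<Prod>i\<in>I. \<integral>\<omega>. h j (A i) (Z' i \<omega>) \<partial>M)"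
    proof (rule tendsto_prod, rule integral_dominated_convergence[where w = "\<lambda>_. 1"])
      show "AE \<omega> in M. (\<lambda>m. h j (A i) (Z m i \<omega>)) \<longlonglongrightarrow> h j (A i) (Z' i \<omega>)" if "i \<in> I" for i
        using lim[OF that] by eventually_elim (rule h1)
    qed (use rv rvZ hb in auto)
    ultimately show ?thesis by (metis (no_types, lifting) LIMSEQ_unique ext)
  qed
  show ?thesis
  proof (subst indep_vars_finite[OF False I, where E = "\<lambda>_. Collect closed"])
    show "sets (borel :: real measure) = sigma_sets (space borel) (Collect closed)"
      by (subst borel_eq_closed) simp
    show "Int_stable (Collect closed :: real set set)" by (auto simp: Int_stable_def)
    show "\<forall>A\<in>I \<rightarrow> (Collect closed :: real set set). prob (\<Inter>j\<in>I. Z' j -` A j \<inter> space M) = (\<Prod>j\<in>I. prob (Z' j -` A j \<inter> space M))"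
    proof
      fix A :: "'i \<Rightarrow> real set" assume "A \<in> I \<rightarrow> Collect closed"
      then have cl: "closed (A i)" if "i \<in> I" for i using that by auto
      then have ev: "Z' i -` A i \<inter> space M \<in> events" if "i \<in> I" for i
        using rv[OF that] that by (intro measurable_sets[of _ _ borel]) auto
      have im: "(\<lambda>\<omega>. indicator (A i) (Z' i \<omega>) :: real) \<in> borel_measurable M" if "i \<in> I" for i
        using cl[OF that] by (intro measurable_compose[OF rv[OF that]] borel_measurable_indicator) auto
      have "(\<lambda>j. \<integral>\<omega>. (\<Prod>i\<in>I. h j (A i) (Z' i \<omega>)) \<partial>M) \<longlonglongrightarrow> (\<integral>\<omega>. (\<Prod>i\<in>I. indicator (A i) (Z' i \<omega>)) \<partial>M)"
      proof (rule integral_dominated_convergence[where w = "\<lambda>_. 1"])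
        show "AE \<omega> in M. (\<lambda>j. \<Prod>i\<in>I. h j (A i) (Z' i \<omega>)) \<longlonglongrightarrow> (\<Prod>i\<in>I. indicator (A i) (Z' i \<omega>))"
          by (intro AE_I2 tendsto_prod hl cl)
      qed (use rv prod_bd im in auto)
      moreover have "(\<lambda>j. \<Prod>i\<in>I. \<integral>\<omega>. h j (A i) (Z' i \<omega>) \<partial>M) \<longlonglongrightarrow> (\<Prod>i\<in>I. \<integral>\<omega>. indicator (A i) (Z' i \<omega>) \<partial>M)"
      proof (rule tendsto_prod, rule integral_dominated_convergence[where w = "\<lambda>_. 1"])
        show "AE \<omega> in M. (\<lambda>j. h j (A i) (Z' i \<omega>)) \<longlonglongrightarrow> indicator (A i) (Z' i \<omega>)" if "i \<in> I" for i
          using that by (intro AE_I2 hl cl)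
      qed (use rv hb im in auto)
      ultimately have eq: "(\<integral>\<omega>. (\<Prod>i\<in>I. indicator (A i) (Z' i \<omega>)) \<partial>M) = (\<Prod>i\<in>I. \<integral>\<omega>. indicator (A i) (Z' i \<omega>) \<partial>M :: real)"
        unfolding prod_lim by (rule LIMSEQ_unique)
      have "(\<integral>\<omega>. (\<Prod>i\<in>I. indicator (A i) (Z' i \<omega>)) \<partial>M) = (\<integral>\<omega>. indicator (\<Inter>j\<in>I. Z' j -` A j \<inter> space M) \<omega> \<partial>M :: real)"
      proof (intro Bochner_Integration.integral_cong refl)
        fix \<omega> assume "\<omega> \<in> space M"
        then show "(\<Prod>i\<in>I. indicator (A i) (Z' i \<omega>)) = (indicator (\<Inter>j\<in>I. Z' j -` A j \<inter> space M) \<omega> :: real)"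
          using I False by (auto simp: indicator_def prod_zero_iff)
      qed
      also have "\<dots> = prob (\<Inter>j\<in>I. Z' j -` A j \<inter> space M)"
        using False by (subst Bochner_Integration.integral_indicator, intro arg_cong[of _ _ prob]) auto
      finally have "prob (\<Inter>j\<in>I. Z' j -` A j \<inter> space M) = (\<integral>\<omega>. (\<Prod>i\<in>I. indicator (A i) (Z' i \<omega>)) \<partial>M)" by simp
      also have "\<dots> = (\<Prod>i\<in>I. \<integral>\<omega>. indicator (A i) (Z' i \<omega>) \<partial>M)" by (rule eq)
      also have "\<dots> = (\<Prod>j\<in>I. prob (Z' j -` A j \<inter> space M))"
      proof (rule prod.cong[OF refl])
        fix i assume i: "i \<in> I"
        have "(\<integral>\<omega>. indicator (A i) (Z' i \<omega>) \<partial>M) = (\<integral>\<omega>. indicator (Z' i -` A i \<inter> space M) \<omega> \<partial>M :: real)"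
          by (intro Bochner_Integration.integral_cong refl) (auto simp: indicator_def)
        then show "(\<integral>\<omega>. indicator (A i) (Z' i \<omega>) \<partial>M) = prob (Z' i -` A i \<inter> space M)"
          using ev[OF i] by simp
      qed
      finally show "prob (\<Inter>j\<in>I. Z' j -` A j \<inter> space M) = (\<Prod>j\<in>I. prob (Z' j -` A j \<inter> space M))" .
    qed
  qed (use rv in auto)
qed

text \<open>\<open>infdiv\<close> supplies one law for each time without relating different times.
  The semigroup property follows because the characteristic functions multiply and determine the
  laws.\<close>

lemma semigroup_of_infdiv:
  assumes "infdiv \<Psi>"
  obtains \<mu> where "convolution_semigroup \<mu>"
    "\<And>t z. 0 \<le> t \<Longrightarrow> 0 \<le> Re z \<Longrightarrow> integrable (\<mu> t) (\<lambda>x. exp (z * complex_of_real x))"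
    "\<And>t z. 0 \<le> t \<Longrightarrow> 0 \<le> Re z \<Longrightarrow> (LINT x|\<mu> t. exp (z * complex_of_real x)) = exp (of_real t * \<Psi> z)"
proof -
  obtain \<mu> where rd: "\<And>t. 0 \<le> t \<Longrightarrow> real_distribution (\<mu> t)"
    and int: "\<And>t z. 0 \<le> t \<Longrightarrow> 0 \<le> Re z \<Longrightarrow> integrable (\<mu> t) (\<lambda>x. exp (z * complex_of_real x))"
    and exp: "\<And>t z. 0 \<le> t \<Longrightarrow> 0 \<le> Re z \<Longrightarrow> (LINT x|\<mu> t. exp (z * complex_of_real x)) = exp (of_real t * \<Psi> z)"
    using assms unfolding infdiv_def by metis
  have "convolution (\<mu> s) (\<mu> t) = \<mu> (s + t)" if st: "0 \<le> s" "0 \<le> t" for s t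
  proof (rule Levy_uniqueness)
    show "real_distribution (convolution (\<mu> s) (\<mu> t))"
      by (rule exp_integral_convolution(1)[OF rd[OF st(1)] rd[OF st(2)] int[OF st(1), of 0] int[OF st(2), of 0]]) auto
    show "real_distribution (\<mu> (s + t))" using st by (intro rd) simp
    have c: "char M u = (LINT x|M. exp ((\<i> * complex_of_real u) * complex_of_real x))" for M u
      unfolding char_def by (simp add: mult_ac)
    show "char (convolution (\<mu> s) (\<mu> t)) = char (\<mu> (s + t))"
      unfolding c
      by (rule ext, subst exp_integral_convolution(3)[OF rd[OF st(1)] rd[OF st(2)] int[OF st(1)] int[OF st(2)]])
         (use st in \<open>auto simp: exp ring_distribs exp_add\<close>)
  qed
  then have "convolution_semigroup \<mu>" by (intro convolution_semigroup.intro rd)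
  then show ?thesis using int exp by (rule that)
qed

text \<open>Take \<open>\<rho>\<close> linear in \<open>n\<close> with slope
  \<open>a = 2 * ln 2 / \<epsilon>\<close>: then \<open>exp (- \<rho> n * \<epsilon>)\<close> is at
  most \<open>(1 / 4) ^ n\<close>, whereas \<open>\<psi> (\<rho> n) / 2 ^ n\<close> stays bounded
  above, since a quadratic in \<open>n\<close> loses against \<open>2 ^ n\<close>. The summand 1 in
  \<open>\<rho>\<close> keeps it in the range of \<open>growth\<close>.\<close>

lemma quadratic_growth_exp_bound:
  fixes \<psi> :: "real \<Rightarrow> real"
  assumes growth: "\<exists>C\<ge>0. \<forall>\<theta>\<ge>1. \<psi> \<theta> \<le> C * \<theta>\<^sup>2" and \<epsilon>: "0 < \<epsilon>"
  shows "\<exists>K \<rho>. \<forall>n. 1 \<le> \<rho> n \<and> exp (1 / 2 ^ n * \<psi> (\<rho> n) - \<rho> n * \<epsilon>) \<le> K * (1 / 4) ^ n"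
proof -
  obtain C where C: "C \<ge> 0" "\<And>\<theta>. \<theta> \<ge> 1 \<Longrightarrow> \<psi> \<theta> \<le> C * \<theta>\<^sup>2" using growth by blast
  define a where "a = 2 * ln 2 / \<epsilon>"
  have a: "0 \<le> a" using \<epsilon> by (simp add: a_def)
  define K where "K = 4 * C * (a + 1)\<^sup>2"
  have sq: "(real (Suc n))\<^sup>2 \<le> 4 * 2 ^ n" for n
  proof (induction n)
    case (Suc n)
    show ?case
    proof (cases "n \<le> 2")
      case True
      then have "n = 0 \<or> n = 1 \<or> n = 2" by auto
      then show ?thesis by (auto simp: power2_eq_square)
    next
      case False
      then have "3 * 3 \<le> real n * real n" by (intro mult_mono) auto
      then show ?thesis using Suc by (simp add: power2_eq_square algebra_simps)
    qed
  qed simp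
  define \<rho> where "\<rho> n = a * real n + 1" for n
  show ?thesis
  proof (intro exI[of _ "exp K"] exI[of _ \<rho>] allI conjI)
    fix n
    have \<rho>: "\<rho> n \<ge> 1" using a by (simp add: \<rho>_def)
    have t1: "\<rho> n \<le> (a + 1) * real (Suc n)" using a by (simp add: \<rho>_def algebra_simps)
    have "1 / 2 ^ n * \<psi> (\<rho> n) \<le> 1 / 2 ^ n * (C * (\<rho> n)\<^sup>2)" using C(2)[OF \<rho>] by (intro mult_left_mono) auto
    also have "\<dots> \<le> 1 / 2 ^ n * (C * ((a + 1) * real (Suc n))\<^sup>2)"
      using t1 \<rho> C(1) by (intro mult_left_mono power_mono) auto
    also have "\<dots> = C * (a + 1)\<^sup>2 * ((real (Suc n))\<^sup>2 / 2 ^ n)" by (simp add: power_mult_distrib)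
    also have "\<dots> \<le> C * (a + 1)\<^sup>2 * 4"
      using sq[of n] C(1) by (intro mult_left_mono) (auto simp: divide_le_eq)
    finally have A: "1 / 2 ^ n * \<psi> (\<rho> n) \<le> K" by (simp add: K_def algebra_simps)
    have B: "real n * (2 * ln 2) \<le> \<rho> n * \<epsilon>" using \<epsilon> by (simp add: \<rho>_def a_def field_simps)
    show "1 \<le> \<rho> n" by (rule \<rho>)
    have "exp (1 / 2 ^ n * \<psi> (\<rho> n) - \<rho> n * \<epsilon>) \<le> exp (K - real n * (2 * ln 2))" using A B by simp
    also have "\<dots> = exp K * (1 / 4) ^ n"
    proof -
      have "exp (2 * ln 2) = (4::real)" by (simp add: exp_double)
      then show ?thesis by (simp add: exp_diff exp_of_nat_mult power_divide)
    qed
    finally show "exp (1 / 2 ^ n * \<psi> (\<rho> n) - \<rho> n * \<epsilon>) \<le> exp K * (1 / 4) ^ n" .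
  qed
qed

text \<open>The assumption \<open>growth\<close> is the trace of the absence of positive jumps,
  which would make \<open>\<psi>\<close> grow exponentially.\<close>

locale spectrally_negative_semigroup = convolution_semigroup \<mu> for \<mu> +
  fixes \<Psi> :: "complex \<Rightarrow> complex" and \<psi> :: "real \<Rightarrow> real"
  assumes integrable_cexp: "\<And>t z. 0 \<le> t \<Longrightarrow> 0 \<le> Re z \<Longrightarrow> integrable (\<mu> t) (\<lambda>x. exp (z * complex_of_real x))"
    and integral_cexp: "\<And>t z. 0 \<le> t \<Longrightarrow> 0 \<le> Re z \<Longrightarrow> (LINT x|\<mu> t. exp (z * complex_of_real x)) = exp (of_real t * \<Psi> z)"
    and \<Psi>_of_real: "\<And>\<theta>. 0 \<le> \<theta> \<Longrightarrow> \<Psi> (of_real \<theta>) = of_real (\<psi> \<theta>)"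
    and growth: "\<exists>C\<ge>0. \<forall>\<theta>\<ge>1. \<psi> \<theta> \<le> C * \<theta>\<^sup>2"
begin

lemma integrable_exp:
  assumes "0 \<le> t" "0 \<le> \<theta>" shows "integrable (\<mu> t) (\<lambda>x. exp (\<theta> * x))"
  using exp_integral_of_real(1)[of "\<mu> t" \<theta>] integrable_cexp[of t "of_real \<theta>"] assms by simp

lemma integral_exp:
  assumes "0 \<le> t" "0 \<le> \<theta>" shows "(LINT x|\<mu> t. exp (\<theta> * x)) = exp (t * \<psi> \<theta>)"
proof -
  have "complex_of_real (LINT x|\<mu> t. exp (\<theta> * x)) = complex_of_real (exp (t * \<psi> \<theta>))"
    using exp_integral_of_real(2)[of "\<mu> t" \<theta>] integrable_cexp[of t "of_real \<theta>"] integral_cexp[of t "of_real \<theta>"] assms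
    by (simp add: \<Psi>_of_real exp_of_real[symmetric] del: exp_of_real)
  then show ?thesis by (simp only: of_real_eq_iff)
qed

lemma char_\<mu>:
  assumes "0 \<le> t" shows "char (\<mu> t) u = exp (of_real t * \<Psi> (\<i> * of_real u))"
  using integral_cexp[OF assms, of "\<i> * of_real u"] unfolding char_def by (simp add: mult_ac)

lemma right_tail_le:
  assumes "0 \<le> h" "0 \<le> \<theta>"
  shows "measure (\<mu> h) {x. \<epsilon> < x} \<le> exp (h * \<psi> \<theta> - \<theta> * \<epsilon>)"
proof -
  interpret real_distribution "\<mu> h" using assms by (intro real_distribution)
  have "measure (\<mu> h) {x. \<epsilon> < x} = (LINT x|\<mu> h. indicator {x. \<epsilon> < x} x)" by simp
  also have "\<dots> \<le> (LINT x|\<mu> h. exp (\<theta> * x) * exp (- (\<theta> * \<epsilon>)))"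
  proof (rule integral_mono)
    show "indicator {x. \<epsilon> < x} x \<le> exp (\<theta> * x) * exp (- (\<theta> * \<epsilon>))" for x
      using assms by (auto simp: indicator_def mult_exp_exp mult_left_mono)
    show "integrable (\<mu> h) (indicator {x. \<epsilon> < x} :: real \<Rightarrow> real)" 
      by (rule integrable_const_bound[of _ 1]) auto
  qed (use integrable_exp assms in auto)
  also have "\<dots> = exp (h * \<psi> \<theta>) * exp (- (\<theta> * \<epsilon>))" using integral_exp assms by simp
  finally show ?thesis by (simp add: mult_exp_exp)
qed

lemma integral_exp_minus_one_sq:
  assumes "0 \<le> h"
  shows "integrable (\<mu> h) (\<lambda>x. (exp x - 1)\<^sup>2)" "(LINT x|\<mu> h. (exp x - 1)\<^sup>2) = exp (h * \<psi> 2) - 2 * exp (h * \<psi> 1) + 1"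
proof -
  interpret real_distribution "\<mu> h" using assms by (intro real_distribution)
  have e: "(exp x - 1)\<^sup>2 = exp (2 * x) - 2 * exp (1 * x) + (1::real)" for x
    by (simp add: power2_eq_square algebra_simps mult_exp_exp)
  show "integrable (\<mu> h) (\<lambda>x. (exp x - 1)\<^sup>2)" 
    unfolding e using integrable_exp[OF assms, of 1] integrable_exp[OF assms, of 2] by simp
  show "(LINT x|\<mu> h. (exp x - 1)\<^sup>2) = exp (h * \<psi> 2) - 2 * exp (h * \<psi> 1) + 1" 
    unfolding e using integrable_exp[OF assms, of 1] integrable_exp[OF assms, of 2]
      integral_exp[OF assms, of 1] integral_exp[OF assms, of 2] prob_space by simp
qed

text \<open>Chebyshev's inequality for \<open>(exp x - 1)\<^sup>2\<close>: its mean
  \<open>exp (h * \<psi> 2) - 2 * exp (h * \<psi> 1) + 1\<close> is of order \<open>h\<close>, and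
  \<open>\<delta> < \<bar>x\<bar>\<close> with \<open>\<delta> \<le> 1\<close> forces
  \<open>\<delta> / 2 \<le> \<bar>exp x - 1\<bar>\<close>.\<close>

lemma two_sided_tail_le:
  "\<exists>C\<ge>0. \<forall>h \<delta>. 0 \<le> h \<and> h \<le> 1 \<and> 0 < \<delta> \<and> \<delta> \<le> 1 \<longrightarrow> measure (\<mu> h) {x. \<delta> < \<bar>x\<bar>} \<le> C * h / \<delta>\<^sup>2"
proof -
  define K where "K a = \<bar>a\<bar> * exp \<bar>a\<bar>" for a :: real
  have K0: "K a \<ge> 0" for a by (simp add: K_def)
  have ex: "\<bar>exp (h * a) - 1\<bar> \<le> h * K a" if "0 \<le> h" "h \<le> 1" for h a :: real
  proof -
    have hb: "\<bar>h * a\<bar> \<le> \<bar>a\<bar>" using that by (simp add: abs_mult mult_left_le_one_le)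
    have "\<bar>exp (h * a) - 1\<bar> \<le> \<bar>h * a\<bar> * exp \<bar>h * a\<bar>"
    proof (cases "h * a \<ge> 0")
      case True
      have "1 - h * a \<le> exp (- (h * a))" using exp_ge_add_one_self[of "- (h * a)"] by simp
      then have "(1 - h * a) * exp (h * a) \<le> exp (- (h * a)) * exp (h * a)" by (rule mult_right_mono) simp
      then show ?thesis using True by (simp add: mult_exp_exp algebra_simps)
    next
      case False
      then have "exp (h * a) \<le> 1" by simp
      then have "\<bar>exp (h * a) - 1\<bar> \<le> \<bar>h * a\<bar> * 1" using exp_ge_add_one_self[of "h * a"] False by linarith
      also have "\<dots> \<le> \<bar>h * a\<bar> * exp \<bar>h * a\<bar>" by (intro mult_left_mono) auto
      finally show ?thesis .
    qed
    also have "\<dots> \<le> \<bar>h * a\<bar> * exp \<bar>a\<bar>" using hb by (intro mult_left_mono) auto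
    finally show ?thesis using that by (simp add: K_def abs_mult)
  qed
  show ?thesis
  proof (intro exI[of _ "4 * (K (\<psi> 2) + 2 * K (\<psi> 1))"] conjI allI impI)
    fix h \<delta> :: real assume hd: "0 \<le> h \<and> h \<le> 1 \<and> 0 < \<delta> \<and> \<delta> \<le> 1"
    then have h: "0 \<le> h" "h \<le> 1" and \<delta>: "0 < \<delta>" "\<delta> \<le> 1" by auto
    interpret real_distribution "\<mu> h" using h by (intro real_distribution)
    have "measure (\<mu> h) {x. \<delta> < \<bar>x\<bar>} = (LINT x|\<mu> h. indicator {x. \<delta> < \<bar>x\<bar>} x)" by simp
    also have "\<dots> \<le> (LINT x|\<mu> h. 4 / \<delta>\<^sup>2 * (exp x - 1)\<^sup>2)"
    proof (rule integral_mono)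
      fix x :: real
      show "indicator {x. \<delta> < \<bar>x\<bar>} x \<le> 4 / \<delta>\<^sup>2 * (exp x - 1)\<^sup>2"
      proof (cases "\<delta> < \<bar>x\<bar>")
        case True
        have "\<delta> / 2 \<le> \<bar>exp x - 1\<bar>"
        proof (cases "x \<ge> 0")
          case True
          then show ?thesis using \<open>\<delta> < \<bar>x\<bar>\<close> \<delta> exp_ge_add_one_self[of x] by linarith
        next
          case False
          have "exp x \<le> exp (- \<delta>)" using False \<open>\<delta> < \<bar>x\<bar>\<close> by simp
          also have "\<dots> \<le> 1 / (1 + \<delta>)"
            using exp_ge_add_one_self[of \<delta>] \<delta> by (simp add: exp_minus field_simps)
          also have "\<dots> \<le> 1 - \<delta> / 2"
          proof -
            have "\<delta> * \<delta> \<le> \<delta>" using \<delta> by (simp add: mult_left_le)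
            then have "1 \<le> (1 - \<delta> / 2) * (1 + \<delta>)" by (simp add: algebra_simps)
            then show ?thesis using \<delta> by (subst pos_divide_le_eq) auto
          qed
          finally show ?thesis using \<delta> by linarith
        qed
        then have "(\<delta> / 2)\<^sup>2 \<le> \<bar>exp x - 1\<bar>\<^sup>2" using \<delta> by (intro power_mono) auto
        then show ?thesis using True \<delta> by (simp add: field_simps power_divide)
      qed simp
      show "integrable (\<mu> h) (indicator {x. \<delta> < \<bar>x\<bar>} :: real \<Rightarrow> real)"
        by (rule integrable_const_bound[of _ 1]) auto
    qed (use integral_exp_minus_one_sq h in auto)
    also have "\<dots> = 4 / \<delta>\<^sup>2 * ((exp (h * \<psi> 2) - 1) - 2 * (exp (h * \<psi> 1) - 1))"
      using integral_exp_minus_one_sq[OF h(1)] by simp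
    also have "\<dots> \<le> 4 / \<delta>\<^sup>2 * (h * K (\<psi> 2) + 2 * (h * K (\<psi> 1)))"
      using ex[OF h, of "\<psi> 2"] ex[OF h, of "\<psi> 1"] by (intro mult_left_mono) auto
    finally show "measure (\<mu> h) {x. \<delta> < \<bar>x\<bar>} \<le> 4 * (K (\<psi> 2) + 2 * K (\<psi> 1)) * h / \<delta>\<^sup>2"
      by (simp add: algebra_simps add_divide_distrib)
  qed (use K0[of "\<psi> 2"] K0[of "\<psi> 1"] in simp)
qed

text \<open>The bound \<open>K * (1 / 4) ^ n\<close> of \<open>quadratic_growth_exp_bound\<close>
  survives multiplication by the number of cells per unit of time.\<close>

lemma right_tail_summable:
  assumes \<epsilon>: "0 < \<epsilon>"
  shows "summable (\<lambda>n. 2 ^ n * measure (\<mu> (1 / 2 ^ n)) {x. \<epsilon> < x})"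
proof -
  obtain K \<rho> where K: "\<And>n. 1 \<le> \<rho> n" "\<And>n. exp (1 / 2 ^ n * \<psi> (\<rho> n) - \<rho> n * \<epsilon>) \<le> K * (1 / 4) ^ n"
    using quadratic_growth_exp_bound[OF growth \<epsilon>] by blast
  have le: "2 ^ n * measure (\<mu> (1 / 2 ^ n)) {x. \<epsilon> < x} \<le> K * (1 / 2) ^ n" for n
  proof -
    have "measure (\<mu> (1 / 2 ^ n)) {x. \<epsilon> < x} \<le> exp (1 / 2 ^ n * \<psi> (\<rho> n) - \<rho> n * \<epsilon>)"
      using K(1)[of n] by (intro right_tail_le) auto
    also have "\<dots> \<le> K * (1 / 4) ^ n" by (rule K)
    finally have "2 ^ n * measure (\<mu> (1 / 2 ^ n)) {x. \<epsilon> < x} \<le> 2 ^ n * (K * (1 / 4) ^ n)"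
      by (intro mult_left_mono) auto
    also have "\<dots> = K * (2 * (1 / 4)) ^ n" by (simp only: power_mult_distrib mult_ac)
    finally show ?thesis by simp
  qed
  show ?thesis
    by (rule summable_comparison_test'[of "\<lambda>n. K * (1 / 2) ^ n" 0])
       (use le in \<open>auto intro!: summable_mult summable_geometric\<close>)
qed

end

section \<open>The process on dyadic times and its regularization\<close>

locale dyadic_levy = spectrally_negative_semigroup \<mu> \<Psi> \<psi> + prob_space L
  for \<mu> \<Psi> \<psi> and L :: "(real \<Rightarrow> real) measure" +
  assumes coordinate_measurable: "\<And>t. t \<in> dyadics \<Longrightarrow> (\<lambda>\<omega>. \<omega> t) \<in> borel_measurable L"
    and start_0: "AE \<omega> in L. \<omega> 0 = 0"
    and indep_increments: "\<And>n. indep_vars (\<lambda>_. borel) (\<lambda>k \<omega>. \<omega> (real (Suc k) / 2 ^ n) - \<omega> (real k / 2 ^ n)) UNIV"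
    and increment_law: "\<And>n k. distr L borel (\<lambda>\<omega>. \<omega> (real (Suc k) / 2 ^ n) - \<omega> (real k / 2 ^ n)) = \<mu> (1 / 2 ^ n)"
begin

lemma dyadic_rats_subset: "dyadic_rats \<subseteq> dyadics"
proof
  fix t assume "t \<in> dyadic_rats"
  then obtain n k where "t = real k / 2 ^ n" by (auto simp: dyadic_rats_def)
  then show "t \<in> dyadics" by (auto simp: dyadics_def intro!: exI[of _ n])
qed

definition incr :: "nat \<Rightarrow> nat \<Rightarrow> (real \<Rightarrow> real) \<Rightarrow> real" where
  "incr n k \<omega> = \<omega> (real (Suc k) / 2 ^ n) - \<omega> (real k / 2 ^ n)"

lemma grid_measurable [measurable]: "(\<lambda>\<omega>. \<omega> (real k / 2 ^ n)) \<in> borel_measurable L"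
  by (rule coordinate_measurable, rule subsetD[OF dyadic_rats_subset]) (auto simp: dyadic_rats_def)

lemma incr_measurable [measurable]: "incr n k \<in> borel_measurable L"
  unfolding incr_def by (intro borel_measurable_diff grid_measurable)

lemma prob_incr:
  assumes "{x. P x} \<in> sets borel"
  shows "prob {\<omega>\<in>space L. P (incr n k \<omega>)} = measure (\<mu> (1 / 2 ^ n)) {x. P x}"
proof -
  have "measure (distr L borel (incr n k)) {x. P x} = prob (incr n k -` {x. P x} \<inter> space L)"
    using assms by (intro measure_distr) auto
  also have "incr n k -` {x. P x} \<inter> space L = {\<omega>\<in>space L. P (incr n k \<omega>)}" by auto
  finally show ?thesis using increment_law[of k n] by (simp add: incr_def[abs_def])
qed

text \<open>By independence two adjacent increments both exceed \<open>\<delta> n\<close> with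
  probability of order \<open>(1 / 4) ^ n / \<delta> n ^ 4\<close>. Over \<open>2 ^ n\<close> cells
  this is summable for \<open>\<delta> n = q ^ n\<close> as soon as \<open>q ^ 4 > 1 / 2\<close>,
  and chaining wants \<open>q < 1\<close>; the choice \<open>q = 7 / 8\<close> gives the ratio
  \<open>2048 / 2401\<close>.\<close>

lemma AE_oscillation_bound: "AE \<omega> in L. oscillation_bound (\<lambda>n. (7 / 8) ^ n) \<omega>"
proof -
  obtain C where C: "C \<ge> 0" "\<And>h \<delta>. 0 \<le> h \<Longrightarrow> h \<le> 1 \<Longrightarrow> 0 < \<delta> \<Longrightarrow> \<delta> \<le> 1 \<Longrightarrow> measure (\<mu> h) {x. \<delta> < \<bar>x\<bar>} \<le> C * h / \<delta>\<^sup>2"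
    using two_sided_tail_le by blast
  define \<delta> where "\<delta> n = (7 / 8 :: real) ^ n" for n
  have \<delta>: "0 < \<delta> n" "\<delta> n \<le> 1" for n by (auto simp: \<delta>_def power_le_one)
  define E where "E n k \<omega> \<longleftrightarrow> \<delta> n < \<bar>incr n k \<omega>\<bar> \<and> \<delta> n < \<bar>incr n (Suc k) \<omega>\<bar>" for n k \<omega>
  define p where "p n = (C * (1 / 2 ^ n) / (\<delta> n)\<^sup>2)\<^sup>2" for n
  have "2 ^ n * p n = C\<^sup>2 * (2048 / 2401) ^ n" for n
  proof -
    have "2 ^ n * p n = C\<^sup>2 * (2 ^ n * ((1 / 2) ^ n * (1 / 2) ^ n) / ((7/8)^n * (7/8)^n * ((7/8)^n * (7/8)^n)))"
      by (simp add: p_def \<delta>_def power2_eq_square power_divide mult_ac)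
    also have "\<dots> = C\<^sup>2 * (2048 / 2401) ^ n"
      by (simp only: power_mult_distrib[symmetric] power_divide[symmetric]) simp
    finally show ?thesis .
  qed
  then have sum: "summable (\<lambda>n. 2 ^ n * p n)" by (auto intro!: summable_mult summable_geometric)
  have le: "prob {\<omega>\<in>space L. E n k \<omega>} \<le> p n" for n k
  proof -
    have tail: "prob {\<omega>\<in>space L. \<delta> n < \<bar>incr n k \<omega>\<bar>} \<le> C * (1 / 2 ^ n) / (\<delta> n)\<^sup>2" for k
      by (subst prob_incr) (use C(2)[of "1 / 2 ^ n" "\<delta> n"] \<delta>[of n] in auto)
    have ind: "indep_vars (\<lambda>_. borel) (incr n) {k, Suc k}"
      using indep_increments[of n] unfolding incr_def[abs_def] by (rule indep_vars_subset) simp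
    have "prob (\<Inter>i\<in>{k, Suc k}. incr n i -` {x. \<delta> n < \<bar>x\<bar>} \<inter> space L) =
        (\<Prod>i\<in>{k, Suc k}. prob (incr n i -` {x. \<delta> n < \<bar>x\<bar>} \<inter> space L))"
      by (rule indep_varsD_finite[OF ind]) auto
    moreover have "(\<Inter>i\<in>{k, Suc k}. incr n i -` {x. \<delta> n < \<bar>x\<bar>} \<inter> space L) = {\<omega>\<in>space L. E n k \<omega>}"
      by (auto simp: E_def)
    moreover have "incr n i -` {x. \<delta> n < \<bar>x\<bar>} \<inter> space L = {\<omega>\<in>space L. \<delta> n < \<bar>incr n i \<omega>\<bar>}" for i by auto
    ultimately have "prob {\<omega>\<in>space L. E n k \<omega>} =
        prob {\<omega>\<in>space L. \<delta> n < \<bar>incr n k \<omega>\<bar>} * prob {\<omega>\<in>space L. \<delta> n < \<bar>incr n (Suc k) \<omega>\<bar>}" by simp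
    also have "\<dots> \<le> p n" unfolding p_def power2_eq_square[of "C * (1 / 2 ^ n) / (\<delta> n)\<^sup>2"]
      using C(1) by (intro mult_mono tail) auto
    finally show ?thesis .
  qed
  have "AE \<omega> in L. \<forall>\<^sub>F n in sequentially. \<forall>k<T * 2 ^ n. \<not> E n k \<omega>" for T :: nat
    by (rule AE_eventually_grid[OF _ le sum]) (simp add: E_def)
  then have "AE \<omega> in L. \<forall>T::nat. \<forall>\<^sub>F n in sequentially. \<forall>k<T * 2 ^ n. \<not> E n k \<omega>"
    unfolding AE_all_countable ..
  then show ?thesis
  proof eventually_elim
    case (elim \<omega>)
    show ?case unfolding oscillation_bound_def
    proof
      fix T
      obtain n0 where n0: "\<And>n k. n \<ge> n0 \<Longrightarrow> k < T * 2 ^ n \<Longrightarrow> \<not> E n k \<omega>"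
        using elim[rule_format, of T] by (auto simp: eventually_sequentially)
      show "\<exists>n0. \<forall>n\<ge>n0. \<forall>k. k + 2 \<le> T * 2 ^ n \<longrightarrow>
        min \<bar>\<omega> (real (k + 1) / 2 ^ n) - \<omega> (real k / 2 ^ n)\<bar> \<bar>\<omega> (real (k + 2) / 2 ^ n) - \<omega> (real (k + 1) / 2 ^ n)\<bar> \<le> (7 / 8) ^ n"
      proof (intro exI[of _ n0] allI impI)
        fix n k assume "n0 \<le> n" "k + 2 \<le> T * 2 ^ n"
        then have "\<not> E n k \<omega>" by (intro n0) auto
        then show "min \<bar>\<omega> (real (k + 1) / 2 ^ n) - \<omega> (real k / 2 ^ n)\<bar> \<bar>\<omega> (real (k + 2) / 2 ^ n) - \<omega> (real (k + 1) / 2 ^ n)\<bar> \<le> (7 / 8) ^ n"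
          unfolding E_def incr_def \<delta>_def min_le_iff_disj by (simp add: not_less add.commute numeral_2_eq_2)
      qed
    qed
  qed
qed

text \<open>The thresholds \<open>1 / real (Suc m)\<close> and the integer horizons form a countable
  family, which lets the quantifiers move inside the almost sure statement.\<close>

lemma AE_increments_small:
  "AE \<omega> in L. \<forall>(T::nat) \<epsilon>. \<epsilon> > 0 \<longrightarrow> (\<forall>\<^sub>F n in sequentially. \<forall>k<T * 2 ^ n. \<omega> (real (Suc k) / 2 ^ n) - \<omega> (real k / 2 ^ n) \<le> \<epsilon>)"
proof -
  have "AE \<omega> in L. \<forall>\<^sub>F n in sequentially. \<forall>k<T * 2 ^ n. \<not> 1 / real (Suc m) < incr n k \<omega>" for T m :: nat
  proof (rule AE_eventually_grid)
    show "summable (\<lambda>n. 2 ^ n * measure (\<mu> (1 / 2 ^ n)) {x. 1 / real (Suc m) < x})"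
      by (rule right_tail_summable) simp
    show "prob {\<omega>\<in>space L. 1 / real (Suc m) < incr n k \<omega>} \<le> measure (\<mu> (1 / 2 ^ n)) {x. 1 / real (Suc m) < x}" for n k
      by (subst prob_incr) auto
  qed measurable
  then have "AE \<omega> in L. \<forall>(T::nat) m. \<forall>\<^sub>F n in sequentially. \<forall>k<T * 2 ^ n. \<not> 1 / real (Suc m) < incr n k \<omega>"
    unfolding AE_all_countable by blast
  then show ?thesis
  proof eventually_elim
    case (elim \<omega>)
    show ?case
    proof (intro allI impI)
      fix T :: nat and \<epsilon> :: real assume "\<epsilon> > 0"
      then obtain m where m: "1 / real (Suc m) < \<epsilon>" using nat_approx_posE by blast
      from elim have "\<forall>\<^sub>F n in sequentially. \<forall>k<T * 2 ^ n. \<not> 1 / real (Suc m) < incr n k \<omega>" by blast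
      then show "\<forall>\<^sub>F n in sequentially. \<forall>k<T * 2 ^ n. \<omega> (real (Suc k) / 2 ^ n) - \<omega> (real k / 2 ^ n) \<le> \<epsilon>"
      proof eventually_elim
        case (elim n)
        then show ?case using m unfolding incr_def by force
      qed
    qed
  qed
qed

definition X :: "real \<Rightarrow> (real \<Rightarrow> real) \<Rightarrow> real" where
  "X t \<omega> = regularize \<omega> t"

definition idx :: "nat \<Rightarrow> real \<Rightarrow> nat" where
  "idx n t = nat \<lfloor>t * 2 ^ n\<rfloor> + 1"

lemma right_approx_idx: "right_approx n t = real (idx n t) / 2 ^ n"
  by (simp add: right_approx_def idx_def)

lemma idx_mono: "s \<le> t \<Longrightarrow> idx n s \<le> idx n t"
  unfolding idx_def by (intro add_right_mono nat_mono floor_mono mult_right_mono) auto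

lemma X_measurable: "X t \<in> borel_measurable L"
  unfolding X_def[abs_def] regularize_def right_approx_idx by measurable

lemma summable_oscillation_bound: "summable (\<lambda>n. (7 / 8 :: real) ^ n)" by (rule summable_geometric) simp

lemma AE_X_limit: "AE \<omega> in L. \<forall>t\<ge>0. (\<lambda>n. \<omega> (right_approx n t)) \<longlonglongrightarrow> X t \<omega>"
  using AE_oscillation_bound
  by eventually_elim (auto simp: X_def intro!: regularize_right(1)[OF _ _ summable_oscillation_bound])

lemma AE_cadlag: "AE \<omega> in L. cadlag (\<lambda>t. X t \<omega>)"
  using AE_oscillation_bound
proof eventually_elim
  case (elim \<omega>)
  show ?case unfolding cadlag_def X_def
    using regularize_right_continuous[OF elim _ summable_oscillation_bound] regularize_left_limit[OF elim _ summable_oscillation_bound] by auto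
qed

lemma AE_no_positive_jumps: "AE \<omega> in L. no_positive_jumps (\<lambda>t. X t \<omega>)"
  using AE_oscillation_bound AE_increments_small
proof eventually_elim
  case (elim \<omega>)
  show ?case unfolding no_positive_jumps_def X_def
    using regularize_jump_le_0[OF elim(1) _ summable_oscillation_bound] elim(2) by auto
qed

lemma block_sum: "k \<le> l \<Longrightarrow> \<omega> (real l / 2 ^ n) - \<omega> (real k / 2 ^ n) = (\<Sum>i\<in>{k..<l}. incr n i \<omega>)"
  unfolding incr_def by (rule sum_Suc_diff'[symmetric])

lemma char_block:
  assumes "k \<le> l"
  shows "char (distr L borel (\<lambda>\<omega>. \<omega> (real l / 2 ^ n) - \<omega> (real k / 2 ^ n))) u =
    exp (of_real ((real l - real k) / 2 ^ n) * \<Psi> (\<i> * of_real u))"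
proof -
  have "indep_vars (\<lambda>_. borel) (incr n) {k..<l}"
    using indep_increments[of n] unfolding incr_def[abs_def] by (rule indep_vars_subset) simp
  then have "char (distr L borel (\<lambda>\<omega>. \<Sum>i\<in>{k..<l}. incr n i \<omega>)) u = (\<Prod>i\<in>{k..<l}. char (distr L borel (incr n i)) u)"
    by (rule char_distr_sum)
  also have "\<dots> = (\<Prod>i\<in>{k..<l}. exp (of_real (1 / 2 ^ n) * \<Psi> (\<i> * of_real u)))"
    using increment_law[of _ n] by (simp add: incr_def[abs_def] char_\<mu>)
  also have "\<dots> = exp (of_real ((real l - real k) / 2 ^ n) * \<Psi> (\<i> * of_real u))"
    using assms by (simp add: exp_of_nat_mult[symmetric] of_nat_diff)
  finally show ?thesis by (simp add: block_sum[OF assms])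
qed

lemma char_limit:
  assumes "AE \<omega> in L. (\<lambda>n. Z n \<omega>) \<longlonglongrightarrow> Z' \<omega>"
    and [measurable]: "\<And>n. Z n \<in> borel_measurable L" "Z' \<in> borel_measurable L"
  shows "(\<lambda>n. char (distr L borel (Z n)) u) \<longlonglongrightarrow> char (distr L borel Z') u"
proof -
  have c: "char (distr L borel Y) u = (LINT \<omega>|L. iexp (u * Y \<omega>))" if "Y \<in> borel_measurable L" for Y
    unfolding char_def using that by (subst integral_distr) auto
  show ?thesis unfolding c[OF assms(2)] c[OF assms(3)]
  proof (rule integral_dominated_convergence[where w = "\<lambda>_. 1"])
    show "AE \<omega> in L. (\<lambda>n. iexp (u * Z n \<omega>)) \<longlonglongrightarrow> iexp (u * Z' \<omega>)"
      using assms(1) by eventually_elim (intro tendsto_intros)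
  qed auto
qed

text \<open>The characteristic function of a grid increment is the exponential of its duration times
  the exponent. Almost sure convergence of the increments and convergence of the durations carry
  this over to \<open>X\<close>.\<close>

lemma distr_X_increment:
  assumes "0 \<le> s" "s \<le> t"
  shows "distr L borel (\<lambda>\<omega>. X t \<omega> - X s \<omega>) = \<mu> (t - s)"
proof (rule Levy_uniqueness)
  show "real_distribution (\<mu> (t - s))" using assms by (intro real_distribution) simp
  show "real_distribution (distr L borel (\<lambda>\<omega>. X t \<omega> - X s \<omega>))"
    using X_measurable by (intro real_distribution_distr borel_measurable_diff)
  show "char (distr L borel (\<lambda>\<omega>. X t \<omega> - X s \<omega>)) = char (\<mu> (t - s))"
  proof
    fix u
    have "AE \<omega> in L. (\<lambda>n. \<omega> (right_approx n t) - \<omega> (right_approx n s)) \<longlonglongrightarrow> X t \<omega> - X s \<omega>"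
      using AE_X_limit by eventually_elim (use assms in \<open>auto intro!: tendsto_intros\<close>)
    then have "(\<lambda>n. char (distr L borel (\<lambda>\<omega>. \<omega> (right_approx n t) - \<omega> (right_approx n s))) u) \<longlonglongrightarrow>
        char (distr L borel (\<lambda>\<omega>. X t \<omega> - X s \<omega>)) u"
      by (rule char_limit) (auto simp: right_approx_idx intro!: borel_measurable_diff grid_measurable X_measurable)
    moreover have "char (distr L borel (\<lambda>\<omega>. \<omega> (right_approx n t) - \<omega> (right_approx n s))) u =
        exp (of_real (right_approx n t - right_approx n s) * \<Psi> (\<i> * of_real u))" for n
      unfolding right_approx_idx by (subst char_block[OF idx_mono[OF assms(2)]]) (simp add: diff_divide_distrib)
    moreover have "(\<lambda>n. exp (of_real (right_approx n t - right_approx n s) * \<Psi> (\<i> * of_real u))) \<longlonglongrightarrow>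
        exp (of_real (t - s) * \<Psi> (\<i> * of_real u))"
      using assms by (intro tendsto_intros right_approx_tendsto) auto
    ultimately show "char (distr L borel (\<lambda>\<omega>. X t \<omega> - X s \<omega>)) u = char (\<mu> (t - s)) u"
      using assms by (simp add: char_\<mu> LIMSEQ_unique)
  qed
qed

text \<open>\<open>X 0\<close> is the limit of the values at \<open>1 / 2 ^ n\<close>, not the
  initial value of the dyadic process, so it has to be shown to vanish: the characteristic functions
  of these values tend to 1.\<close>

lemma X_0: "AE \<omega> in L. X 0 \<omega> = 0"
proof -
  have "distr L borel (X 0) = return borel 0"
  proof (rule Levy_uniqueness)
    interpret r: prob_space "return borel (0::real)" by (rule prob_space_return) simp
    show "real_distribution (return borel (0::real))" by unfold_locales auto
    show "real_distribution (distr L borel (X 0))"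
      using X_measurable by (intro real_distribution_distr)
    show "char (distr L borel (X 0)) = char (return borel 0)"
    proof
      fix u
      have "AE \<omega> in L. (\<lambda>n. \<omega> (real 1 / 2 ^ n) - \<omega> (real 0 / 2 ^ n)) \<longlonglongrightarrow> X 0 \<omega>"
        using AE_X_limit start_0
      proof eventually_elim
        case (elim \<omega>)
        then show ?case by (auto dest!: spec[of _ 0] simp: right_approx_def)
      qed
      then have "(\<lambda>n. char (distr L borel (\<lambda>\<omega>. \<omega> (real 1 / 2 ^ n) - \<omega> (real 0 / 2 ^ n))) u) \<longlonglongrightarrow> char (distr L borel (X 0)) u"
        by (rule char_limit[OF _ borel_measurable_diff[OF grid_measurable grid_measurable] X_measurable])
      moreover have "(\<lambda>n. char (distr L borel (\<lambda>\<omega>. \<omega> (real 1 / 2 ^ n) - \<omega> (real 0 / 2 ^ n))) u) =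
          (\<lambda>n. exp (of_real ((1 / 2) ^ n) * \<Psi> (\<i> * of_real u)))"
        by (subst char_block) (auto simp: power_divide)
      moreover have "(\<lambda>n. exp (of_real ((1 / 2) ^ n) * \<Psi> (\<i> * of_real u))) \<longlonglongrightarrow> exp (of_real 0 * \<Psi> (\<i> * of_real u))"
        by (intro tendsto_intros LIMSEQ_realpow_zero) auto
      ultimately have "char (distr L borel (X 0)) u = 1" by (simp add: LIMSEQ_unique)
      moreover have "char (return borel 0) u = 1" unfolding char_def by (subst integral_return) auto
      ultimately show "char (distr L borel (X 0)) u = char (return borel 0) u" by simp
    qed
  qed
  moreover have "AE x in return borel (0::real). x = 0" by (simp add: AE_return)
  ultimately have "AE x in distr L borel (X 0). x = 0" by metis
  then show ?thesis using X_measurable by (subst (asm) AE_distr_iff) auto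
qed

lemma distr_X:
  assumes "0 \<le> t" shows "distr L borel (X t) = \<mu> t"
proof -
  have "distr L borel (X t) = distr L borel (\<lambda>\<omega>. X t \<omega> - X 0 \<omega>)"
    using X_0 X_measurable by (intro distr_cong_AE borel_measurable_diff refl) (auto elim!: eventually_mono)
  then show ?thesis using distr_X_increment[of 0 t] assms by simp
qed

text \<open>At each level the approximating increments are sums over disjoint blocks
  \<open>K i\<close> of grid increments, hence independent; \<open>indep_vars_limit\<close> passes
  this to \<open>X\<close>.\<close>

lemma indep_X_increments:
  fixes t :: "nat \<Rightarrow> real"
  assumes t0: "0 \<le> t 0" and mono: "\<And>i. i < N \<Longrightarrow> t i \<le> t (Suc i)"
  shows "indep_vars (\<lambda>_. borel) (\<lambda>i \<omega>. X (t (Suc i)) \<omega> - X (t i) \<omega>) {..<N}"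
proof (rule indep_vars_limit[where Z = "\<lambda>m i \<omega>. \<omega> (right_approx m (t (Suc i))) - \<omega> (right_approx m (t i))"])
  have le: "t i \<le> t j" if "i \<le> j" "j \<le> N" for i j
    using that
  proof (induction j rule: dec_induct)
    case (step j)
    then show ?case using mono[of j] by auto
  qed simp
  have nn: "0 \<le> t i" if "i \<le> N" for i using le[of 0 i] t0 that by simp
  show "AE \<omega> in L. (\<lambda>m. \<omega> (right_approx m (t (Suc i))) - \<omega> (right_approx m (t i))) \<longlonglongrightarrow> X (t (Suc i)) \<omega> - X (t i) \<omega>"
    if "i \<in> {..<N}" for i
    using AE_X_limit by eventually_elim (use that nn in \<open>auto intro!: tendsto_diff\<close>)
  fix m
  define K where "K i = {idx m (t i)..<idx m (t (Suc i))}" for i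
  have disj: "disjoint_family_on K {..<N}"
    unfolding disjoint_family_on_def
  proof (intro ballI impI)
    fix i j assume ij: "i \<in> {..<N}" "j \<in> {..<N}" "i \<noteq> j"
    have *: "K i \<inter> K j = {}" if "i < j" "j < N" for i j
      using idx_mono[of "t (Suc i)" "t j" m] le[of "Suc i" j] that unfolding K_def by auto
    from ij show "K i \<inter> K j = {}" using *[of i j] *[of j i] by (cases "i < j") auto
  qed
  have "indep_vars (\<lambda>_. borel) (incr m) UNIV"
    using indep_increments[of m] unfolding incr_def[abs_def] .
  then have "indep_vars (\<lambda>i. PiM (K i) (\<lambda>_. borel)) (\<lambda>i \<omega>. restrict (\<lambda>k. incr m k \<omega>) (K i)) {..<N}"
    by (rule indep_vars_restrict[OF _ _ disj]) auto
  then have "indep_vars (\<lambda>_. borel) (\<lambda>i \<omega>. (\<lambda>x. \<Sum>k\<in>K i. x k) (restrict (\<lambda>k. incr m k \<omega>) (K i))) {..<N}"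
    by (rule indep_vars_compose2) measurable
  then show "indep_vars (\<lambda>_. borel) (\<lambda>i \<omega>. \<omega> (right_approx m (t (Suc i))) - \<omega> (right_approx m (t i))) {..<N}"
  proof (rule iffD1[OF indep_vars_cong, rotated -1])
    fix i assume "i \<in> {..<N}"
    then have "idx m (t i) \<le> idx m (t (Suc i))" using mono by (intro idx_mono) auto
    then show "(\<lambda>\<omega>. (\<lambda>x. \<Sum>k\<in>K i. x k) (restrict (\<lambda>k. incr m k \<omega>) (K i))) =
        (\<lambda>\<omega>. \<omega> (right_approx m (t (Suc i))) - \<omega> (right_approx m (t i)))"
      unfolding right_approx_idx by (subst block_sum) (auto simp: K_def fun_eq_iff)
  qed auto
qed (use X_measurable in auto)

lemma levy_process_X: "levy_process L X"
  unfolding levy_process_def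
  using prob_space_axioms X_measurable X_0 AE_cadlag indep_X_increments distr_X_increment distr_X
  by auto

end

context spectrally_negative_semigroup
begin

theorem levy_process_exists:
  "\<exists>(M :: (real \<Rightarrow> real) measure) X. levy_process M X \<and> (AE \<omega> in M. no_positive_jumps (\<lambda>t. X t \<omega>)) \<and>
     (\<forall>t\<ge>0. distr M borel (X t) = \<mu> t)"
proof -
  obtain L :: "(real \<Rightarrow> real) measure" where L: "prob_space L" "\<And>t. t \<in> dyadics \<Longrightarrow> (\<lambda>\<omega>. \<omega> t) \<in> borel_measurable L"
    "AE \<omega> in L. \<omega> 0 = 0"
    "\<And>n. prob_space.indep_vars L (\<lambda>_. borel) (\<lambda>k \<omega>. \<omega> (real (Suc k) / 2 ^ n) - \<omega> (real k / 2 ^ n)) UNIV"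
    "\<And>n k. distr L borel (\<lambda>\<omega>. \<omega> (real (Suc k) / 2 ^ n) - \<omega> (real k / 2 ^ n)) = \<mu> (1 / 2 ^ n)"
    using dyadic_process_exists by blast
  interpret prob_space L by (rule L(1))
  interpret dyadic_levy \<mu> \<Psi> \<psi> L using L by unfold_locales
  show ?thesis using levy_process_X AE_no_positive_jumps distr_X by blast
qed

end

section \<open>Exponents and drift\<close>

text \<open>One-sided limits bound the path from above near every point, and bisection
  (\<open>Bolzano\<close>) makes the bound global.\<close>

lemma cadlag_bdd_above:
  assumes "cadlag x" "0 \<le> T"
  shows "\<exists>B. \<forall>t\<in>{0..T}. x t \<le> B"
proof -
  have "\<exists>B. \<forall>t. 0 \<le> t \<and> t \<le> T \<and> 0 \<le> t \<longrightarrow> x t \<le> B"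
  proof (rule Bolzano[OF assms(2), of "\<lambda>a b. \<exists>B. \<forall>t. a \<le> t \<and> t \<le> b \<and> 0 \<le> t \<longrightarrow> x t \<le> B"], goal_cases)
    case (1 a b c)
    then obtain B B' where B: "\<forall>t. a \<le> t \<and> t \<le> b \<and> 0 \<le> t \<longrightarrow> x t \<le> B" "\<forall>t. b \<le> t \<and> t \<le> c \<and> 0 \<le> t \<longrightarrow> x t \<le> B'" by blast
    show ?case
    proof (intro exI[of _ "max B B'"] allI impI)
      fix t assume "a \<le> t \<and> t \<le> c \<and> 0 \<le> t"
      then show "x t \<le> max B B'" using B by (cases "t \<le> b") (auto simp: le_max_iff_disj)
    qed
  next
    case (2 s)
    have "(x \<longlongrightarrow> x s) (at_right s)" using assms(1) 2 by (auto simp: cadlag_def)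
    then have "\<forall>\<^sub>F t in at_right s. x t < x s + 1" by (rule order_tendstoD(2)) simp
    then obtain b where b: "b > s" "\<And>t. s < t \<Longrightarrow> t < b \<Longrightarrow> x t < x s + 1"
      unfolding eventually_at_right_field by auto
    obtain a B where a: "a < s" "\<And>t. a < t \<Longrightarrow> t < s \<Longrightarrow> 0 \<le> t \<Longrightarrow> x t < B"
    proof (cases "s = 0")
      case True
      then show ?thesis using that[of "-1" 0] by auto
    next
      case False
      then have "0 < s" using 2 by simp
      then obtain l where "(x \<longlongrightarrow> l) (at_left s)" using assms(1) unfolding cadlag_def by blast
      then have "\<forall>\<^sub>F t in at_left s. x t < l + 1" by (rule order_tendstoD(2)) simp
      then show ?thesis using that unfolding eventually_at_left_field by blast
    qed
    show ?case
    proof (rule exI[of _ "min (b - s) (s - a)"], intro conjI allI impI)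
      show "0 < min (b - s) (s - a)" using a b by auto
      fix c e assume ce: "c \<le> s \<and> s \<le> e \<and> e - c < min (b - s) (s - a)"
      show "\<exists>B. \<forall>t. c \<le> t \<and> t \<le> e \<and> 0 \<le> t \<longrightarrow> x t \<le> B"
      proof (intro exI[of _ "max B (x s + 1)"] allI impI)
        fix t assume t: "c \<le> t \<and> t \<le> e \<and> 0 \<le> t"
        consider "t = s" | "s < t" | "t < s" by linarith
        then show "x t \<le> max B (x s + 1)"
        proof cases
          case 2
          then have "t < b" using t ce by auto
          then show ?thesis using b(2)[OF 2] by (simp add: le_max_iff_disj less_imp_le)
        next
          case 3
          then have "a < t" "0 \<le> t" using t ce by auto
          then show ?thesis using a(2)[OF _ 3] by (simp add: le_max_iff_disj less_imp_le)
        qed simp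
      qed
    qed
  qed
  then obtain B where "\<forall>t. 0 \<le> t \<and> t \<le> T \<and> 0 \<le> t \<longrightarrow> x t \<le> B" by blast
  then show ?thesis by (intro exI[of _ B]) auto
qed

text \<open>
  Optional stopping of the submartingale \<open>exp (\<theta> R k)\<close> at the first passage above \<open>a\<close>; the
  overshoot is at most \<open>\<epsilon>\<close> unless some step exceeds \<open>\<epsilon>\<close>, which costs \<open>q\<close> per step.
\<close>

lemma (in prob_space) random_walk_passage_bound:
  fixes \<xi> :: "nat \<Rightarrow> 'a \<Rightarrow> real" and R :: "nat \<Rightarrow> 'a \<Rightarrow> real"
  defines "R k \<omega> \<equiv> (\<Sum>i<k. \<xi> i \<omega>)"
  assumes ind: "indep_vars (\<lambda>_. borel) \<xi> UNIV"
    and int: "\<And>i. integrable M (\<lambda>\<omega>. exp (\<theta> * \<xi> i \<omega>))"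
    and sub: "\<And>i. 1 \<le> (\<integral>\<omega>. exp (\<theta> * \<xi> i \<omega>) \<partial>M)"
    and big: "\<And>i. (\<integral>\<omega>. exp (\<theta> * \<xi> i \<omega>) * indicator {x. \<epsilon> < x} (\<xi> i \<omega>) \<partial>M) \<le> q"
    and pos: "0 < a" "0 \<le> \<theta>" "0 \<le> \<epsilon>"
  shows "1 \<le> (\<integral>\<omega>. exp (\<theta> * R k \<omega>) * (if \<forall>j\<le>k. R j \<omega> < a then 1 else 0) \<partial>M) +
    exp (\<theta> * (a + \<epsilon>)) * prob {\<omega>\<in>space M. \<exists>j\<le>k. a \<le> R j \<omega>} + real k * (exp (\<theta> * a) * q)"
proof (induction k)
  case 0
  have "{\<omega>\<in>space M. \<exists>j\<le>(0::nat). a \<le> R j \<omega>} = {}" using pos by (auto simp: R_def)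
  then show ?case using pos prob_space by (simp add: R_def)
next
  case (Suc k)
  have \<xi>m [measurable]: "\<xi> i \<in> borel_measurable M" for i using ind by (auto simp: indep_vars_def)
  have Rm [measurable]: "R j \<in> borel_measurable M" for j unfolding R_def by measurable
  define below where "below k \<omega> = (if \<forall>j\<le>k. R j \<omega> < a then 1 else 0 :: real)" for k \<omega>
  have bm [measurable]: "below k \<in> borel_measurable M" for k unfolding below_def[abs_def] by measurable
  define U where "U \<omega> = exp (\<theta> * R k \<omega>) * below k \<omega>" for \<omega>
  define V where "V \<omega> = exp (\<theta> * \<xi> k \<omega>)" for \<omega>
  have Vm [measurable]: "V \<in> borel_measurable M" unfolding V_def[abs_def] by measurable
  have Um [measurable]: "U \<in> borel_measurable M" unfolding U_def[abs_def] by measurable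
  have Ub: "0 \<le> U \<omega>" "U \<omega> \<le> exp (\<theta> * a)" for \<omega>
    using pos by (auto simp: U_def below_def intro!: mult_left_mono)
  have Ui: "integrable M U" by (rule integrable_const_bound[of _ "exp (\<theta> * a)"]) (use Ub in auto)
  have Vi: "integrable M V" using int[of k] by (simp add: V_def[abs_def])
  \<comment> \<open>\<open>U\<close> is a function of the steps before \<open>k\<close> and
    \<open>V\<close> of step \<open>k\<close> alone, so the means multiply.\<close>
  have UV: "integrable M (\<lambda>\<omega>. U \<omega> * V \<omega>) \<and> (\<integral>\<omega>. U \<omega> * V \<omega> \<partial>M) = (\<integral>\<omega>. U \<omega> \<partial>M) * (\<integral>\<omega>. V \<omega> \<partial>M)"
  proof -
    define F where "F x = exp (\<theta> * (\<Sum>i<k. x i)) * (if \<forall>j\<le>k. (\<Sum>i<j. x i) < a then 1 else 0 :: real)" for x :: "nat \<Rightarrow> real"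
    have Fm: "F \<in> borel_measurable (PiM {..<k} (\<lambda>_. borel))"
    proof -
      have s: "(\<lambda>x. \<Sum>i<j. x i) \<in> borel_measurable (PiM {..<k} (\<lambda>_. borel :: real measure))" if "j \<le> k" for j
        using that by (intro borel_measurable_sum measurable_component_singleton) auto
      have "Measurable.pred (PiM {..<k} (\<lambda>_. borel :: real measure)) (\<lambda>x. \<forall>j\<in>{..k}. (\<Sum>i<j. x i) < a)"
        using s by (intro pred_intros_finite) (auto simp: pred_def intro!: borel_measurable_less)
      then have p: "Measurable.pred (PiM {..<k} (\<lambda>_. borel :: real measure)) (\<lambda>x. \<forall>j\<le>k. (\<Sum>i<j. x i) < a)" by simp
      show ?thesis unfolding F_def[abs_def]
        using p s[of k] by (intro borel_measurable_times borel_measurable_exp measurable_If) auto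
    qed
    have "indep_var (PiM {..<k} (\<lambda>_. borel)) (\<lambda>\<omega>. restrict (\<lambda>i. \<xi> i \<omega>) {..<k}) (PiM {k} (\<lambda>_. borel)) (\<lambda>\<omega>. restrict (\<lambda>i. \<xi> i \<omega>) {k})"
      by (rule indep_var_restrict[OF ind]) auto
    then have "indep_var borel (F \<circ> (\<lambda>\<omega>. restrict (\<lambda>i. \<xi> i \<omega>) {..<k})) borel ((\<lambda>x. exp (\<theta> * x k)) \<circ> (\<lambda>\<omega>. restrict (\<lambda>i. \<xi> i \<omega>) {k}))"
      by (rule indep_var_compose[OF _ Fm]) measurable
    moreover have "F \<circ> (\<lambda>\<omega>. restrict (\<lambda>i. \<xi> i \<omega>) {..<k}) = U"
      by (auto simp: fun_eq_iff F_def U_def R_def below_def)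
    moreover have "(\<lambda>x. exp (\<theta> * x k)) \<circ> (\<lambda>\<omega>. restrict (\<lambda>i. \<xi> i \<omega>) {k}) = V"
      by (auto simp: fun_eq_iff V_def)
    ultimately have iv: "indep_var borel U borel V" by simp
    show ?thesis using indep_var_integrable[OF iv Ui Vi] indep_var_lebesgue_integral[OF iv Ui Vi] by simp
  qed
  \<comment> \<open>\<open>N\<close> indicates that the level is reached for the first time by the
    walk with \<open>Suc k\<close> steps.\<close>
  define N where "N \<omega> = below k \<omega> * indicator {x. a \<le> x} (R (Suc k) \<omega>)" for \<omega>
  define J where "J \<omega> = V \<omega> * indicator {x. \<epsilon> < x} (\<xi> k \<omega>)" for \<omega>
  have below_Suc: "below (Suc k) \<omega> = below k \<omega> - N \<omega>" for \<omega>
    by (auto simp: below_def N_def le_Suc_eq indicator_def)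
  have Nm [measurable]: "N \<in> borel_measurable M" unfolding N_def[abs_def] by measurable
  have Ni: "integrable M N"
    by (rule integrable_const_bound[of _ 1]) (auto simp: N_def below_def indicator_def)
  have Jm [measurable]: "J \<in> borel_measurable M" unfolding J_def[abs_def] by measurable
  have Ji: "integrable M J"
    by (rule Bochner_Integration.integrable_bound[OF Vi]) (auto simp: J_def V_def indicator_def)
  have eR: "exp (\<theta> * R (Suc k) \<omega>) = exp (\<theta> * R k \<omega>) * V \<omega>" for \<omega>
    by (simp add: R_def V_def ring_distribs exp_add)
  \<comment> \<open>Without a passage the first term alone equals the left side. At a passage the
    new exponential is at most \<open>exp (\<theta> * (a + \<epsilon>))\<close>, unless the step
    exceeds \<open>\<epsilon>\<close>; in that case the term with \<open>J\<close> pays for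
    it.\<close>
  have step: "U \<omega> * V \<omega> \<le> exp (\<theta> * R (Suc k) \<omega>) * below (Suc k) \<omega> + (exp (\<theta> * (a + \<epsilon>)) * N \<omega> + exp (\<theta> * a) * J \<omega>)" for \<omega>
  proof (cases "below k \<omega> = 1 \<and> a \<le> R (Suc k) \<omega>")
    case False
    then have "N \<omega> = 0" by (auto simp: N_def below_def indicator_def)
    moreover have "0 \<le> J \<omega>" by (simp add: J_def V_def)
    ultimately show ?thesis by (simp add: below_Suc U_def eR mult_ac)
  next
    case True
    then have N: "N \<omega> = 1" and b: "below k \<omega> = 1" by (auto simp: N_def)
    then have Rk: "R k \<omega> < a" by (auto simp: below_def split: if_splits)
    have "U \<omega> * V \<omega> = exp (\<theta> * R k \<omega>) * V \<omega>" using b by (simp add: U_def)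
    also have "\<dots> \<le> exp (\<theta> * (a + \<epsilon>)) + exp (\<theta> * a) * J \<omega>"
    proof (cases "\<epsilon> < \<xi> k \<omega>")
      case True
      then have "exp (\<theta> * R k \<omega>) * V \<omega> \<le> exp (\<theta> * a) * J \<omega>"
        using Rk pos by (auto simp: J_def V_def intro!: mult_right_mono mult_left_mono)
      then show ?thesis by (simp add: add_increasing)
    next
      case False
      then have "exp (\<theta> * R k \<omega>) * V \<omega> \<le> exp (\<theta> * (a + \<epsilon>))"
        unfolding V_def mult_exp_exp using Rk pos by (simp add: distrib_left[symmetric] mult_left_mono)
      then show ?thesis by (simp add: J_def V_def add_increasing2)
    qed
    finally show ?thesis using N by (simp add: below_Suc b)
  qed
  have ei: "integrable M (\<lambda>\<omega>. exp (\<theta> * R (Suc k) \<omega>) * below (Suc k) \<omega>)"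
    by (rule integrable_const_bound[of _ "exp (\<theta> * a)"]) (use pos in \<open>auto simp: below_def intro!: AE_I2 mult_left_mono dest!: spec[of _ "Suc k"]\<close>)
  have "(\<integral>\<omega>. U \<omega> \<partial>M) \<le> (\<integral>\<omega>. U \<omega> \<partial>M) * (\<integral>\<omega>. V \<omega> \<partial>M)"
  proof -
    have "1 \<le> (\<integral>\<omega>. V \<omega> \<partial>M)" using sub[of k] by (simp add: V_def)
    moreover have "0 \<le> (\<integral>\<omega>. U \<omega> \<partial>M)" by (intro Bochner_Integration.integral_nonneg Ub(1))
    ultimately have "(\<integral>\<omega>. U \<omega> \<partial>M) * 1 \<le> (\<integral>\<omega>. U \<omega> \<partial>M) * (\<integral>\<omega>. V \<omega> \<partial>M)" by (rule mult_left_mono)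
    then show ?thesis by simp
  qed
  also have "\<dots> = (\<integral>\<omega>. U \<omega> * V \<omega> \<partial>M)" using UV by simp
  also have "\<dots> \<le> (\<integral>\<omega>. exp (\<theta> * R (Suc k) \<omega>) * below (Suc k) \<omega> + (exp (\<theta> * (a + \<epsilon>)) * N \<omega> + exp (\<theta> * a) * J \<omega>) \<partial>M)"
    using UV ei Ni Ji by (intro integral_mono step) auto
  also have "\<dots> = (\<integral>\<omega>. exp (\<theta> * R (Suc k) \<omega>) * below (Suc k) \<omega> \<partial>M) + (exp (\<theta> * (a + \<epsilon>)) * (\<integral>\<omega>. N \<omega> \<partial>M) + exp (\<theta> * a) * (\<integral>\<omega>. J \<omega> \<partial>M))"
    using ei Ni Ji by simp
  also have "\<dots> \<le> (\<integral>\<omega>. exp (\<theta> * R (Suc k) \<omega>) * below (Suc k) \<omega> \<partial>M) + (exp (\<theta> * (a + \<epsilon>)) * (\<integral>\<omega>. N \<omega> \<partial>M) + exp (\<theta> * a) * q)"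
    using big[of k] by (simp add: J_def V_def)
  finally have main: "(\<integral>\<omega>. U \<omega> \<partial>M) \<le> \<dots>" .
  have Np: "(\<integral>\<omega>. N \<omega> \<partial>M) = prob {\<omega>\<in>space M. \<exists>j\<le>Suc k. a \<le> R j \<omega>} - prob {\<omega>\<in>space M. \<exists>j\<le>k. a \<le> R j \<omega>}"
  proof -
    have "(\<integral>\<omega>. N \<omega> \<partial>M) = (\<integral>\<omega>. indicator {\<omega>\<in>space M. \<exists>j\<le>Suc k. a \<le> R j \<omega>} \<omega> - indicator {\<omega>\<in>space M. \<exists>j\<le>k. a \<le> R j \<omega>} \<omega> \<partial>M)"
    proof (intro Bochner_Integration.integral_cong refl)
      fix \<omega> assume "\<omega> \<in> space M"
      moreover have "below k \<omega> = (if \<exists>j\<le>k. a \<le> R j \<omega> then 0 else 1)"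
      proof -
        have "(\<forall>j\<le>k. R j \<omega> < a) \<longleftrightarrow> \<not> (\<exists>j\<le>k. a \<le> R j \<omega>)" by (meson not_le)
        then show ?thesis by (simp add: below_def)
      qed
      ultimately show "N \<omega> = indicator {\<omega>\<in>space M. \<exists>j\<le>Suc k. a \<le> R j \<omega>} \<omega> - indicator {\<omega>\<in>space M. \<exists>j\<le>k. a \<le> R j \<omega>} \<omega>"
        by (auto simp: N_def le_Suc_eq indicator_def)
    qed
    also have "\<dots> = (\<integral>\<omega>. indicator {\<omega>\<in>space M. \<exists>j\<le>Suc k. a \<le> R j \<omega>} \<omega> \<partial>M) - (\<integral>\<omega>. indicator {\<omega>\<in>space M. \<exists>j\<le>k. a \<le> R j \<omega>} \<omega> \<partial>M)"
      by (intro Bochner_Integration.integral_diff integrable_real_indicator) (auto simp: less_top[symmetric])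
    also have "\<dots> = prob {\<omega>\<in>space M. \<exists>j\<le>Suc k. a \<le> R j \<omega>} - prob {\<omega>\<in>space M. \<exists>j\<le>k. a \<le> R j \<omega>}"
      by (simp add: Int_absorb2)
    finally show ?thesis .
  qed
  show ?case
    using Suc.IH main unfolding Np U_def below_def by (simp add: algebra_simps)
qed

section \<open>Levy processes with exponential moments\<close>

locale levy_proc =
  fixes M :: "'w measure" and X :: "real \<Rightarrow> 'w \<Rightarrow> real"
  assumes levy: "levy_process M X"
begin

sublocale prob_space M using levy by (simp add: levy_process_def)

lemma X_measurable: "0 \<le> t \<Longrightarrow> X t \<in> borel_measurable M"
  using levy by (simp add: levy_process_def)

lemma X_0: "AE \<omega> in M. X 0 \<omega> = 0"
  using levy by (simp add: levy_process_def)

lemma AE_cadlag: "AE \<omega> in M. cadlag (\<lambda>t. X t \<omega>)"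
  using levy by (simp add: levy_process_def)

lemma distr_increment: "0 \<le> s \<Longrightarrow> s \<le> t \<Longrightarrow> distr M borel (\<lambda>\<omega>. X t \<omega> - X s \<omega>) = distr M borel (X (t - s))"
  using levy by (simp add: levy_process_def)

lemma indep_increments:
  fixes t :: "nat \<Rightarrow> real"
  assumes "0 \<le> t 0" "\<And>i. i < n \<Longrightarrow> t i \<le> t (Suc i)"
  shows "indep_vars (\<lambda>_. borel) (\<lambda>i \<omega>. X (t (Suc i)) \<omega> - X (t i) \<omega>) {..<n}"
proof -
  have "\<forall>(n::nat) (t::nat \<Rightarrow> real). 0 \<le> t 0 \<and> (\<forall>i<n. t i \<le> t (Suc i)) \<longrightarrow>
      indep_vars (\<lambda>_. borel) (\<lambda>i \<omega>. X (t (Suc i)) \<omega> - X (t i) \<omega>) {..<n}"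
    using levy unfolding levy_process_def by (elim conjE)
  from this[THEN spec[of _ n], THEN spec[of _ t]] assms show ?thesis by simp
qed

text \<open>The definition gives independence of finitely many successive increments; an infinite
  family is independent once all its finite subfamilies are.\<close>

lemma indep_grid:
  assumes "0 \<le> h"
  shows "indep_vars (\<lambda>_. borel) (\<lambda>i \<omega>. X (real (Suc i) * h) \<omega> - X (real i * h) \<omega>) UNIV"
proof -
  have f: "indep_vars (\<lambda>_. borel) (\<lambda>i \<omega>. X (real (Suc i) * h) \<omega> - X (real i * h) \<omega>) {..<n}" for n
    using assms by (intro indep_increments[of "\<lambda>i. real i * h"]) (auto intro: mult_right_mono)
  have fin: "indep_vars (\<lambda>_. borel) (\<lambda>i \<omega>. X (real (Suc i) * h) \<omega> - X (real i * h) \<omega>) J" if "finite J" for J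
  proof (rule indep_vars_subset[OF f[of "Suc (Max (insert 0 J))"]], rule subsetI)
    fix x assume "x \<in> J"
    then have "x \<le> Max (insert 0 J)" using that by (intro Max_ge) auto
    then show "x \<in> {..<Suc (Max (insert 0 J))}" unfolding lessThan_iff less_Suc_eq_le .
  qed
  show ?thesis unfolding indep_vars_def2
  proof (intro conjI ballI)
    show "(\<lambda>\<omega>. X (real (Suc i) * h) \<omega> - X (real i * h) \<omega>) \<in> borel_measurable M" for i
      using assms by (intro borel_measurable_diff X_measurable) auto
    show "indep_sets (\<lambda>i. {(\<lambda>\<omega>. X (real (Suc i) * h) \<omega> - X (real i * h) \<omega>) -` A \<inter> space M |A. A \<in> sets borel}) UNIV"
    proof (subst indep_sets_finite_index_sets, intro allI impI)
      fix J :: "nat set" assume "finite J"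
      from fin[OF this] show "indep_sets (\<lambda>i. {(\<lambda>\<omega>. X (real (Suc i) * h) \<omega> - X (real i * h) \<omega>) -` A \<inter> space M |A. A \<in> sets borel}) J"
        unfolding indep_vars_def2 by simp
    qed
  qed
qed

lemma increment_integral:
  assumes "0 \<le> s" "s \<le> t" and g: "g \<in> borel_measurable borel"
  shows "(LINT \<omega>|M. g (X t \<omega> - X s \<omega>)) = (LINT \<omega>|M. g (X (t - s) \<omega>) :: real)"
    and "integrable M (\<lambda>\<omega>. g (X t \<omega> - X s \<omega>)) \<longleftrightarrow> integrable M (\<lambda>\<omega>. g (X (t - s) \<omega>))"
proof -
  have m: "(\<lambda>\<omega>. X t \<omega> - X s \<omega>) \<in> borel_measurable M" "X (t - s) \<in> borel_measurable M"
    using assms by (auto intro!: borel_measurable_diff X_measurable)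
  show "(LINT \<omega>|M. g (X t \<omega> - X s \<omega>)) = (LINT \<omega>|M. g (X (t - s) \<omega>))"
    using integral_distr[OF m(1) g] integral_distr[OF m(2) g] distr_increment[OF assms(1,2)] by simp
  show "integrable M (\<lambda>\<omega>. g (X t \<omega> - X s \<omega>)) \<longleftrightarrow> integrable M (\<lambda>\<omega>. g (X (t - s) \<omega>))"
    using integrable_distr_eq[OF m(1) g] integrable_distr_eq[OF m(2) g] distr_increment[OF assms(1,2)] by simp
qed

end

locale levy_with_exponent = levy_proc M X for M :: "'w measure" and X :: "real \<Rightarrow> 'w \<Rightarrow> real" +
  fixes \<psi> :: "real \<Rightarrow> real"
  assumes integrable_exp: "\<And>t \<theta>. 0 \<le> t \<Longrightarrow> 0 \<le> \<theta> \<Longrightarrow> integrable M (\<lambda>\<omega>. exp (\<theta> * X t \<omega>))"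
    and integral_exp: "\<And>t \<theta>. 0 \<le> t \<Longrightarrow> 0 \<le> \<theta> \<Longrightarrow> (LINT \<omega>|M. exp (\<theta> * X t \<omega>)) = exp (t * \<psi> \<theta>)"
begin

text \<open>For \<open>x > \<epsilon>\<close> one has \<open>exp (\<theta> * x) \<le> exp ((\<theta>
  - \<rho>) * \<epsilon>) * exp (\<rho> * x)\<close>, so a truncated moment of small order inherits
  the estimate made with a large \<open>\<rho>\<close>.\<close>

lemma exp_truncated_le:
  assumes "0 \<le> h" "0 \<le> \<theta>" "\<theta> \<le> \<rho>"
  shows "(LINT \<omega>|M. exp (\<theta> * X h \<omega>) * indicator {x. \<epsilon> < x} (X h \<omega>)) \<le> exp (\<theta> * \<epsilon>) * exp (h * \<psi> \<rho> - \<rho> * \<epsilon>)"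
proof -
  have \<rho>: "0 \<le> \<rho>" using assms by simp
  have "(LINT \<omega>|M. exp (\<theta> * X h \<omega>) * indicator {x. \<epsilon> < x} (X h \<omega>)) \<le> (LINT \<omega>|M. exp (\<theta> * \<epsilon> - \<rho> * \<epsilon>) * exp (\<rho> * X h \<omega>))"
  proof (rule integral_mono)
    show "integrable M (\<lambda>\<omega>. exp (\<theta> * X h \<omega>) * indicator {x. \<epsilon> < x} (X h \<omega>))"
      using X_measurable[OF assms(1)]
      by (intro Bochner_Integration.integrable_bound[OF integrable_exp[OF assms(1,2)]]) (auto simp: indicator_def)
    show "integrable M (\<lambda>\<omega>. exp (\<theta> * \<epsilon> - \<rho> * \<epsilon>) * exp (\<rho> * X h \<omega>))" using integrable_exp[OF assms(1) \<rho>] by simp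
    fix \<omega>
    show "exp (\<theta> * X h \<omega>) * indicator {x. \<epsilon> < x} (X h \<omega>) \<le> exp (\<theta> * \<epsilon> - \<rho> * \<epsilon>) * exp (\<rho> * X h \<omega>)"
    proof (cases "\<epsilon> < X h \<omega>")
      case True
      then have "(\<rho> - \<theta>) * \<epsilon> \<le> (\<rho> - \<theta>) * X h \<omega>" using assms by (intro mult_left_mono) auto
      then show ?thesis using True by (simp add: mult_exp_exp algebra_simps)
    qed simp
  qed
  also have "\<dots> = exp (\<theta> * \<epsilon> - \<rho> * \<epsilon>) * exp (h * \<psi> \<rho>)"
    using integral_exp[OF assms(1) \<rho>] by simp
  also have "\<dots> = exp (\<theta> * \<epsilon>) * exp (h * \<psi> \<rho> - \<rho> * \<epsilon>)" by (simp add: mult_exp_exp)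
  finally show ?thesis .
qed

lemma not_drifts_to_minus_infinity:
  assumes nonneg: "\<And>\<theta>. 0 < \<theta> \<Longrightarrow> 0 \<le> \<psi> \<theta>"
    and growth: "\<exists>C\<ge>0. \<forall>\<theta>\<ge>1. \<psi> \<theta> \<le> C * \<theta>\<^sup>2"
  shows "\<not> drifts_to_minus_infinity M X"
proof
  assume "drifts_to_minus_infinity M X"
  then have drift: "AE \<omega> in M. filterlim (\<lambda>t. X t \<omega>) at_bot at_top" by (simp add: drifts_to_minus_infinity_def)
  define G where "G a = {\<omega>\<in>space M. \<exists>n k. a \<le> X (real k * (1 / 2 ^ n)) \<omega> - X 0 \<omega>}" for a
  have Xm [measurable]: "X (real k * (1 / 2 ^ n)) \<in> borel_measurable M" "X 0 \<in> borel_measurable M" for k n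
    by (auto intro!: X_measurable)
  have Gm: "G a \<in> events" for a unfolding G_def by measurable
  have G1: "1 \<le> prob (G a)" if a: "0 < a" for a
  proof -
    obtain K \<rho> where K: "\<And>n. 1 \<le> \<rho> n" "\<And>n. exp (1 / 2 ^ n * \<psi> (\<rho> n) - \<rho> n * 1) \<le> K * (1 / 4) ^ n"
      using quadratic_growth_exp_bound[OF growth, of 1] by auto
    have th: "1 \<le> exp (\<theta> * (a + 1)) * prob (G a)" if \<theta>: "0 < \<theta>" "\<theta> \<le> 1" for \<theta>
    proof -
      have bound: "1 \<le> (LINT \<omega>|M. exp (\<theta> * min (X (real T) \<omega> - X 0 \<omega>) a)) + exp (\<theta> * (a + 1)) * prob (G a)" for T :: nat
      proof -
        have "1 \<le> (LINT \<omega>|M. exp (\<theta> * min (X (real T) \<omega> - X 0 \<omega>) a)) + exp (\<theta> * (a + 1)) * prob (G a)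
            + real T * exp (\<theta> * a) * exp \<theta> * K * (1 / 2) ^ n" for n
        proof -
          define h where "h = (1 / 2 ^ n :: real)"
          define \<xi> where "\<xi> i \<omega> = X (real (Suc i) * h) \<omega> - X (real i * h) \<omega>" for i \<omega>
          have R: "(\<Sum>i<k. \<xi> i \<omega>) = X (real k * h) \<omega> - X 0 \<omega>" for k \<omega>
            unfolding \<xi>_def by (subst sum_lessThan_telescope) simp
          have h: "0 \<le> h" by (simp add: h_def)
          have d: "real (Suc i) * h - real i * h = h" "0 \<le> real i * h" "real i * h \<le> real (Suc i) * h" for i
            using h by (auto simp: algebra_simps)
          have inc: "(\<integral>\<omega>. g (\<xi> i \<omega>) \<partial>M) = (\<integral>\<omega>. g (X h \<omega>) \<partial>M)"
            "integrable M (\<lambda>\<omega>. g (\<xi> i \<omega>)) \<longleftrightarrow> integrable M (\<lambda>\<omega>. g (X h \<omega>))"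
            if "g \<in> borel_measurable borel" for g :: "real \<Rightarrow> real" and i
            using increment_integral[OF d(2,3)[of i] that, unfolded d(1)] by (simp_all only: \<xi>_def)
          define q where "q = exp (\<theta> * 1) * (K * (1 / 4) ^ n)"
          have "1 \<le> (\<integral>\<omega>. exp (\<theta> * (\<Sum>i<T * 2 ^ n. \<xi> i \<omega>)) * (if \<forall>j\<le>T * 2 ^ n. (\<Sum>i<j. \<xi> i \<omega>) < a then 1 else 0) \<partial>M) +
              exp (\<theta> * (a + 1)) * prob {\<omega>\<in>space M. \<exists>j\<le>T * 2 ^ n. a \<le> (\<Sum>i<j. \<xi> i \<omega>)} + real (T * 2 ^ n) * (exp (\<theta> * a) * q)"
          proof (rule random_walk_passage_bound)
            show "indep_vars (\<lambda>_. borel) \<xi> UNIV" unfolding \<xi>_def[abs_def] using h by (rule indep_grid)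
            show "integrable M (\<lambda>\<omega>. exp (\<theta> * \<xi> i \<omega>))" for i
              using inc(2)[of "\<lambda>x. exp (\<theta> * x)" i] integrable_exp[OF h, of \<theta>] \<theta> by simp
            show "1 \<le> (\<integral>\<omega>. exp (\<theta> * \<xi> i \<omega>) \<partial>M)" for i
              using inc(1)[of "\<lambda>x. exp (\<theta> * x)" i] integral_exp[OF h, of \<theta>] \<theta> nonneg[of \<theta>] h by simp
            show "(\<integral>\<omega>. exp (\<theta> * \<xi> i \<omega>) * indicator {x. 1 < x} (\<xi> i \<omega>) \<partial>M) \<le> q" for i
            proof -
              have "(\<integral>\<omega>. exp (\<theta> * \<xi> i \<omega>) * indicator {x. 1 < x} (\<xi> i \<omega>) \<partial>M) = (\<integral>\<omega>. exp (\<theta> * X h \<omega>) * indicator {x. 1 < x} (X h \<omega>) \<partial>M)"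
                by (rule inc(1)[of "\<lambda>x. exp (\<theta> * x) * indicator {x. 1 < x} x"]) measurable
              also have "\<dots> \<le> exp (\<theta> * 1) * exp (h * \<psi> (\<rho> n) - \<rho> n * 1)"
                using h \<theta> K(1)[of n] by (intro exp_truncated_le) auto
              also have "\<dots> \<le> q" unfolding q_def h_def using K(2)[of n] by (intro mult_left_mono) auto
              finally show ?thesis .
            qed
          qed (use a \<theta> in auto)
          also have "(\<integral>\<omega>. exp (\<theta> * (\<Sum>i<T * 2 ^ n. \<xi> i \<omega>)) * (if \<forall>j\<le>T * 2 ^ n. (\<Sum>i<j. \<xi> i \<omega>) < a then 1 else 0) \<partial>M)
              \<le> (LINT \<omega>|M. exp (\<theta> * min (X (real T) \<omega> - X 0 \<omega>) a))"
          proof (rule integral_mono')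
            have [measurable]: "X (real T) \<in> borel_measurable M" by (rule X_measurable) simp
            show "integrable M (\<lambda>\<omega>. exp (\<theta> * min (X (real T) \<omega> - X 0 \<omega>) a))"
              by (rule integrable_const_bound[of _ "exp (\<theta> * a)"]) (use \<theta> in \<open>auto intro!: mult_left_mono\<close>)
            fix \<omega>
            have "real (T * 2 ^ n) * h = real T" by (simp add: h_def)
            then have e: "(\<Sum>i<T * 2 ^ n. \<xi> i \<omega>) = X (real T) \<omega> - X 0 \<omega>" by (simp only: R)
            show "exp (\<theta> * (\<Sum>i<T * 2 ^ n. \<xi> i \<omega>)) * (if \<forall>j\<le>T * 2 ^ n. (\<Sum>i<j. \<xi> i \<omega>) < a then 1 else 0)
              \<le> exp (\<theta> * min (X (real T) \<omega> - X 0 \<omega>) a)"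
              unfolding e by (auto simp: min_def e dest!: spec[of _ "T * 2 ^ n"])
          qed simp
          also have "prob {\<omega>\<in>space M. \<exists>j\<le>T * 2 ^ n. a \<le> (\<Sum>i<j. \<xi> i \<omega>)} \<le> prob (G a)"
            unfolding R G_def h_def using Gm[of a] unfolding G_def by (intro finite_measure_mono) auto
          also have "real (T * 2 ^ n) * (exp (\<theta> * a) * q) = real T * exp (\<theta> * a) * exp \<theta> * K * (2 * (1 / 4)) ^ n"
            unfolding q_def power_mult_distrib by simp
          finally show ?thesis by simp
        qed
        moreover have "(\<lambda>n. (LINT \<omega>|M. exp (\<theta> * min (X (real T) \<omega> - X 0 \<omega>) a)) + exp (\<theta> * (a + 1)) * prob (G a)
            + real T * exp (\<theta> * a) * exp \<theta> * K * (1 / 2) ^ n) \<longlonglongrightarrow>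
            (LINT \<omega>|M. exp (\<theta> * min (X (real T) \<omega> - X 0 \<omega>) a)) + exp (\<theta> * (a + 1)) * prob (G a) + real T * exp (\<theta> * a) * exp \<theta> * K * 0"
          by (intro tendsto_intros LIMSEQ_realpow_zero) auto
        ultimately show ?thesis using LIMSEQ_le_const by fastforce
      qed
      have "(\<lambda>T. LINT \<omega>|M. exp (\<theta> * min (X (real T) \<omega> - X 0 \<omega>) a)) \<longlonglongrightarrow> (LINT \<omega>|M. 0)"
      proof (rule integral_dominated_convergence[where w = "\<lambda>_. exp (\<theta> * a)"])
        show "AE \<omega> in M. (\<lambda>T. exp (\<theta> * min (X (real T) \<omega> - X 0 \<omega>) a)) \<longlonglongrightarrow> 0"
          using drift
        proof eventually_elim
          case (elim \<omega>)
          have "filterlim (\<lambda>T. X (real T) \<omega>) at_bot sequentially"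
            using filterlim_compose[OF elim filterlim_real_sequentially] .
          then have "\<forall>\<^sub>F T in sequentially. X (real T) \<omega> \<le> Z + X 0 \<omega>" for Z by (simp add: filterlim_at_bot)
          then have "filterlim (\<lambda>T. X (real T) \<omega> - X 0 \<omega>) at_bot sequentially"
            by (simp add: filterlim_at_bot diff_le_eq)
          then have fl: "filterlim (\<lambda>T. \<theta> * (X (real T) \<omega> - X 0 \<omega>)) at_bot sequentially"
            using \<theta> by (intro filterlim_tendsto_pos_mult_at_bot[OF tendsto_const]) auto
          have "(\<lambda>T. exp (\<theta> * (X (real T) \<omega> - X 0 \<omega>))) \<longlonglongrightarrow> 0"
            by (rule filterlim_compose[OF exp_at_bot fl])
          then show ?case
            by (rule tendsto_sandwich[OF _ _ tendsto_const, rotated 2]) (use \<theta> in \<open>auto intro!: always_eventually mult_left_mono\<close>)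
        qed
        show "(\<lambda>\<omega>. exp (\<theta> * min (X (real T) \<omega> - X 0 \<omega>) a)) \<in> borel_measurable M" for T
        proof -
          have [measurable]: "X (real T) \<in> borel_measurable M" by (rule X_measurable) simp
          show ?thesis by measurable
        qed
      qed (use \<theta> in \<open>auto intro!: mult_left_mono\<close>)
      then have "(\<lambda>T. (LINT \<omega>|M. exp (\<theta> * min (X (real T) \<omega> - X 0 \<omega>) a)) + exp (\<theta> * (a + 1)) * prob (G a)) \<longlonglongrightarrow> 0 + exp (\<theta> * (a + 1)) * prob (G a)"
        by (intro tendsto_intros) simp
      then show ?thesis using LIMSEQ_le_const bound by fastforce
    qed
    have "((\<lambda>\<theta>. exp (\<theta> * (a + 1)) * prob (G a)) \<longlongrightarrow> exp (0 * (a + 1)) * prob (G a)) (at_right 0)"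
      by (intro tendsto_intros)
    moreover have "\<forall>\<^sub>F \<theta> in at_right 0. 1 \<le> exp (\<theta> * (a + 1)) * prob (G a)"
      unfolding eventually_at_right_field using th by (intro exI[of _ 1]) auto
    ultimately have "1 \<le> exp (0 * (a + 1)) * prob (G a)" by (rule tendsto_lowerbound) simp
    then show ?thesis by simp
  qed
  \<comment> \<open>Reaching every level contradicts boundedness from above, which holds on an
    initial interval by \<open>cadlag_bdd_above\<close> and afterwards by the drift.\<close>
  have "AE \<omega> in M. \<omega> \<in> G (real (Suc m))" for m
    using G1[of "real (Suc m)"] Gm by (intro prob_eq_1[THEN iffD1]) (auto intro: antisym prob_le_1)
  then have "AE \<omega> in M. \<forall>m. \<omega> \<in> G (real (Suc m))" unfolding AE_all_countable ..
  then have "AE \<omega> in M. False"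
    using drift AE_cadlag
  proof eventually_elim
    case (elim \<omega>)
    have "\<forall>\<^sub>F t in at_top. X t \<omega> \<le> 0" using elim(2) by (simp add: filterlim_at_bot)
    then obtain T where T: "\<And>t. t \<ge> T \<Longrightarrow> X t \<omega> \<le> 0" by (auto simp: eventually_at_top_linorder)
    obtain B where "\<forall>t\<in>{0..max T 0}. X t \<omega> \<le> B"
      using cadlag_bdd_above[OF elim(3), of "max T 0"] by auto
    then have B: "X t \<omega> \<le> B" if "0 \<le> t" "t \<le> max T 0" for t using that by auto
    have le: "X t \<omega> \<le> max B 0" if "0 \<le> t" for t
      using T[of t] B[of t] that by (cases "t \<le> T") auto
    obtain m :: nat where m: "max B 0 - X 0 \<omega> < real m" using reals_Archimedean2 by blast
    obtain n k where "real (Suc m) \<le> X (real k * (1 / 2 ^ n)) \<omega> - X 0 \<omega>"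
      using elim(1)[THEN spec[of _ m]] unfolding G_def by blast
    moreover have "X (real k * (1 / 2 ^ n)) \<omega> \<le> max B 0" by (rule le) simp
    ultimately show False using m by simp
  qed
  then show False by simp
qed

end

section \<open>Bernstein functions and scale functions\<close>

locale half_line_measure =
  fixes U :: "real measure"
  assumes sets_U: "sets U = sets (restrict_space borel {0<..})"
    and emeasure_tail_finite: "0 < y \<Longrightarrow> emeasure U {y<..} < \<infinity>"
begin

lemma space_U: "space U = {0<..}"
  using sets_eq_imp_space_eq[OF sets_U] by (simp add: space_restrict_space)

lemma measurable_U: "f \<in> borel_measurable borel \<Longrightarrow> f \<in> borel_measurable U"
  unfolding measurable_cong_sets[OF sets_U refl] by (rule measurable_restrict_space1)

lemma sets_greaterThan: "0 \<le> y \<Longrightarrow> {y<..} \<in> sets U"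
  unfolding sets_U by (subst sets_restrict_space_iff) auto

sublocale U: sigma_finite_measure U
proof
  show "\<exists>A. countable A \<and> A \<subseteq> sets U \<and> \<Union> A = space U \<and> (\<forall>a\<in>A. emeasure U a \<noteq> \<infinity>)"
  proof (intro exI[of _ "range (\<lambda>n. {1 / real (Suc n)<..})"] conjI ballI)
    show "\<Union> (range (\<lambda>n. {1 / real (Suc n)<..})) = space U"
    proof (intro set_eqI iffI)
      fix x assume "x \<in> space U"
      then have "0 < x" by (simp add: space_U)
      then show "x \<in> \<Union> (range (\<lambda>n. {1 / real (Suc n)<..}))" using nat_approx_posE[of x] by auto
    next
      fix x assume "x \<in> \<Union> (range (\<lambda>n. {1 / real (Suc n)<..}))"
      then obtain n where "1 / real (Suc n) < x" by auto
      moreover have "0 < 1 / real (Suc n)" by simp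
      ultimately have "0 < x" by linarith
      then show "x \<in> space U" by (simp add: space_U)
    qed
    show "emeasure U a \<noteq> \<infinity>" if "a \<in> range (\<lambda>n. {1 / real (Suc n)<..})" for a
    proof -
      from that obtain n where a: "a = {1 / real (Suc n)<..}" by blast
      have "emeasure U a < \<infinity>" unfolding a by (rule emeasure_tail_finite) simp
      then show ?thesis by simp
    qed
  qed (auto intro!: sets_greaterThan)
qed

definition tail :: "real \<Rightarrow> real" where
  "tail y = measure U {y<..}"

lemma emeasure_tail: "0 < y \<Longrightarrow> emeasure U {y<..} = ennreal (tail y)"
  unfolding tail_def using emeasure_tail_finite[of y] by (intro emeasure_eq_ennreal_measure) auto

lemma tail_nonneg: "0 \<le> tail y" by (simp add: tail_def)

lemma tail_antimono: "0 < x \<Longrightarrow> x \<le> y \<Longrightarrow> tail y \<le> tail x"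
  unfolding tail_def using emeasure_tail_finite[of x]
  by (intro measure_mono_fmeasurable) (auto simp: fmeasurable_def intro!: sets_greaterThan)

text \<open>Layer-cake formula: Fubini's theorem for the region \<open>0 < y < z\<close>.\<close>

lemma nn_integral_tail:
  assumes [measurable]: "f \<in> borel_measurable borel"
  shows "(\<integral>\<^sup>+y. f y * indicator {0<..} y * ennreal (tail y) \<partial>lborel) =
    (\<integral>\<^sup>+z. (\<integral>\<^sup>+y. f y * indicator {0<..<z} y \<partial>lborel) \<partial>U)"
proof -
  interpret P: pair_sigma_finite lborel U ..
  have [measurable]: "(\<lambda>z. z) \<in> borel_measurable U" by (rule measurable_U) simp
  have "(\<integral>\<^sup>+y. f y * indicator {0<..} y * ennreal (tail y) \<partial>lborel) =
      (\<integral>\<^sup>+y. (\<integral>\<^sup>+z. f y * indicator {0<..<z} y \<partial>U) \<partial>lborel)"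
  proof (rule nn_integral_cong)
    fix y
    show "f y * indicator {0<..} y * ennreal (tail y) = (\<integral>\<^sup>+z. f y * indicator {0<..<z} y \<partial>U)"
    proof (cases "0 < y")
      case True
      have "(\<integral>\<^sup>+z. f y * indicator {0<..<z} y \<partial>U) = (\<integral>\<^sup>+z. f y * indicator {y<..} z \<partial>U)"
        using True by (intro nn_integral_cong) (auto simp: indicator_def)
      also have "\<dots> = f y * ennreal (tail y)"
        using True by (subst nn_integral_cmult_indicator) (auto intro: sets_greaterThan simp: emeasure_tail)
      finally show ?thesis using True by simp
    qed simp
  qed
  also have "\<dots> = (\<integral>\<^sup>+z. (\<integral>\<^sup>+y. f y * indicator {0<..<z} y \<partial>lborel) \<partial>U)"
  proof (rule P.Fubini'[symmetric])
    have "(\<lambda>(y, z). f y * indicator {p. 0 < fst p \<and> fst p < snd p} (y, z)) \<in> borel_measurable (lborel \<Otimes>\<^sub>M U)"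
      by measurable
    also have "(\<lambda>(y, z). f y * indicator {p. 0 < fst p \<and> fst p < snd p} (y, z)) = (\<lambda>(y, z). f y * indicator {0<..<z} y)"
      by (auto simp: fun_eq_iff indicator_def)
    finally show "(\<lambda>(y, z). f y * indicator {0<..<z} y) \<in> borel_measurable (lborel \<Otimes>\<^sub>M U)" .
  qed
  finally show ?thesis .
qed

end

lemma half_line_measure_if_finite_min:
  assumes sets: "sets U = sets (restrict_space borel {0<..})"
    and fin: "(\<integral>\<^sup>+x. ennreal (min 1 x) \<partial>U) < \<infinity>"
  shows "half_line_measure U"
proof
  fix y :: real assume y: "0 < y"
  have "{y<..} \<in> sets U" unfolding sets using y by (subst sets_restrict_space_iff) auto
  then have "ennreal (min 1 y) * emeasure U {y<..} = (\<integral>\<^sup>+x. ennreal (min 1 y) * indicator {y<..} x \<partial>U)"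
    by (subst nn_integral_cmult_indicator) auto
  also have "\<dots> \<le> (\<integral>\<^sup>+x. ennreal (min 1 x) \<partial>U)"
    by (intro nn_integral_mono) (auto simp: indicator_def intro!: ennreal_leI)
  also have "\<dots> < \<infinity>" by (rule fin)
  finally show "emeasure U {y<..} < \<infinity>" using y by (auto simp: ennreal_mult_less_top)
qed (rule sets)

locale levy_measure_half_line =
  fixes U :: "real measure"
  assumes sets_U': "sets U = sets (restrict_space borel {0<..})"
    and finite_min: "(\<integral>\<^sup>+x. ennreal (min 1 x) \<partial>U) < \<infinity>"
begin

sublocale half_line_measure U using sets_U' finite_min by (rule half_line_measure_if_finite_min)

lemma integrable_min1: "integrable U (\<lambda>x. min 1 x)"
proof (rule integrableI_nonneg)
  show "AE x in U. 0 \<le> min 1 x" by (rule AE_I2) (auto simp: space_U)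
qed (use finite_min in \<open>auto intro: measurable_U\<close>)

text \<open>As an integral of the functions \<open>min x z\<close> it is easily seen to be
  continuous and concave; \<open>integral_tail\<close> identifies it with the integrated tail in the
  formula for the scale function.\<close>

definition G :: "real \<Rightarrow> real" where
  "G x = (LINT z|U. min x z)"

lemma min_le_max: "0 \<le> (x::real) \<Longrightarrow> 0 < z \<Longrightarrow> min x z \<le> max 1 x * min 1 z"
proof (cases "z \<le> 1")
  case True
  assume "0 \<le> x" "0 < z"
  then have "1 * z \<le> max 1 x * z" by (intro mult_right_mono) auto
  then show ?thesis using True by (simp add: min_le_iff_disj)
next
  case False
  then show ?thesis by (simp add: min_le_iff_disj le_max_iff_disj)
qed

lemma integrable_min: 
  assumes "0 \<le> x" shows "integrable U (\<lambda>z. min x z)"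
proof (rule Bochner_Integration.integrable_bound)
  show "integrable U (\<lambda>z. max 1 x * min 1 z)" using integrable_min1 by simp
  show "AE z in U. norm (min x z) \<le> norm (max 1 x * min 1 z)"
  proof (rule AE_I2)
    fix z assume "z \<in> space U"
    then have "0 < z" by (simp add: space_U)
    then show "norm (min x z) \<le> norm (max 1 x * min 1 z)"
      using assms min_le_max[OF assms, of z] by simp
  qed
qed (auto intro: measurable_U)

lemma nn_integral_min: "0 \<le> x \<Longrightarrow> (\<integral>\<^sup>+z. ennreal (min x z) \<partial>U) = ennreal (G x)"
  unfolding G_def by (intro nn_integral_eq_integral integrable_min) (auto simp: space_U)

lemma G_nonneg: "0 \<le> x \<Longrightarrow> 0 \<le> G x"
  unfolding G_def by (intro integral_nonneg_AE AE_I2) (auto simp: space_U)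

lemma integral_tail:
  assumes "0 \<le> x"
  shows "set_integrable lborel {0..x} tail" "(LINT y:{0..x}|lborel. tail y) = G x"
proof -
  \<comment> \<open>The point 0 is left out because the tail is monotone only on
    \<open>{0<..}\<close>: when \<open>U\<close> has infinite mass, \<open>tail 0\<close> is 0 by
    the convention for \<open>measure\<close>.\<close>
  define g where "g y = indicator {0<..x} y * tail y" for y
  have gm: "g \<in> borel_measurable borel"
  proof -
    have "(\<lambda>y. - tail y) \<in> borel_measurable (restrict_space borel {0<..x})"
      by (intro borel_measurable_mono_on_fnc monotone_onI) (auto intro: tail_antimono)
    then have "(\<lambda>y. - (- tail y)) \<in> borel_measurable (restrict_space borel {0<..x})" by (rule borel_measurable_uminus)
    then show ?thesis unfolding g_def[abs_def] by (subst (asm) borel_measurable_restrict_space_iff) (auto simp: mult.commute)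
  qed
  have "(\<integral>\<^sup>+y. ennreal (g y) \<partial>lborel) = (\<integral>\<^sup>+y. indicator {..x} y * indicator {0<..} y * ennreal (tail y) \<partial>lborel)"
    by (intro nn_integral_cong) (auto simp: g_def indicator_def)
  also have "\<dots> = (\<integral>\<^sup>+z. (\<integral>\<^sup>+y. indicator {..x} y * indicator {0<..<z} y \<partial>lborel) \<partial>U)"
    by (rule nn_integral_tail) measurable
  also have "\<dots> = (\<integral>\<^sup>+z. ennreal (min x z) \<partial>U)"
  proof (rule nn_integral_cong)
    fix z assume "z \<in> space U"
    then have z: "0 < z" by (simp add: space_U)
    have "(\<integral>\<^sup>+y. indicator {..x} y * indicator {0<..<z} y \<partial>lborel) = (\<integral>\<^sup>+y. indicator {0..min x z} y \<partial>lborel)"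
    proof (rule nn_integral_cong_AE)
      show "AE y in lborel. indicator {..x} y * indicator {0<..<z} y = (indicator {0..min x z} y :: ennreal)"
        using AE_lborel_singleton[of 0] AE_lborel_singleton[of z]
        by eventually_elim (auto simp: indicator_def)
    qed
    also have "\<dots> = ennreal (min x z)" using assms z by simp
    finally show "(\<integral>\<^sup>+y. indicator {..x} y * indicator {0<..<z} y \<partial>lborel) = ennreal (min x z)" .
  qed
  also have "\<dots> = ennreal (G x)" by (rule nn_integral_min[OF assms])
  finally have nn: "(\<integral>\<^sup>+y. ennreal (g y) \<partial>lborel) = ennreal (G x)" .
  have "has_bochner_integral lborel g (G x)"
    by (rule has_bochner_integral_nn_integral) (use gm nn G_nonneg[OF assms] in \<open>auto simp: g_def tail_nonneg\<close>)
  moreover have "AE y in lborel. g y = indicator {0..x} y *\<^sub>R tail y"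
    using AE_lborel_singleton[of 0] by eventually_elim (auto simp: g_def indicator_def)
  moreover have "(\<lambda>y. indicator {0..x} y *\<^sub>R tail y) \<in> borel_measurable lborel"
  proof -
    have "(\<lambda>y. indicator {0..x} y *\<^sub>R tail y) = (\<lambda>y. g y + indicator {0} y * (indicator {0..x} 0 * tail 0))"
      by (auto simp: g_def indicator_def fun_eq_iff)
    then show ?thesis using gm by simp
  qed
  ultimately have "has_bochner_integral lborel (\<lambda>y. indicator {0..x} y *\<^sub>R tail y) (G x)"
    using gm by (subst (asm) has_bochner_integral_cong_AE) auto
  then show "set_integrable lborel {0..x} tail" "(LINT y:{0..x}|lborel. tail y) = G x"
    unfolding set_integrable_def set_lebesgue_integral_def by (auto simp: has_bochner_integral_iff)
qed

lemma continuous_G: "continuous_on {0..} G"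
  unfolding continuous_on_sequentially comp_def
proof (intro allI ballI impI)
  fix a :: "nat \<Rightarrow> real" and x :: real assume x: "x \<in> {0..}" and a: "(\<forall>n. a n \<in> {0..}) \<and> a \<longlonglongrightarrow> x"
  then have "Bseq a" by (intro convergent_imp_Bseq convergentI) auto
  then obtain B where B: "\<And>n. \<bar>a n\<bar> \<le> B" by (auto simp: Bseq_def)
  show "(\<lambda>n. G (a n)) \<longlonglongrightarrow> G x" unfolding G_def
  proof (rule integral_dominated_convergence[where w = "\<lambda>z. max 1 B * min 1 z"])
    show "AE z in U. (\<lambda>n. min (a n) z) \<longlonglongrightarrow> min x z"
      using a by (intro AE_I2 tendsto_intros) auto
    show "AE z in U. norm (min (a n) z) \<le> max 1 B * min 1 z" for n
    proof (rule AE_I2)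
      fix z assume "z \<in> space U"
      then have z: "0 < z" by (simp add: space_U)
      have an: "0 \<le> a n" "a n \<le> B" using a B[of n] by auto
      have "min (a n) z \<le> max 1 (a n) * min 1 z" using an z by (intro min_le_max) auto
      also have "\<dots> \<le> max 1 B * min 1 z" using an z by (intro mult_right_mono) auto
      finally show "norm (min (a n) z) \<le> max 1 B * min 1 z" using an z by simp
    qed
  qed (use integrable_min1 in \<open>auto intro: measurable_U\<close>)
qed

lemma concave_G: "concave_on {0..} G"
  unfolding concave_on_iff
proof (intro conjI ballI allI impI)
  fix x y u v :: real assume xy: "x \<in> {0..}" "y \<in> {0..}" and uv: "0 \<le> u" "0 \<le> v" "u + v = 1"
  have nn: "0 \<le> u * x + v * y" using xy uv by simp
  have "u * G x + v * G y = (LINT z|U. u * min x z + v * min y z)"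
    unfolding G_def using integrable_min xy by simp
  also have "\<dots> \<le> (LINT z|U. min (u * x + v * y) z)"
  proof (rule integral_mono)
    fix z
    have "u * min x z + v * min y z \<le> u * x + v * y" using uv by (intro add_mono mult_left_mono) auto
    moreover have "u * min x z + v * min y z \<le> u * z + v * z" using uv by (intro add_mono mult_left_mono) auto
    moreover have "u * z + v * z = z" using uv by (simp add: distrib_right[symmetric])
    ultimately show "u * min x z + v * min y z \<le> min (u * x + v * y) z" by simp
  qed (use integrable_min xy nn in auto)
  finally show "u * G x + v * G y \<le> G (u *\<^sub>R x + v *\<^sub>R y)" by (simp add: G_def)
qed simp

end

lemma nn_integral_exp_atLeast:
  assumes "0 < \<theta>"
  shows "(\<integral>\<^sup>+x. ennreal (exp (- \<theta> * x)) * indicator {a..} x \<partial>lborel) = ennreal (exp (- \<theta> * a) / \<theta>)"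
proof -
  have "(\<integral>\<^sup>+x. ennreal (exp (- \<theta> * x)) * indicator {a..} x \<partial>lborel) = ennreal (0 - (- exp (- \<theta> * a) / \<theta>))"
  proof (rule nn_integral_FTC_atLeast)
    have "filterlim (\<lambda>x. - \<theta> * x) at_bot at_top"
      using assms by (intro filterlim_tendsto_neg_mult_at_bot[OF tendsto_const _ filterlim_ident]) auto
    from tendsto_minus[OF tendsto_divide[OF filterlim_compose[OF exp_at_bot this] tendsto_const[of \<theta>]]] assms
    show "((\<lambda>x. - exp (- \<theta> * x) / \<theta>) \<longlongrightarrow> 0) at_top" by simp
  qed (use assms in \<open>auto intro!: derivative_eq_intros\<close>)
  then show ?thesis by simp
qed

text \<open>The link between concave and Bernstein functions: up to the factor
  \<open>1 / \<theta>\<^sup>2\<close>, the Laplace transform turns \<open>min x z\<close> into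
  \<open>1 - exp (- \<theta> * z)\<close>. The integral is split at \<open>z\<close>.\<close>

lemma nn_integral_exp_min:
  assumes \<theta>: "0 < \<theta>" and z: "0 \<le> z"
  shows "(\<integral>\<^sup>+x. ennreal (exp (- \<theta> * x) * min x z) * indicator {0..} x \<partial>lborel) = ennreal ((1 - exp (- \<theta> * z)) / \<theta>\<^sup>2)"
proof -
  have "(\<integral>\<^sup>+x. ennreal (exp (- \<theta> * x) * min x z) * indicator {0..} x \<partial>lborel) =
    (\<integral>\<^sup>+x. ennreal (exp (- \<theta> * x) * x) * indicator {0..z} x + ennreal z * (ennreal (exp (- \<theta> * x)) * indicator {z..} x) \<partial>lborel)"
    by (rule nn_integral_cong_AE, use AE_lborel_singleton[of z] in eventually_elim)
       (use z in \<open>auto simp: indicator_def min_def ennreal_mult'' mult.commute\<close>)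
  also have "\<dots> = (\<integral>\<^sup>+x. ennreal (exp (- \<theta> * x) * x) * indicator {0..z} x \<partial>lborel) + ennreal z * ennreal (exp (- \<theta> * z) / \<theta>)"
    by (subst nn_integral_add) (auto simp: nn_integral_cmult nn_integral_exp_atLeast[OF \<theta>, simplified])
  also have "(\<integral>\<^sup>+x. ennreal (exp (- \<theta> * x) * x) * indicator {0..z} x \<partial>lborel) =
      ennreal (- (z / \<theta> + 1 / \<theta>\<^sup>2) * exp (- \<theta> * z) - (- (0 / \<theta> + 1 / \<theta>\<^sup>2) * exp (- \<theta> * 0)))"
    by (rule nn_integral_FTC_Icc) (use \<theta> z in \<open>auto intro!: derivative_eq_intros simp: field_simps power2_eq_square\<close>)
  also have "\<dots> + ennreal z * ennreal (exp (- \<theta> * z) / \<theta>) = ennreal ((1 - exp (- \<theta> * z)) / \<theta>\<^sup>2)"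
  proof -
    have "1 + \<theta> * z \<le> exp (\<theta> * z)" by (rule exp_ge_add_one_self)
    then have "(1 + \<theta> * z) * exp (- (\<theta> * z)) \<le> exp (\<theta> * z) * exp (- (\<theta> * z))" by (rule mult_right_mono) simp
    then have "0 \<le> (1 - (1 + \<theta> * z) * exp (- (\<theta> * z))) / \<theta>\<^sup>2" by (simp add: mult_exp_exp)
    also have "(1 - (1 + \<theta> * z) * exp (- (\<theta> * z))) / \<theta>\<^sup>2 = - (z / \<theta> + 1 / \<theta>\<^sup>2) * exp (- \<theta> * z) - (- (0 / \<theta> + 1 / \<theta>\<^sup>2) * exp (- \<theta> * 0))"
      using \<theta> by (simp add: field_simps power2_eq_square)
    finally show ?thesis using \<theta> z
      by (simp add: ennreal_mult''[symmetric] ennreal_plus[symmetric] del: ennreal_plus) (simp add: field_simps power2_eq_square)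
  qed
  finally show ?thesis .
qed

context levy_measure_half_line
begin

lemma one_minus_exp_bound:
  fixes \<theta> z :: real
  assumes "0 \<le> \<theta>" "0 < z" shows "0 \<le> 1 - exp (- \<theta> * z)" "1 - exp (- \<theta> * z) \<le> max 1 \<theta> * min 1 z"
proof -
  have "0 \<le> \<theta> * z" using assms by simp
  then show "0 \<le> 1 - exp (- \<theta> * z)" by simp
  have "1 - \<theta> * z \<le> exp (- \<theta> * z)" using exp_ge_add_one_self[of "- \<theta> * z"] by simp
  moreover have "\<theta> * z \<le> max 1 \<theta> * z" using assms by (intro mult_right_mono) auto
  moreover have "0 < exp (- \<theta> * z)" by simp
  moreover note max.cobounded1[of 1 \<theta>]
  ultimately have calculation: "1 - exp (- \<theta> * z) \<le> max 1 \<theta> * z" "1 - exp (- \<theta> * z) \<le> max 1 \<theta>" by linarith+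
  show "1 - exp (- \<theta> * z) \<le> max 1 \<theta> * min 1 z"
  proof (cases "z \<le> 1")
    case True
    then have "max 1 \<theta> * min 1 z = max 1 \<theta> * z" by simp
    then show ?thesis using calculation by linarith
  next
    case False
    then have "max 1 \<theta> * min 1 z = max 1 \<theta>" by simp
    then show ?thesis using calculation by linarith
  qed
qed

lemma integrable_one_minus_exp:
  assumes "0 \<le> \<theta>" shows "integrable U (\<lambda>z. 1 - exp (- \<theta> * z))"
proof (rule Bochner_Integration.integrable_bound)
  show "integrable U (\<lambda>z. max 1 \<theta> * min 1 z)" using integrable_min1 by simp
  show "AE z in U. norm (1 - exp (- \<theta> * z)) \<le> norm (max 1 \<theta> * min 1 z)"
    by (rule AE_I2) (use one_minus_exp_bound[OF assms] in \<open>force simp: space_U\<close>)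
qed (auto intro: measurable_U)

lemma laplace_G:
  assumes \<theta>: "0 < \<theta>"
  shows "(\<integral>\<^sup>+x. ennreal (exp (- \<theta> * x) * G x) * indicator {0..} x \<partial>lborel) =
    ennreal ((LINT z|U. 1 - exp (- \<theta> * z)) / \<theta>\<^sup>2)"
proof -
  interpret P: pair_sigma_finite lborel U ..
  have [measurable]: "(\<lambda>z. z) \<in> borel_measurable U" by (rule measurable_U) simp
  have "(\<integral>\<^sup>+x. ennreal (exp (- \<theta> * x) * G x) * indicator {0..} x \<partial>lborel) =
      (\<integral>\<^sup>+x. (\<integral>\<^sup>+z. ennreal (exp (- \<theta> * x) * min x z) * indicator {0..} x \<partial>U) \<partial>lborel)"
  proof (rule nn_integral_cong)
    fix x
    show "ennreal (exp (- \<theta> * x) * G x) * indicator {0..} x = (\<integral>\<^sup>+z. ennreal (exp (- \<theta> * x) * min x z) * indicator {0..} x \<partial>U)"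
    proof (cases "0 \<le> x")
      case True
      have "(\<integral>\<^sup>+z. ennreal (exp (- \<theta> * x) * min x z) \<partial>U) = (\<integral>\<^sup>+z. ennreal (exp (- \<theta> * x)) * ennreal (min x z) \<partial>U)"
        using True by (intro nn_integral_cong) (simp add: ennreal_mult space_U)
      also have "\<dots> = ennreal (exp (- \<theta> * x)) * ennreal (G x)"
        using True by (subst nn_integral_cmult) (auto simp: nn_integral_min intro: measurable_U)
      finally show ?thesis using True by (simp add: ennreal_mult G_nonneg)
    qed simp
  qed
  also have "\<dots> = (\<integral>\<^sup>+z. (\<integral>\<^sup>+x. ennreal (exp (- \<theta> * x) * min x z) * indicator {0..} x \<partial>lborel) \<partial>U)"
    by (rule P.Fubini'[symmetric]) measurable
  also have "\<dots> = (\<integral>\<^sup>+z. ennreal ((1 - exp (- \<theta> * z)) / \<theta>\<^sup>2) \<partial>U)"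
    by (rule nn_integral_cong, subst nn_integral_exp_min[OF \<theta>]) (auto simp: space_U)
  also have "\<dots> = ennreal (LINT z|U. (1 - exp (- \<theta> * z)) / \<theta>\<^sup>2)"
    using integrable_one_minus_exp[of \<theta>] \<theta> one_minus_exp_bound(1)[of \<theta>]
    by (intro nn_integral_eq_integral) (auto simp: space_U intro!: AE_I2 divide_nonneg_nonneg)
  finally show ?thesis by simp
qed

text \<open>Serves both directions: it verifies that the constructed function is a scale function,
  and it expresses \<open>1 / \<psi>\<close> by the Bernstein function obtained from a given concave
  \<open>W\<close>.\<close>

lemma scale_function_laplace:
  assumes \<theta>: "0 < \<theta>" and nn: "0 \<le> \<kappa>" "0 \<le> d"
    and W: "\<And>x. 0 \<le> x \<Longrightarrow> W x = d + \<kappa> * x + G x" and Wm: "W \<in> borel_measurable borel"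
  shows "set_integrable lborel {0..} (\<lambda>x. exp (- \<theta> * x) * W x)"
    and "(LINT x:{0..}|lborel. exp (- \<theta> * x) * W x) = (\<kappa> + d * \<theta> + (LINT z|U. 1 - exp (- \<theta> * z))) / \<theta>\<^sup>2"
proof -
  define V where "V x = indicator {0..} x *\<^sub>R (exp (- \<theta> * x) * W x)" for x
  have V0: "0 \<le> V x" for x unfolding V_def using W G_nonneg nn by (auto simp: indicator_def)
  have [measurable]: "W \<in> borel_measurable borel" by (rule Wm)
  have Gm: "(\<lambda>x. ennreal (exp (- \<theta> * x) * G x) * indicator {0..} x) \<in> borel_measurable borel"
  proof -
    have "(\<lambda>x. ennreal (exp (- \<theta> * x) * G x) * indicator {0..} x) =
        (\<lambda>x. ennreal (exp (- \<theta> * x) * (W x - d - \<kappa> * x)) * indicator {0..} x)"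
      using W by (auto simp: fun_eq_iff indicator_def)
    then show ?thesis by simp
  qed
  have lin: "(\<integral>\<^sup>+x. ennreal (exp (- \<theta> * x) * x) * indicator {0..} x \<partial>lborel) = ennreal (1 / \<theta>\<^sup>2)"
  proof -
    have "(\<integral>\<^sup>+x. ennreal (exp (- \<theta> * x) * x) * indicator {0..} x \<partial>lborel) =
      ennreal (0 - (- (0 / \<theta> + 1 / \<theta>\<^sup>2) * exp (- \<theta> * 0)))"
    proof (rule nn_integral_FTC_atLeast)
      have *: "((\<lambda>x. (\<theta> * x) ^ k * exp (- (\<theta> * x))) \<longlongrightarrow> 0) at_top" for k
      proof -
        have "filterlim (\<lambda>x. \<theta> * x) at_top at_top"
          using \<theta> by (intro filterlim_tendsto_pos_mult_at_top[OF tendsto_const _ filterlim_ident])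
        from filterlim_compose[OF tendsto_power_div_exp_0 this, of k] show ?thesis
          by (simp add: exp_minus field_simps)
      qed
      have "((\<lambda>x. - (1 / \<theta>\<^sup>2) * ((\<theta> * x) ^ 1 * exp (- (\<theta> * x)) + (\<theta> * x) ^ 0 * exp (- (\<theta> * x)))) \<longlongrightarrow> - (1 / \<theta>\<^sup>2) * (0 + 0)) at_top"
        by (intro tendsto_intros *)
      moreover have "(\<lambda>x. - (1 / \<theta>\<^sup>2) * ((\<theta> * x) ^ 1 * exp (- (\<theta> * x)) + (\<theta> * x) ^ 0 * exp (- (\<theta> * x)))) =
         (\<lambda>x. - (x / \<theta> + 1 / \<theta>\<^sup>2) * exp (- \<theta> * x))"
        using \<theta> by (auto simp: fun_eq_iff field_simps power2_eq_square)
      ultimately show "((\<lambda>x. - (x / \<theta> + 1 / \<theta>\<^sup>2) * exp (- \<theta> * x)) \<longlongrightarrow> 0) at_top" by simp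
    qed (use \<theta> in \<open>auto intro!: derivative_eq_intros simp: field_simps power2_eq_square\<close>)
    then show ?thesis by simp
  qed
  have I0: "0 \<le> (LINT z|U. 1 - exp (- \<theta> * z))"
    using one_minus_exp_bound(1)[of \<theta>] \<theta> by (intro integral_nonneg_AE AE_I2) (auto simp: space_U)
  have "(\<integral>\<^sup>+x. ennreal (V x) \<partial>lborel) = (\<integral>\<^sup>+x. ennreal d * (ennreal (exp (- \<theta> * x)) * indicator {0..} x)
      + (ennreal \<kappa> * (ennreal (exp (- \<theta> * x) * x) * indicator {0..} x) + ennreal (exp (- \<theta> * x) * G x) * indicator {0..} x) \<partial>lborel)"
    using nn W G_nonneg
    by (intro nn_integral_cong)
       (auto simp: V_def indicator_def ennreal_mult''[symmetric] ennreal_plus[symmetric] algebra_simps simp del: ennreal_plus)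
  also have "\<dots> = ennreal d * ennreal (exp (- \<theta> * 0) / \<theta>) + (ennreal \<kappa> * ennreal (1 / \<theta>\<^sup>2) + ennreal ((LINT z|U. 1 - exp (- \<theta> * z)) / \<theta>\<^sup>2))"
    using Gm by (subst nn_integral_add, measurable)+ (simp only: nn_integral_cmult nn_integral_exp_atLeast[OF \<theta>] lin laplace_G[OF \<theta>] | subst nn_integral_cmult, measurable)+
  also have "\<dots> = ennreal ((\<kappa> + d * \<theta> + (LINT z|U. 1 - exp (- \<theta> * z))) / \<theta>\<^sup>2)"
    using nn \<theta> I0
    by (simp add: ennreal_mult''[symmetric] ennreal_plus[symmetric] del: ennreal_plus) (simp add: field_simps power2_eq_square)
  finally have e: "(\<integral>\<^sup>+x. ennreal (V x) \<partial>lborel) = ennreal ((\<kappa> + d * \<theta> + (LINT z|U. 1 - exp (- \<theta> * z))) / \<theta>\<^sup>2)" .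
  have "has_bochner_integral lborel V ((\<kappa> + d * \<theta> + (LINT z|U. 1 - exp (- \<theta> * z))) / \<theta>\<^sup>2)"
    by (rule has_bochner_integral_nn_integral) (use e V0 nn \<theta> I0 in \<open>auto simp: V_def[abs_def]\<close>)
  then show "set_integrable lborel {0..} (\<lambda>x. exp (- \<theta> * x) * W x)"
    "(LINT x:{0..}|lborel. exp (- \<theta> * x) * W x) = (\<kappa> + d * \<theta> + (LINT z|U. 1 - exp (- \<theta> * z))) / \<theta>\<^sup>2"
    unfolding set_integrable_def set_lebesgue_integral_def V_def[abs_def] by (auto simp: has_bochner_integral_iff)
qed

end

section \<open>Non-increasing densities and the process of a conjugate pair\<close>

locale decreasing_levy_density =
  fixes u :: "real \<Rightarrow> real" and \<Upsilon> :: "real measure"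
  assumes u_nonneg: "\<And>x. 0 < x \<Longrightarrow> 0 \<le> u x" and u_anti: "antimono_on {0<..} u"
    and density: "\<Upsilon> = density (restrict_space lborel {0<..}) (\<lambda>x. ennreal (u x))"
    and finite_min: "(\<integral>\<^sup>+x. ennreal (min 1 x) \<partial>\<Upsilon>) < \<infinity>"
begin

lemma u_measurable: "u \<in> borel_measurable (restrict_space lborel {0<..})"
proof -
  have "(\<lambda>x. - u x) \<in> borel_measurable (restrict_space borel {0<..})"
    using u_anti by (intro borel_measurable_mono_on_fnc) (auto simp: monotone_on_def)
  then have "(\<lambda>x. - (- u x)) \<in> borel_measurable (restrict_space borel {0<..})" by (rule borel_measurable_uminus)
  then show ?thesis
    by (simp add: measurable_cong_sets[OF sets_restrict_space_cong[OF sets_lborel] refl])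
qed

lemma integral_density_eq:
  fixes f :: "real \<Rightarrow> real"
  assumes f: "f \<in> borel_measurable borel"
  shows "(LINT x|\<Upsilon>. f x) = (LINT x:{0<..}|lborel. f x * u x)"
    and "integrable \<Upsilon> f \<longleftrightarrow> set_integrable lborel {0<..} (\<lambda>x. f x * u x)"
proof -
  have fm: "f \<in> borel_measurable (restrict_space lborel {0<..})"
    using f by (intro measurable_restrict_space1) simp
  have nn: "AE x in restrict_space lborel {0<..}. 0 \<le> u x"
    using u_nonneg by (intro AE_I2) (simp add: space_restrict_space)
  have "(LINT x|\<Upsilon>. f x) = (LINT x|restrict_space lborel {0<..}. u x *\<^sub>R f x)"
    unfolding density by (rule integral_density[OF fm u_measurable nn])
  also have "\<dots> = (LINT x:{0<..}|lborel. f x * u x)"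
    by (subst integral_restrict_space) (auto simp: set_lebesgue_integral_def mult.commute)
  finally show "(LINT x|\<Upsilon>. f x) = (LINT x:{0<..}|lborel. f x * u x)" .
  have "integrable \<Upsilon> f \<longleftrightarrow> integrable (restrict_space lborel {0<..}) (\<lambda>x. u x *\<^sub>R f x)"
    unfolding density by (rule integrable_density[OF fm u_measurable nn])
  also have "\<dots> \<longleftrightarrow> set_integrable lborel {0<..} (\<lambda>x. f x * u x)"
    by (subst integrable_restrict_space) (auto simp: set_integrable_def mult.commute)
  finally show "integrable \<Upsilon> f \<longleftrightarrow> set_integrable lborel {0<..} (\<lambda>x. f x * u x)" .
qed

lemma sets_\<Upsilon>: "sets \<Upsilon> = sets (restrict_space borel {0<..})"
  unfolding density by (simp add: sets_restrict_space)

sublocale \<Upsilon>: levy_measure_half_line \<Upsilon>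
  by unfold_locales (rule sets_\<Upsilon>, rule finite_min)

lemma set_integrable_min: "set_integrable lborel {0<..} (\<lambda>x. min 1 x * u x)"
  using \<Upsilon>.integrable_min1 integral_density_eq(2)[of "\<lambda>x. min 1 x"] by simp

lemma complex_integral_one_minus_exp:
  "(CLINT x:{0<..}|lborel. (1 - exp (- complex_of_real \<theta> * of_real x)) * of_real (u x)) =
    of_real (LINT x|\<Upsilon>. 1 - exp (- \<theta> * x))"
proof -
  have e: "indicator {0<..} x *\<^sub>R ((1 - exp (- complex_of_real \<theta> * of_real x)) * of_real (u x)) =
      complex_of_real (indicator {0<..} x *\<^sub>R ((1 - exp (- \<theta> * x)) * u x))" for x
    by (simp add: exp_of_real[symmetric] scaleR_conv_of_real del: exp_of_real)
  show ?thesis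
    unfolding set_lebesgue_integral_def e integral_complex_of_real
    by (subst integral_density_eq(1)) (simp_all add: set_lebesgue_integral_def)
qed

end

lemma bernstein_rep_levy_measure: "bernstein_rep \<kappa> d \<Upsilon> \<phi> \<Longrightarrow> levy_measure_half_line \<Upsilon>"
  by (simp add: bernstein_rep_def levy_measure_half_line_def)

lemma bernstein_rep_nonneg:
  assumes "bernstein_rep \<kappa> d \<Upsilon> \<phi>" "0 \<le> \<theta>" shows "0 \<le> \<phi> \<theta>"
proof -
  interpret levy_measure_half_line \<Upsilon> using assms(1) by (rule bernstein_rep_levy_measure)
  have "0 \<le> (LINT x|\<Upsilon>. 1 - exp (- \<theta> * x))"
    using one_minus_exp_bound(1)[OF assms(2)] by (intro integral_nonneg_AE AE_I2) (auto simp: space_U)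
  then show ?thesis using assms by (auto simp: bernstein_rep_def)
qed

text \<open>For \<open>\<theta> \<ge> 1\<close> the integrand is at most
  \<open>\<theta> * min 1 x\<close>. After multiplication by \<open>\<theta>\<close> this becomes
  the quadratic growth of \<open>\<psi>\<close>.\<close>

lemma bernstein_rep_linear_growth:
  assumes "bernstein_rep \<kappa> d \<Upsilon> \<phi>"
  shows "\<exists>C\<ge>0. \<forall>\<theta>\<ge>1. \<phi> \<theta> \<le> C * \<theta>"
proof -
  interpret levy_measure_half_line \<Upsilon> using assms(1) by (rule bernstein_rep_levy_measure)
  define I where "I = (LINT x|\<Upsilon>. min 1 x)"
  have I: "0 \<le> I" unfolding I_def by (intro integral_nonneg_AE AE_I2) (auto simp: space_U)
  show ?thesis
  proof (intro exI[of _ "\<kappa> + d + I"] conjI allI impI)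
    show "0 \<le> \<kappa> + d + I" using assms I by (simp add: bernstein_rep_def)
    fix \<theta> :: real assume \<theta>: "1 \<le> \<theta>"
    have "(LINT x|\<Upsilon>. 1 - exp (- \<theta> * x)) \<le> (LINT x|\<Upsilon>. \<theta> * min 1 x)"
    proof (rule integral_mono)
      show "1 - exp (- \<theta> * x) \<le> \<theta> * min 1 x" if "x \<in> space \<Upsilon>" for x
        using one_minus_exp_bound(2)[of \<theta> x] \<theta> that by (simp add: space_U max_def)
    qed (use integrable_one_minus_exp[of \<theta>] integrable_min1 \<theta> in auto)
    also have "\<dots> = \<theta> * I" by (simp add: I_def)
    moreover have "\<kappa> \<le> \<kappa> * \<theta>" using assms \<theta> by (simp add: bernstein_rep_def mult_le_cancel_left1)
    ultimately show "\<phi> \<theta> \<le> (\<kappa> + d + I) * \<theta>"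
      using assms \<theta> by (simp add: bernstein_rep_def algebra_simps)
  qed
qed

text \<open>The quotient is \<open>\<theta>\<close> times the one for \<open>\<phi>\<close>, so its
  limit at 0 is \<open>0 * \<phi> 0\<close>, the value of \<open>\<psi>\<close> there.\<close>

lemma eq_quotient_psi:
  assumes conj: "conjugate_bernstein \<phi> \<phi>s" and \<psi>: "\<And>\<theta>. 0 \<le> \<theta> \<Longrightarrow> \<psi> \<theta> = \<theta> * \<phi> \<theta>"
  shows "eq_quotient \<psi> (\<lambda>\<theta>. \<theta>\<^sup>2) \<phi>s"
proof -
  have q: "\<And>\<theta>. 0 < \<theta> \<Longrightarrow> \<phi>s \<theta> \<noteq> 0 \<and> \<phi> \<theta> = \<theta> / \<phi>s \<theta>" and l: "((\<lambda>\<theta>. \<theta> / \<phi>s \<theta>) \<longlongrightarrow> \<phi> 0) (at_right 0)"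
    using conj by (auto simp: conjugate_bernstein_def eq_quotient_def)
  have "((\<lambda>\<theta>. \<theta> * (\<theta> / \<phi>s \<theta>)) \<longlongrightarrow> 0 * \<phi> 0) (at_right 0)" by (intro tendsto_intros l)
  then show ?thesis unfolding eq_quotient_def using q \<psi> by (auto simp: power2_eq_square)
qed

lemma scale_function_of_bernstein:
  assumes rep: "bernstein_rep \<kappa> d \<Upsilon> \<phi>"
    and W: "\<And>x. 0 \<le> x \<Longrightarrow> W x = d + \<kappa> * x + (LINT y:{0..x}|lborel. measure \<Upsilon> {y<..})" "\<And>x. x < 0 \<Longrightarrow> W x = 0"
    and \<psi>: "\<And>\<theta>. 0 < \<theta> \<Longrightarrow> 1 / \<psi> \<theta> = \<phi> \<theta> / \<theta>\<^sup>2"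
  shows "is_scale_function \<psi> W" "concave_on {0..} W"
proof -
  interpret levy_measure_half_line \<Upsilon> using rep by (rule bernstein_rep_levy_measure)
  have nn: "0 \<le> \<kappa>" "0 \<le> d" using rep by (auto simp: bernstein_rep_def)
  have WG: "W x = d + \<kappa> * x + G x" if "0 \<le> x" for x
    using W(1)[OF that] integral_tail(2)[OF that] by (simp add: tail_def[abs_def])
  have cont: "continuous_on {0..} W"
    by (subst continuous_on_cong[OF refl WG]) (auto intro!: continuous_intros continuous_G)
  have "W = (\<lambda>x. indicator {0..} x *\<^sub>R W x)" using W(2) by (auto simp: fun_eq_iff indicator_def)
  also have "\<dots> \<in> borel_measurable borel" using cont by (intro borel_measurable_continuous_on_indicator) auto
  finally have Wm: "W \<in> borel_measurable borel" .
  have "0 \<le> W x" for x using W(2)[of x] WG[of x] G_nonneg[of x] nn by (cases "x < 0") auto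
  moreover have "set_integrable lborel {0..} (\<lambda>x. exp (- \<theta> * x) * W x) \<and> (LINT x:{0..}|lborel. exp (- \<theta> * x) * W x) = 1 / \<psi> \<theta>"
    if "0 < \<theta>" for \<theta>
    using scale_function_laplace[OF that nn WG Wm] \<psi>[OF that] rep that by (auto simp: bernstein_rep_def)
  ultimately show "is_scale_function \<psi> W" using cont W(2) by (auto simp: is_scale_function_def)
  show "concave_on {0..} W"
    unfolding concave_on_iff
  proof (intro conjI ballI allI impI)
    fix x y a b :: real assume xy: "x \<in> {0..}" "y \<in> {0..}" and ab: "0 \<le> a" "0 \<le> b" "a + b = 1"
    have "a * G x + b * G y \<le> G (a *\<^sub>R x + b *\<^sub>R y)"
      using concave_G xy ab unfolding concave_on_iff by blast
    moreover have "a * d + b * d = d" using ab by (simp add: distrib_right[symmetric])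
    moreover have "0 \<le> a * x + b * y" using xy ab by simp
    ultimately show "a * W x + b * W y \<le> W (a *\<^sub>R x + b *\<^sub>R y)"
      using xy by (simp add: WG algebra_simps)
  qed simp
qed

lemma spectrally_negative_exists:
  assumes rep: "bernstein_rep \<kappa> d \<Upsilon> \<phi>" and dens: "has_nonincreasing_density \<Upsilon>" and pos: "0 < \<phi> 1"
  shows "\<exists>(M :: (real \<Rightarrow> real) measure) X. spectrally_negative M X \<and> \<not> drifts_to_minus_infinity M X \<and>
    has_laplace_exponent M X (\<lambda>\<theta>. \<theta> * \<phi> \<theta>)"
proof -
  obtain u where u: "\<And>x. 0 < x \<Longrightarrow> 0 \<le> u x" "antimono_on {0<..} u"
    "\<Upsilon> = density (restrict_space lborel {0<..}) (\<lambda>x. ennreal (u x))"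
    using dens unfolding has_nonincreasing_density_def by blast
  have nn: "0 \<le> \<kappa>" "0 \<le> d" and fin: "(\<integral>\<^sup>+x. ennreal (min 1 x) \<partial>\<Upsilon>) < \<infinity>"
    and \<phi>: "\<And>\<theta>. 0 \<le> \<theta> \<Longrightarrow> \<phi> \<theta> = \<kappa> + d * \<theta> + (LINT x|\<Upsilon>. 1 - exp (- \<theta> * x))"
    using rep by (auto simp: bernstein_rep_def)
  interpret decreasing_levy_density u \<Upsilon> using u fin by unfold_locales
  define \<Psi> where "\<Psi> z = z * (of_real \<kappa> + of_real d * z +
    (CLINT x:{0<..}|lborel. (1 - exp (- z * of_real x)) * of_real (u x)))" for z
  define \<psi> where "\<psi> \<theta> = \<theta> * \<phi> \<theta>" for \<theta>
  have "infdiv \<Psi>" unfolding \<Psi>_def[abs_def]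
    using nn(2) u(1,2) set_integrable_min by (rule infdiv_times_bernstein)
  then obtain \<mu> where \<mu>: "convolution_semigroup \<mu>"
    "\<And>t z. 0 \<le> t \<Longrightarrow> 0 \<le> Re z \<Longrightarrow> integrable (\<mu> t) (\<lambda>x. exp (z * complex_of_real x))"
    "\<And>t z. 0 \<le> t \<Longrightarrow> 0 \<le> Re z \<Longrightarrow> (LINT x|\<mu> t. exp (z * complex_of_real x)) = exp (of_real t * \<Psi> z)"
    by (rule semigroup_of_infdiv) blast
  have growth: "\<exists>C\<ge>0. \<forall>\<theta>\<ge>1. \<psi> \<theta> \<le> C * \<theta>\<^sup>2"
  proof -
    obtain C where C: "C \<ge> 0" "\<And>\<theta>. 1 \<le> \<theta> \<Longrightarrow> \<phi> \<theta> \<le> C * \<theta>" using bernstein_rep_linear_growth[OF rep] by blast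
    have "\<psi> \<theta> \<le> C * \<theta>\<^sup>2" if "1 \<le> \<theta>" for \<theta>
      using mult_left_mono[OF C(2)[OF that], of \<theta>] that by (simp add: \<psi>_def power2_eq_square mult_ac)
    then show ?thesis using C(1) by blast
  qed
  interpret spectrally_negative_semigroup \<mu> \<Psi> \<psi>
  proof (intro spectrally_negative_semigroup.intro spectrally_negative_semigroup_axioms.intro \<mu> growth)
    show "\<Psi> (of_real \<theta>) = of_real (\<psi> \<theta>)" if "0 \<le> \<theta>" for \<theta>
      unfolding \<Psi>_def \<psi>_def complex_integral_one_minus_exp \<phi>[OF that] by simp
  qed
  obtain M :: "(real \<Rightarrow> real) measure" and X where
    levy: "levy_process M X" and jumps: "AE \<omega> in M. no_positive_jumps (\<lambda>t. X t \<omega>)"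
    and law: "\<And>t. 0 \<le> t \<Longrightarrow> distr M borel (X t) = \<mu> t"
    using levy_process_exists by blast
  have Xm: "X t \<in> borel_measurable M" if "0 \<le> t" for t using levy that by (simp add: levy_process_def)
  interpret L: levy_with_exponent M X \<psi>
  proof
    show "levy_process M X" by (rule levy)
    fix t \<theta> :: real assume t: "0 \<le> t" "0 \<le> \<theta>"
    show "integrable M (\<lambda>\<omega>. exp (\<theta> * X t \<omega>))"
      using integrable_exp[OF t] Xm[OF t(1)] unfolding law[OF t(1), symmetric] by (subst (asm) integrable_distr_eq) auto
    show "(LINT \<omega>|M. exp (\<theta> * X t \<omega>)) = exp (t * \<psi> \<theta>)"
      using integral_exp[OF t] Xm[OF t(1)] unfolding law[OF t(1), symmetric] by (subst (asm) integral_distr) auto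
  qed
  have "\<not> drifts_to_minus_infinity M X"
    using growth by (intro L.not_drifts_to_minus_infinity) (auto simp: \<psi>_def intro!: mult_nonneg_nonneg bernstein_rep_nonneg[OF rep])
  \<comment> \<open>Decreasing paths would make the mean of \<open>exp (X 1)\<close> at most 1,
    while its logarithm is \<open>\<phi> 1 > 0\<close>.\<close>
  moreover have "\<not> subordinator M (\<lambda>t \<omega>. - X t \<omega>)"
  proof
    assume "subordinator M (\<lambda>t \<omega>. - X t \<omega>)"
    then have "AE \<omega> in M. mono_on {0..} (\<lambda>t. - X t \<omega>)" by (simp add: subordinator_def)
    then have "AE \<omega> in M. exp (1 * X 1 \<omega>) \<le> 1"
      using L.X_0
    proof eventually_elim
      case (elim \<omega>)
      then have "- X 0 \<omega> \<le> - X 1 \<omega>" by (intro monotone_onD[OF elim(1)]) auto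
      then show ?case using elim(2) by simp
    qed
    then have "(LINT \<omega>|M. exp (1 * X 1 \<omega>)) \<le> (LINT \<omega>|M. 1)"
      using L.integrable_exp[of 1 1] by (intro integral_mono_AE) auto
    then show False using L.integral_exp[of 1 1] pos L.prob_space by (simp add: \<psi>_def)
  qed
  moreover have "has_laplace_exponent M X (\<lambda>\<theta>. \<theta> * \<phi> \<theta>)"
    unfolding has_laplace_exponent_def using L.integrable_exp[of 1] L.integral_exp[of 1] by (auto simp: \<psi>_def)
  ultimately show ?thesis using levy jumps by (auto simp: spectrally_negative_def)
qed

theorem concave_scale_function_of_conjugate_pair:
  assumes conj: "conjugate_bernstein \<phi> \<phi>s" and rep: "bernstein_rep \<kappa> d \<Upsilon> \<phi>" "bernstein_rep \<kappa>s ds \<Upsilon>s \<phi>s"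
    and dens: "has_nonincreasing_density \<Upsilon>"
  shows "\<exists>(M::(real \<Rightarrow> real) measure) (X::real \<Rightarrow> (real \<Rightarrow> real) \<Rightarrow> real) (\<psi>::real \<Rightarrow> real) (W::real \<Rightarrow> real).
    spectrally_negative M X \<and> \<not> drifts_to_minus_infinity M X \<and> has_laplace_exponent M X \<psi> \<and>
    eq_quotient \<psi> (\<lambda>\<theta>. \<theta>\<^sup>2) \<phi>s \<and> (\<forall>\<theta>\<ge>0. \<psi> \<theta> = \<theta> * \<phi> \<theta>) \<and> is_scale_function \<psi> W \<and> concave_on {0..} W \<and>
    (\<forall>x\<ge>0. W x = ds + \<kappa>s * x + (LINT y:{0..x}|lborel. measure \<Upsilon>s {y<..}))"
proof -
  have q: "\<And>\<theta>. 0 < \<theta> \<Longrightarrow> \<phi>s \<theta> \<noteq> 0 \<and> \<phi> \<theta> = \<theta> / \<phi>s \<theta>"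
    using conj by (auto simp: conjugate_bernstein_def eq_quotient_def)
  \<comment> \<open>Conjugacy excludes \<open>\<phi> = 0\<close>, which would belong to the constant
    process.\<close>
  have "\<phi> 1 \<noteq> 0" using q[of 1] by simp
  then have "0 < \<phi> 1" using bernstein_rep_nonneg[OF rep(1), of 1] by simp
  then obtain M :: "(real \<Rightarrow> real) measure" and X where
    MX: "spectrally_negative M X" "\<not> drifts_to_minus_infinity M X" "has_laplace_exponent M X (\<lambda>\<theta>. \<theta> * \<phi> \<theta>)"
    using spectrally_negative_exists[OF rep(1) dens] by blast
  define W where "W x = (if 0 \<le> x then ds + \<kappa>s * x + (LINT y:{0..x}|lborel. measure \<Upsilon>s {y<..}) else 0)" for x
  have s: "is_scale_function (\<lambda>\<theta>. \<theta> * \<phi> \<theta>) W" "concave_on {0..} W"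
  proof -
    have "1 / (\<theta> * \<phi> \<theta>) = \<phi>s \<theta> / \<theta>\<^sup>2" if "0 < \<theta>" for \<theta>
      using q[OF that] by (simp add: power2_eq_square)
    then show "is_scale_function (\<lambda>\<theta>. \<theta> * \<phi> \<theta>) W" "concave_on {0..} W"
      by (intro scale_function_of_bernstein[OF rep(2)]; simp add: W_def)+
  qed
  show ?thesis
    using MX s eq_quotient_psi[OF conj, of "\<lambda>\<theta>. \<theta> * \<phi> \<theta>"]
    by (intro exI[of _ M] exI[of _ X] exI[of _ "\<lambda>\<theta>. \<theta> * \<phi> \<theta>"] exI[of _ W]) (auto simp: W_def)
qed

section \<open>The representing measure of a concave function\<close>

locale concave_half_line =
  fixes W :: "real \<Rightarrow> real"
  assumes concave: "concave_on {0..} W" and nonneg: "\<And>x. 0 \<le> W x" and cont: "continuous_on {0..} W"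
begin

definition slope :: "real \<Rightarrow> real \<Rightarrow> real" where
  "slope x y = (W y - W x) / (y - x)"

lemma three_points:
  assumes "0 \<le> x" "x < y" "y < z"
  shows "(z - y) * W x + (y - x) * W z \<le> (z - x) * W y"
proof -
  define a where "a = (z - y) / (z - x)"
  define b where "b = (y - x) / (z - x)"
  have ab: "0 \<le> a" "0 \<le> b" "a + b = 1" using assms by (auto simp: a_def b_def add_divide_distrib[symmetric])
  have "a * W x + b * W z \<le> W (a *\<^sub>R x + b *\<^sub>R z)"
    using concave assms ab unfolding concave_on_iff by auto
  also have "a *\<^sub>R x + b *\<^sub>R z = y"
  proof -
    have "a *\<^sub>R x + b *\<^sub>R z = ((z - y) * x + (y - x) * z) / (z - x)"
      by (simp add: a_def b_def add_divide_distrib)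
    also have "(z - y) * x + (y - x) * z = y * (z - x)" by (simp add: algebra_simps)
    finally show ?thesis using assms by simp
  qed
  finally have "(z - x) * (a * W x + b * W z) \<le> (z - x) * W y" using assms by (intro mult_left_mono) auto
  moreover have "(z - x) * a = z - y" "(z - x) * b = y - x" using assms by (auto simp: a_def b_def)
  ultimately show ?thesis by (simp add: distrib_left mult.assoc[symmetric])
qed

lemma slope_left_le: "0 \<le> x \<Longrightarrow> x < y \<Longrightarrow> y < z \<Longrightarrow> slope y z \<le> slope x y"
  using three_points[of x y z] unfolding slope_def by (simp add: divide_le_eq le_divide_eq) (simp add: algebra_simps)

text \<open>A nonnegative concave function on a half-line cannot decrease: after a negative slope it
  would fall below zero.\<close>

lemma slope_nonneg:
  assumes "0 \<le> x" "x < y" shows "0 \<le> slope x y"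
proof (rule ccontr)
  assume "\<not> 0 \<le> slope x y"
  then have s: "slope x y < 0" by simp
  \<comment> \<open>The line through \<open>(y, W y)\<close> with slope \<open>slope x y\<close> has
    the negative height \<open>slope x y\<close> at this \<open>z\<close>, and \<open>W\<close> lies
    below that line.\<close>
  define z where "z = y + 1 + W y / (- slope x y)"
  have z: "y < z" using s nonneg[of y] by (simp add: z_def add_pos_nonneg divide_nonneg_neg[THEN le_imp_neg_le, simplified] divide_nonneg_pos)
  have "slope y z \<le> slope x y" using assms z by (rule slope_left_le)
  then have "W z - W y \<le> slope x y * (z - y)" using z unfolding slope_def[of y z] by (simp add: divide_le_eq)
  also have "\<dots> = slope x y - W y" using s by (simp add: z_def field_simps)
  finally have "W z \<le> slope x y" by simp
  then show False using s nonneg[of z] by simp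
qed

text \<open>The right derivative of \<open>W\<close>: by concavity the slopes increase as
  \<open>h\<close> shrinks, so the limit is a supremum.\<close>

definition w :: "real \<Rightarrow> real" where
  "w x = (SUP h\<in>{0<..}. slope x (x + h))"

lemma bdd_slopes: "0 < x \<Longrightarrow> bdd_above ((\<lambda>h. slope x (x + h)) ` {0<..})"
  by (rule bdd_aboveI2[where M = "slope 0 x"]) (auto intro: slope_left_le)

lemma slope_le_w: "0 < x \<Longrightarrow> x < y \<Longrightarrow> slope x y \<le> w x"
  unfolding w_def using cSUP_upper[OF _ bdd_slopes, of "y - x" x] by simp

lemma w_le_slope: "0 \<le> x \<Longrightarrow> x < y \<Longrightarrow> w y \<le> slope x y"
  unfolding w_def by (rule cSUP_least) (auto intro: slope_left_le)

lemma w_nonneg: "0 < x \<Longrightarrow> 0 \<le> w x"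
  using slope_nonneg[of x "x + 1"] slope_le_w[of x "x + 1"] by simp

lemma w_antimono: "0 < x \<Longrightarrow> x \<le> y \<Longrightarrow> w y \<le> w x"
  using w_le_slope[of x y] slope_le_w[of x y] by (cases "x = y") auto

text \<open>Together with monotonicity this amounts to right-continuity of \<open>w\<close>. It
  holds because the slope of a chord depends continuously on its left end, as \<open>W\<close> is
  continuous.\<close>

lemma w_right_open:
  assumes "0 < x" "a < w x" shows "\<exists>y>x. a < w y"
proof -
  obtain h where h: "0 < h" "a < slope x (x + h)"
    using assms less_cSUP_iff[OF _ bdd_slopes[OF assms(1)], of a] unfolding w_def by auto
  have "((\<lambda>t. slope t (x + h)) \<longlongrightarrow> slope x (x + h)) (at_right x)"
  proof -
    have "(W \<longlongrightarrow> W x) (at x within {0..})" using cont assms(1) by (auto simp: continuous_on_def)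
    then have "(W \<longlongrightarrow> W x) (at_right x)" by (rule tendsto_within_subset) (use assms in auto)
    then show ?thesis unfolding slope_def using h by (intro tendsto_intros) auto
  qed
  then have "\<forall>\<^sub>F t in at_right x. a < slope t (x + h)" using h(2) by (rule order_tendstoD(1))
  then obtain b where b: "b > x" "\<And>t. x < t \<Longrightarrow> t < b \<Longrightarrow> a < slope t (x + h)"
    unfolding eventually_at_right_field by auto
  define y where "y = (x + min b (x + h)) / 2"
  have y: "x < y" "y < b" "y < x + h" using b(1) h(1) by (auto simp: y_def)
  then have "a < slope y (x + h)" by (intro b)
  also have "\<dots> \<le> w y" using y assms by (intro slope_le_w) auto
  finally show ?thesis using y by blast
qed

lemma increment_between:
  assumes "0 < x" "x \<le> y"
  shows "(y - x) * w y \<le> W y - W x" "W y - W x \<le> (y - x) * w x"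
proof -
  have "(y - x) * w y \<le> W y - W x \<and> W y - W x \<le> (y - x) * w x"
  proof (cases "x = y")
    case False
    then show ?thesis using w_le_slope[of x y] slope_le_w[of x y] assms unfolding slope_def
      by (simp add: le_divide_eq divide_le_eq mult.commute)
  qed simp
  then show "(y - x) * w y \<le> W y - W x" "W y - W x \<le> (y - x) * w x" by auto
qed

lemma w_integrable:
  assumes "0 < a" shows "set_integrable lborel {a<..b} w"
proof -
  have "(\<lambda>x. - w x) \<in> borel_measurable (restrict_space borel {a<..b})"
    using assms by (intro borel_measurable_mono_on_fnc monotone_onI) (auto intro!: w_antimono)
  then have "(\<lambda>x. - (- w x)) \<in> borel_measurable (restrict_space borel {a<..b})" by (rule borel_measurable_uminus)
  then have m: "(\<lambda>x. indicator {a<..b} x *\<^sub>R w x) \<in> borel_measurable borel"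
    by (subst (asm) borel_measurable_restrict_space_iff) (auto simp: mult.commute)
  show ?thesis unfolding set_integrable_def
  proof (rule Bochner_Integration.integrable_bound)
    show "integrable lborel (\<lambda>x. w a * indicator {a<..b} x)"
      by (cases "a \<le> b") (auto intro!: integrable_mult_right integrable_real_indicator)
    show "AE x in lborel. norm (indicator {a<..b} x *\<^sub>R w x) \<le> norm (w a * indicator {a<..b} x)"
      using assms w_nonneg w_antimono by (intro AE_I2) (auto simp: indicator_def)
  qed (use m in simp)
qed

text \<open>The increments of \<open>W\<close> and of the integral both lie between
  \<open>(y - x) * w y\<close> and \<open>(y - x) * w x\<close>. Over \<open>n\<close> equal parts
  these errors telescope to \<open>(b - a) * (w a - w b) / n\<close>, which tends to 0.\<close>

lemma integral_w:
  assumes a: "0 < a" and ab: "a \<le> b"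
  shows "(LINT y:{a<..b}|lborel. w y) = W b - W a"
proof -
  define F where "F x = W x - (LINT y:{a<..x}|lborel. w y)" for x
  have step: "\<bar>F y - F x\<bar> \<le> (y - x) * (w x - w y)" if "a \<le> x" "x \<le> y" for x y
  proof -
    have x: "0 < x" using a that by simp
    have "(LINT y:{a<..y}|lborel. w y) = (LINT y:{a<..x}|lborel. w y) + (LINT y:{x<..y}|lborel. w y)"
    proof -
      have u: "{a<..y} = {a<..x} \<union> {x<..y}" using that by auto
      show ?thesis unfolding u using a x by (intro set_integral_Un w_integrable) auto
    qed
    then have "F y - F x = (W y - W x) - (LINT y:{x<..y}|lborel. w y)" by (simp add: F_def)
    moreover have c: "(LINT t:{x<..y}|lborel. c) = (y - x) * c" for c :: real
      using that by (simp add: set_lebesgue_integral_def)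
    have ci: "set_integrable lborel {x<..y} (\<lambda>t. c)" for c :: real
      unfolding set_integrable_def using that by (cases "c = 0") (auto intro!: integrable_real_indicator)
    have "(LINT t:{x<..y}|lborel. w t) \<le> (LINT t:{x<..y}|lborel. w x)"
      using x by (intro set_integral_mono w_integrable ci) (auto intro: w_antimono)
    moreover have "(LINT t:{x<..y}|lborel. w y) \<le> (LINT t:{x<..y}|lborel. w t)"
      using x by (intro set_integral_mono w_integrable ci) (auto intro: w_antimono)
    ultimately show ?thesis
      using increment_between[OF x that(2)] unfolding c by (simp add: abs_le_iff right_diff_distrib)
  qed
  have "\<bar>F b - F a\<bar> \<le> (b - a) * (w a - w b) / real n" if n: "n > 0" for n :: nat
  proof -
    define t where "t i = a + (b - a) * real i / real n" for i
    have t: "a \<le> t i" "t i \<le> t (Suc i)" "t (Suc i) - t i = (b - a) / real n" for i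
    proof -
      show "a \<le> t i" using ab by (simp add: t_def)
      show "t i \<le> t (Suc i)" using ab unfolding t_def by (intro add_left_mono divide_right_mono mult_left_mono) auto
      show "t (Suc i) - t i = (b - a) / real n"
        by (simp add: t_def diff_divide_distrib[symmetric]) (simp add: algebra_simps)
    qed
    have "F b - F a = (\<Sum>i<n. F (t (Suc i)) - F (t i))"
      using n by (subst sum_lessThan_telescope) (simp add: t_def)
    also have "\<bar>\<dots>\<bar> \<le> (\<Sum>i<n. \<bar>F (t (Suc i)) - F (t i)\<bar>)" by (rule sum_abs)
    also have "\<dots> \<le> (\<Sum>i<n. (b - a) / real n * (w (t i) - w (t (Suc i))))"
      using step[OF t(1,2)] unfolding t(3) by (intro sum_mono)
    also have "\<dots> = (b - a) / real n * (w (t 0) - w (t n))"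
      unfolding sum_distrib_left[symmetric] by (subst sum_lessThan_telescope') simp
    also have "\<dots> = (b - a) * (w a - w b) / real n" using n by (simp add: t_def)
    finally show ?thesis .
  qed
  then have "\<forall>n\<ge>1. \<bar>F b - F a\<bar> \<le> (b - a) * (w a - w b) / real n" by auto
  moreover have "(\<lambda>n. (b - a) * (w a - w b) / real n) \<longlonglongrightarrow> 0" by (rule lim_const_over_n)
  ultimately have "\<bar>F b - F a\<bar> \<le> 0" using LIMSEQ_le_const by metis
  moreover have "F a = W a" by (simp add: F_def set_lebesgue_integral_def)
  ultimately show ?thesis by (simp add: F_def)
qed

section \<open>The measure with prescribed tail\<close>

definition w_inf :: real where "w_inf = (INF x\<in>{0<..}. w x)"

text \<open>Subtracting the limiting slope leaves a function that vanishes at infinity, as a tail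
  must; the limiting slope itself becomes \<open>\<kappa>s\<close>.\<close>

definition v :: "real \<Rightarrow> real" where "v x = w x - w_inf"

lemma bdd_w: "bdd_below (w ` {0<..})"
  by (rule bdd_belowI2[where m = 0]) (auto intro: w_nonneg)

lemma w_inf_nonneg: "0 \<le> w_inf"
  unfolding w_inf_def by (rule cINF_greatest) (auto intro: w_nonneg)

lemma v_nonneg: "0 < x \<Longrightarrow> 0 \<le> v x"
  unfolding v_def w_inf_def using cINF_lower[OF bdd_w, of x] by simp

lemma v_antimono: "0 < x \<Longrightarrow> x \<le> y \<Longrightarrow> v y \<le> v x"
  by (simp add: v_def w_antimono)

lemma v_right_open: "0 < x \<Longrightarrow> a < v x \<Longrightarrow> \<exists>y>x. a < v y"
  using w_right_open[of x "a + w_inf"] by (auto simp: v_def less_diff_eq)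

lemma v_small: "0 < a \<Longrightarrow> \<exists>x>0. v x < a"
  using cINF_less_iff[OF _ bdd_w, of "w_inf + a"] by (auto simp: v_def w_inf_def)

text \<open>The open interval from 0 to the supremum of \<open>v\<close>, on which
  \<open>ginv\<close> is the supremum of a nonempty bounded set.\<close>

definition D :: "real set" where "D = {a. 0 < a \<and> (\<exists>y>0. a < v y)}"

definition ginv :: "real \<Rightarrow> real" where "ginv a = Sup {y. 0 < y \<and> a < v y}"

text \<open>Right-continuity of \<open>v\<close>, in the form \<open>v_right_open\<close>, makes the
  equivalence hold with strict inequalities on both sides; \<open>v_small\<close> bounds the
  supremum.\<close>

lemma less_ginv_iff:
  assumes "a \<in> D" "0 < y" shows "y < ginv a \<longleftrightarrow> a < v y"
proof -
  have ne: "{y. 0 < y \<and> a < v y} \<noteq> {}" using assms by (auto simp: D_def)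
  obtain x where x: "0 < x" "v x < a" using v_small assms by (auto simp: D_def)
  have bdd: "bdd_above {y. 0 < y \<and> a < v y}"
  proof (rule bdd_aboveI[where M = x])
    fix y assume "y \<in> {y. 0 < y \<and> a < v y}"
    then show "y \<le> x" using v_antimono[of x y] x by (cases "y \<le> x") auto
  qed
  show ?thesis unfolding ginv_def less_cSup_iff[OF ne bdd]
  proof
    assume "\<exists>z\<in>{y. 0 < y \<and> a < v y}. y < z"
    then obtain z where "a < v z" "y < z" by auto
    then show "a < v y" using v_antimono[of y z] assms(2) by simp
  next
    assume "a < v y"
    then obtain z where "y < z" "a < v z" using v_right_open[OF assms(2)] by blast
    then show "\<exists>z\<in>{y. 0 < y \<and> a < v y}. y < z" using assms(2) by (intro bexI[of _ z]) auto
  qed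
qed

lemma ginv_pos: "a \<in> D \<Longrightarrow> 0 < ginv a"
proof -
  assume a: "a \<in> D"
  then obtain y where "0 < y" "a < v y" by (auto simp: D_def)
  then show "0 < ginv a" using less_ginv_iff[OF a, of y] by simp
qed

lemma D_measurable: "D \<in> sets borel"
proof -
  have "D = (\<Union>y\<in>{0<..}. {0<..<v y})" by (auto simp: D_def)
  then show ?thesis by (simp add: open_UN)
qed

lemma ginv_measurable: "ginv \<in> measurable (restrict_space lborel D) (restrict_space borel {0<..})"
proof (rule measurable_restrict_space2)
  show "ginv \<in> space (restrict_space lborel D) \<rightarrow> {0<..}"
    by (auto simp: space_restrict_space ginv_pos)
  have "(\<lambda>a. - ginv a) \<in> borel_measurable (restrict_space borel D)"
  proof (intro borel_measurable_mono_on_fnc monotone_onI)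
    fix a b assume ab: "a \<in> D" "b \<in> D" "a \<le> b"
    show "- ginv a \<le> - ginv b"
    proof (rule ccontr)
      assume "\<not> - ginv a \<le> - ginv b"
      then have l: "ginv a < ginv b" by simp
      then have "b < v (ginv a)" using less_ginv_iff[OF ab(2) ginv_pos[OF ab(1)]] by simp
      then have "ginv a < ginv a" using less_ginv_iff[OF ab(1) ginv_pos[OF ab(1)]] ab(3) by simp
      then show False by simp
    qed
  qed
  then have "(\<lambda>a. - (- ginv a)) \<in> borel_measurable (restrict_space borel D)" by (rule borel_measurable_uminus)
  then show "ginv \<in> borel_measurable (restrict_space lborel D)"
    by (simp add: measurable_cong_sets[OF sets_restrict_space_cong[OF sets_lborel] refl])
qed

text \<open>The measure with tail \<open>v\<close>: the image of Lebesgue measure under the generalized inverse of \<open>v\<close>.\<close>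

definition levy :: "real measure" where
  "levy = distr (restrict_space lborel D) (restrict_space borel {0<..}) ginv"

lemma sets_levy: "sets levy = sets (restrict_space borel {0<..})"
  by (simp add: levy_def)

text \<open>By \<open>less_ginv_iff\<close> the preimage of \<open>{y<..}\<close> under
  \<open>ginv\<close> is \<open>{0<..<v y}\<close>, an interval of length
  \<open>v y\<close>.\<close>

lemma emeasure_levy:
  assumes "0 < y" shows "emeasure levy {y<..} = ennreal (v y)"
proof -
  have s: "{y<..} \<in> sets (restrict_space borel {0<..})" using assms by (subst sets_restrict_space_iff) auto
  have Db: "D \<inter> space lborel \<in> sets lborel" using D_measurable by simp
  have eq: "ginv -` {y<..} \<inter> space (restrict_space lborel D) = {0<..<v y}"
  proof -
    have "a \<in> D" if "0 < a" "a < v y" for a using that assms by (auto simp: D_def)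
    moreover have "0 < a" if "a \<in> D" for a using that by (simp add: D_def)
    ultimately show ?thesis using less_ginv_iff[OF _ assms] by (auto simp: space_restrict_space)
  qed
  have "emeasure levy {y<..} = emeasure (restrict_space lborel D) {0<..<v y}"
    unfolding levy_def by (subst emeasure_distr[OF ginv_measurable s]) (simp add: eq)
  also have "\<dots> = emeasure lborel {0<..<v y}"
    using assms by (intro emeasure_restrict_space Db) (auto simp: D_def)
  also have "\<dots> = ennreal (v y)" using v_nonneg[OF assms] by simp
  finally show ?thesis .
qed

sublocale levy: half_line_measure levy
  by unfold_locales (auto simp: sets_levy emeasure_levy)

lemma tail_levy: "0 < y \<Longrightarrow> levy.tail y = v y"
  unfolding levy.tail_def measure_def by (simp add: emeasure_levy v_nonneg)

lemma integral_v:
  assumes "0 < a" "a \<le> b"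
  shows "set_integrable lborel {a<..b} v" "(LINT y:{a<..b}|lborel. v y) = W b - W a - w_inf * (b - a)"
proof -
  have ci: "set_integrable lborel {a<..b} (\<lambda>y. w_inf)"
    unfolding set_integrable_def using assms by (cases "w_inf = 0") (auto intro!: integrable_real_indicator)
  show "set_integrable lborel {a<..b} v"
    unfolding v_def[abs_def] by (intro set_integral_diff w_integrable ci assms)
  show "(LINT y:{a<..b}|lborel. v y) = W b - W a - w_inf * (b - a)"
  proof -
    have "(LINT y:{a<..b}|lborel. w_inf) = w_inf * (b - a)" using assms by (simp add: set_lebesgue_integral_def)
    then show ?thesis unfolding v_def[abs_def] using assms by (simp add: set_integral_diff(2)[OF w_integrable ci] integral_w)
  qed
qed

text \<open>By the layer-cake formula this is the integral of \<open>v\<close> over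
  \<open>{0<..1}\<close>. Since \<open>integral_v\<close> works only away from 0, the interval is
  exhausted by \<open>{1 / real (Suc n)<..1}\<close>; each piece contributes at most
  \<open>W 1\<close>, because \<open>W\<close> is nonnegative.\<close>

lemma finite_min_levy: "(\<integral>\<^sup>+x. ennreal (min 1 x) \<partial>levy) < \<infinity>"
proof -
  have "(\<integral>\<^sup>+x. ennreal (min 1 x) \<partial>levy) = (\<integral>\<^sup>+z. (\<integral>\<^sup>+y. indicator {..1} y * indicator {0<..<z} y \<partial>lborel) \<partial>levy)"
  proof (rule nn_integral_cong)
    fix z assume "z \<in> space levy"
    then have z: "0 < z" by (simp add: levy.space_U)
    have "(\<integral>\<^sup>+y. indicator {..1} y * indicator {0<..<z} y \<partial>lborel) = (\<integral>\<^sup>+y. indicator {0..min 1 z} y \<partial>lborel)"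
    proof (rule nn_integral_cong_AE)
      show "AE y in lborel. indicator {..1} y * indicator {0<..<z} y = (indicator {0..min 1 z} y :: ennreal)"
        using AE_lborel_singleton[of 0] AE_lborel_singleton[of z]
        by eventually_elim (auto simp: indicator_def)
    qed
    then show "ennreal (min 1 z) = (\<integral>\<^sup>+y. indicator {..1} y * indicator {0<..<z} y \<partial>lborel)" using z by simp
  qed
  also have "\<dots> = (\<integral>\<^sup>+y. indicator {..1} y * indicator {0<..} y * ennreal (levy.tail y) \<partial>lborel)"
    by (rule levy.nn_integral_tail[symmetric]) measurable
  also have "\<dots> = (\<integral>\<^sup>+y. (SUP n. ennreal (indicator {1 / real (Suc n)<..1} y *\<^sub>R v y)) \<partial>lborel)"
  proof (rule nn_integral_cong)
    fix y :: real
    show "indicator {..1} y * indicator {0<..} y * ennreal (levy.tail y) = (SUP n. ennreal (indicator {1 / real (Suc n)<..1} y *\<^sub>R v y))"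
    proof (cases "0 < y \<and> y \<le> 1")
      case True
      then obtain n where n: "1 / real (Suc n) < y" using nat_approx_posE by blast
      have "(SUP n. ennreal (indicator {1 / real (Suc n)<..1} y *\<^sub>R v y)) = ennreal (v y)"
      proof (rule antisym)
        show "(SUP n. ennreal (indicator {1 / real (Suc n)<..1} y *\<^sub>R v y)) \<le> ennreal (v y)"
          using True v_nonneg[of y] by (intro SUP_least ennreal_leI) (auto simp: indicator_def)
        show "ennreal (v y) \<le> (SUP n. ennreal (indicator {1 / real (Suc n)<..1} y *\<^sub>R v y))"
          by (rule SUP_upper2[of n]) (use n True in \<open>auto simp: indicator_def\<close>)
      qed
      then show ?thesis using True by (simp add: tail_levy)
    next
      case False
      have "ennreal (indicator {1 / real (Suc n)<..1} y *\<^sub>R v y) = 0" for n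
      proof -
        have "0 < 1 / real (Suc n)" by simp
        then have "y \<notin> {1 / real (Suc n)<..1}" using False by (metis greaterThanAtMost_iff less_trans)
        then show ?thesis by simp
      qed
      then show ?thesis using False by (auto simp: indicator_def)
    qed
  qed
  also have "\<dots> = (SUP n. \<integral>\<^sup>+y. ennreal (indicator {1 / real (Suc n)<..1} y *\<^sub>R v y) \<partial>lborel)"
  proof (rule nn_integral_monotone_convergence_SUP)
    show "incseq (\<lambda>n y. ennreal (indicator {1 / real (Suc n)<..1} y *\<^sub>R v y))"
    proof (intro incseq_SucI le_funI ennreal_leI)
      fix n y
      have "1 / real (Suc (Suc n)) \<le> 1 / real (Suc n)" by (intro divide_left_mono) auto
      moreover have "0 < y" if "1 / real (Suc (Suc n)) < y"
        by (rule less_trans[OF _ that]) simp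
      ultimately show "indicator {1 / real (Suc n)<..1} y *\<^sub>R v y \<le> indicator {1 / real (Suc (Suc n))<..1} y *\<^sub>R v y"
        using v_nonneg[of y] by (auto simp: indicator_def simp del: of_nat_Suc)
    qed
    show "(\<lambda>y. ennreal (indicator {1 / real (Suc n)<..1} y *\<^sub>R v y)) \<in> borel_measurable lborel" for n
      using integral_v(1)[of "1 / real (Suc n)" 1] unfolding set_integrable_def
      by (auto intro!: measurable_compose[OF borel_measurable_integrable measurable_ennreal])
  qed
  also have "\<dots> \<le> ennreal (W 1)"
  proof (rule SUP_least)
    fix n
    define a where "a = 1 / real (Suc n)"
    have a: "0 < a" "a \<le> 1" by (auto simp: a_def)
    have "(\<integral>\<^sup>+y. ennreal (indicator {a<..1} y *\<^sub>R v y) \<partial>lborel) = ennreal (W 1 - W a - w_inf * (1 - a))"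
      using integral_v[OF a] v_nonneg a(1) unfolding set_integrable_def set_lebesgue_integral_def
      by (subst nn_integral_eq_integral) (auto simp: indicator_def)
    also have "\<dots> \<le> ennreal (W 1)"
    proof (rule ennreal_leI)
      have "0 \<le> w_inf * (1 - a)" using a w_inf_nonneg by simp
      then show "W 1 - W a - w_inf * (1 - a) \<le> W 1" using nonneg[of a] by linarith
    qed
    finally show "(\<integral>\<^sup>+y. ennreal (indicator {1 / real (Suc n)<..1} y *\<^sub>R v y) \<partial>lborel) \<le> ennreal (W 1)"
      by (simp add: a_def)
  qed
  also have "\<dots> < \<infinity>" by simp
  finally show ?thesis .
qed

sublocale levy: levy_measure_half_line levy
  using sets_levy finite_min_levy by (rule levy_measure_half_line.intro)

text \<open>Both sides have the same increment between \<open>a > 0\<close> and \<open>x\<close>;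
  letting \<open>a\<close> tend to 0 uses continuity of \<open>W\<close> and of
  \<open>levy.G\<close> at 0.\<close>

lemma W_representation:
  assumes "0 \<le> x"
  shows "W x = W 0 + w_inf * x + (LINT y:{0..x}|lborel. measure levy {y<..})"
proof -
  have G0: "levy.G 0 = 0"
  proof -
    have "levy.G 0 = (LINT z|levy. 0)" unfolding levy.G_def
      by (intro Bochner_Integration.integral_cong refl) (auto simp: levy.space_U)
    then show ?thesis by simp
  qed
  have tail: "(LINT y:{0..x}|lborel. measure levy {y<..}) = levy.G x"
    using levy.integral_tail(2)[OF assms] by (simp add: levy.tail_def[abs_def])
  show ?thesis
  proof (cases "x = 0")
  case True
  then show ?thesis using tail G0 by simp
next
  case False
  then have x: "0 < x" using assms by simp
  have diff: "levy.G x - levy.G a = W x - W a - w_inf * (x - a)" if a: "0 < a" "a \<le> x" for a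
  proof -
    have "(LINT y:{0..x}|lborel. levy.tail y) = (LINT y:{0..a}|lborel. levy.tail y) + (LINT y:{a<..x}|lborel. levy.tail y)"
    proof -
      have u: "{0..x} = {0..a} \<union> {a<..x}" using a by auto
      have "set_integrable lborel {a<..x} levy.tail"
        using levy.integral_tail(1)[of x] x by (rule_tac set_integrable_subset) (use a in auto)
      then show ?thesis unfolding u using a levy.integral_tail(1)[of a] by (intro set_integral_Un) auto
    qed
    also have "(LINT y:{a<..x}|lborel. levy.tail y) = (LINT y:{a<..x}|lborel. v y)"
      using a by (intro set_lebesgue_integral_cong) (auto simp: tail_levy)
    finally show ?thesis using integral_v(2)[OF a] levy.integral_tail(2)[of x] levy.integral_tail(2)[of a] a x by simp
  qed
  have right: "(f \<longlongrightarrow> f 0) (at_right 0)" if "continuous_on {0..} f" for f :: "real \<Rightarrow> real"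
  proof -
    have "(f \<longlongrightarrow> f 0) (at 0 within {0..})" using that by (auto simp: continuous_on_def)
    then show ?thesis by (rule tendsto_within_subset) auto
  qed
  have l: "((\<lambda>a. levy.G x - levy.G a) \<longlongrightarrow> levy.G x - levy.G 0) (at_right 0)"
    by (intro tendsto_intros right levy.continuous_G)
  have "((\<lambda>a. W x - W a - w_inf * (x - a)) \<longlongrightarrow> W x - W 0 - w_inf * (x - 0)) (at_right 0)"
    by (intro tendsto_intros right cont)
  moreover have "\<forall>\<^sub>F a in at_right 0. W x - W a - w_inf * (x - a) = levy.G x - levy.G a"
    unfolding eventually_at_right_field using diff x by (intro exI[of _ x]) auto
  ultimately have "((\<lambda>a. levy.G x - levy.G a) \<longlongrightarrow> W x - W 0 - w_inf * (x - 0)) (at_right 0)"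
    by (rule Lim_transform_eventually)
  from tendsto_unique[OF _ this l] have "levy.G x = W x - W 0 - w_inf * x" by (simp add: G0)
  then show ?thesis using tail by simp
  qed
qed

end

section \<open>Spectrally negative exponents as weak limits\<close>

text \<open>Around a time \<open>p\<close> the path is close to its left limit before
  \<open>p\<close> and to \<open>x p\<close> from \<open>p\<close> on, and \<open>x p\<close> is not
  larger than the left limit; so upward moves are small locally. The Lebesgue number of the cover
  makes the window uniform on \<open>{0..1}\<close>.\<close>

lemma upward_increments_small:
  assumes "cadlag x" "no_positive_jumps x" and \<epsilon>: "0 < \<epsilon>"
  shows "\<exists>e>0. \<forall>s t. 0 \<le> s \<and> s \<le> t \<and> t \<le> 1 \<and> t - s < e \<longrightarrow> x t - x s \<le> \<epsilon>"
proof -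
  have loc: "\<exists>d>0. \<forall>s t. 0 \<le> s \<and> s \<le> t \<and> \<bar>s - p\<bar> < d \<and> \<bar>t - p\<bar> < d \<longrightarrow> x t - x s \<le> \<epsilon>" if p: "0 \<le> p" for p
  proof -
    have "(x \<longlongrightarrow> x p) (at_right p)" using assms(1) p by (auto simp: cadlag_def)
    then have "\<forall>\<^sub>F s in at_right p. dist (x s) (x p) < \<epsilon> / 4" using \<epsilon> by (intro tendstoD) auto
    then obtain b where b: "p < b" "\<And>s. p < s \<Longrightarrow> s < b \<Longrightarrow> \<bar>x s - x p\<bar> < \<epsilon> / 4"
      unfolding eventually_at_right_field by (auto simp: dist_real_def)
    have b': "\<bar>x s - x p\<bar> < \<epsilon> / 4" if "p \<le> s" "s < b" for s
      using b(2)[of s] that \<epsilon> by (cases "s = p") auto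
    obtain a l where a: "a < p" "\<And>s. a < s \<Longrightarrow> s < p \<Longrightarrow> 0 \<le> s \<Longrightarrow> \<bar>x s - l\<bar> < \<epsilon> / 4" "x p \<le> l"
    proof (cases "p = 0")
      case True
      then show ?thesis using that[of "-1" "x p"] by auto
    next
      case False
      then have p0: "0 < p" using p by simp
      then obtain l where l: "(x \<longlongrightarrow> l) (at_left p)" using assms(1) unfolding cadlag_def by blast
      have "x p - l \<le> 0" using assms(2) p0 l unfolding no_positive_jumps_def by blast
      moreover have "\<forall>\<^sub>F s in at_left p. dist (x s) l < \<epsilon> / 4" using l \<epsilon> by (intro tendstoD) auto
      then obtain a where "a < p" "\<And>s. a < s \<Longrightarrow> s < p \<Longrightarrow> \<bar>x s - l\<bar> < \<epsilon> / 4"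
        unfolding eventually_at_left_field by (auto simp: dist_real_def)
      ultimately show ?thesis using that by auto
    qed
    show ?thesis
    proof (rule exI[of _ "min (b - p) (p - a)"], intro conjI allI impI)
      show "0 < min (b - p) (p - a)" using a b by simp
      fix s t assume st: "0 \<le> s \<and> s \<le> t \<and> \<bar>s - p\<bar> < min (b - p) (p - a) \<and> \<bar>t - p\<bar> < min (b - p) (p - a)"
      then have *: "a < s" "a < t" "s < b" "t < b" "0 \<le> s" "s \<le> t" "0 \<le> t" by auto
      consider "t < p" | "s < p" "p \<le> t" | "p \<le> s" by linarith
      then show "x t - x s \<le> \<epsilon>"
      proof cases
        case 1
        then show ?thesis using a(2)[of s] a(2)[of t] * \<epsilon> by linarith
      next
        case 2
        then show ?thesis using a(2)[of s] b'[of t] a(3) * \<epsilon> by linarith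
      next
        case 3
        then show ?thesis using b'[of s] b'[of t] * \<epsilon> by linarith
      qed
    qed
  qed
  then have "\<forall>p\<in>{0..1}. \<exists>d>0. \<forall>s t. 0 \<le> s \<and> s \<le> t \<and> \<bar>s - p\<bar> < d \<and> \<bar>t - p\<bar> < d \<longrightarrow> x t - x s \<le> \<epsilon>" by simp
  then obtain d where d: "\<And>p. p \<in> {0..1} \<Longrightarrow> 0 < d p"
    "\<And>p s t. p \<in> {0..1} \<Longrightarrow> 0 \<le> s \<Longrightarrow> s \<le> t \<Longrightarrow> \<bar>s - p\<bar> < d p \<Longrightarrow> \<bar>t - p\<bar> < d p \<Longrightarrow> x t - x s \<le> \<epsilon>"
    by metis
  have "\<exists>e>0. \<forall>s\<in>{0..1}. \<exists>G\<in>(\<lambda>p. ball p (d p)) ` {0..1}. ball s e \<subseteq> G"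
  proof (rule Heine_Borel_lemma)
    show "{0..1} \<subseteq> \<Union> ((\<lambda>p. ball p (d p)) ` {0..1})" using d(1) by auto
  qed auto
  then obtain e where e: "0 < e" "\<And>s. s \<in> {0..1} \<Longrightarrow> \<exists>p\<in>{0..1}. ball s e \<subseteq> ball p (d p)" by auto
  show ?thesis
  proof (intro exI[of _ e] conjI allI impI e(1))
    fix s t assume st: "0 \<le> s \<and> s \<le> t \<and> t \<le> 1 \<and> t - s < e"
    then obtain p where p: "p \<in> {0..1}" "ball s e \<subseteq> ball p (d p)" using e(2)[of s] by auto
    have "s \<in> ball s e" "t \<in> ball s e" using st e(1) by (auto simp: dist_real_def)
    then have "s \<in> ball p (d p)" "t \<in> ball p (d p)" using subsetD[OF p(2)] by blast+
    then show "x t - x s \<le> \<epsilon>" using st p(1) by (intro d(2)[of p]) (auto simp: dist_real_def abs_minus_commute)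
  qed
qed

lemma exp_difference_quotient_limit: "(\<lambda>n. real (Suc n) * (exp (c / real (Suc n)) - 1)) \<longlonglongrightarrow> (c::real)"
proof (cases "c = 0")
  case False
  have "(\<lambda>n. c / real (Suc n)) \<longlonglongrightarrow> 0"
    using tendsto_mult_right_zero[OF LIMSEQ_inverse_real_of_nat, of c] by (simp add: divide_inverse)
  then have "filterlim (\<lambda>n. c / real (Suc n)) (at 0) sequentially"
    using False by (auto simp: filterlim_at simp del: of_nat_Suc)
  from filterlim_compose[OF lim_exp_minus_1 this]
  have "(\<lambda>n. c * ((exp (c / real (Suc n)) - 1) / (c / real (Suc n)))) \<longlonglongrightarrow> c * 1"
    by (intro tendsto_intros)
  moreover have "c * (x / (c / m)) = m * x" for x m using False by simp
  ultimately show ?thesis by simp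
qed simp

section \<open>Taylor quotients of powers\<close>

definition taylor_rest :: "real \<Rightarrow> real \<Rightarrow> real" where
  "taylor_rest \<theta> y = y powr \<theta> - 1 - \<theta> * (y - 1)"

text \<open>The value at 1 is half the second derivative of \<open>y powr \<theta>\<close> there,
  which makes the quotient continuous.\<close>

definition taylor_quot :: "real \<Rightarrow> real \<Rightarrow> real" where
  "taylor_quot \<theta> y = (if y = 1 then \<theta> * (\<theta> - 1) / 2 else taylor_rest \<theta> y / (y - 1)\<^sup>2)"

lemma taylor_rest_eq: "taylor_rest \<theta> y = taylor_quot \<theta> y * (y - 1)\<^sup>2"
  by (simp add: taylor_quot_def taylor_rest_def)

text \<open>Taylor's theorem with Lagrange remainder. It yields continuity at 1 and, for
  \<open>\<theta> \<le> 1\<close>, the sign of the quotient.\<close>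

lemma taylor_quot_mean_value:
  assumes "0 < y"
  shows "\<exists>t. \<bar>t - 1\<bar> \<le> \<bar>y - 1\<bar> \<and> 0 < t \<and> taylor_quot \<theta> y = \<theta> * (\<theta> - 1) / 2 * t powr (\<theta> - 2)"
proof (cases "y = 1")
  case True
  then show ?thesis by (intro exI[of _ 1]) (simp add: taylor_quot_def)
next
  case False
  define diff where "diff m t = (if m = 0 then t powr \<theta> else if m = 1 then \<theta> * t powr (\<theta> - 1)
     else \<theta> * (\<theta> - 1) * t powr (\<theta> - 2))" for m :: nat and t :: real
  have "\<exists>t. (if y < 1 then y < t \<and> t < 1 else 1 < t \<and> t < y) \<and>
     y powr \<theta> = (\<Sum>m<2. diff m 1 / fact m * (y - 1) ^ m) + diff 2 t / fact 2 * (y - 1) ^ 2"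
  proof (rule Taylor[where a = "min y 1" and b = "max y 1"])
    show "\<forall>m t. m < 2 \<and> min y 1 \<le> t \<and> t \<le> max y 1 \<longrightarrow> DERIV (diff m) t :> diff (Suc m) t"
    proof (intro allI impI)
      fix m :: nat and t assume m: "m < 2 \<and> min y 1 \<le> t \<and> t \<le> max y 1"
      then have t: "0 < t" using assms by auto
      have "m = 0 \<or> m = 1" using m by auto
      then show "DERIV (diff m) t :> diff (Suc m) t"
      proof
        assume "m = 0"
        moreover have "((\<lambda>t. t powr \<theta>) has_real_derivative \<theta> * t powr (\<theta> - 1)) (at t)"
          using t by (auto intro!: derivative_eq_intros)
        ultimately show ?thesis by (simp add: diff_def[abs_def])
      next
        assume "m = 1"
        moreover have "((\<lambda>t. \<theta> * t powr (\<theta> - 1)) has_real_derivative \<theta> * ((\<theta> - 1) * t powr (\<theta> - 2))) (at t)"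
          using t by (auto intro!: derivative_eq_intros)
        ultimately show ?thesis by (simp add: diff_def[abs_def] mult.assoc)
      qed
    qed
  qed (use False in \<open>auto simp: diff_def\<close>)
  then obtain t where t: "if y < 1 then y < t \<and> t < 1 else 1 < t \<and> t < y"
    "y powr \<theta> = 1 + \<theta> * (y - 1) + \<theta> * (\<theta> - 1) * t powr (\<theta> - 2) / 2 * (y - 1)\<^sup>2"
    by (auto simp: diff_def numeral_2_eq_2)
  then have "taylor_quot \<theta> y = \<theta> * (\<theta> - 1) / 2 * t powr (\<theta> - 2)"
    using False by (simp add: taylor_quot_def taylor_rest_def)
  moreover have "\<bar>t - 1\<bar> \<le> \<bar>y - 1\<bar>" "0 < t" using t(1) assms by (auto split: if_splits)
  ultimately show ?thesis by blast
qed

text \<open>Away from 1 this is continuity of \<open>powr\<close>, which includes the point 0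
  because \<open>\<theta> > 0\<close>; at 1 the intermediate point of the mean value form is
  squeezed to 1.\<close>

lemma taylor_quot_continuous:
  assumes \<theta>: "0 < \<theta>" shows "continuous_on {0..} (taylor_quot \<theta>)"
  unfolding continuous_on_def
proof
  fix y :: real assume y: "y \<in> {0..}"
  show "(taylor_quot \<theta> \<longlongrightarrow> taylor_quot \<theta> y) (at y within {0..})"
  proof (cases "y = 1")
    case False
    have nn: "\<forall>\<^sub>F t in at y within {0..}. 0 \<le> t" by (auto simp: eventually_at_filter)
    have L: "((\<lambda>t. t powr \<theta>) \<longlongrightarrow> y powr \<theta>) (at y within {0..})"
    proof -
      have "y \<noteq> 0 \<or> 0 < \<theta> \<and> (\<forall>\<^sub>F t in at y within {0..}. 0 \<le> t)" using \<theta> nn by blast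
      then show ?thesis by (rule tendsto_powr'[OF tendsto_ident_at tendsto_const])
    qed
    then have "((\<lambda>t. (t powr \<theta> - 1 - \<theta> * (t - 1)) / (t - 1)\<^sup>2) \<longlongrightarrow> (y powr \<theta> - 1 - \<theta> * (y - 1)) / (y - 1)\<^sup>2) (at y within {0..})"
      using False by (intro tendsto_divide tendsto_diff tendsto_mult L tendsto_power tendsto_const tendsto_ident_at) auto
    moreover have "\<forall>\<^sub>F t in at y within {0..}. t \<noteq> 1"
      by (rule tendsto_imp_eventually_ne[OF tendsto_ident_at False])
    from this have "\<forall>\<^sub>F t in at y within {0..}. (t powr \<theta> - 1 - \<theta> * (t - 1)) / (t - 1)\<^sup>2 = taylor_quot \<theta> t"
      by eventually_elim (simp add: taylor_quot_def taylor_rest_def)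
    ultimately show ?thesis using False by (auto simp: taylor_quot_def taylor_rest_def elim: Lim_transform_eventually)
  next
    case True
    obtain s where s: "\<And>t. 0 < t \<Longrightarrow> \<bar>s t - 1\<bar> \<le> \<bar>t - 1\<bar>"
      "\<And>t. 0 < t \<Longrightarrow> taylor_quot \<theta> t = \<theta> * (\<theta> - 1) / 2 * s t powr (\<theta> - 2)"
      using taylor_quot_mean_value[of _ \<theta>] by metis
    have pos: "\<forall>\<^sub>F t in at 1 within {0..}. 0 < (t::real)"
      by (rule order_tendstoD(1)[OF tendsto_ident_at]) simp
    have "((\<lambda>t. s t - 1) \<longlongrightarrow> 0) (at 1 within {0..})"
    proof (rule Lim_null_comparison)
      show "\<forall>\<^sub>F t in at 1 within {0..}. norm (s t - 1) \<le> \<bar>t - 1\<bar>"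
        using pos by eventually_elim (simp add: s(1))
      have "((\<lambda>t. \<bar>t - 1\<bar>) \<longlongrightarrow> \<bar>1 - 1 :: real\<bar>) (at 1 within {0..})" by (intro tendsto_intros)
      then show "((\<lambda>t. \<bar>t - 1 :: real\<bar>) \<longlongrightarrow> 0) (at 1 within {0..})" by simp
    qed
    then have "(s \<longlongrightarrow> 1) (at 1 within {0..})" by (rule LIM_zero_cancel)
    then have "((\<lambda>t. \<theta> * (\<theta> - 1) / 2 * s t powr (\<theta> - 2)) \<longlongrightarrow> \<theta> * (\<theta> - 1) / 2 * 1 powr (\<theta> - 2)) (at 1 within {0..})"
      by (intro tendsto_intros) auto
    moreover have "\<forall>\<^sub>F t in at 1 within {0..}. \<theta> * (\<theta> - 1) / 2 * s t powr (\<theta> - 2) = taylor_quot \<theta> t"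
      using pos by eventually_elim (simp add: s(2))
    ultimately show ?thesis using True by (auto simp: taylor_quot_def elim: Lim_transform_eventually)
  qed
qed

section \<open>Small-time behaviour of a spectrally negative process\<close>

locale spectrally_negative_levy = levy_proc M X for M :: "'w measure" and X :: "real \<Rightarrow> 'w \<Rightarrow> real" +
  fixes \<psi> :: "real \<Rightarrow> real"
  assumes jumps: "AE \<omega> in M. no_positive_jumps (\<lambda>t. X t \<omega>)"
    and laplace: "has_laplace_exponent M X \<psi>"
begin

lemma integral_exp_1: "0 \<le> \<theta> \<Longrightarrow> integrable M (\<lambda>\<omega>. exp (\<theta> * X 1 \<omega>)) \<and> (LINT \<omega>|M. exp (\<theta> * X 1 \<omega>)) = exp (\<psi> \<theta>)"
proof -
  assume \<theta>: "0 \<le> \<theta>"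
  have i: "integrable M (\<lambda>\<omega>. exp (\<theta> * X 1 \<omega>))" and p: "\<psi> \<theta> = ln (LINT \<omega>|M. exp (\<theta> * X 1 \<omega>))"
    using laplace \<theta> by (auto simp: has_laplace_exponent_def)
  \<comment> \<open>The exponential undoes \<open>ln\<close> only at positive arguments, so
    positivity of the moment must be checked.\<close>
  have "(LINT \<omega>|M. exp (\<theta> * X 1 \<omega>)) \<noteq> 0"
  proof
    assume "(LINT \<omega>|M. exp (\<theta> * X 1 \<omega>)) = 0"
    then have "AE \<omega> in M. exp (\<theta> * X 1 \<omega>) = 0" using integral_nonneg_eq_0_iff_AE[OF i] by simp
    then show False by simp
  qed
  moreover have "0 \<le> (LINT \<omega>|M. exp (\<theta> * X 1 \<omega>))" by (intro Bochner_Integration.integral_nonneg) simp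
  ultimately have "0 < (LINT \<omega>|M. exp (\<theta> * X 1 \<omega>))" by linarith
  then show ?thesis using i p by simp
qed

definition h :: "nat \<Rightarrow> real" where "h n = 1 / real (Suc n)"

lemma h: "0 < h n" "h n \<le> 1" "real (Suc n) * h n = 1" by (auto simp: h_def)

definition step :: "nat \<Rightarrow> nat \<Rightarrow> 'w \<Rightarrow> real" where
  "step n i \<omega> = X (real (Suc i) * h n) \<omega> - X (real i * h n) \<omega>"

lemma step_measurable [measurable]: "step n i \<in> borel_measurable M"
  unfolding step_def[abs_def] using h(1)[of n] by (intro borel_measurable_diff X_measurable) auto

lemma step_law: "distr M borel (step n i) = distr M borel (X (h n))"
proof -
  have "real (Suc i) * h n - real i * h n = h n" by (simp add: algebra_simps)
  then show ?thesis using distr_increment[of "real i * h n" "real (Suc i) * h n"] h(1)[of n]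
    by (simp add: step_def[abs_def])
qed

lemma X_h_measurable [measurable]: "X (h n) \<in> borel_measurable M"
  using h(1)[of n] by (intro X_measurable) simp

lemma indep_steps: "indep_vars (\<lambda>_. borel) (step n) UNIV"
  using indep_grid[of "h n"] h(1)[of n] by (simp add: step_def[abs_def])

lemma sum_steps: "(\<Sum>i<k. step n i \<omega>) = X (real k * h n) \<omega> - X 0 \<omega>"
  unfolding step_def by (subst sum_lessThan_telescope) simp

text \<open>Almost surely \<open>X 1\<close> is the sum of \<open>Suc n\<close> independent steps
  with the law of \<open>X (h n)\<close>, so the moment at time \<open>h n\<close> is a root of the
  one at time 1. Nonnegative integrals are used because finiteness is part of the claim.\<close>

lemma exp_moment_root:
  assumes \<theta>: "0 \<le> \<theta>"
  shows "integrable M (\<lambda>\<omega>. exp (\<theta> * X (h n) \<omega>))" "(LINT \<omega>|M. exp (\<theta> * X (h n) \<omega>)) = exp (\<psi> \<theta> / real (Suc n))"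
proof -
  define a where "a = (\<integral>\<^sup>+\<omega>. ennreal (exp (\<theta> * X (h n) \<omega>)) \<partial>M)"
  have "(\<integral>\<^sup>+\<omega>. (\<Prod>i<Suc n. ennreal (exp (\<theta> * step n i \<omega>))) \<partial>M) = (\<Prod>i<Suc n. \<integral>\<^sup>+\<omega>. ennreal (exp (\<theta> * step n i \<omega>)) \<partial>M)"
  proof (rule indep_vars_nn_integral)
    have "indep_vars (\<lambda>_. borel) (step n) {..<Suc n}" using indep_steps by (rule indep_vars_subset) simp
    then show "indep_vars (\<lambda>_. borel) (\<lambda>i \<omega>. ennreal (exp (\<theta> * step n i \<omega>))) {..<Suc n}"
      by (rule indep_vars_compose2[where Y = "\<lambda>_ x. ennreal (exp (\<theta> * x))"]) measurable
  qed auto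
  moreover have "(\<integral>\<^sup>+\<omega>. ennreal (exp (\<theta> * step n i \<omega>)) \<partial>M) = a" for i
    using nn_integral_distr[of "step n i" M borel "\<lambda>x. ennreal (exp (\<theta> * x))"]
      nn_integral_distr[of "X (h n)" M borel "\<lambda>x. ennreal (exp (\<theta> * x))"] by (simp add: step_law a_def)
  moreover have "(\<integral>\<^sup>+\<omega>. (\<Prod>i<Suc n. ennreal (exp (\<theta> * step n i \<omega>))) \<partial>M) = (\<integral>\<^sup>+\<omega>. ennreal (exp (\<theta> * X 1 \<omega>)) \<partial>M)"
  proof (rule nn_integral_cong_AE, use X_0 in eventually_elim)
    case (elim \<omega>)
    have "(\<Prod>i<Suc n. ennreal (exp (\<theta> * step n i \<omega>))) = ennreal (\<Prod>i<Suc n. exp (\<theta> * step n i \<omega>))"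
      by (rule prod_ennreal) simp
    also have "(\<Prod>i<Suc n. exp (\<theta> * step n i \<omega>)) = exp (\<theta> * (\<Sum>i<Suc n. step n i \<omega>))"
      by (simp only: exp_sum[symmetric] sum_distrib_left finite_lessThan)
    also have "(\<Sum>i<Suc n. step n i \<omega>) = X 1 \<omega>" unfolding sum_steps h(3) using elim by simp
    finally show ?case .
  qed
  moreover have "(\<integral>\<^sup>+\<omega>. ennreal (exp (\<theta> * X 1 \<omega>)) \<partial>M) = ennreal (exp (\<psi> \<theta>))"
    using integral_exp_1[OF \<theta>] by (subst nn_integral_eq_integral) auto
  ultimately have pw: "a ^ Suc n = ennreal (exp (\<psi> \<theta>))" by simp
  have "a \<noteq> \<top>"
  proof
    assume "a = \<top>"
    then have "a ^ Suc n = \<top>" by (simp add: ennreal_top_mult power_eq_top_ennreal)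
    then show False using pw by simp
  qed
  then obtain r where r: "a = ennreal r" "0 \<le> r" by (cases a) auto
  have "r ^ Suc n = exp (\<psi> \<theta>)" using pw r by (simp add: ennreal_power ennreal_inj del: power_Suc)
  also have "\<dots> = exp (\<psi> \<theta> / real (Suc n)) ^ Suc n" by (simp add: exp_of_nat_mult[symmetric] del: power_Suc of_nat_Suc)
  finally have "r = exp (\<psi> \<theta> / real (Suc n))" using r by (intro power_eq_imp_eq_base[of r "Suc n"]) auto
  then have "(\<integral>\<^sup>+\<omega>. ennreal (exp (\<theta> * X (h n) \<omega>)) \<partial>M) = ennreal (exp (\<psi> \<theta> / real (Suc n)))" using r a_def by simp
  then have "has_bochner_integral M (\<lambda>\<omega>. exp (\<theta> * X (h n) \<omega>)) (exp (\<psi> \<theta> / real (Suc n)))"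
    by (intro has_bochner_integral_nn_integral) auto
  then show "integrable M (\<lambda>\<omega>. exp (\<theta> * X (h n) \<omega>))" "(LINT \<omega>|M. exp (\<theta> * X (h n) \<omega>)) = exp (\<psi> \<theta> / real (Suc n))"
    by (auto simp: has_bochner_integral_iff)
qed

definition Y :: "nat \<Rightarrow> 'w \<Rightarrow> real" where "Y n \<omega> = exp (X (h n) \<omega>)"

lemma Y_measurable [measurable]: "Y n \<in> borel_measurable M"
  unfolding Y_def[abs_def] by measurable

lemma Y_pos: "0 < Y n \<omega>" by (simp add: Y_def)

lemma Y_powr: "Y n \<omega> powr \<theta> = exp (\<theta> * X (h n) \<omega>)" by (simp add: Y_def exp_powr_real mult.commute)

lemma integrable_Y_powr: "0 \<le> \<theta> \<Longrightarrow> integrable M (\<lambda>\<omega>. Y n \<omega> powr \<theta>)"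
  unfolding Y_powr by (rule exp_moment_root)

lemma Y_powr_limit:
  assumes "0 \<le> \<theta>"
  shows "(\<lambda>n. real (Suc n) * (LINT \<omega>|M. Y n \<omega> powr \<theta> - 1)) \<longlonglongrightarrow> \<psi> \<theta>"
proof -
  have "(LINT \<omega>|M. Y n \<omega> powr \<theta> - 1) = exp (\<psi> \<theta> / real (Suc n)) - 1" for n
    using exp_moment_root[OF assms, of n] integrable_Y_powr[OF assms, of n] prob_space by (simp add: Y_powr)
  then show ?thesis using exp_difference_quotient_limit by simp
qed

text \<open>By \<open>upward_increments_small\<close> almost every path eventually has no step above
  \<open>\<epsilon>\<close>, so the probability of this event tends to 1. By independence it equals
  \<open>(1 - p n) ^ Suc n\<close>, which is at most \<open>exp (- (real (Suc n) * p n))\<close>;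
  hence the exponent tends to 0.\<close>

lemma rate_upward_0:
  assumes \<epsilon>: "0 < \<epsilon>"
  shows "(\<lambda>n. real (Suc n) * prob {\<omega>\<in>space M. \<epsilon> < X (h n) \<omega>}) \<longlonglongrightarrow> 0"
proof -
  define p where "p n = prob {\<omega>\<in>space M. \<epsilon> < X (h n) \<omega>}" for n
  define F where "F n = {\<omega>\<in>space M. \<forall>i<Suc n. step n i \<omega> \<le> \<epsilon>}" for n
  have p01: "0 \<le> p n" "p n \<le> 1" for n by (auto simp: p_def)
  have Fm: "F n \<in> events" for n unfolding F_def by measurable
  have pF: "prob (F n) = (1 - p n) ^ Suc n" for n
  proof -
    have ind: "indep_vars (\<lambda>_. borel) (step n) {..<Suc n}" using indep_steps by (rule indep_vars_subset) simp
    have "F n = (\<Inter>i\<in>{..<Suc n}. step n i -` {..\<epsilon>} \<inter> space M)" by (auto simp: F_def)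
    then have "prob (F n) = (\<Prod>i<Suc n. prob (step n i -` {..\<epsilon>} \<inter> space M))"
      using indep_varsD_finite[OF ind, of "\<lambda>_. {..\<epsilon>}"] by auto
    moreover have "prob (step n i -` {..\<epsilon>} \<inter> space M) = 1 - p n" for i
    proof -
      have "prob (step n i -` {..\<epsilon>} \<inter> space M) = measure (distr M borel (X (h n))) {..\<epsilon>}"
        by (subst step_law[symmetric, of n i], subst measure_distr) auto
      also have "\<dots> = prob (space M - {\<omega>\<in>space M. \<epsilon> < X (h n) \<omega>})"
        by (subst measure_distr) (auto intro!: arg_cong[of _ _ prob])
      also have "\<dots> = 1 - p n" unfolding p_def by (rule prob_compl) measurable
      finally show ?thesis .
    qed
    ultimately show ?thesis by simp
  qed
  have "AE \<omega> in M. \<forall>\<^sub>F n in sequentially. \<omega> \<in> F n"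
    using AE_cadlag jumps AE_space
  proof eventually_elim
    case (elim \<omega>)
    obtain e where e: "0 < e" "\<And>s t. 0 \<le> s \<Longrightarrow> s \<le> t \<Longrightarrow> t \<le> 1 \<Longrightarrow> t - s < e \<Longrightarrow> X t \<omega> - X s \<omega> \<le> \<epsilon>"
      using upward_increments_small[OF elim(1,2) \<epsilon>] by blast
    obtain N where N: "h N < e" using nat_approx_posE[OF e(1)] unfolding h_def by blast
    show ?case
    proof (rule eventually_sequentiallyI[of N])
      fix n assume "N \<le> n"
      then have "h n \<le> h N" unfolding h_def by (intro divide_left_mono) auto
      then have hn: "h n < e" using N by simp
      have "step n i \<omega> \<le> \<epsilon>" if "i < Suc n" for i
      proof -
        have "real (Suc i) * h n \<le> real (Suc n) * h n" using that h(1)[of n] by (intro mult_right_mono) auto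
        then have "real (Suc i) * h n \<le> 1" unfolding h(3) .
        then show ?thesis unfolding step_def using h(1)[of n] hn by (intro e(2)) (auto simp: algebra_simps)
      qed
      then show "\<omega> \<in> F n" using elim(3) by (auto simp: F_def)
    qed
  qed
  then have "(\<lambda>n. LINT \<omega>|M. indicator (F n) \<omega>) \<longlonglongrightarrow> (LINT \<omega>|M. 1 :: real)"
  proof (intro integral_dominated_convergence[where w = "\<lambda>_. 1"])
    assume "AE \<omega> in M. \<forall>\<^sub>F n in sequentially. \<omega> \<in> F n"
    then show "AE \<omega> in M. (\<lambda>n. indicator (F n) \<omega>) \<longlonglongrightarrow> (1 :: real)"
    proof eventually_elim
      case (elim \<omega>)
      then show ?case by (intro tendsto_eventually) (auto elim: eventually_mono)
    qed
  qed (use Fm in \<open>auto simp: indicator_def\<close>)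
  then have one: "(\<lambda>n. prob (F n)) \<longlonglongrightarrow> 1" using Fm prob_space by simp
  have up: "prob (F n) \<le> exp (- (real (Suc n) * p n))" for n
  proof -
    have "1 - p n \<le> exp (- p n)" using exp_ge_add_one_self[of "- p n"] by simp
    then have "(1 - p n) ^ Suc n \<le> exp (- p n) ^ Suc n" using p01[of n] by (intro power_mono) auto
    then show ?thesis unfolding pF by (simp add: exp_of_nat_mult[symmetric] del: power_Suc of_nat_Suc)
  qed
  have "(\<lambda>n. exp (- (real (Suc n) * p n))) \<longlonglongrightarrow> 1"
    by (rule tendsto_sandwich[OF _ _ one tendsto_const]) (use up p01 in \<open>auto intro!: always_eventually\<close>)
  then have "(\<lambda>n. - ln (exp (- (real (Suc n) * p n)))) \<longlonglongrightarrow> - ln 1"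
    by (intro tendsto_minus tendsto_ln) auto
  then show ?thesis by (simp add: p_def)
qed

end

context spectrally_negative_levy
begin

definition rate :: "nat \<Rightarrow> (real \<Rightarrow> real) \<Rightarrow> real" where
  "rate n f = real (Suc n) * (LINT \<omega>|M. f (Y n \<omega>))"

lemma rate_taylor_rest:
  assumes "0 < \<theta>"
  shows "integrable M (\<lambda>\<omega>. taylor_rest \<theta> (Y n \<omega>))"
    and "(\<lambda>n. rate n (taylor_rest \<theta>)) \<longlonglongrightarrow> \<psi> \<theta> - \<theta> * \<psi> 1"
proof -
  have i: "integrable M (\<lambda>\<omega>. Y n \<omega> powr \<theta> - 1)" for n using integrable_Y_powr[of \<theta> n] assms by simp
  have i1: "integrable M (\<lambda>\<omega>. Y n \<omega> powr 1 - 1)" for n using integrable_Y_powr[of 1 n] by simp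
  have e: "taylor_rest \<theta> (Y n \<omega>) = (Y n \<omega> powr \<theta> - 1) - \<theta> * (Y n \<omega> powr 1 - 1)" for n \<omega>
    using Y_pos[of n \<omega>] by (simp add: taylor_rest_def)
  show "integrable M (\<lambda>\<omega>. taylor_rest \<theta> (Y n \<omega>))"
    unfolding e by (intro Bochner_Integration.integrable_diff integrable_mult_right i i1)
  have "rate n (taylor_rest \<theta>) = real (Suc n) * (LINT \<omega>|M. Y n \<omega> powr \<theta> - 1) - \<theta> * (real (Suc n) * (LINT \<omega>|M. Y n \<omega> powr 1 - 1))" for n
  proof -
    have "(LINT \<omega>|M. taylor_rest \<theta> (Y n \<omega>)) = (LINT \<omega>|M. Y n \<omega> powr \<theta> - 1) - \<theta> * (LINT \<omega>|M. Y n \<omega> powr 1 - 1)"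
      unfolding e by (subst Bochner_Integration.integral_diff[OF i integrable_mult_right[OF i1]], subst integral_mult_right_zero) (rule refl)
    then show ?thesis unfolding rate_def by (simp only: right_diff_distrib mult.left_commute)
  qed
  moreover have "(\<lambda>n. real (Suc n) * (LINT \<omega>|M. Y n \<omega> powr \<theta> - 1) - \<theta> * (real (Suc n) * (LINT \<omega>|M. Y n \<omega> powr 1 - 1))) \<longlonglongrightarrow> \<psi> \<theta> - \<theta> * \<psi> 1"
    using assms by (intro tendsto_diff tendsto_mult tendsto_const Y_powr_limit) auto
  ultimately show "(\<lambda>n. rate n (taylor_rest \<theta>)) \<longlonglongrightarrow> \<psi> \<theta> - \<theta> * \<psi> 1" by simp
qed

lemma rate_Y_upward_0:
  assumes \<epsilon>: "0 < \<epsilon>"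
  shows "(\<lambda>n. rate n (indicator {1 + \<epsilon><..})) \<longlonglongrightarrow> 0"
proof -
  have "0 < ln (1 + \<epsilon>)" using \<epsilon> by simp
  from rate_upward_0[OF this]
  have "(\<lambda>n. real (Suc n) * prob {\<omega>\<in>space M. ln (1 + \<epsilon>) < X (h n) \<omega>}) \<longlonglongrightarrow> 0" .
  moreover have "prob {\<omega>\<in>space M. ln (1 + \<epsilon>) < X (h n) \<omega>} = (LINT \<omega>|M. indicator {1 + \<epsilon><..} (Y n \<omega>))" for n
  proof -
    have "1 + \<epsilon> < Y n \<omega> \<longleftrightarrow> ln (1 + \<epsilon>) < X (h n) \<omega>" for \<omega>
      unfolding Y_def using \<epsilon> by (metis add_pos_pos exp_less_cancel_iff exp_ln zero_less_one)
    then have "(LINT \<omega>|M. indicator {1 + \<epsilon><..} (Y n \<omega>)) = (LINT \<omega>|M. indicator {\<omega>\<in>space M. ln (1 + \<epsilon>) < X (h n) \<omega>} \<omega> :: real)"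
      by (intro Bochner_Integration.integral_cong refl) (auto simp: indicator_def)
    then show ?thesis by (simp add: Int_absorb2)
  qed
  ultimately show ?thesis by (simp add: rate_def)
qed

text \<open>A uniform integrability argument: \<open>z = Y n \<omega> powr p\<close> satisfies
  \<open>z \<le> K + z * z / K\<close>, and \<open>z * z \<le> 4 * (z - 1)\<^sup>2\<close> where
  \<open>Y n \<omega> > 2\<close>. The rate of \<open>(z - 1)\<^sup>2\<close> is bounded since it
  tends to \<open>\<psi> (2 * p) - 2 * \<psi> p\<close>, and the constant part has vanishing rate by
  \<open>rate_Y_upward_0\<close>.\<close>

lemma rate_powr_upward_0:
  assumes p: "1 \<le> p"
  shows "integrable M (\<lambda>\<omega>. Y n \<omega> powr p * indicator {2<..} (Y n \<omega>))"
    and "(\<lambda>n. rate n (\<lambda>y. y powr p * indicator {2<..} y)) \<longlonglongrightarrow> 0"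
proof -
  show i: "integrable M (\<lambda>\<omega>. Y n \<omega> powr p * indicator {2<..} (Y n \<omega>))" for n
    by (rule Bochner_Integration.integrable_bound[OF integrable_Y_powr[of p n]]) (use p in \<open>auto simp: indicator_def\<close>)
  define s where "s n = real (Suc n) * (LINT \<omega>|M. Y n \<omega> powr (2 * p) - 1) - 2 * (real (Suc n) * (LINT \<omega>|M. Y n \<omega> powr p - 1))" for n
  have sq: "(Y n \<omega> powr p - 1)\<^sup>2 = (Y n \<omega> powr (2 * p) - 1) - 2 * (Y n \<omega> powr p - 1)" for n \<omega>
    by (simp add: power2_eq_square algebra_simps powr_add[symmetric])
  have ia: "integrable M (\<lambda>\<omega>. Y n \<omega> powr (2 * p) - 1)" "integrable M (\<lambda>\<omega>. Y n \<omega> powr p - 1)" for n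
    using integrable_Y_powr[of "2 * p" n] integrable_Y_powr[of p n] p by auto
  have isq: "integrable M (\<lambda>\<omega>. (Y n \<omega> powr p - 1)\<^sup>2)" for n
    unfolding sq by (intro Bochner_Integration.integrable_diff integrable_mult_right ia)
  have s_eq: "s n = rate n (\<lambda>y. (y powr p - 1)\<^sup>2)" for n
  proof -
    have "(LINT \<omega>|M. (Y n \<omega> powr p - 1)\<^sup>2) = (LINT \<omega>|M. Y n \<omega> powr (2 * p) - 1) - 2 * (LINT \<omega>|M. Y n \<omega> powr p - 1)"
      unfolding sq by (subst Bochner_Integration.integral_diff[OF ia(1) integrable_mult_right[OF ia(2)]], subst integral_mult_right_zero) (rule refl)
    then show ?thesis unfolding s_def rate_def by (simp only: right_diff_distrib mult.left_commute)
  qed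
  have "s \<longlonglongrightarrow> \<psi> (2 * p) - 2 * \<psi> p"
    unfolding s_def[abs_def] using p by (intro tendsto_diff tendsto_mult tendsto_const Y_powr_limit) auto
  then have "Bseq s" by (intro convergent_imp_Bseq convergentI)
  then obtain B where B: "0 < B" "\<And>n. \<bar>s n\<bar> \<le> B" by (auto simp: Bseq_def)
  show "(\<lambda>n. rate n (\<lambda>y. y powr p * indicator {2<..} y)) \<longlonglongrightarrow> 0"
  proof (rule LIMSEQ_I)
    fix e :: real assume e: "0 < e"
    \<comment> \<open>Makes the quadratic contribution \<open>4 / K * B\<close> equal to
      \<open>e / 2\<close>.\<close>
    define K where "K = 8 * B / e"
    have K: "0 < K" using B e by (simp add: K_def)
    have "\<forall>\<^sub>F n in sequentially. rate n (indicator {1 + 1<..}) < e / (2 * K)"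
      using rate_Y_upward_0[of 1] e K by (intro order_tendstoD(2)) auto
    then obtain N where N: "\<And>n. n \<ge> N \<Longrightarrow> rate n (indicator {2<..}) < e / (2 * K)" by (auto simp: eventually_sequentially)
    show "\<exists>no. \<forall>n\<ge>no. norm (rate n (\<lambda>y. y powr p * indicator {2<..} y) - 0) < e"
    proof (intro exI[of _ N] allI impI)
      fix n assume n: "N \<le> n"
      have "(LINT \<omega>|M. Y n \<omega> powr p * indicator {2<..} (Y n \<omega>)) \<le> (LINT \<omega>|M. K * indicator {2<..} (Y n \<omega>) + 4 / K * (Y n \<omega> powr p - 1)\<^sup>2)"
      proof (rule integral_mono[OF i])
        show "integrable M (\<lambda>\<omega>. K * indicator {2<..} (Y n \<omega>) + 4 / K * (Y n \<omega> powr p - 1)\<^sup>2)"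
          by (intro Bochner_Integration.integrable_add integrable_mult_right isq integrable_const_bound[of _ 1]) (auto simp: indicator_def)
        fix \<omega>
        show "Y n \<omega> powr p * indicator {2<..} (Y n \<omega>) \<le> K * indicator {2<..} (Y n \<omega>) + 4 / K * (Y n \<omega> powr p - 1)\<^sup>2"
        proof (cases "2 < Y n \<omega>")
          case True
          define z where "z = Y n \<omega> powr p"
          have "2 powr 1 \<le> Y n \<omega> powr p" using True p by (intro powr_mono_both) auto
          then have z: "2 \<le> z" by (simp add: z_def)
          then have "z\<^sup>2 \<le> (2 * (z - 1))\<^sup>2" by (intro power_mono) auto
          then have z2: "z * z \<le> 4 * (z - 1)\<^sup>2" by (simp only: power_mult_distrib) (simp add: power2_eq_square)
          have "z \<le> K + z * z / K"
          proof (cases "z \<le> K")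
            case False
            then have "K * z \<le> z * z" using z by (intro mult_right_mono) auto
            then have "z \<le> z * z / K" using K by (simp add: le_divide_eq mult.commute)
            then show ?thesis using K by simp
          qed (use K z in \<open>simp add: add_increasing2\<close>)
          also have "\<dots> \<le> K + 4 * (z - 1)\<^sup>2 / K" using z2 K by (intro add_left_mono divide_right_mono) auto
          finally show ?thesis using True by (simp add: z_def)
        qed (use K in simp)
      qed
      also have "\<dots> = K * (LINT \<omega>|M. indicator {2<..} (Y n \<omega>)) + 4 / K * (LINT \<omega>|M. (Y n \<omega> powr p - 1)\<^sup>2)"
        using isq[of n] by (subst Bochner_Integration.integral_add) (auto intro!: integrable_mult_right integrable_const_bound[of _ 1] simp: indicator_def)
      finally have "rate n (\<lambda>y. y powr p * indicator {2<..} y) \<le> real (Suc n) * \<dots>" unfolding rate_def by (intro mult_left_mono) auto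
      also have "\<dots> = K * rate n (indicator {2<..}) + 4 / K * s n"
        unfolding s_eq rate_def by (simp add: distrib_left mult_ac)
      also have "\<dots> < e"
      proof -
        have "K * rate n (indicator {2<..}) < K * (e / (2 * K))" using N[OF n] K by (intro mult_strict_left_mono) auto
        also have "\<dots> = e / 2" using K by simp
        finally have 1: "K * rate n (indicator {2<..}) < e / 2" .
        have "4 / K * s n \<le> 4 / K * B" using B(2)[of n] K by (intro mult_left_mono) auto
        also have "\<dots> = e / 2" using B e by (simp add: K_def)
        finally show ?thesis using 1 by simp
      qed
      finally have "rate n (\<lambda>y. y powr p * indicator {2<..} y) < e" .
      moreover have "0 \<le> rate n (\<lambda>y. y powr p * indicator {2<..} y)"
        unfolding rate_def by (intro mult_nonneg_nonneg Bochner_Integration.integral_nonneg) auto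
      ultimately show "norm (rate n (\<lambda>y. y powr p * indicator {2<..} y) - 0) < e" by simp
    qed
  qed
qed

text \<open>Above 2 the remainder is dominated by a multiple of \<open>y powr p\<close> with
  \<open>p = max 1 \<theta>\<close>, whose rate vanishes; so the cut at 2 does not change the
  limit.\<close>

lemma rate_truncated:
  assumes \<theta>: "0 < \<theta>"
  shows "(\<lambda>n. rate n (\<lambda>y. taylor_rest \<theta> y * indicator {..2} y)) \<longlonglongrightarrow> \<psi> \<theta> - \<theta> * \<psi> 1"
proof -
  define p where "p = max 1 \<theta>"
  have p: "1 \<le> p" "\<theta> \<le> p" by (auto simp: p_def)
  have big: "\<bar>taylor_rest \<theta> y * indicator {2<..} y\<bar> \<le> (2 + 2 * \<theta>) * (y powr p * indicator {2<..} y)" for y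
  proof (cases "2 < y")
    case True
    have "y powr \<theta> \<le> y powr p" "y powr 1 \<le> y powr p" by (rule powr_mono; use True p in simp)+
    then have y: "y powr \<theta> \<le> y powr p" "y \<le> y powr p" "0 \<le> y powr \<theta>" using True by auto
    have "\<bar>taylor_rest \<theta> y\<bar> \<le> y powr \<theta> + 1 + \<theta> * (y - 1)"
    proof -
      have "0 \<le> \<theta> * (y - 1)" using True \<theta> by simp
      then show ?thesis unfolding taylor_rest_def using y(3) by linarith
    qed
    also have "\<dots> \<le> y powr p + y powr p + \<theta> * y powr p" using y True \<theta> by (intro add_mono mult_left_mono) auto
    also have "\<dots> \<le> (2 + 2 * \<theta>) * y powr p" using \<theta> by (simp add: algebra_simps)
    finally show ?thesis using True by simp
  qed simp
  have i: "integrable M (\<lambda>\<omega>. taylor_rest \<theta> (Y n \<omega>) * indicator {2<..} (Y n \<omega>))" for n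
    using rate_taylor_rest(1)[OF \<theta>, of n]
    by (rule Bochner_Integration.integrable_bound) (auto simp: taylor_rest_def indicator_def)
  have "(\<lambda>n. rate n (\<lambda>y. taylor_rest \<theta> y * indicator {2<..} y)) \<longlonglongrightarrow> 0"
  proof (rule Lim_null_comparison)
    have "(\<lambda>n. (2 + 2 * \<theta>) * rate n (\<lambda>y. y powr p * indicator {2<..} y)) \<longlonglongrightarrow> (2 + 2 * \<theta>) * 0"
      by (intro tendsto_mult tendsto_const rate_powr_upward_0 p)
    then show "(\<lambda>n. (2 + 2 * \<theta>) * rate n (\<lambda>y. y powr p * indicator {2<..} y)) \<longlonglongrightarrow> 0" by simp
    show "\<forall>\<^sub>F n in sequentially. norm (rate n (\<lambda>y. taylor_rest \<theta> y * indicator {2<..} y)) \<le> (2 + 2 * \<theta>) * rate n (\<lambda>y. y powr p * indicator {2<..} y)"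
    proof (rule always_eventually, rule allI)
      fix n
      have "norm (LINT \<omega>|M. taylor_rest \<theta> (Y n \<omega>) * indicator {2<..} (Y n \<omega>)) \<le> (LINT \<omega>|M. norm (taylor_rest \<theta> (Y n \<omega>) * indicator {2<..} (Y n \<omega>)))"
        by (rule integral_norm_bound)
      also have "\<dots> \<le> (LINT \<omega>|M. (2 + 2 * \<theta>) * (Y n \<omega> powr p * indicator {2<..} (Y n \<omega>)))"
        using i[of n] big rate_powr_upward_0(1)[OF p(1), of n] by (intro integral_mono integrable_norm integrable_mult_right) auto
      finally have "real (Suc n) * norm (LINT \<omega>|M. taylor_rest \<theta> (Y n \<omega>) * indicator {2<..} (Y n \<omega>)) \<le> real (Suc n) * \<dots>"
        by (intro mult_left_mono) auto
      then show "norm (rate n (\<lambda>y. taylor_rest \<theta> y * indicator {2<..} y)) \<le> (2 + 2 * \<theta>) * rate n (\<lambda>y. y powr p * indicator {2<..} y)"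
        unfolding rate_def integral_mult_right_zero by (simp only: real_norm_def abs_mult abs_of_nat mult.left_commute[of "2 + 2 * \<theta>"])
    qed
  qed
  from tendsto_diff[OF rate_taylor_rest(2)[OF \<theta>] this]
  have "(\<lambda>n. rate n (taylor_rest \<theta>) - rate n (\<lambda>y. taylor_rest \<theta> y * indicator {2<..} y)) \<longlonglongrightarrow> \<psi> \<theta> - \<theta> * \<psi> 1" by simp
  moreover have "rate n (taylor_rest \<theta>) - rate n (\<lambda>y. taylor_rest \<theta> y * indicator {2<..} y) = rate n (\<lambda>y. taylor_rest \<theta> y * indicator {..2} y)" for n
  proof -
    have "(LINT \<omega>|M. taylor_rest \<theta> (Y n \<omega>)) - (LINT \<omega>|M. taylor_rest \<theta> (Y n \<omega>) * indicator {2<..} (Y n \<omega>)) =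
        (LINT \<omega>|M. taylor_rest \<theta> (Y n \<omega>) - taylor_rest \<theta> (Y n \<omega>) * indicator {2<..} (Y n \<omega>))"
      using rate_taylor_rest(1)[OF \<theta>, of n] i[of n] by simp
    also have "\<dots> = (LINT \<omega>|M. taylor_rest \<theta> (Y n \<omega>) * indicator {..2} (Y n \<omega>))"
      by (intro Bochner_Integration.integral_cong refl) (auto simp: indicator_def)
    finally show ?thesis unfolding rate_def by (simp only: right_diff_distrib[symmetric])
  qed
  ultimately show ?thesis by simp
qed

lemma taylor_rest_2: "0 < y \<Longrightarrow> taylor_rest 2 y = (y - 1)\<^sup>2"
  by (simp add: taylor_rest_def power2_eq_square powr_numeral algebra_simps)

definition mass :: "nat \<Rightarrow> real" where
  "mass n = rate n (\<lambda>y. (y - 1)\<^sup>2 * indicator {..2} y)"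

lemma mass_nonneg: "0 \<le> mass n"
  unfolding mass_def rate_def by (intro mult_nonneg_nonneg Bochner_Integration.integral_nonneg) auto

text \<open>The case \<open>\<theta> = 2\<close> of \<open>rate_truncated\<close>, where the Taylor
  remainder is \<open>(y - 1)\<^sup>2\<close> itself.\<close>

lemma mass_limit: "mass \<longlonglongrightarrow> \<psi> 2 - 2 * \<psi> 1"
proof -
  have "rate n (\<lambda>y. taylor_rest 2 y * indicator {..2} y) = mass n" for n
    unfolding mass_def rate_def using Y_pos by (simp add: taylor_rest_2)
  then show ?thesis using rate_truncated[of 2] by simp
qed

text \<open>A density with mean 1 whenever \<open>mass n > 0\<close>. It turns rates of truncated
  Taylor remainders into integrals of Taylor quotients against a probability law.\<close>

definition weight :: "nat \<Rightarrow> 'w \<Rightarrow> real" where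
  "weight n \<omega> = real (Suc n) * (Y n \<omega> - 1)\<^sup>2 * indicator {..2} (Y n \<omega>) / mass n"

definition tilted :: "nat \<Rightarrow> real measure" where
  "tilted n = distr (density M (\<lambda>\<omega>. ennreal (weight n \<omega>))) borel (Y n)"

lemma weight_measurable [measurable]: "weight n \<in> borel_measurable M"
  unfolding weight_def[abs_def] by measurable

lemma weight_nonneg: "0 \<le> weight n \<omega>"
  unfolding weight_def using mass_nonneg[of n] by (intro divide_nonneg_nonneg mult_nonneg_nonneg) auto

lemma sq_bound: "(Y n \<omega> - 1)\<^sup>2 * indicator {..2} (Y n \<omega>) \<le> 1"
proof (cases "Y n \<omega> \<le> 2")
  case True
  then have "\<bar>Y n \<omega> - 1\<bar> \<le> 1" using Y_pos[of n \<omega>] by (simp add: abs_le_iff)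
  then have "\<bar>Y n \<omega> - 1\<bar>\<^sup>2 \<le> 1\<^sup>2" by (intro power_mono) auto
  then show ?thesis using True by simp
qed simp

lemma weight_le: "weight n \<omega> \<le> real (Suc n) / mass n"
proof -
  have "real (Suc n) * ((Y n \<omega> - 1)\<^sup>2 * indicator {..2} (Y n \<omega>)) \<le> real (Suc n) * 1"
    by (intro mult_left_mono sq_bound) auto
  then show ?thesis unfolding weight_def using mass_nonneg[of n] by (intro divide_right_mono) (auto simp: mult.assoc)
qed

lemma integrable_weight: "integrable M (weight n)"
  by (rule integrable_const_bound[of _ "real (Suc n) / mass n"]) (use weight_nonneg weight_le in auto)

lemma integral_tilted:
  fixes f :: "real \<Rightarrow> real"
  assumes f: "f \<in> borel_measurable borel"
  shows "(LINT y|tilted n. f y) = rate n (\<lambda>y. f y * ((y - 1)\<^sup>2 * indicator {..2} y)) / mass n"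
proof -
  have [measurable]: "f \<in> borel_measurable borel" by (rule f)
  have "(LINT y|tilted n. f y) = (LINT \<omega>|density M (\<lambda>\<omega>. ennreal (weight n \<omega>)). f (Y n \<omega>))"
    unfolding tilted_def by (rule integral_distr) auto
  also have "\<dots> = (LINT \<omega>|M. weight n \<omega> *\<^sub>R f (Y n \<omega>))"
    by (rule integral_density) (auto intro: weight_nonneg)
  also have "\<dots> = (LINT \<omega>|M. real (Suc n) / mass n * (f (Y n \<omega>) * ((Y n \<omega> - 1)\<^sup>2 * indicator {..2} (Y n \<omega>))))"
    by (intro Bochner_Integration.integral_cong refl) (simp add: weight_def mult_ac)
  also have "\<dots> = rate n (\<lambda>y. f y * ((y - 1)\<^sup>2 * indicator {..2} y)) / mass n"
    unfolding rate_def by simp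
  finally show ?thesis .
qed

lemma real_distribution_tilted:
  assumes "0 < mass n" shows "real_distribution (tilted n)"
proof -
  have "(\<integral>\<^sup>+\<omega>. ennreal (weight n \<omega>) \<partial>M) = ennreal (LINT \<omega>|M. weight n \<omega>)"
    using integrable_weight weight_nonneg by (intro nn_integral_eq_integral) auto
  also have "(LINT \<omega>|M. weight n \<omega>) = (LINT \<omega>|M. real (Suc n) / mass n * ((Y n \<omega> - 1)\<^sup>2 * indicator {..2} (Y n \<omega>)))"
    by (intro Bochner_Integration.integral_cong refl) (simp add: weight_def mult_ac)
  also have "\<dots> = mass n / mass n" unfolding mass_def rate_def by simp
  finally have "(\<integral>\<^sup>+\<omega>. ennreal (weight n \<omega>) \<partial>M) = 1" using assms by simp
  then have "prob_space (density M (\<lambda>\<omega>. ennreal (weight n \<omega>)))"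
    by (intro prob_spaceI) (simp add: emeasure_density cong: nn_integral_cong_simp)
  then have "prob_space (tilted n)" unfolding tilted_def by (rule prob_space.prob_space_distr) simp
  then show ?thesis by (auto simp: real_distribution_def real_distribution_axioms_def tilted_def)
qed

lemma AE_tilted: "AE y in tilted n. 0 < y \<and> y \<le> 2"
proof -
  have "AE \<omega> in density M (\<lambda>\<omega>. ennreal (weight n \<omega>)). 0 < Y n \<omega> \<and> Y n \<omega> \<le> 2"
    by (subst AE_density) (auto intro!: AE_I2 simp: Y_pos weight_def split: split_indicator_asm)
  then show ?thesis unfolding tilted_def by (subst AE_distr_iff) auto
qed

text \<open>
  The clamped argument makes the Taylor quotient bounded and continuous on the whole line without
  changing it on the support of the tilted measures.
\<close>

definition clamped_quot :: "real \<Rightarrow> real \<Rightarrow> real" where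
  "clamped_quot \<theta> y = taylor_quot \<theta> (max 0 (min 2 y))"

lemma clamped_quot_continuous: "0 < \<theta> \<Longrightarrow> continuous_on UNIV (clamped_quot \<theta>)"
  unfolding clamped_quot_def[abs_def]
  by (rule continuous_on_compose2[OF taylor_quot_continuous]) (auto intro!: continuous_intros)

lemma clamped_quot_bounded:
  assumes "0 < \<theta>" shows "\<exists>B. \<forall>y. \<bar>clamped_quot \<theta> y\<bar> \<le> B"
proof -
  have "compact (taylor_quot \<theta> ` {0..2})"
    using taylor_quot_continuous[OF assms] by (intro compact_continuous_image) (auto elim: continuous_on_subset)
  then obtain B where B: "\<And>y. y \<in> {0..2} \<Longrightarrow> \<bar>taylor_quot \<theta> y\<bar> \<le> B"
    using compact_imp_bounded bounded_iff by (metis image_eqI real_norm_def)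
  have "\<bar>clamped_quot \<theta> y\<bar> \<le> B" for y unfolding clamped_quot_def by (rule B) auto
  then show ?thesis by blast
qed

lemma rate_clamped:
  "rate n (\<lambda>y. clamped_quot \<theta> y * ((y - 1)\<^sup>2 * indicator {..2} y)) = rate n (\<lambda>y. taylor_rest \<theta> y * indicator {..2} y)"
proof -
  have "clamped_quot \<theta> y * ((y - 1)\<^sup>2 * indicator {..2} y) = taylor_rest \<theta> y * indicator {..2} y" if "0 < y" for y
    using that by (cases "y \<le> 2") (auto simp: clamped_quot_def taylor_rest_eq)
  from this[OF Y_pos] show ?thesis unfolding rate_def by (simp only:)
qed

theorem weak_limit_representation:
  "\<exists>c Q. 0 \<le> c \<and> real_distribution Q \<and> (AE y in Q. 0 \<le> y \<and> y \<le> 1) \<and>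
    (\<forall>\<theta>>0. integrable Q (taylor_quot \<theta>) \<and> \<psi> \<theta> = \<theta> * \<psi> 1 + c * (LINT y|Q. taylor_quot \<theta> y))"
proof -
  define c where "c = \<psi> 2 - 2 * \<psi> 1"
  have c0: "0 \<le> c" unfolding c_def using mass_nonneg by (intro tendsto_lowerbound[OF mass_limit]) auto
  have int: "integrable Q (taylor_quot \<theta>) \<and> (LINT y|Q. taylor_quot \<theta> y) = (LINT y|Q. clamped_quot \<theta> y)"
    if Q: "real_distribution Q" "AE y in Q. 0 \<le> y \<and> y \<le> 1" and \<theta>: "0 < \<theta>" for Q \<theta>
  proof -
    interpret Q: real_distribution Q by fact
    have [measurable]: "clamped_quot \<theta> \<in> borel_measurable borel"
      by (rule borel_measurable_continuous_onI[OF clamped_quot_continuous[OF \<theta>]])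
    have [measurable]: "taylor_quot \<theta> \<in> borel_measurable borel"
      unfolding taylor_quot_def[abs_def] taylor_rest_def by measurable
    have ae: "AE y in Q. clamped_quot \<theta> y = taylor_quot \<theta> y"
      using Q(2) by eventually_elim (simp add: clamped_quot_def)
    obtain B where "\<And>y. \<bar>clamped_quot \<theta> y\<bar> \<le> B" using clamped_quot_bounded[OF \<theta>] by blast
    then have ic: "integrable Q (clamped_quot \<theta>)" by (intro Q.integrable_const_bound[of _ B]) auto
    have "integrable Q (taylor_quot \<theta>)" using ic ae by (subst (asm) integrable_cong_AE[OF _ _ ae]) auto
    moreover have "(LINT y|Q. taylor_quot \<theta> y) = (LINT y|Q. clamped_quot \<theta> y)"
      using ae by (intro integral_cong_AE) auto
    ultimately show ?thesis by simp
  qed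
  show ?thesis
  proof (cases "c = 0")
    \<comment> \<open>If the mass vanishes in the limit, so do all truncated Taylor rates, and
      \<open>\<psi>\<close> is linear; any law on \<open>{0..1}\<close> may then serve as
      \<open>Q\<close>.\<close>
    case True
    have "\<psi> \<theta> = \<theta> * \<psi> 1" if \<theta>: "0 < \<theta>" for \<theta>
    proof -
      obtain B where B: "\<And>y. \<bar>clamped_quot \<theta> y\<bar> \<le> B" using clamped_quot_bounded[OF \<theta>] by blast
      have B0: "0 \<le> B" using B[of 0] by (rule order_trans[OF abs_ge_zero])
      have [measurable]: "clamped_quot \<theta> \<in> borel_measurable borel"
        by (rule borel_measurable_continuous_onI[OF clamped_quot_continuous[OF \<theta>]])
      have "(\<lambda>n. rate n (\<lambda>y. taylor_rest \<theta> y * indicator {..2} y)) \<longlonglongrightarrow> 0"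
      proof (rule Lim_null_comparison)
        show "\<forall>\<^sub>F n in sequentially. norm (rate n (\<lambda>y. taylor_rest \<theta> y * indicator {..2} y)) \<le> B * mass n"
        proof (rule always_eventually, rule allI)
          fix n
          have i: "integrable M (\<lambda>\<omega>. (Y n \<omega> - 1)\<^sup>2 * indicator {..2} (Y n \<omega>))"
            by (rule integrable_const_bound[of _ 1]) (use sq_bound in auto)
          have "norm (LINT \<omega>|M. clamped_quot \<theta> (Y n \<omega>) * ((Y n \<omega> - 1)\<^sup>2 * indicator {..2} (Y n \<omega>))) \<le>
              (LINT \<omega>|M. norm (clamped_quot \<theta> (Y n \<omega>) * ((Y n \<omega> - 1)\<^sup>2 * indicator {..2} (Y n \<omega>))))"
            by (rule integral_norm_bound)
          also have "\<dots> \<le> (LINT \<omega>|M. B * ((Y n \<omega> - 1)\<^sup>2 * indicator {..2} (Y n \<omega>)))"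
            by (rule integral_mono') (use i B B0 in \<open>auto simp: abs_mult intro!: mult_right_mono\<close>)
          finally have "real (Suc n) * norm (LINT \<omega>|M. clamped_quot \<theta> (Y n \<omega>) * ((Y n \<omega> - 1)\<^sup>2 * indicator {..2} (Y n \<omega>))) \<le> real (Suc n) * \<dots>"
            by (intro mult_left_mono) auto
          then show "norm (rate n (\<lambda>y. taylor_rest \<theta> y * indicator {..2} y)) \<le> B * mass n"
            unfolding rate_clamped[symmetric] mass_def rate_def integral_mult_right_zero
            by (simp only: real_norm_def abs_mult abs_of_nat mult.left_commute[of B])
        qed
        have "(\<lambda>n. B * mass n) \<longlonglongrightarrow> B * c" unfolding c_def by (intro tendsto_intros mass_limit)
        then show "(\<lambda>n. B * mass n) \<longlonglongrightarrow> 0" using True by simp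
      qed
      from LIMSEQ_unique[OF this rate_truncated[OF \<theta>]] show ?thesis by simp
    qed
    note rep = this
    have Q: "real_distribution (return borel (0::real))"
      by (auto simp: real_distribution_def real_distribution_axioms_def intro: prob_space_return)
    have ae: "AE y in return borel (0::real). 0 \<le> y \<and> y \<le> 1" by (simp add: AE_return)
    show ?thesis
    proof (rule exI[of _ 0], rule exI[of _ "return borel 0"], intro conjI allI impI order_refl Q ae)
      fix \<theta> :: real assume \<theta>: "0 < \<theta>"
      show "integrable (return borel 0) (taylor_quot \<theta>)" using int[OF Q ae \<theta>] by (rule conjunct1)
      show "\<psi> \<theta> = \<theta> * \<psi> 1 + 0 * (LINT y|return borel 0. taylor_quot \<theta> y)" unfolding mult_zero_left add_0_right by (rule rep[OF \<theta>])
    qed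
  next
    case False
    then have cpos: "0 < c" using c0 by simp
    obtain n0 where n0: "\<And>n. n0 \<le> n \<Longrightarrow> 0 < mass n"
      using order_tendstoD(1)[OF mass_limit, of 0] cpos by (auto simp: c_def eventually_sequentially)
    \<comment> \<open>The shift skips the finitely many indices at which \<open>mass\<close> may
      vanish and \<open>tilted\<close> fails to be a probability law.\<close>
    define P where "P n = tilted (n + n0)" for n
    have rd: "real_distribution (P n)" for n unfolding P_def by (intro real_distribution_tilted n0) simp
    have "tight P" unfolding tight_def
    proof (intro conjI allI impI rd)
      fix \<epsilon> :: real assume "0 < \<epsilon>"
      have "measure (P n) {-1<..2} = 1" for n
      proof -
        interpret Pn: real_distribution "P n" by (rule rd)
        have "AE y in P n. y \<in> {-1<..2}" unfolding P_def using AE_tilted[of "n + n0"] by eventually_elim auto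
        then show ?thesis by (subst Pn.prob_eq_1) auto
      qed
      then show "\<exists>a b. a < b \<and> (\<forall>n. 1 - \<epsilon> < measure (P n) {a<..b})"
        using \<open>0 < \<epsilon>\<close> by (intro exI[of _ "-1"] exI[of _ 2]) auto
    qed
    from tight_imp_convergent_subsubsequence[OF this strict_mono_id] obtain r Q where
      r: "strict_mono r" and Q: "real_distribution Q" and wc: "weak_conv_m (P \<circ> id \<circ> r) Q" by auto
    interpret Q: real_distribution Q by (rule Q)
    define k where "k n = r n + n0" for n
    have k: "strict_mono k" using r by (auto simp: k_def strict_mono_def)
    have conv: "(\<lambda>n. LINT y|tilted (k n). f y) \<longlonglongrightarrow> (LINT y|Q. f y)"
      if "continuous_on UNIV f" "\<And>y. \<bar>f y\<bar> \<le> B" for f :: "real \<Rightarrow> real" and B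
    proof -
      have "(\<lambda>n. LINT y|(P \<circ> id \<circ> r) n. f y) \<longlonglongrightarrow> (LINT y|Q. f y)"
        by (rule weak_conv_imp_integral_bdd_continuous_conv[OF _ Q wc, of f B])
           (use rd that in \<open>auto simp: continuous_on_eq_continuous_at\<close>)
      then show ?thesis by (simp add: P_def k_def o_def)
    qed
    \<comment> \<open>A nonnegative test function whose integrals tend to 0 vanishes almost
      everywhere under the weak limit.\<close>
    have support: "AE y in Q. f y = 0"
      if f: "continuous_on UNIV f" "\<And>y. 0 \<le> f y" "\<And>y. f y \<le> 1" and z: "(\<lambda>n. LINT y|tilted (k n). f y) \<longlonglongrightarrow> 0" for f :: "real \<Rightarrow> real"
    proof -
      have [measurable]: "f \<in> borel_measurable borel" by (rule borel_measurable_continuous_onI[OF f(1)])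
      have "integrable Q f" using f by (intro Q.integrable_const_bound[of _ 1]) auto
      moreover have "(LINT y|Q. f y) = 0"
        using conv[OF f(1), of 1] z f by (intro LIMSEQ_unique[OF _ z]) auto
      ultimately show ?thesis using integral_nonneg_eq_0_iff_AE[of Q f] f(2) by simp
    qed
    have kpos: "0 < mass (k n)" for n by (rule n0) (simp add: k_def)
    have mk: "(\<lambda>n. mass (k n)) \<longlonglongrightarrow> c" using LIMSEQ_subseq_LIMSEQ[OF mass_limit k] by (simp add: c_def o_def)
    have low: "AE y in Q. min 1 (max 0 (- y)) = 0"
    proof (rule support)
      have "(LINT y|tilted (k n). min 1 (max 0 (- y))) = 0" for n
        by (rule integral_eq_zero_AE) (use AE_tilted[of "k n"] in eventually_elim, auto)
      then show "(\<lambda>n. LINT y|tilted (k n). min 1 (max 0 (- y))) \<longlonglongrightarrow> 0" by simp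
    qed (auto intro!: continuous_intros)
    \<comment> \<open>Since the square in the weight is at most 1 on the truncated range, the tilted
      law gives \<open>{1 + \<delta><..}\<close> at most the rate of such upward moves divided by
      \<open>mass\<close>, and this tends to 0.\<close>
    have high: "AE y in Q. min 1 (max 0 (y - (1 + \<delta>))) = 0" if \<delta>: "0 < \<delta>" for \<delta>
    proof (rule support)
      have "(\<lambda>n. rate (k n) (indicator {1 + \<delta><..}) / mass (k n)) \<longlonglongrightarrow> 0 / c"
        using LIMSEQ_subseq_LIMSEQ[OF rate_Y_upward_0[OF \<delta>] k] cpos by (intro tendsto_divide mk) (auto simp: o_def)
      then have up: "(\<lambda>n. rate (k n) (indicator {1 + \<delta><..}) / mass (k n)) \<longlonglongrightarrow> 0" by simp
      show "(\<lambda>n. LINT y|tilted (k n). min 1 (max 0 (y - (1 + \<delta>)))) \<longlonglongrightarrow> 0"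
      proof (rule tendsto_sandwich[OF _ _ tendsto_const up])
        show "\<forall>\<^sub>F n in sequentially. 0 \<le> (LINT y|tilted (k n). min 1 (max 0 (y - (1 + \<delta>))))"
          by (intro always_eventually allI Bochner_Integration.integral_nonneg) auto
        show "\<forall>\<^sub>F n in sequentially. (LINT y|tilted (k n). min 1 (max 0 (y - (1 + \<delta>)))) \<le> rate (k n) (indicator {1 + \<delta><..}) / mass (k n)"
        proof (intro always_eventually allI)
          fix n
          have "rate (k n) (\<lambda>y. min 1 (max 0 (y - (1 + \<delta>))) * ((y - 1)\<^sup>2 * indicator {..2} y)) \<le> rate (k n) (indicator {1 + \<delta><..})"
            unfolding rate_def
          proof (intro mult_left_mono integral_mono')
            show "integrable M (\<lambda>\<omega>. indicator {1 + \<delta><..} (Y (k n) \<omega>) :: real)"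
              by (rule integrable_const_bound[of _ 1]) (auto simp: indicator_def)
            fix \<omega>
            show "min 1 (max 0 (Y (k n) \<omega> - (1 + \<delta>))) * ((Y (k n) \<omega> - 1)\<^sup>2 * indicator {..2} (Y (k n) \<omega>)) \<le> indicator {1 + \<delta><..} (Y (k n) \<omega>)"
            proof (cases "1 + \<delta> < Y (k n) \<omega>")
              case True
              have "min 1 (max 0 (Y (k n) \<omega> - (1 + \<delta>))) * ((Y (k n) \<omega> - 1)\<^sup>2 * indicator {..2} (Y (k n) \<omega>)) \<le> 1 * 1"
                by (intro mult_mono sq_bound) auto
              then show ?thesis using True by simp
            qed simp
          qed auto
          then show "(LINT y|tilted (k n). min 1 (max 0 (y - (1 + \<delta>)))) \<le> rate (k n) (indicator {1 + \<delta><..}) / mass (k n)"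
            using kpos[of n] by (subst integral_tilted) (auto intro!: divide_right_mono)
        qed
      qed
    qed (auto intro!: continuous_intros)
    have "AE y in Q. \<forall>m. min 1 (max 0 (y - (1 + 1 / real (Suc m)))) = 0"
      unfolding AE_all_countable using high by simp
    then have ae: "AE y in Q. 0 \<le> y \<and> y \<le> 1"
      using low
    proof eventually_elim
      case (elim y)
      have "y \<le> 1 + e" if e: "0 < e" for e
      proof -
        obtain m where m: "1 / real (Suc m) < e" using nat_approx_posE[OF e] .
        have "y \<le> 1 + 1 / real (Suc m)" using elim(1)[rule_format, of m] by (auto simp: min_def max_def split: if_splits)
        then show ?thesis using m by linarith
      qed
      then have "y \<le> 1" by (rule field_le_epsilon)
      moreover have "0 \<le> y" using elim(2) by (auto simp: min_def max_def split: if_splits)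
      ultimately show ?case by simp
    qed
    have "\<psi> \<theta> = \<theta> * \<psi> 1 + c * (LINT y|Q. taylor_quot \<theta> y)" if \<theta>: "0 < \<theta>" for \<theta>
    proof -
      obtain B where B: "\<And>y. \<bar>clamped_quot \<theta> y\<bar> \<le> B" using clamped_quot_bounded[OF \<theta>] by blast
      have "(\<lambda>n. mass (k n) * (LINT y|tilted (k n). clamped_quot \<theta> y)) \<longlonglongrightarrow> c * (LINT y|Q. clamped_quot \<theta> y)"
        by (intro tendsto_mult mk conv[OF clamped_quot_continuous[OF \<theta>] B])
      moreover have "mass (k n) * (LINT y|tilted (k n). clamped_quot \<theta> y) = rate (k n) (\<lambda>y. taylor_rest \<theta> y * indicator {..2} y)" for n
        using kpos[of n] by (subst integral_tilted[OF borel_measurable_continuous_onI[OF clamped_quot_continuous[OF \<theta>]]]) (simp add: rate_clamped)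
      moreover have "(\<lambda>n. rate (k n) (\<lambda>y. taylor_rest \<theta> y * indicator {..2} y)) \<longlonglongrightarrow> \<psi> \<theta> - \<theta> * \<psi> 1"
        using LIMSEQ_subseq_LIMSEQ[OF rate_truncated[OF \<theta>] k] by (simp add: o_def)
      ultimately have "c * (LINT y|Q. clamped_quot \<theta> y) = \<psi> \<theta> - \<theta> * \<psi> 1" by (simp add: LIMSEQ_unique)
      then show ?thesis using int[OF Q ae \<theta>] by simp
    qed
    note rep = this
    show ?thesis
    proof (rule exI[of _ c], rule exI[of _ Q], intro conjI allI impI c0 Q ae)
      fix \<theta> :: real assume \<theta>: "0 < \<theta>"
      show "integrable Q (taylor_quot \<theta>)" using int[OF Q ae \<theta>] by (rule conjunct1)
      show "\<psi> \<theta> = \<theta> * \<psi> 1 + c * (LINT y|Q. taylor_quot \<theta> y)" by (rule rep[OF \<theta>])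
    qed
  qed
qed

end

section \<open>From the limit measure to a non-increasing density\<close>

definition log_quot :: "real \<Rightarrow> real" where
  "log_quot y = (if y = 1 then 1 / 2 else (y - 1 - ln y) / (y - 1)\<^sup>2)"

lemma log_quot_nonneg: "0 < y \<Longrightarrow> 0 \<le> log_quot y"
  using ln_le_minus_one[of y] by (auto simp: log_quot_def)

lemma log_quot_measurable [measurable]: "log_quot \<in> borel_measurable borel"
  unfolding log_quot_def[abs_def] by measurable

lemma taylor_quot_measurable [measurable]: "taylor_quot \<theta> \<in> borel_measurable borel"
  unfolding taylor_quot_def[abs_def] taylor_rest_def by measurable

lemma taylor_quot_nonpos:
  assumes "0 < \<theta>" "\<theta> \<le> 1" "0 \<le> y" shows "taylor_quot \<theta> y \<le> 0"
proof (cases "y = 0")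
  case False
  then have "0 < y" using assms by simp
  then obtain t where t: "taylor_quot \<theta> y = \<theta> * (\<theta> - 1) / 2 * t powr (\<theta> - 2)"
    using taylor_quot_mean_value by blast
  have "\<theta> * (\<theta> - 1) \<le> 0" using assms by (intro mult_nonneg_nonpos) auto
  then show ?thesis unfolding t by (intro mult_nonpos_nonneg) auto
qed (use assms in \<open>simp add: taylor_quot_def taylor_rest_def\<close>)

text \<open>Up to sign, \<open>log_quot y\<close> is the derivative of
  \<open>taylor_quot \<theta> y\<close> with respect to \<open>\<theta>\<close> at 0, where the
  quotient vanishes.\<close>

lemma taylor_quot_small_limit:
  assumes "0 < y"
  shows "(\<lambda>n. - (real (Suc n) * taylor_quot (1 / real (Suc n)) y)) \<longlonglongrightarrow> log_quot y"
proof (cases "y = 1")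
  case True
  have e: "real (Suc n) * taylor_quot (1 / real (Suc n)) y = (1 / real (Suc n) - 1) / 2" for n
    using True by (simp add: taylor_quot_def del: of_nat_Suc)
  have "(\<lambda>n. - ((1 / real (Suc n) - 1) / 2)) \<longlonglongrightarrow> - ((0 - 1) / 2)"
    using LIMSEQ_inverse_real_of_nat by (intro tendsto_intros) (simp_all add: inverse_eq_divide)
  then show ?thesis unfolding e using True by (simp add: log_quot_def del: of_nat_Suc)
next
  case False
  have e: "- (real (Suc n) * taylor_quot (1 / real (Suc n)) y) =
      ((y - 1) - real (Suc n) * (exp (ln y / real (Suc n)) - 1)) / (y - 1)\<^sup>2" for n
  proof -
    define m where "m = real (Suc n)"
    have m: "m \<noteq> 0" by (simp add: m_def)
    have "y powr (1 / m) = exp (ln y / m)" using assms by (simp add: powr_def)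
    then have "m * taylor_rest (1 / m) y = m * (exp (ln y / m) - 1) - (y - 1)"
      using m by (simp add: taylor_rest_def field_simps)
    moreover have "- (m * taylor_quot (1 / m) y) = - (m * taylor_rest (1 / m) y) / (y - 1)\<^sup>2"
      using False by (simp add: taylor_quot_def)
    ultimately show ?thesis by (simp add: m_def)
  qed
  have "(\<lambda>n. ((y - 1) - real (Suc n) * (exp (ln y / real (Suc n)) - 1)) / (y - 1)\<^sup>2) \<longlonglongrightarrow> ((y - 1) - ln y) / (y - 1)\<^sup>2"
    using False by (intro tendsto_divide tendsto_diff tendsto_const exp_difference_quotient_limit) auto
  then show ?thesis unfolding e using False by (simp add: log_quot_def)
qed

lemma nn_integral_one_minus_exp:
  assumes "0 < \<theta>" "0 \<le> x"
  shows "(\<integral>\<^sup>+s. ennreal (1 - exp (- \<theta> * s)) * indicator {0..x} s \<partial>lborel) = ennreal (x + (exp (- \<theta> * x) - 1) / \<theta>)"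
proof -
  have "(\<integral>\<^sup>+s. ennreal (1 - exp (- \<theta> * s)) * indicator {0..x} s \<partial>lborel) =
      ennreal ((x + exp (- \<theta> * x) / \<theta>) - (0 + exp (- \<theta> * 0) / \<theta>))"
  proof (rule nn_integral_FTC_Icc)
    fix s :: real assume s: "s \<in> {0..x}"
    show "((\<lambda>s. s + exp (- \<theta> * s) / \<theta>) has_real_derivative 1 - exp (- \<theta> * s)) (at s)"
        using assms by (auto intro!: derivative_eq_intros)
    show "0 \<le> 1 - exp (- \<theta> * s)" using assms s by simp
  qed (use assms in auto)
  then show ?thesis by (simp add: diff_divide_distrib algebra_simps)
qed

text \<open>Adding \<open>log_quot\<close> replaces the compensator \<open>y - 1\<close> by
  \<open>ln y\<close>, for which the remainder is exactly the integral computed in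
  \<open>nn_integral_one_minus_exp\<close>.\<close>

lemma taylor_quot_plus_log_quot:
  assumes \<theta>: "0 < \<theta>" and y: "0 < y" "y < 1"
  shows "ennreal (taylor_quot \<theta> y / \<theta> + log_quot y) =
    (\<integral>\<^sup>+s. ennreal (1 / (1 - y)\<^sup>2) * (ennreal (1 - exp (- \<theta> * s)) * indicator {0..- ln y} s) \<partial>lborel)"
proof -
  have "(\<integral>\<^sup>+s. ennreal (1 / (1 - y)\<^sup>2) * (ennreal (1 - exp (- \<theta> * s)) * indicator {0..- ln y} s) \<partial>lborel) =
      ennreal (1 / (1 - y)\<^sup>2) * ennreal (- ln y + (exp (- \<theta> * - ln y) - 1) / \<theta>)"
    using y by (subst nn_integral_cmult, simp, subst nn_integral_one_minus_exp[OF \<theta>]) auto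
  also have "\<dots> = ennreal (1 / (1 - y)\<^sup>2 * (- ln y + (exp (- \<theta> * - ln y) - 1) / \<theta>))"
    by (rule ennreal_mult'[symmetric]) simp
  also have "1 / (1 - y)\<^sup>2 * (- ln y + (exp (- \<theta> * - ln y) - 1) / \<theta>) = taylor_quot \<theta> y / \<theta> + log_quot y"
  proof -
    have p: "exp (- \<theta> * - ln y) = y powr \<theta>" using y by (simp add: powr_def)
    have q: "(1 - y)\<^sup>2 = (y - 1)\<^sup>2" by (simp add: power2_eq_square algebra_simps)
    have "taylor_quot \<theta> y / \<theta> + log_quot y = (taylor_rest \<theta> y / \<theta> + (y - 1 - ln y)) / (y - 1)\<^sup>2"
      using y by (simp add: taylor_quot_def log_quot_def add_divide_distrib)
    also have "taylor_rest \<theta> y / \<theta> + (y - 1 - ln y) = - ln y + (y powr \<theta> - 1) / \<theta>"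
      using \<theta> by (simp add: taylor_rest_def diff_divide_distrib)
    finally show ?thesis unfolding p q by simp
  qed
  finally show ?thesis by simp
qed

text \<open>Fatou's lemma along \<open>\<theta> = 1 / real (Suc n)\<close>: by \<open>low\<close>
  the integrals of \<open>- taylor_quot \<theta> y / \<theta>\<close> are at most
  \<open>a / c\<close>, while the integrands tend to \<open>log_quot y\<close>, and to infinity at
  \<open>y = 0\<close>. A finite integral leaves no room for an atom there.\<close>

lemma log_quot_integrable:
  assumes c: "0 < c" and Q: "real_distribution Q" and supp: "AE y in Q. 0 \<le> y \<and> y \<le> 1"
    and int: "\<And>\<theta>. 0 < \<theta> \<Longrightarrow> integrable Q (taylor_quot \<theta>)"
    and low: "\<And>\<theta>. 0 < \<theta> \<Longrightarrow> 0 \<le> \<theta> * a + c * (LINT y|Q. taylor_quot \<theta> y)"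
  shows "AE y in Q. 0 < y \<and> y \<le> 1" and "integrable Q log_quot" and "c * (LINT y|Q. log_quot y) \<le> a"
proof -
  interpret Q: real_distribution Q by fact
  define L where "L y = (if y = 0 then \<top> else ennreal (log_quot y))" for y
  define g where "g n y = ennreal (- (real (Suc n) * taylor_quot (1 / real (Suc n)) y))" for n y
  have [measurable]: "L \<in> borel_measurable borel" "g n \<in> borel_measurable borel" for n
    unfolding L_def[abs_def] g_def[abs_def] by measurable
  have lim: "AE y in Q. liminf (\<lambda>n. g n y) = L y"
    using supp
  proof eventually_elim
    case (elim y)
    have "(\<lambda>n. g n y) \<longlonglongrightarrow> L y"
    proof (cases "y = 0")
      case True
      have "real (Suc n) * taylor_quot (1 / real (Suc n)) 0 = - real n" for n
        by (simp add: taylor_quot_def taylor_rest_def field_simps)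
      then have "g n y = of_nat n" for n using True by (simp add: g_def ennreal_of_nat_eq_real_of_nat)
      then show ?thesis using True of_nat_tendsto_top_ennreal by (simp add: L_def)
    next
      case False
      then show ?thesis using taylor_quot_small_limit[of y] elim by (simp add: L_def g_def tendsto_ennrealI)
    qed
    then show ?case by (rule lim_imp_Liminf[OF sequentially_bot])
  qed
  have le: "(\<integral>\<^sup>+y. g n y \<partial>Q) \<le> ennreal (a / c)" for n
  proof -
    define m where "m = real (Suc n)"
    have m: "1 \<le> m" by (simp add: m_def)
    have "(\<integral>\<^sup>+y. g n y \<partial>Q) = ennreal (LINT y|Q. - (m * taylor_quot (1 / m) y))"
      unfolding g_def m_def[symmetric]
    proof (rule nn_integral_eq_integral)
      show "integrable Q (\<lambda>y. - (m * taylor_quot (1 / m) y))" using int[of "1 / m"] m by simp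
      show "AE y in Q. 0 \<le> - (m * taylor_quot (1 / m) y)"
        using supp by eventually_elim (use taylor_quot_nonpos[of "1 / m"] m in \<open>auto intro!: mult_nonneg_nonpos\<close>)
    qed
    also have "(LINT y|Q. - (m * taylor_quot (1 / m) y)) = - (m * (LINT y|Q. taylor_quot (1 / m) y))" by simp
    also have "\<dots> \<le> a / c"
    proof -
      define q where "q = (LINT y|Q. taylor_quot (1 / m) y)"
      have "0 \<le> 1 / m * a + c * q" using low[of "1 / m"] m by (simp add: q_def)
      then have "0 \<le> m * (1 / m * a + c * q)" using m by (intro mult_nonneg_nonneg) auto
      then have "0 \<le> a + c * (m * q)" using m by (simp add: algebra_simps)
      then have "- (m * q) * c \<le> a" by (simp add: algebra_simps)
      then show ?thesis unfolding q_def[symmetric] using c by (simp add: pos_le_divide_eq)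
    qed
    finally show ?thesis by (simp add: ennreal_leI)
  qed
  have "(\<integral>\<^sup>+y. L y \<partial>Q) = (\<integral>\<^sup>+y. liminf (\<lambda>n. g n y) \<partial>Q)" using lim by (intro nn_integral_cong_AE) auto
  also have "\<dots> \<le> liminf (\<lambda>n. \<integral>\<^sup>+y. g n y \<partial>Q)" by (rule nn_integral_liminf) simp
  also have "\<dots> \<le> ennreal (a / c)" by (rule Liminf_le) (use le in auto)
  finally have fin: "(\<integral>\<^sup>+y. L y \<partial>Q) \<le> ennreal (a / c)" .
  then have "(\<integral>\<^sup>+y. L y \<partial>Q) \<noteq> \<infinity>" by (auto simp: top_unique)
  then have "AE y in Q. L y \<noteq> \<infinity>" by (intro nn_integral_noteq_infinite) auto
  then show pos: "AE y in Q. 0 < y \<and> y \<le> 1"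
    using supp by eventually_elim (auto simp: L_def split: if_splits)
  have nn: "AE y in Q. 0 \<le> log_quot y" using pos by eventually_elim (simp add: log_quot_nonneg)
  have "(\<integral>\<^sup>+y. ennreal (log_quot y) \<partial>Q) = (\<integral>\<^sup>+y. L y \<partial>Q)"
    using pos by (intro nn_integral_cong_AE, eventually_elim) (auto simp: L_def)
  then have fin': "(\<integral>\<^sup>+y. ennreal (log_quot y) \<partial>Q) \<le> ennreal (a / c)" using fin by simp
  then have "(\<integral>\<^sup>+y. ennreal (log_quot y) \<partial>Q) < \<infinity>" using ennreal_less_top le_less_trans infinity_ennreal_def by metis
  then show i: "integrable Q log_quot" using nn by (intro integrableI_nonneg) auto
  \<comment> \<open>At \<open>\<theta> = 1\<close> the remainder vanishes on the support, so
    \<open>low\<close> yields \<open>0 \<le> a\<close>; the return from \<open>ennreal\<close> to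
    reals uses this sign.\<close>
  have "AE y in Q. taylor_quot 1 y = 0"
    using supp by eventually_elim (simp add: taylor_quot_def taylor_rest_def)
  then have "(LINT y|Q. taylor_quot 1 y) = 0" by (rule integral_eq_zero_AE)
  then have "0 \<le> a" using low[of 1] by simp
  moreover have "ennreal (LINT y|Q. log_quot y) \<le> ennreal (a / c)"
    using fin' nn_integral_eq_integral[OF i nn] by simp
  ultimately have "(LINT y|Q. log_quot y) \<le> a / c" using c by (subst (asm) ennreal_le_iff) auto
  then show "c * (LINT y|Q. log_quot y) \<le> a" using c by (simp add: pos_le_divide_eq mult.commute)
qed

lemma min_le_one_minus_exp: "0 < s \<Longrightarrow> min 1 s \<le> 2 * (1 - exp (- s :: real))"
proof -
  assume s: "0 < s"
  have "exp (- s) \<le> 1 / (1 + s)"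
    using exp_ge_add_one_self[of s] s by (simp add: exp_minus field_simps)
  then have "s / (1 + s) \<le> 1 - exp (- s)" using s by (simp add: field_simps)
  moreover have "min 1 s \<le> 2 * (s / (1 + s))"
  proof (cases "s \<le> 1")
    case True
    then have "s * (1 + s) \<le> s * 2" using s by (intro mult_left_mono) auto
    then show ?thesis using s True by (simp add: pos_le_divide_eq mult.commute)
  next
    case False
    then show ?thesis using s by (simp add: pos_le_divide_eq)
  qed
  ultimately show ?thesis by simp
qed

text \<open>
  Substituting \<open>y = exp (- x)\<close> turns the Taylor remainder \<open>y powr \<theta> - 1 - \<theta> * (y - 1)\<close>, up to a multiple of
  \<open>\<theta>\<close>, into \<open>exp (- \<theta> * x) - 1 + \<theta> * x = \<theta> * \<integral>\<^sub>0\<^sup>x (1 - exp (- \<theta> * s)) ds\<close>. Exchanging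
  the order of integration exhibits the density \<open>u s\<close> as an integral over \<open>y \<le> exp (- s)\<close>, hence non-increasing.
\<close>

lemma decreasing_density_if_taylor_integral:
  assumes c: "0 \<le> c" and Q: "real_distribution Q" and supp: "AE y in Q. 0 < y \<and> y \<le> 1"
    and int: "\<And>\<theta>. 0 < \<theta> \<Longrightarrow> integrable Q (taylor_quot \<theta>)" and il: "integrable Q log_quot"
  shows "\<exists>d u. 0 \<le> d \<and> decreasing_levy_density u (density (restrict_space lborel {0<..}) (\<lambda>x. ennreal (u x))) \<and>
    (\<forall>\<theta>>0. c * (LINT y|Q. taylor_quot \<theta> y / \<theta> + log_quot y) =
      d * \<theta> + (LINT x|density (restrict_space lborel {0<..}) (\<lambda>x. ennreal (u x)). 1 - exp (- \<theta> * x)))"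
proof -
  interpret Q: real_distribution Q by fact
  interpret QL: pair_sigma_finite lborel Q ..
  define U where "U s = (\<integral>\<^sup>+y. (if 0 < y \<and> y < 1 \<and> s \<le> - ln y then ennreal (1 / (1 - y)\<^sup>2) else 0) \<partial>Q)" for s :: real
  have Um [measurable]: "U \<in> borel_measurable borel" unfolding U_def[abs_def] by measurable
  define u where "u s = c * enn2real (U s)" for s
  have um [measurable]: "u \<in> borel_measurable borel" unfolding u_def[abs_def] by measurable
  have anti: "U t \<le> U s" if "s \<le> t" for s t
    unfolding U_def using that by (intro nn_integral_mono) auto
  \<comment> \<open>For \<open>s > 0\<close> only points \<open>y \<le> exp (- s)\<close>
    contribute, where \<open>1 / (1 - y)\<^sup>2\<close> is bounded.\<close>
  have fin: "U s < \<top>" if s: "0 < s" for s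
  proof -
    have "U s \<le> (\<integral>\<^sup>+y. ennreal (1 / (1 - exp (- s))\<^sup>2) \<partial>Q)" unfolding U_def
    proof (rule nn_integral_mono)
      fix y :: real
      have "1 / (1 - y)\<^sup>2 \<le> 1 / (1 - exp (- s))\<^sup>2" if y: "0 < y" "y < 1" "s \<le> - ln y"
      proof -
        have "exp (ln y) \<le> exp (- s)" using y(3) by simp
        then have "y \<le> exp (- s)" using y by simp
        then have "(1 - exp (- s))\<^sup>2 \<le> (1 - y)\<^sup>2" using s by (intro power_mono) auto
        then show ?thesis using s y by (intro divide_left_mono) auto
      qed
      then show "(if 0 < y \<and> y < 1 \<and> s \<le> - ln y then ennreal (1 / (1 - y)\<^sup>2) else 0) \<le> ennreal (1 / (1 - exp (- s))\<^sup>2)"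
        by (auto intro!: ennreal_leI)
    qed
    also have "\<dots> < \<top>" using Q.emeasure_space_1 by simp
    finally show ?thesis .
  qed
  have u: "ennreal (u s) = ennreal c * U s" if "0 < s" for s
    unfolding u_def using c fin[OF that] by (subst ennreal_mult) auto
  have u0: "0 \<le> u s" for s unfolding u_def using c by simp
  have ua: "antimono_on {0<..} u"
  proof (rule monotone_onI)
    fix s t :: real assume st: "s \<in> {0<..}" "t \<in> {0<..}" "s \<le> t"
    have "enn2real (U t) \<le> enn2real (U s)" using anti[OF st(3)] fin[of s] st by (intro enn2real_mono) auto
    then show "u t \<le> u s" unfolding u_def using c by (intro mult_left_mono)
  qed
  define \<Upsilon> where "\<Upsilon> = density (restrict_space lborel {0<..}) (\<lambda>x. ennreal (u x))"
  have nnY: "(\<integral>\<^sup>+x. ennreal (f x) \<partial>\<Upsilon>) = (\<integral>\<^sup>+s. ennreal (f s) * (ennreal (u s) * indicator {0<..} s) \<partial>lborel)"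
    if [measurable]: "f \<in> borel_measurable borel" for f :: "real \<Rightarrow> real"
  proof -
    have "(\<integral>\<^sup>+x. ennreal (f x) \<partial>\<Upsilon>) = (\<integral>\<^sup>+x. ennreal (u x) * ennreal (f x) \<partial>restrict_space lborel {0<..})"
      unfolding \<Upsilon>_def by (rule nn_integral_density) (auto intro!: measurable_restrict_space1)
    also have "\<dots> = (\<integral>\<^sup>+x. ennreal (u x) * ennreal (f x) * indicator {0<..} x \<partial>lborel)"
      by (rule nn_integral_restrict_space) simp
    finally show ?thesis by (simp add: mult_ac)
  qed
  define A where "A \<theta> y = taylor_quot \<theta> y / \<theta> + log_quot y" for \<theta> y
  have [measurable]: "A \<theta> \<in> borel_measurable borel" for \<theta> unfolding A_def[abs_def] by measurable
  \<comment> \<open>The atom of \<open>Q\<close> at 1, where \<open>A \<theta>\<close> equals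
    \<open>\<theta> / 2\<close>, becomes the linear term of the Bernstein function.\<close>
  define d where "d = c * measure Q {1} / 2"
  have d0: "0 \<le> d" unfolding d_def using c by simp
  have A1: "A \<theta> 1 = \<theta> / 2" if "0 < \<theta>" for \<theta> using that by (simp add: A_def taylor_quot_def log_quot_def field_simps)
  have key: "ennreal c * (\<integral>\<^sup>+y. ennreal (A \<theta> y) \<partial>Q) = ennreal (d * \<theta>) + (\<integral>\<^sup>+x. ennreal (1 - exp (- \<theta> * x)) \<partial>\<Upsilon>)" if \<theta>: "0 < \<theta>" for \<theta>
  proof -
    define K where "K s y = (if 0 < y \<and> y < 1 \<and> 0 < s \<and> s \<le> - ln y then ennreal (1 / (1 - y)\<^sup>2) * ennreal (1 - exp (- \<theta> * s)) else 0)" for s y :: real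
    have [measurable]: "case_prod K \<in> borel_measurable (lborel \<Otimes>\<^sub>M Q)" unfolding K_def by measurable
    have "(\<integral>\<^sup>+y. ennreal (A \<theta> y) \<partial>Q) = (\<integral>\<^sup>+y. ennreal (\<theta> / 2) * indicator {1} y + (\<integral>\<^sup>+s. K s y \<partial>lborel) \<partial>Q)"
    proof (intro nn_integral_cong_AE, use supp in eventually_elim)
      case (elim y)
      show ?case
      proof (cases "y = 1")
        case True
        show ?thesis by (simp only: True A1[OF \<theta>]) (simp add: K_def)
      next
        case False
        then have y: "0 < y" "y < 1" using elim by auto
        have "ennreal (A \<theta> y) = (\<integral>\<^sup>+s. K s y \<partial>lborel)"
          unfolding A_def taylor_quot_plus_log_quot[OF \<theta> y]
        proof (rule nn_integral_cong)
          fix s :: real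
          consider "s < 0" | "s = 0" | "0 < s" by linarith
          then show "ennreal (1 / (1 - y)\<^sup>2) * (ennreal (1 - exp (- \<theta> * s)) * indicator {0..- ln y} s) = K s y"
            by cases (use y in \<open>auto simp: K_def indicator_def\<close>)
        qed
        then show ?thesis using False by simp
      qed
    qed
    also have "\<dots> = ennreal (\<theta> / 2) * emeasure Q {1} + (\<integral>\<^sup>+y. (\<integral>\<^sup>+s. K s y \<partial>lborel) \<partial>Q)"
      by (subst nn_integral_add) (auto simp: nn_integral_cmult_indicator)
    also have "(\<integral>\<^sup>+y. (\<integral>\<^sup>+s. K s y \<partial>lborel) \<partial>Q) = (\<integral>\<^sup>+s. (\<integral>\<^sup>+y. K s y \<partial>Q) \<partial>lborel)"
      by (rule QL.Fubini') measurable
    also have "(\<integral>\<^sup>+s. (\<integral>\<^sup>+y. K s y \<partial>Q) \<partial>lborel) = (\<integral>\<^sup>+s. ennreal (1 - exp (- \<theta> * s)) * (U s * indicator {0<..} s) \<partial>lborel)"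
    proof (rule nn_integral_cong)
      fix s :: real
      show "(\<integral>\<^sup>+y. K s y \<partial>Q) = ennreal (1 - exp (- \<theta> * s)) * (U s * indicator {0<..} s)"
      proof (cases "0 < s")
        case True
        have "(\<integral>\<^sup>+y. K s y \<partial>Q) = (\<integral>\<^sup>+y. ennreal (1 - exp (- \<theta> * s)) * (if 0 < y \<and> y < 1 \<and> s \<le> - ln y then ennreal (1 / (1 - y)\<^sup>2) else 0) \<partial>Q)"
          using True by (intro nn_integral_cong) (auto simp: K_def mult.commute)
        also have "\<dots> = ennreal (1 - exp (- \<theta> * s)) * U s" unfolding U_def by (rule nn_integral_cmult) measurable
        finally show ?thesis using True by simp
      qed (simp add: K_def)
    qed
    finally have "ennreal c * (\<integral>\<^sup>+y. ennreal (A \<theta> y) \<partial>Q) = ennreal c * (ennreal (\<theta> / 2) * emeasure Q {1}) +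
        ennreal c * (\<integral>\<^sup>+s. ennreal (1 - exp (- \<theta> * s)) * (U s * indicator {0<..} s) \<partial>lborel)"
      by (simp add: distrib_left)
    also have "ennreal c * (ennreal (\<theta> / 2) * emeasure Q {1}) = ennreal (d * \<theta>)"
      unfolding Q.emeasure_eq_measure d_def using c \<theta> by (simp add: ennreal_mult[symmetric] mult_ac)
    also have "ennreal c * (\<integral>\<^sup>+s. ennreal (1 - exp (- \<theta> * s)) * (U s * indicator {0<..} s) \<partial>lborel) =
        (\<integral>\<^sup>+s. ennreal c * (ennreal (1 - exp (- \<theta> * s)) * (U s * indicator {0<..} s)) \<partial>lborel)"
      by (rule nn_integral_cmult[symmetric]) measurable
    also have "\<dots> = (\<integral>\<^sup>+s. ennreal (1 - exp (- \<theta> * s)) * (ennreal (u s) * indicator {0<..} s) \<partial>lborel)"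
      by (intro nn_integral_cong) (auto simp: indicator_def u mult_ac)
    also have "\<dots> = (\<integral>\<^sup>+x. ennreal (1 - exp (- \<theta> * x)) \<partial>\<Upsilon>)" by (rule nnY[symmetric]) measurable
    finally show ?thesis .
  qed
  have iA: "integrable Q (A \<theta>)" if "0 < \<theta>" for \<theta>
    unfolding A_def[abs_def] using int[OF that] il by simp
  have A0: "AE y in Q. 0 \<le> A \<theta> y" if \<theta>: "0 < \<theta>" for \<theta>
    using supp
  proof eventually_elim
    case (elim y)
    show ?case
    proof (cases "y = 1")
      case False
      define x where "x = - ln y"
      have "0 \<le> \<theta> * x + (exp (- (\<theta> * x)) - 1)" using exp_ge_add_one_self[of "- (\<theta> * x)"] by simp
      then have "0 \<le> (\<theta> * x + (exp (- (\<theta> * x)) - 1)) / (\<theta> * (y - 1)\<^sup>2)" using \<theta> by (intro divide_nonneg_nonneg) auto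
      also have "\<dots> = A \<theta> y"
      proof -
        have "exp (- (\<theta> * x)) = y powr \<theta>" using elim by (simp add: powr_def x_def)
        moreover have "(y - 1)\<^sup>2 \<noteq> 0" using False by simp
        ultimately show ?thesis using \<theta> False
          by (simp add: A_def taylor_quot_def log_quot_def taylor_rest_def x_def add_frac_eq) (simp add: field_simps)
      qed
      finally show ?thesis .
    qed (use A1[OF \<theta>] \<theta> in simp)
  qed
  have nnA: "ennreal c * (\<integral>\<^sup>+y. ennreal (A \<theta> y) \<partial>Q) = ennreal (c * (LINT y|Q. A \<theta> y))" if \<theta>: "0 < \<theta>" for \<theta>
    using nn_integral_eq_integral[OF iA[OF \<theta>] A0[OF \<theta>]] c by (simp add: ennreal_mult' )
  \<comment> \<open>The case \<open>\<theta> = 1\<close> of \<open>key\<close> bounds the integral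
    of \<open>1 - exp (- x)\<close>, and twice this function dominates
    \<open>min 1 x\<close>.\<close>
  have fm: "(\<integral>\<^sup>+x. ennreal (min 1 x) \<partial>\<Upsilon>) < \<infinity>"
  proof -
    have sp: "space \<Upsilon> = {0<..}" by (simp add: \<Upsilon>_def space_restrict_space)
    have "(\<integral>\<^sup>+x. ennreal (min 1 x) \<partial>\<Upsilon>) \<le> (\<integral>\<^sup>+x. ennreal 2 * ennreal (1 - exp (- 1 * x)) \<partial>\<Upsilon>)"
    proof (rule nn_integral_mono)
      fix x assume "x \<in> space \<Upsilon>"
      then have "ennreal (min 1 x) \<le> ennreal (2 * (1 - exp (- 1 * x)))" using min_le_one_minus_exp[of x] by (intro ennreal_leI) (simp add: sp)
      then show "ennreal (min 1 x) \<le> ennreal 2 * ennreal (1 - exp (- 1 * x))" by (subst ennreal_mult'[symmetric]) auto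
    qed
    also have "\<dots> = ennreal 2 * (\<integral>\<^sup>+x. ennreal (1 - exp (- 1 * x)) \<partial>\<Upsilon>)"
      unfolding \<Upsilon>_def by (rule nn_integral_cmult) (auto intro!: measurable_restrict_space1)
    also have "\<dots> < \<infinity>"
    proof -
      have "(\<integral>\<^sup>+x. ennreal (1 - exp (- 1 * x)) \<partial>\<Upsilon>) \<le> ennreal (c * (LINT y|Q. A 1 y))"
        using key[of 1] nnA[of 1] by simp
      then have "(\<integral>\<^sup>+x. ennreal (1 - exp (- 1 * x)) \<partial>\<Upsilon>) < \<top>" by (rule le_less_trans) simp
      then show ?thesis by (simp add: ennreal_mult_less_top)
    qed
    finally show ?thesis .
  qed
  have D: "decreasing_levy_density u \<Upsilon>"
    by (rule decreasing_levy_density.intro[OF u0 ua \<Upsilon>_def fm])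
  interpret D: decreasing_levy_density u \<Upsilon> by (rule D)
  have "c * (LINT y|Q. A \<theta> y) = d * \<theta> + (LINT x|\<Upsilon>. 1 - exp (- \<theta> * x))" if \<theta>: "0 < \<theta>" for \<theta>
  proof -
    have nn: "AE x in \<Upsilon>. 0 \<le> 1 - exp (- \<theta> * x)"
      using \<theta> by (intro AE_I2) (simp add: D.\<Upsilon>.space_U)
    have "(\<integral>\<^sup>+x. ennreal (1 - exp (- \<theta> * x)) \<partial>\<Upsilon>) = ennreal (LINT x|\<Upsilon>. 1 - exp (- \<theta> * x))"
      using D.\<Upsilon>.integrable_one_minus_exp[of \<theta>] \<theta> by (intro nn_integral_eq_integral nn) simp
    moreover have I0: "0 \<le> (LINT x|\<Upsilon>. 1 - exp (- \<theta> * x))" using nn by (rule integral_nonneg_AE)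
    ultimately have "ennreal (c * (LINT y|Q. A \<theta> y)) = ennreal (d * \<theta> + (LINT x|\<Upsilon>. 1 - exp (- \<theta> * x)))"
      using key[OF \<theta>] nnA[OF \<theta>] d0 \<theta> by (simp add: ennreal_plus)
    moreover have "0 \<le> c * (LINT y|Q. A \<theta> y)" using A0[OF \<theta>] c by (intro mult_nonneg_nonneg integral_nonneg_AE)
    ultimately show ?thesis using I0 d0 \<theta> by (subst (asm) ennreal_inj) auto
  qed
  then show ?thesis using d0 D unfolding A_def \<Upsilon>_def by blast
qed

lemma integrable_return:
  fixes f :: "real \<Rightarrow> real"
  assumes [measurable]: "f \<in> borel_measurable borel" shows "integrable (return borel x) f"
proof -
  interpret prob_space "return borel x" by (rule prob_space_return) simp
  show ?thesis by (rule integrable_const_bound[of _ "\<bar>f x\<bar>"]) (auto simp: AE_return)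
qed

text \<open>The constant \<open>\<kappa>\<close> is what remains of \<open>a\<close> after paying
  for the change of compensator, \<open>a - c * (LINT y|R. log_quot y)\<close>; its sign is the last
  claim of \<open>log_quot_integrable\<close>.\<close>

theorem bernstein_form_of_weak_limit:
  assumes c: "0 \<le> c" and Q: "real_distribution Q" and supp: "AE y in Q. 0 \<le> y \<and> y \<le> 1"
    and int: "\<And>\<theta>. 0 < \<theta> \<Longrightarrow> integrable Q (taylor_quot \<theta>)"
    and rep: "\<And>\<theta>. 0 < \<theta> \<Longrightarrow> \<psi> \<theta> = \<theta> * a + c * (LINT y|Q. taylor_quot \<theta> y)"
    and nn: "\<And>\<theta>. 0 < \<theta> \<Longrightarrow> 0 \<le> \<psi> \<theta>"
  shows "\<exists>\<kappa> d u. 0 \<le> \<kappa> \<and> 0 \<le> d \<and> decreasing_levy_density u (density (restrict_space lborel {0<..}) (\<lambda>x. ennreal (u x))) \<and>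
    (\<forall>\<theta>>0. \<psi> \<theta> = \<theta> * (\<kappa> + d * \<theta> + (LINT x|density (restrict_space lborel {0<..}) (\<lambda>x. ennreal (u x)). 1 - exp (- \<theta> * x))))"
proof -
  \<comment> \<open>For \<open>c = 0\<close> the law \<open>Q\<close> may well have an atom at 0;
    the point mass at 1 has all the required properties, so both cases continue together.\<close>
  define R where "R = (if c = 0 then return borel 1 else Q)"
  have R: "real_distribution R"
    using Q by (auto simp: R_def real_distribution_def real_distribution_axioms_def intro: prob_space_return)
  have tq: "integrable R (taylor_quot \<theta>)" if "0 < \<theta>" for \<theta>
    using int[OF that] by (auto simp: R_def integrable_return)
  have props: "(AE y in R. 0 < y \<and> y \<le> 1) \<and> integrable R log_quot \<and> c * (LINT y|R. log_quot y) \<le> a"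
  proof (cases "c = 0")
    case True
    have "0 \<le> a" using nn[of 1] rep[of 1] True by simp
    then show ?thesis using True unfolding R_def by (simp add: AE_return integrable_return)
  next
    case False
    have "0 \<le> \<theta> * a + c * (LINT y|Q. taylor_quot \<theta> y)" if "0 < \<theta>" for \<theta> using nn[OF that] rep[OF that] by simp
    from log_quot_integrable[OF _ Q supp int this] show ?thesis using False c unfolding R_def by simp
  qed
  then have il: "integrable R log_quot" by simp
  from props decreasing_density_if_taylor_integral[OF c R _ tq il] obtain d u where du: "0 \<le> d"
    "decreasing_levy_density u (density (restrict_space lborel {0<..}) (\<lambda>x. ennreal (u x)))"
    "\<And>\<theta>. 0 < \<theta> \<Longrightarrow> c * (LINT y|R. taylor_quot \<theta> y / \<theta> + log_quot y) =
      d * \<theta> + (LINT x|density (restrict_space lborel {0<..}) (\<lambda>x. ennreal (u x)). 1 - exp (- \<theta> * x))"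
    by blast
  have eq: "\<psi> \<theta> = \<theta> * ((a - c * (LINT y|R. log_quot y)) + d * \<theta> + (LINT x|density (restrict_space lborel {0<..}) (\<lambda>x. ennreal (u x)). 1 - exp (- \<theta> * x)))"
    if \<theta>: "0 < \<theta>" for \<theta>
  proof -
    have "c * (LINT y|Q. taylor_quot \<theta> y) = c * (LINT y|R. taylor_quot \<theta> y)" by (simp add: R_def)
    moreover have "(LINT y|R. taylor_quot \<theta> y / \<theta> + log_quot y) = (LINT y|R. taylor_quot \<theta> y) / \<theta> + (LINT y|R. log_quot y)"
      using tq[OF \<theta>] il by simp
    then have "d * \<theta> + (LINT x|density (restrict_space lborel {0<..}) (\<lambda>x. ennreal (u x)). 1 - exp (- \<theta> * x)) =
        c * ((LINT y|R. taylor_quot \<theta> y) / \<theta> + (LINT y|R. log_quot y))" using du(3)[OF \<theta>] by simp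
    ultimately show ?thesis using rep[OF \<theta>] \<theta> by (simp only: add.assoc) (simp add: field_simps)
  qed
  show ?thesis
    by (rule exI[of _ "a - c * (LINT y|R. log_quot y)"], rule exI[of _ d], rule exI[of _ u])
       (intro conjI allI impI du(1,2) eq, use props in auto)
qed

text \<open>\<open>subordinator\<close> demands the full Levy property of \<open>- X\<close> in
  addition to monotone paths.\<close>

lemma levy_process_uminus:
  assumes "levy_process M X" shows "levy_process M (\<lambda>t \<omega>. - X t \<omega>)"
proof -
  interpret levy_proc M X by (rule levy_proc.intro[OF assms])
  have "AE \<omega> in M. cadlag (\<lambda>t. - X t \<omega>)"
    using AE_cadlag
  proof eventually_elim
    case (elim \<omega>)
    then show ?case unfolding cadlag_def by (metis tendsto_minus)
  qed
  moreover have "AE \<omega> in M. - X 0 \<omega> = 0" using X_0 by eventually_elim simp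
  moreover have "indep_vars (\<lambda>_. borel) (\<lambda>i \<omega>. - X (t (Suc i)) \<omega> - (- X (t i) \<omega>)) {..<n}"
    if "0 \<le> t 0 \<and> (\<forall>i<n. t i \<le> t (Suc i))" for n :: nat and t :: "nat \<Rightarrow> real"
  proof -
    have "indep_vars (\<lambda>_. borel) (\<lambda>i \<omega>. - (X (t (Suc i)) \<omega> - X (t i) \<omega>)) {..<n}"
      by (rule indep_vars_compose2[where Y = "\<lambda>_ x. - x", OF indep_increments]) (use that in auto)
    then show ?thesis by simp
  qed
  moreover have "distr M borel (\<lambda>\<omega>. - X t \<omega> - (- X s \<omega>)) = distr M borel (\<lambda>\<omega>. - X (t - s) \<omega>)"
    if st: "0 \<le> s \<and> s \<le> t" for s t
  proof -
    have m: "(\<lambda>\<omega>. X t \<omega> - X s \<omega>) \<in> borel_measurable M" "X (t - s) \<in> borel_measurable M"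
      using st by (auto intro!: borel_measurable_diff X_measurable)
    have "distr (distr M borel (\<lambda>\<omega>. X t \<omega> - X s \<omega>)) borel uminus = distr (distr M borel (X (t - s))) borel (uminus :: real \<Rightarrow> real)"
      using distr_increment st by simp
    then show ?thesis using m by (simp add: distr_distr o_def)
  qed
  moreover have "(\<lambda>\<omega>. - X t \<omega>) \<in> borel_measurable M" if "0 \<le> t" for t
    using X_measurable[OF that] by (rule borel_measurable_uminus)
  ultimately show ?thesis unfolding levy_process_def by (intro conjI allI impI prob_space_axioms)
qed

lemma cadlag_zero_if_zero_on_grids:
  assumes x: "cadlag x" and z: "\<And>n k. x (real k * (1 / real (Suc n))) = 0" and t: "0 \<le> t"
  shows "x t = 0"
proof (rule ccontr)
  assume "x t \<noteq> 0"
  moreover have "(x \<longlongrightarrow> x t) (at_right t)" using x t by (auto simp: cadlag_def)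
  ultimately have "\<forall>\<^sub>F s in at_right t. x s \<noteq> 0" by (intro tendsto_imp_eventually_ne)
  then obtain b where b: "t < b" "\<And>s. t < s \<Longrightarrow> s < b \<Longrightarrow> x s \<noteq> 0"
    unfolding eventually_at_right_field by auto
  obtain n where n: "1 / real (Suc n) < b - t" using nat_approx_posE[of "b - t"] b(1) by auto
  define m where "m = real (Suc n)"
  have m: "0 < m" by (simp add: m_def)
  define k where "k = nat \<lfloor>t * m\<rfloor> + 1"
  have "real k = of_int \<lfloor>t * m\<rfloor> + 1" using t m by (simp add: k_def)
  then have "t * m < real k" "real k \<le> t * m + 1" by linarith+
  then have "t < real k * (1 / m)" "real k * (1 / m) \<le> t + 1 / m" using m by (simp_all add: field_simps)
  then show False using b(2)[of "real k * (1 / m)"] n z[of k n] by (simp add: m_def)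
qed

context spectrally_negative_levy
begin

lemma exponent_0: "\<psi> 0 = 0"
  using integral_exp_1[of 0] prob_space by simp

text \<open>The moments of orders 1 and 2 are all 1, so the mean of
  \<open>(exp (X (h n)) - 1)\<^sup>2\<close> is 0. Thus all grid increments vanish almost surely,
  right-continuity extends this to all times, and the zero path is monotone.\<close>

lemma subordinator_if_exponent_zero:
  assumes z: "\<And>\<theta>. 0 < \<theta> \<Longrightarrow> \<psi> \<theta> = 0"
  shows "subordinator M (\<lambda>t \<omega>. - X t \<omega>)"
proof -
  have X0: "AE \<omega> in M. X (h n) \<omega> = 0" for n
  proof -
    have i: "integrable M (\<lambda>\<omega>. exp (\<theta> * X (h n) \<omega>))" "(LINT \<omega>|M. exp (\<theta> * X (h n) \<omega>)) = 1" if "0 < \<theta>" for \<theta>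
      using exp_moment_root[of \<theta> n] z[OF that] that by auto
    have sq: "(exp (X (h n) \<omega>) - 1)\<^sup>2 = exp (2 * X (h n) \<omega>) - 2 * exp (1 * X (h n) \<omega>) + 1" for \<omega>
      by (simp add: power2_eq_square algebra_simps exp_add[symmetric])
    have isq: "integrable M (\<lambda>\<omega>. (exp (X (h n) \<omega>) - 1)\<^sup>2)"
      unfolding sq using i(1)[of 1] i(1)[of 2] by simp
    have "(LINT \<omega>|M. (exp (X (h n) \<omega>) - 1)\<^sup>2) = 0"
      unfolding sq using i[of 1] i[of 2] prob_space by simp
    then have "AE \<omega> in M. (exp (X (h n) \<omega>) - 1)\<^sup>2 = 0"
      using integral_nonneg_eq_0_iff_AE[OF isq] by simp
    then show ?thesis by eventually_elim simp
  qed
  have "AE \<omega> in M. step n i \<omega> = 0" for n i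
  proof -
    have "AE x in distr M borel (X (h n)). x = 0" using X0[of n] by (subst AE_distr_iff) auto
    then have "AE x in distr M borel (step n i). x = 0" unfolding step_law .
    then show ?thesis by (subst (asm) AE_distr_iff) auto
  qed
  then have "AE \<omega> in M. \<forall>n i. step n i \<omega> = 0" by (simp add: AE_all_countable)
  then have "AE \<omega> in M. \<forall>t\<ge>0. X t \<omega> = 0"
    using X_0 AE_cadlag
  proof eventually_elim
    case (elim \<omega>)
    have "X (real k * (1 / real (Suc n))) \<omega> = 0" for n k
      using sum_steps[of n \<omega> k] elim by (simp add: h_def)
    then show ?case using cadlag_zero_if_zero_on_grids[OF elim(3)] by blast
  qed
  then have "AE \<omega> in M. mono_on {0..} (\<lambda>t. - X t \<omega>)" by eventually_elim (auto simp: mono_on_def)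
  then show ?thesis unfolding subordinator_def using levy_process_uminus[OF levy] by simp
qed

end

text \<open>As the transform of a nonnegative function \<open>1 / \<psi> \<theta>\<close> is
  nonnegative. At a zero of \<open>\<psi>\<close> the convention \<open>1 / 0 = 0\<close> makes the
  transform 0, so \<open>W\<close> vanishes almost everywhere, all other transforms vanish too,
  \<open>\<psi>\<close> is 0 on \<open>{0<..}\<close>, and \<open>- X\<close> would be a
  subordinator.\<close>

lemma exponent_pos_if_scale_function:
  assumes X: "spectrally_negative M X" and \<psi>: "has_laplace_exponent M X \<psi>" and W: "is_scale_function \<psi> W"
    and \<theta>: "0 < \<theta>"
  shows "0 < \<psi> \<theta>"
proof -
  interpret spectrally_negative_levy M X \<psi>
    using X \<psi> by unfold_locales (auto simp: spectrally_negative_def)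
  have W0: "\<And>x. 0 \<le> W x" and Wi: "\<And>\<theta>. 0 < \<theta> \<Longrightarrow> set_integrable lborel {0..} (\<lambda>x. exp (- \<theta> * x) * W x)"
    and Wl: "\<And>\<theta>. 0 < \<theta> \<Longrightarrow> (LINT x:{0..}|lborel. exp (- \<theta> * x) * W x) = 1 / \<psi> \<theta>"
    using W by (auto simp: is_scale_function_def)
  have "0 \<le> 1 / \<psi> \<theta>"
    unfolding Wl[OF \<theta>, symmetric] set_lebesgue_integral_def using W0 by (intro Bochner_Integration.integral_nonneg) auto
  moreover have "\<psi> \<theta> \<noteq> 0"
  proof
    assume "\<psi> \<theta> = 0"
    then have "(LINT x|lborel. indicator {0..} x *\<^sub>R (exp (- \<theta> * x) * W x)) = 0"
      using Wl[OF \<theta>] by (simp add: set_lebesgue_integral_def)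
    then have "AE x in lborel. indicator {0..} x *\<^sub>R (exp (- \<theta> * x) * W x) = 0"
      using Wi[OF \<theta>] W0 by (subst (asm) integral_nonneg_eq_0_iff_AE) (auto simp: set_integrable_def)
    then have ae: "AE x in lborel. indicator {0..} x * W x = 0" by eventually_elim auto
    have "\<psi> t = 0" if t: "0 < t" for t
    proof -
      have "(LINT x|lborel. indicator {0..} x *\<^sub>R (exp (- t * x) * W x)) = 0"
        by (rule integral_eq_zero_AE) (use ae in eventually_elim, auto)
      then show ?thesis using Wl[OF t] by (simp add: set_lebesgue_integral_def)
    qed
    then have "subordinator M (\<lambda>t \<omega>. - X t \<omega>)" by (rule subordinator_if_exponent_zero)
    then show False using X by (simp add: spectrally_negative_def)
  qed
  ultimately show ?thesis by (auto simp: zero_le_divide_iff)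
qed

theorem conjugate_pair_of_concave_scale_function:
  assumes X: "spectrally_negative M X" and lap: "has_laplace_exponent M X \<psi>" and W: "is_scale_function \<psi> W"
    and conc: "concave_on {0..} W"
  shows "\<exists>\<phi> \<phi>s \<kappa> d \<Upsilon> \<kappa>s ds \<Upsilon>s. conjugate_bernstein \<phi> \<phi>s \<and>
    bernstein_rep \<kappa> d \<Upsilon> \<phi> \<and> bernstein_rep \<kappa>s ds \<Upsilon>s \<phi>s \<and> has_nonincreasing_density \<Upsilon> \<and>
    eq_quotient \<psi> (\<lambda>\<theta>. \<theta>\<^sup>2) \<phi>s \<and> (\<forall>\<theta>\<ge>0. \<psi> \<theta> = \<theta> * \<phi> \<theta>) \<and>
    (\<forall>x\<ge>0. W x = ds + \<kappa>s * x + (LINT y:{0..x}|lborel. measure \<Upsilon>s {y<..}))"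
proof -
  interpret S: spectrally_negative_levy M X \<psi>
    using X lap by unfold_locales (auto simp: spectrally_negative_def)
  have "\<forall>x. 0 \<le> W x" "continuous_on {0..} W" using W by (simp_all add: is_scale_function_def)
  then interpret K: concave_half_line W
    by (intro concave_half_line.intro conc) auto
  have pos: "0 < \<psi> \<theta>" if "0 < \<theta>" for \<theta> by (rule exponent_pos_if_scale_function[OF X lap W that])
  obtain c Q where cQ: "0 \<le> c" "real_distribution Q" "AE y in Q. 0 \<le> y \<and> y \<le> 1"
    "\<And>\<theta>. 0 < \<theta> \<Longrightarrow> integrable Q (taylor_quot \<theta>)" "\<And>\<theta>. 0 < \<theta> \<Longrightarrow> \<psi> \<theta> = \<theta> * \<psi> 1 + c * (LINT y|Q. taylor_quot \<theta> y)"
    using S.weak_limit_representation by blast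
  obtain \<kappa> d u where \<kappa>: "0 \<le> \<kappa>" and d: "0 \<le> d"
    and u: "decreasing_levy_density u (density (restrict_space lborel {0<..}) (\<lambda>x. ennreal (u x)))"
    and rep: "\<And>\<theta>. 0 < \<theta> \<Longrightarrow> \<psi> \<theta> = \<theta> * (\<kappa> + d * \<theta> + (LINT x|density (restrict_space lborel {0<..}) (\<lambda>x. ennreal (u x)). 1 - exp (- \<theta> * x)))"
    using bernstein_form_of_weak_limit[OF cQ less_imp_le[OF pos]] by blast
  define \<Upsilon> where "\<Upsilon> = density (restrict_space lborel {0<..}) (\<lambda>x. ennreal (u x))"
  interpret D: decreasing_levy_density u \<Upsilon> unfolding \<Upsilon>_def by (rule u)
  define \<phi> where "\<phi> \<theta> = \<kappa> + d * \<theta> + (LINT x|\<Upsilon>. 1 - exp (- \<theta> * x))" for \<theta>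
  define \<phi>s where "\<phi>s \<theta> = K.w_inf + W 0 * \<theta> + (LINT x|K.levy. 1 - exp (- \<theta> * x))" for \<theta>
  have r1: "bernstein_rep \<kappa> d \<Upsilon> \<phi>"
    using \<kappa> d D.sets_\<Upsilon> D.finite_min by (auto simp: bernstein_rep_def \<phi>_def)
  have r2: "bernstein_rep K.w_inf (W 0) K.levy \<phi>s"
    using K.w_inf_nonneg K.nonneg K.sets_levy K.finite_min_levy by (auto simp: bernstein_rep_def \<phi>s_def)
  have dens: "has_nonincreasing_density \<Upsilon>"
    unfolding has_nonincreasing_density_def using D.u_nonneg D.u_anti \<Upsilon>_def by blast
  \<comment> \<open>The representation covers positive arguments; at 0 both sides vanish by
    \<open>exponent_0\<close>.\<close>
  have \<psi>: "\<psi> \<theta> = \<theta> * \<phi> \<theta>" if "0 \<le> \<theta>" for \<theta>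
    using rep[of \<theta>] S.exponent_0 that by (cases "\<theta> = 0") (auto simp: \<phi>_def \<Upsilon>_def)
  have "W = (\<lambda>x. indicator {0..} x *\<^sub>R W x)" using W by (auto simp: is_scale_function_def fun_eq_iff indicator_def)
  also have "\<dots> \<in> borel_measurable borel" using K.cont by (intro borel_measurable_continuous_on_indicator) auto
  finally have Wm: "W \<in> borel_measurable borel" .
  have WG: "W x = W 0 + K.w_inf * x + K.levy.G x" if "0 \<le> x" for x
    using K.W_representation[OF that] K.levy.integral_tail(2)[OF that] by (simp add: K.levy.tail_def[abs_def])
  have quot: "\<phi>s \<theta> \<noteq> 0 \<and> \<phi> \<theta> = \<theta> / \<phi>s \<theta>" if \<theta>: "0 < \<theta>" for \<theta>
  proof -
    \<comment> \<open>Two evaluations of the Laplace transform of \<open>W\<close>: by the scale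
      function property, and by the concave representation.\<close>
    have e: "1 / \<psi> \<theta> = \<phi>s \<theta> / \<theta>\<^sup>2"
      using K.levy.scale_function_laplace(2)[OF \<theta> K.w_inf_nonneg K.nonneg WG Wm] W \<theta>
      by (simp add: is_scale_function_def \<phi>s_def)
    then have nz: "\<phi>s \<theta> \<noteq> 0" using pos[OF \<theta>] by auto
    have "\<phi> \<theta> \<noteq> 0" using \<psi>[of \<theta>] pos[OF \<theta>] \<theta> by auto
    then have "\<phi>s \<theta> * \<phi> \<theta> = \<theta>"
      using e \<psi>[of \<theta>] \<theta> by (simp add: divide_eq_eq power2_eq_square)
    then show ?thesis using nz by (simp add: eq_divide_eq mult.commute)
  qed
  have b: "bernstein \<phi>" "bernstein \<phi>s" using r1 r2 by (auto simp: bernstein_def)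
  have "\<forall>\<^sub>F \<theta> in at_right 0. \<phi> \<theta> = \<theta> / \<phi>s \<theta>"
    using quot by (auto simp: eventually_at_right_field intro!: exI[of _ 1])
  with bernstein_tendsto_0[OF b(1)] have "((\<lambda>\<theta>. \<theta> / \<phi>s \<theta>) \<longlongrightarrow> \<phi> 0) (at_right 0)"
    by (rule Lim_transform_eventually)
  then have conj: "conjugate_bernstein \<phi> \<phi>s"
    unfolding conjugate_bernstein_def eq_quotient_def using b quot by blast
  show ?thesis
    by (rule exI[of _ \<phi>], rule exI[of _ \<phi>s], rule exI[of _ \<kappa>], rule exI[of _ d], rule exI[of _ \<Upsilon>],
        rule exI[of _ K.w_inf], rule exI[of _ "W 0"], rule exI[of _ K.levy])
       (intro conjI allI impI conj r1 r2 dens eq_quotient_psi[OF conj \<psi>] \<psi> K.W_representation)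
qed

theorem theorem2:
  shows
    "(\<forall>(\<phi>::real \<Rightarrow> real) (\<phi>s::real \<Rightarrow> real)
        (\<kappa>::real) (d::real) (\<Upsilon>::real measure)
        (\<kappa>s::real) (ds::real) (\<Upsilon>s::real measure).
        conjugate_bernstein \<phi> \<phi>s \<and>
        bernstein_rep \<kappa> d \<Upsilon> \<phi> \<and> bernstein_rep \<kappa>s ds \<Upsilon>s \<phi>s \<and>
        has_nonincreasing_density \<Upsilon> \<longrightarrow>
        (\<exists>(M::(real \<Rightarrow> real) measure) (X::real \<Rightarrow> (real \<Rightarrow> real) \<Rightarrow> real)
           (\<psi>::real \<Rightarrow> real) (W::real \<Rightarrow> real).
           spectrally_negative M X \<and>
           \<not> drifts_to_minus_infinity M X \<and>
           has_laplace_exponent M X \<psi> \<and>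
           eq_quotient \<psi> (\<lambda>\<theta>. \<theta>\<^sup>2) \<phi>s \<and>
           (\<forall>\<theta>\<ge>0. \<psi> \<theta> = \<theta> * \<phi> \<theta>) \<and>
           is_scale_function \<psi> W \<and>
           concave_on {0..} W \<and>
           (\<forall>x\<ge>0. W x = ds + \<kappa>s * x + (LINT y:{0..x}|lborel. measure \<Upsilon>s {y<..}))))
     \<and>
     (\<forall>(M::'w measure) (X::real \<Rightarrow> 'w \<Rightarrow> real) (\<psi>::real \<Rightarrow> real) (W::real \<Rightarrow> real).
        spectrally_negative M X \<and>
        \<not> drifts_to_minus_infinity M X \<and>
        has_laplace_exponent M X \<psi> \<and>
        is_scale_function \<psi> W \<and>
        concave_on {0..} W \<longrightarrow>
        (\<exists>(\<phi>::real \<Rightarrow> real) (\<phi>s::real \<Rightarrow> real)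
           (\<kappa>::real) (d::real) (\<Upsilon>::real measure)
           (\<kappa>s::real) (ds::real) (\<Upsilon>s::real measure).
           conjugate_bernstein \<phi> \<phi>s \<and>
           bernstein_rep \<kappa> d \<Upsilon> \<phi> \<and> bernstein_rep \<kappa>s ds \<Upsilon>s \<phi>s \<and>
           has_nonincreasing_density \<Upsilon> \<and>
           eq_quotient \<psi> (\<lambda>\<theta>. \<theta>\<^sup>2) \<phi>s \<and>
           (\<forall>\<theta>\<ge>0. \<psi> \<theta> = \<theta> * \<phi> \<theta>) \<and>
           (\<forall>x\<ge>0. W x = ds + \<kappa>s * x + (LINT y:{0..x}|lborel. measure \<Upsilon>s {y<..}))))"
proof (rule conjI, goal_cases)
  case 1
  show ?case by (intro allI impI, elim conjE, rule concave_scale_function_of_conjugate_pair)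
next
  case 2
  show ?case by (intro allI impI, elim conjE, rule conjugate_pair_of_concave_scale_function)
qed

end
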